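(* For a cotorsion pair $(\mathcal U,\mathcal V)$ in a triangulated category $\mathcal T$, there exists a localization sequence $$\mathsf{def}\,\mathcal U\longrightarrow\operatorname{mod}\mathcal U\xrightarrow{\;Q\;}\mathsf{lex}\,\mathcal U$$ in which the right adjoint $R:\mathsf{lex}\,\mathcal U\to\operatorname{mod}\mathcal U$ of $Q$ is the canonical inclusion.
   Context: All categories and functors are additive; subcategories are full, additive and closed under isomorphisms. $\mathcal T$ is a triangulated category with translation $[1]$. A pair $(\mathcal U,\mathcal V)$ of full subcategories of $\mathcal T$, both closed under direct summands, is a cotorsion pair if $\mathcal T(U,V[1])=0$ for all $U\in\mathcal U$, $V\in\mathcal V$, and every object $X\in\mathcal T$ admits a triangle $U\to X\to V[1]\to U[1]$ with $U\in\mathcal U$, $V\in\mathcal V$. The extension-closed, contravariantly finite subcategory $\mathcal U$ is an extriangulated category with weak-kernels, with $\mathbb E(X,Z)=\mathcal T(X,Z[1])$: a conflation in $\mathcal U$ is a sequence $Z\to Y\to X$ of objects of $\mathcal U$ that completes to a triangle $Z\to Y\to X\to Z[1]$ in $\mathcal T$; the morphism $Y\to X$ in it is a deflation. $\operatorname{mod}\mathcal U$ is the abelian category of finitely presented contravariant functors $F:\mathcal U\to\mathsf{Ab}$, i.e. those with an exact sequence $\mathcal U(-,U_1)\to\mathcal U(-,U_0)\to F\to0$. $\mathsf{def}\,\mathcal U\subseteq\operatorname{mod}\mathcal U$ is the full subcategory of functors isomorphic to $\operatorname{Cok}(\mathcal U(-,Y)\xrightarrow{f\circ-}\mathcal U(-,X))$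 for some deflation $f:Y\to X$ in $\mathcal U$. $\mathsf{lex}\,\mathcal U\subseteq\operatorname{mod}\mathcal U$ is the full subcategory of functors $F$ with $0\to F(X)\to F(Y)\to F(Z)$ exact for every conflation $Z\to Y\to X$ in $\mathcal U$. A localization sequence $\mathcal S\to\mathcal A\xrightarrow{Q}\mathcal B$ consists of an abelian category $\mathcal A$, a Serre subcategory $\mathcal S$ with its inclusion, and a functor $Q$ which, up to an equivalence $\mathcal A/\mathcal S\simeq\mathcal B$, is the Serre quotient functor, such that both the inclusion $\mathcal S\to\mathcal A$ and $Q$ admit right adjoints. *)

theory Defs
  imports "HOL-Algebra.Coset"
begin

section \<open>Additive categories\<close>

text \<open>
  Abelian groups are commutative groups of \<^theory>\<open>HOL-Algebra.Group\<close>; their notation is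
  multiplicative, so in a group of morphisms \<open>\<otimes>\<close> is the sum, \<open>\<one>\<close> the zero morphism and
  \<open>inv\<close> the negative. Only the values of the operations on \<open>Obj\<close> and on the sets \<open>Arr\<close> matter.
\<close>

record ('o, 'm) precat =
  Obj :: "'o set"
  Dom :: "'m \<Rightarrow> 'o"
  Cod :: "'m \<Rightarrow> 'o"
  Hom :: "'o \<Rightarrow> 'o \<Rightarrow> 'm monoid"
  Ide :: "'o \<Rightarrow> 'm"
  Comp :: "'m \<Rightarrow> 'm \<Rightarrow> 'm" (infixl "\<cdot>\<index>" 70)

abbreviation Arr :: "('o, 'm, 'z) precat_scheme \<Rightarrow> 'o \<Rightarrow> 'o \<Rightarrow> 'm set" where
  "Arr C X Y \<equiv> carrier (Hom C X Y)"

abbreviation Zero :: "('o, 'm, 'z) precat_scheme \<Rightarrow> 'o \<Rightarrow> 'o \<Rightarrow> 'm" where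
  "Zero C X Y \<equiv> \<one>\<^bsub>Hom C X Y\<^esub>"

locale preadditive_category =
  fixes C :: "('o, 'm, 'z) precat_scheme" (structure)
  assumes hom_group: "\<lbrakk>X \<in> Obj C; Y \<in> Obj C\<rbrakk> \<Longrightarrow> comm_group (Hom C X Y)"
    and dom_cod: "\<lbrakk>X \<in> Obj C; Y \<in> Obj C; f \<in> Arr C X Y\<rbrakk> \<Longrightarrow> Dom C f = X \<and> Cod C f = Y"
    and ide_in: "X \<in> Obj C \<Longrightarrow> Ide C X \<in> Arr C X X"
    and ide_left: "\<lbrakk>X \<in> Obj C; Y \<in> Obj C; f \<in> Arr C X Y\<rbrakk> \<Longrightarrow> Ide C Y \<cdot> f = f"
    and ide_right: "\<lbrakk>X \<in> Obj C; Y \<in> Obj C; f \<in> Arr C X Y\<rbrakk> \<Longrightarrow> f \<cdot> Ide C X = f"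
    and comp_assoc: "\<lbrakk>W \<in> Obj C; X \<in> Obj C; Y \<in> Obj C; Z \<in> Obj C;
        f \<in> Arr C W X; g \<in> Arr C X Y; h \<in> Arr C Y Z\<rbrakk> \<Longrightarrow> (h \<cdot> g) \<cdot> f = h \<cdot> (g \<cdot> f)"
    and comp_hom_right: "\<lbrakk>X \<in> Obj C; Y \<in> Obj C; Z \<in> Obj C; f \<in> Arr C X Y\<rbrakk>
        \<Longrightarrow> (\<lambda>g. g \<cdot> f) \<in> hom (Hom C Y Z) (Hom C X Z)"
    and comp_hom_left: "\<lbrakk>X \<in> Obj C; Y \<in> Obj C; Z \<in> Obj C; g \<in> Arr C Y Z\<rbrakk>
        \<Longrightarrow> (\<lambda>f. g \<cdot> f) \<in> hom (Hom C X Y) (Hom C X Z)"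

definition zero_object :: "('o, 'm, 'z) precat_scheme \<Rightarrow> 'o \<Rightarrow> bool" where
  "zero_object C Z \<longleftrightarrow> Z \<in> Obj C \<and>
     (\<forall>X\<in>Obj C. Arr C X Z = {Zero C X Z} \<and> Arr C Z X = {Zero C Z X})"

definition biproduct :: "('o, 'm, 'z) precat_scheme \<Rightarrow> 'o \<Rightarrow> 'o \<Rightarrow> 'o \<Rightarrow> bool" where
  "biproduct C X Y B \<longleftrightarrow> X \<in> Obj C \<and> Y \<in> Obj C \<and> B \<in> Obj C \<and>
     (\<exists>i\<in>Arr C X B. \<exists>j\<in>Arr C Y B. \<exists>p\<in>Arr C B X. \<exists>q\<in>Arr C B Y.
        p \<cdot>\<^bsub>C\<^esub> i = Ide C X \<and> q \<cdot>\<^bsub>C\<^esub> j = Ide C Y \<and>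
        q \<cdot>\<^bsub>C\<^esub> i = Zero C X Y \<and> p \<cdot>\<^bsub>C\<^esub> j = Zero C Y X \<and>
        (i \<cdot>\<^bsub>C\<^esub> p) \<otimes>\<^bsub>Hom C B B\<^esub> (j \<cdot>\<^bsub>C\<^esub> q) = Ide C B)"

locale additive_category = preadditive_category +
  assumes ex_zero: "\<exists>Z. zero_object C Z"
    and ex_biproduct: "\<lbrakk>X \<in> Obj C; Y \<in> Obj C\<rbrakk> \<Longrightarrow> \<exists>B. biproduct C X Y B"

definition isomorphism :: "('o, 'm, 'z) precat_scheme \<Rightarrow> 'o \<Rightarrow> 'o \<Rightarrow> 'm \<Rightarrow> bool" where
  "isomorphism C X Y f \<longleftrightarrow> f \<in> Arr C X Y \<and>
     (\<exists>g\<in>Arr C Y X. g \<cdot>\<^bsub>C\<^esub> f = Ide C X \<and> f \<cdot>\<^bsub>C\<^esub> g = Ide C Y)"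

definition full_subcat :: "('o, 'm, 'z) precat_scheme \<Rightarrow> 'o set \<Rightarrow> ('o, 'm) precat" where
  "full_subcat C U = \<lparr>Obj = U, Dom = Dom C, Cod = Cod C, Hom = Hom C, Ide = Ide C, Comp = Comp C\<rparr>"

definition additive_subcat :: "('o, 'm, 'z) precat_scheme \<Rightarrow> 'o set \<Rightarrow> bool" where
  "additive_subcat C U \<longleftrightarrow> U \<subseteq> Obj C \<and>
     (\<forall>X\<in>U. \<forall>Y\<in>Obj C. (\<exists>f. isomorphism C X Y f) \<longrightarrow> Y \<in> U) \<and>
     (\<forall>Z. zero_object C Z \<longrightarrow> Z \<in> U) \<and>
     (\<forall>X\<in>U. \<forall>Y\<in>U. \<forall>B. biproduct C X Y B \<longrightarrow> B \<in> U)"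

definition summand_closed :: "('o, 'm, 'z) precat_scheme \<Rightarrow> 'o set \<Rightarrow> bool" where
  "summand_closed C U \<longleftrightarrow> (\<forall>X Y B. biproduct C X Y B \<longrightarrow> B \<in> U \<longrightarrow> X \<in> U)"


section \<open>Additive functors, equivalences, adjunctions\<close>

record ('o, 'm, 'p, 'n) cat_functor =
  FOb :: "'o \<Rightarrow> 'p"
  FAr :: "'m \<Rightarrow> 'n"

locale additive_functor =
  source: additive_category C + target: additive_category D
  for C :: "('o, 'm, 'y) precat_scheme" and D :: "('p, 'n, 'z) precat_scheme"
    and F :: "('o, 'm, 'p, 'n) cat_functor" +
  assumes fun_obj: "X \<in> Obj C \<Longrightarrow> FOb F X \<in> Obj D"
    and fun_hom: "\<lbrakk>X \<in> Obj C; Y \<in> Obj C\<rbrakk> \<Longrightarrow> FAr F \<in> hom (Hom C X Y) (Hom D (FOb F X) (FOb F Y))"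
    and fun_ide: "X \<in> Obj C \<Longrightarrow> FAr F (Ide C X) = Ide D (FOb F X)"
    and fun_comp: "\<lbrakk>X \<in> Obj C; Y \<in> Obj C; Z \<in> Obj C; f \<in> Arr C X Y; g \<in> Arr C Y Z\<rbrakk>
        \<Longrightarrow> FAr F (g \<cdot>\<^bsub>C\<^esub> f) = FAr F g \<cdot>\<^bsub>D\<^esub> FAr F f"

text \<open>The identity functor; it also serves as the inclusion functor of a full subcategory.\<close>

definition incl_functor :: "('o, 'm, 'o, 'm) cat_functor" where
  "incl_functor = \<lparr>FOb = (\<lambda>X. X), FAr = (\<lambda>f. f)\<rparr>"

definition comp_functor ::
  "('p, 'n, 'q, 'k) cat_functor \<Rightarrow> ('o, 'm, 'p, 'n) cat_functor \<Rightarrow> ('o, 'm, 'q, 'k) cat_functor" where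
  "comp_functor G F = \<lparr>FOb = FOb G \<circ> FOb F, FAr = FAr G \<circ> FAr F\<rparr>"

definition naturally_isomorphic :: "('o, 'm, 'y) precat_scheme \<Rightarrow> ('p, 'n, 'z) precat_scheme
    \<Rightarrow> ('o, 'm, 'p, 'n) cat_functor \<Rightarrow> ('o, 'm, 'p, 'n) cat_functor \<Rightarrow> bool" where
  "naturally_isomorphic C D F G \<longleftrightarrow>
     (\<exists>\<eta>. (\<forall>X\<in>Obj C. isomorphism D (FOb F X) (FOb G X) (\<eta> X)) \<and>
          (\<forall>X\<in>Obj C. \<forall>Y\<in>Obj C. \<forall>f\<in>Arr C X Y. \<eta> Y \<cdot>\<^bsub>D\<^esub> FAr F f = FAr G f \<cdot>\<^bsub>D\<^esub> \<eta> X))"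

definition equivalence :: "('o, 'm, 'y) precat_scheme \<Rightarrow> ('p, 'n, 'z) precat_scheme
    \<Rightarrow> ('o, 'm, 'p, 'n) cat_functor \<Rightarrow> bool" where
  "equivalence C D F \<longleftrightarrow> additive_functor C D F \<and>
     (\<exists>G. additive_functor D C G \<and>
        naturally_isomorphic C C incl_functor (comp_functor G F) \<and>
        naturally_isomorphic D D (comp_functor F G) incl_functor)"

text \<open>\<open>adjunction C D F G\<close>: the functor \<open>G: D \<rightarrow> C\<close> is right adjoint to \<open>F: C \<rightarrow> D\<close>.\<close>

definition adjunction :: "('o, 'm, 'y) precat_scheme \<Rightarrow> ('p, 'n, 'z) precat_scheme
    \<Rightarrow> ('o, 'm, 'p, 'n) cat_functor \<Rightarrow> ('p, 'n, 'o, 'm) cat_functor \<Rightarrow> bool" where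
  "adjunction C D F G \<longleftrightarrow> additive_functor C D F \<and> additive_functor D C G \<and>
     (\<exists>\<phi>. (\<forall>X\<in>Obj C. \<forall>Y\<in>Obj D. bij_betw (\<phi> X Y) (Arr D (FOb F X) Y) (Arr C X (FOb G Y))) \<and>
          (\<forall>X'\<in>Obj C. \<forall>X\<in>Obj C. \<forall>Y\<in>Obj D. \<forall>Y'\<in>Obj D.
             \<forall>a\<in>Arr C X' X. \<forall>f\<in>Arr D (FOb F X) Y. \<forall>b\<in>Arr D Y Y'.
               \<phi> X' Y' (b \<cdot>\<^bsub>D\<^esub> f \<cdot>\<^bsub>D\<^esub> FAr F a) = FAr G b \<cdot>\<^bsub>C\<^esub> \<phi> X Y f \<cdot>\<^bsub>C\<^esub> a))"


section \<open>Abelian categories and Serre quotients\<close>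

definition is_kernel :: "('o, 'm, 'z) precat_scheme \<Rightarrow> 'o \<Rightarrow> 'o \<Rightarrow> 'm \<Rightarrow> 'o \<Rightarrow> 'm \<Rightarrow> bool" where
  "is_kernel C X Y f K k \<longleftrightarrow> K \<in> Obj C \<and> k \<in> Arr C K X \<and> f \<cdot>\<^bsub>C\<^esub> k = Zero C K Y \<and>
     (\<forall>W\<in>Obj C. \<forall>g\<in>Arr C W X. f \<cdot>\<^bsub>C\<^esub> g = Zero C W Y \<longrightarrow> (\<exists>!u. u \<in> Arr C W K \<and> k \<cdot>\<^bsub>C\<^esub> u = g))"

definition is_cokernel :: "('o, 'm, 'z) precat_scheme \<Rightarrow> 'o \<Rightarrow> 'o \<Rightarrow> 'm \<Rightarrow> 'o \<Rightarrow> 'm \<Rightarrow> bool" where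
  "is_cokernel C X Y f L l \<longleftrightarrow> L \<in> Obj C \<and> l \<in> Arr C Y L \<and> l \<cdot>\<^bsub>C\<^esub> f = Zero C X L \<and>
     (\<forall>W\<in>Obj C. \<forall>g\<in>Arr C Y W. g \<cdot>\<^bsub>C\<^esub> f = Zero C X W \<longrightarrow> (\<exists>!u. u \<in> Arr C L W \<and> u \<cdot>\<^bsub>C\<^esub> l = g))"

definition monic :: "('o, 'm, 'z) precat_scheme \<Rightarrow> 'o \<Rightarrow> 'o \<Rightarrow> 'm \<Rightarrow> bool" where
  "monic C X Y f \<longleftrightarrow> f \<in> Arr C X Y \<and>
     (\<forall>W\<in>Obj C. \<forall>g\<in>Arr C W X. \<forall>h\<in>Arr C W X. f \<cdot>\<^bsub>C\<^esub> g = f \<cdot>\<^bsub>C\<^esub> h \<longrightarrow> g = h)"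

definition epic :: "('o, 'm, 'z) precat_scheme \<Rightarrow> 'o \<Rightarrow> 'o \<Rightarrow> 'm \<Rightarrow> bool" where
  "epic C X Y f \<longleftrightarrow> f \<in> Arr C X Y \<and>
     (\<forall>W\<in>Obj C. \<forall>g\<in>Arr C Y W. \<forall>h\<in>Arr C Y W. g \<cdot>\<^bsub>C\<^esub> f = h \<cdot>\<^bsub>C\<^esub> f \<longrightarrow> g = h)"

locale abelian_category = additive_category +
  assumes ex_kernel: "\<lbrakk>X \<in> Obj C; Y \<in> Obj C; f \<in> Arr C X Y\<rbrakk> \<Longrightarrow> \<exists>K k. is_kernel C X Y f K k"
    and ex_cokernel: "\<lbrakk>X \<in> Obj C; Y \<in> Obj C; f \<in> Arr C X Y\<rbrakk> \<Longrightarrow> \<exists>L l. is_cokernel C X Y f L l"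
    and monic_normal: "\<lbrakk>X \<in> Obj C; Y \<in> Obj C; monic C X Y f\<rbrakk>
        \<Longrightarrow> \<exists>Z\<in>Obj C. \<exists>g\<in>Arr C Y Z. is_kernel C Y Z g X f"
    and epic_normal: "\<lbrakk>X \<in> Obj C; Y \<in> Obj C; epic C X Y f\<rbrakk>
        \<Longrightarrow> \<exists>W\<in>Obj C. \<exists>g\<in>Arr C W X. is_cokernel C W X g Y f"

definition short_exact :: "('o, 'm, 'z) precat_scheme \<Rightarrow> 'o \<Rightarrow> 'o \<Rightarrow> 'o \<Rightarrow> 'm \<Rightarrow> 'm \<Rightarrow> bool" where
  "short_exact A X Y Z f g \<longleftrightarrow> X \<in> Obj A \<and> Y \<in> Obj A \<and> Z \<in> Obj A \<and>
     f \<in> Arr A X Y \<and> g \<in> Arr A Y Z \<and> is_kernel A Y Z g X f \<and> is_cokernel A X Y f Z g"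

definition serre_subcat :: "('o, 'm, 'z) precat_scheme \<Rightarrow> 'o set \<Rightarrow> bool" where
  "serre_subcat A S \<longleftrightarrow> S \<subseteq> Obj A \<and> S \<noteq> {} \<and>
     (\<forall>X Y Z f g. short_exact A X Y Z f g \<longrightarrow> (Y \<in> S \<longleftrightarrow> X \<in> S \<and> Z \<in> S))"

text \<open>
  The Serre quotient \<open>A/S\<close> is the localization of \<open>A\<close> at the class of morphisms with kernel and
  cokernel in \<open>S\<close>, which admits a calculus of fractions. A morphism \<open>X \<rightarrow> Y\<close> is a class of
  fractions \<open>X \<leftarrow>s\<midarrow> W \<midarrow>f\<rightarrow> Y\<close>, stored as \<open>(W, s, f)\<close>, with \<open>s\<close> in this class.
\<close>

definition serre_iso :: "('o, 'm, 'z) precat_scheme \<Rightarrow> 'o set \<Rightarrow> 'o \<Rightarrow> 'o \<Rightarrow> 'm \<Rightarrow> bool" where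
  "serre_iso A S X Y s \<longleftrightarrow> s \<in> Arr A X Y \<and>
     (\<exists>K\<in>S. \<exists>k. is_kernel A X Y s K k) \<and> (\<exists>L\<in>S. \<exists>l. is_cokernel A X Y s L l)"

definition fractions ::
  "('o, 'm, 'z) precat_scheme \<Rightarrow> 'o set \<Rightarrow> 'o \<Rightarrow> 'o \<Rightarrow> ('o \<times> 'm \<times> 'm) set" where
  "fractions A S X Y = {(W, s, f). W \<in> Obj A \<and> serre_iso A S W X s \<and> f \<in> Arr A W Y}"

definition frac_eq ::
  "('o, 'm, 'z) precat_scheme \<Rightarrow> 'o set \<Rightarrow> 'o \<Rightarrow> 'o \<times> 'm \<times> 'm \<Rightarrow> 'o \<times> 'm \<times> 'm \<Rightarrow> bool" where
  "frac_eq A S X = (\<lambda>(W, s, f) (W', t, g).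
     \<exists>P\<in>Obj A. \<exists>u\<in>Arr A P W. \<exists>v\<in>Arr A P W'.
       serre_iso A S P X (s \<cdot>\<^bsub>A\<^esub> u) \<and> s \<cdot>\<^bsub>A\<^esub> u = t \<cdot>\<^bsub>A\<^esub> v \<and> f \<cdot>\<^bsub>A\<^esub> u = g \<cdot>\<^bsub>A\<^esub> v)"

definition frac_class :: "('o, 'm, 'z) precat_scheme \<Rightarrow> 'o set \<Rightarrow> 'o \<Rightarrow> 'o
    \<Rightarrow> 'o \<times> 'm \<times> 'm \<Rightarrow> ('o \<times> 'm \<times> 'm) set" where
  "frac_class A S X Y r = {r' \<in> fractions A S X Y. frac_eq A S X r r'}"

text \<open>
  Fractions are added after passing to a common denominator and composed by completing
  \<open>W \<midarrow>f\<rightarrow> Y \<leftarrow>t\<midarrow> V\<close> to a commutative square with vertex \<open>P\<close>. The unions below run over all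
  choices of representatives and squares, which all give the same class.
\<close>

definition frac_add :: "('o, 'm, 'z) precat_scheme \<Rightarrow> 'o set \<Rightarrow> 'o \<Rightarrow> 'o
    \<Rightarrow> ('o \<times> 'm \<times> 'm) set \<Rightarrow> ('o \<times> 'm \<times> 'm) set \<Rightarrow> ('o \<times> 'm \<times> 'm) set" where
  "frac_add A S X Y c d =
     \<Union> {frac_class A S X Y (W, s, f \<otimes>\<^bsub>Hom A W Y\<^esub> g) | W s f g. (W, s, f) \<in> c \<and> (W, s, g) \<in> d}"

definition frac_comp :: "('o, 'm, 'z) precat_scheme \<Rightarrow> 'o set \<Rightarrow> 'o \<Rightarrow> 'o
    \<Rightarrow> ('o \<times> 'm \<times> 'm) set \<Rightarrow> ('o \<times> 'm \<times> 'm) set \<Rightarrow> ('o \<times> 'm \<times> 'm) set" where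
  "frac_comp A S X Z d c =
     \<Union> {frac_class A S X Z (P, s \<cdot>\<^bsub>A\<^esub> t', g \<cdot>\<^bsub>A\<^esub> f') | P W V s f t g t' f'.
           (W, s, f) \<in> c \<and> (V, t, g) \<in> d \<and> P \<in> Obj A \<and>
           serre_iso A S P W t' \<and> f' \<in> Arr A P V \<and> f \<cdot>\<^bsub>A\<^esub> t' = t \<cdot>\<^bsub>A\<^esub> f'}"

type_synonym ('o, 'm) frac_mor = "'o \<times> 'o \<times> ('o \<times> 'm \<times> 'm) set"

definition serre_quotient ::
  "('o, 'm, 'z) precat_scheme \<Rightarrow> 'o set \<Rightarrow> ('o, ('o, 'm) frac_mor) precat" where
  "serre_quotient A S = \<lparr>
     Obj = Obj A,
     Dom = (\<lambda>(X, Y, c). X),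
     Cod = (\<lambda>(X, Y, c). Y),
     Hom = (\<lambda>X Y. \<lparr>
       carrier = {(X, Y, frac_class A S X Y r) | r. r \<in> fractions A S X Y},
       mult = (\<lambda>(_, _, c) (_, _, d). (X, Y, frac_add A S X Y c d)),
       one = (X, Y, frac_class A S X Y (X, Ide A X, Zero A X Y))\<rparr>),
     Ide = (\<lambda>X. (X, X, frac_class A S X X (X, Ide A X, Ide A X))),
     Comp = (\<lambda>(Y, Z, d) (X, _, c). (X, Z, frac_comp A S X Z d c))\<rparr>"

definition quotient_functor ::
  "('o, 'm, 'z) precat_scheme \<Rightarrow> 'o set \<Rightarrow> ('o, 'm, 'o, ('o, 'm) frac_mor) cat_functor" where
  "quotient_functor A S = \<lparr>
     FOb = (\<lambda>X. X),
     FAr = (\<lambda>f. (Dom A f, Cod A f,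
               frac_class A S (Dom A f) (Cod A f) (Dom A f, Ide A (Dom A f), f)))\<rparr>"

definition localization_sequence :: "('o, 'm, 'y) precat_scheme \<Rightarrow> 'o set
    \<Rightarrow> ('p, 'n, 'z) precat_scheme \<Rightarrow> ('o, 'm, 'p, 'n) cat_functor \<Rightarrow> bool" where
  "localization_sequence A S B Q \<longleftrightarrow>
     abelian_category A \<and> serre_subcat A S \<and> additive_functor A B Q \<and>
     (\<exists>E. equivalence (serre_quotient A S) B E \<and>
          naturally_isomorphic A B (comp_functor E (quotient_functor A S)) Q) \<and>
     (\<exists>J. adjunction (full_subcat A S) A incl_functor J) \<and>
     (\<exists>R. adjunction A B Q R)"


section \<open>Triangulated categories and cotorsion pairs\<close>

text \<open>A triangle \<open>X \<midarrow>f\<rightarrow> Y \<midarrow>g\<rightarrow> Z \<midarrow>h\<rightarrow> X[1]\<close> is stored as \<open>(f, g, h)\<close>.\<close>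

record ('o, 'm) tricat = "('o, 'm) precat" +
  Shift :: "('o, 'm, 'o, 'm) cat_functor"
  Tri :: "('m \<times> 'm \<times> 'm) set"

abbreviation shO :: "('o, 'm, 'z) tricat_scheme \<Rightarrow> 'o \<Rightarrow> 'o" where
  "shO T \<equiv> FOb (Shift T)"

abbreviation shA :: "('o, 'm, 'z) tricat_scheme \<Rightarrow> 'm \<Rightarrow> 'm" where
  "shA T \<equiv> FAr (Shift T)"

definition triangle :: "('o, 'm, 'z) tricat_scheme \<Rightarrow> 'o \<Rightarrow> 'o \<Rightarrow> 'o \<Rightarrow> 'm \<Rightarrow> 'm \<Rightarrow> 'm \<Rightarrow> bool" where
  "triangle T X Y Z f g h \<longleftrightarrow> X \<in> Obj T \<and> Y \<in> Obj T \<and> Z \<in> Obj T \<and>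
     f \<in> Arr T X Y \<and> g \<in> Arr T Y Z \<and> h \<in> Arr T Z (shO T X)"

definition distinguished :: "('o, 'm, 'z) tricat_scheme \<Rightarrow> 'o \<Rightarrow> 'o \<Rightarrow> 'o \<Rightarrow> 'm \<Rightarrow> 'm \<Rightarrow> 'm \<Rightarrow> bool" where
  "distinguished T X Y Z f g h \<longleftrightarrow> triangle T X Y Z f g h \<and> (f, g, h) \<in> Tri T"

locale triangulated_category = additive_category T
  for T :: "('o, 'm, 'z) tricat_scheme" (structure) +
  assumes shift_equiv: "equivalence T T (Shift T)"
    and tri_iso: "\<lbrakk>distinguished T X Y Z f g h; triangle T X' Y' Z' f' g' h';
        isomorphism T X X' a; isomorphism T Y Y' b; isomorphism T Z Z' c;
        f' \<cdot> a = b \<cdot> f; g' \<cdot> b = c \<cdot> g; h' \<cdot> c = shA T a \<cdot> h\<rbrakk>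
        \<Longrightarrow> distinguished T X' Y' Z' f' g' h'"
    and tri_ide: "\<lbrakk>X \<in> Obj T; zero_object T Z\<rbrakk>
        \<Longrightarrow> distinguished T X X Z (Ide T X) (Zero T X Z) (Zero T Z (shO T X))"
    and tri_complete: "\<lbrakk>X \<in> Obj T; Y \<in> Obj T; f \<in> Arr T X Y\<rbrakk>
        \<Longrightarrow> \<exists>Z g h. distinguished T X Y Z f g h"
    and tri_rotate: "triangle T X Y Z f g h \<Longrightarrow> distinguished T X Y Z f g h \<longleftrightarrow>
        distinguished T Y Z (shO T X) g h (inv\<^bsub>Hom T (shO T X) (shO T Y)\<^esub> (shA T f))"
    and tri_morphism: "\<lbrakk>distinguished T X Y Z f g h; distinguished T X' Y' Z' f' g' h';
        a \<in> Arr T X X'; b \<in> Arr T Y Y'; f' \<cdot> a = b \<cdot> f\<rbrakk>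
        \<Longrightarrow> \<exists>c\<in>Arr T Z Z'. g' \<cdot> b = c \<cdot> g \<and> h' \<cdot> c = shA T a \<cdot> h"
    and octahedral: "\<lbrakk>distinguished T X Y Z' f a a'; distinguished T Y Z X' g b b';
        distinguished T X Z Y' (g \<cdot> f) c c'\<rbrakk>
        \<Longrightarrow> \<exists>u v. distinguished T Z' Y' X' u v (shA T a \<cdot> b') \<and>
              u \<cdot> a = c \<cdot> g \<and> c' \<cdot> u = a' \<and> v \<cdot> c = b \<and> b' \<cdot> v = shA T f \<cdot> c'"

definition cotorsion_pair :: "('o, 'm, 'z) tricat_scheme \<Rightarrow> 'o set \<Rightarrow> 'o set \<Rightarrow> bool" where
  "cotorsion_pair T U V \<longleftrightarrow>
     additive_subcat T U \<and> additive_subcat T V \<and> summand_closed T U \<and> summand_closed T V \<and>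
     (\<forall>A\<in>U. \<forall>B\<in>V. Arr T A (shO T B) = {Zero T A (shO T B)}) \<and>
     (\<forall>X\<in>Obj T. \<exists>A\<in>U. \<exists>B\<in>V. \<exists>f g h. distinguished T A X (shO T B) f g h)"

definition conflation :: "('o, 'm, 'z) tricat_scheme \<Rightarrow> 'o set \<Rightarrow> 'o \<Rightarrow> 'o \<Rightarrow> 'o \<Rightarrow> 'm \<Rightarrow> 'm \<Rightarrow> bool" where
  "conflation T U Z Y X f g \<longleftrightarrow> Z \<in> U \<and> Y \<in> U \<and> X \<in> U \<and> (\<exists>h. distinguished T Z Y X f g h)"

definition deflation :: "('o, 'm, 'z) tricat_scheme \<Rightarrow> 'o set \<Rightarrow> 'o \<Rightarrow> 'o \<Rightarrow> 'm \<Rightarrow> bool" where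
  "deflation T U Y X g \<longleftrightarrow> (\<exists>Z f. conflation T U Z Y X f g)"


section \<open>Finitely presented functors\<close>

text \<open>
  Contravariant functors into the category of abelian groups whose elements are of type \<open>'g\<close>.
  Representable functors have values in groups on the type of morphisms, so natural
  transformations are allowed to relate functors with values in groups on different types.
\<close>

record ('o, 'm, 'g) abfunctor =
  AOb :: "'o \<Rightarrow> 'g monoid"
  AAr :: "'m \<Rightarrow> 'g \<Rightarrow> 'g"

definition additive_abfunctor :: "('o, 'm, 'z) precat_scheme \<Rightarrow> ('o, 'm, 'g) abfunctor \<Rightarrow> bool" where
  "additive_abfunctor C F \<longleftrightarrow>
     (\<forall>X\<in>Obj C. comm_group (AOb F X)) \<and>
     (\<forall>X\<in>Obj C. \<forall>Y\<in>Obj C. \<forall>f\<in>Arr C X Y. AAr F f \<in> hom (AOb F Y) (AOb F X)) \<and>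
     (\<forall>X\<in>Obj C. \<forall>x\<in>carrier (AOb F X). AAr F (Ide C X) x = x) \<and>
     (\<forall>X\<in>Obj C. \<forall>Y\<in>Obj C. \<forall>Z\<in>Obj C. \<forall>f\<in>Arr C X Y. \<forall>g\<in>Arr C Y Z.
        \<forall>z\<in>carrier (AOb F Z). AAr F (g \<cdot>\<^bsub>C\<^esub> f) z = AAr F f (AAr F g z)) \<and>
     (\<forall>X\<in>Obj C. \<forall>Y\<in>Obj C. \<forall>f\<in>Arr C X Y. \<forall>g\<in>Arr C X Y. \<forall>y\<in>carrier (AOb F Y).
        AAr F (f \<otimes>\<^bsub>Hom C X Y\<^esub> g) y = AAr F f y \<otimes>\<^bsub>AOb F X\<^esub> AAr F g y)"

definition natural_trans :: "('o, 'm, 'z) precat_scheme \<Rightarrow> ('o, 'm, 'g) abfunctor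
    \<Rightarrow> ('o, 'm, 'h) abfunctor \<Rightarrow> ('o \<Rightarrow> 'g \<Rightarrow> 'h) \<Rightarrow> bool" where
  "natural_trans C F G \<eta> \<longleftrightarrow>
     (\<forall>X\<in>Obj C. \<eta> X \<in> hom (AOb F X) (AOb G X)) \<and>
     (\<forall>X\<in>Obj C. \<forall>Y\<in>Obj C. \<forall>f\<in>Arr C X Y. \<forall>y\<in>carrier (AOb F Y).
        \<eta> X (AAr F f y) = AAr G f (\<eta> Y y))"

definition abfunctor_iso :: "('o, 'm, 'z) precat_scheme \<Rightarrow> ('o, 'm, 'g) abfunctor
    \<Rightarrow> ('o, 'm, 'h) abfunctor \<Rightarrow> bool" where
  "abfunctor_iso C F G \<longleftrightarrow>
     (\<exists>\<eta>. natural_trans C F G \<eta> \<and> (\<forall>X\<in>Obj C. \<eta> X \<in> iso (AOb F X) (AOb G X)))"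

definition representable :: "('o, 'm, 'z) precat_scheme \<Rightarrow> 'o \<Rightarrow> ('o, 'm, 'm) abfunctor" where
  "representable C U = \<lparr>AOb = (\<lambda>X. Hom C X U), AAr = (\<lambda>f g. g \<cdot>\<^bsub>C\<^esub> f)\<rparr>"

definition representable_map :: "('o, 'm, 'z) precat_scheme \<Rightarrow> 'm \<Rightarrow> 'o \<Rightarrow> 'm \<Rightarrow> 'm" where
  "representable_map C f = (\<lambda>X g. f \<cdot>\<^bsub>C\<^esub> g)"

definition cokernel_functor :: "('o, 'm, 'z) precat_scheme \<Rightarrow> ('o, 'm, 'g) abfunctor
    \<Rightarrow> ('o, 'm, 'h) abfunctor \<Rightarrow> ('o \<Rightarrow> 'g \<Rightarrow> 'h) \<Rightarrow> ('o, 'm, 'h set) abfunctor" where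
  "cokernel_functor C F G \<alpha> = \<lparr>
     AOb = (\<lambda>X. AOb G X Mod (\<alpha> X ` carrier (AOb F X))),
     AAr = (\<lambda>f c. let X = Dom C f in
              (\<Union>y\<in>c. (\<alpha> X ` carrier (AOb F X)) #>\<^bsub>AOb G X\<^esub> AAr G f y))\<rparr>"

definition finitely_presented :: "('o, 'm, 'z) precat_scheme \<Rightarrow> ('o, 'm, 'g) abfunctor \<Rightarrow> bool" where
  "finitely_presented C F \<longleftrightarrow> additive_abfunctor C F \<and>
     (\<exists>U\<^sub>1\<in>Obj C. \<exists>U\<^sub>0\<in>Obj C. \<exists>\<alpha> \<pi>.
        natural_trans C (representable C U\<^sub>1) (representable C U\<^sub>0) \<alpha> \<and>
        natural_trans C (representable C U\<^sub>0) F \<pi> \<and>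
        (\<forall>X\<in>Obj C. \<alpha> X ` Arr C X U\<^sub>1 = kernel (Hom C X U\<^sub>0) (AOb F X) (\<pi> X) \<and>
                   \<pi> X ` Arr C X U\<^sub>0 = carrier (AOb F X)))"

text \<open>
  The components of a natural transformation are cut off outside the objects and outside the
  carriers, so that equality of morphisms is equality of natural transformations.
\<close>

type_synonym ('o, 'm, 'g) nattrans =
  "('o, 'm, 'g) abfunctor \<times> ('o, 'm, 'g) abfunctor \<times> ('o \<Rightarrow> 'g \<Rightarrow> 'g)"

definition mod_cat ::
  "('o, 'm, 'z) precat_scheme \<Rightarrow> (('o, 'm, 'g) abfunctor, ('o, 'm, 'g) nattrans) precat" where
  "mod_cat C = \<lparr>
     Obj = {F. finitely_presented C F},
     Dom = (\<lambda>(F, G, \<eta>). F),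
     Cod = (\<lambda>(F, G, \<eta>). G),
     Hom = (\<lambda>F G. \<lparr>
       carrier = {(F, G, \<eta>) | \<eta>. natural_trans C F G \<eta> \<and>
                    \<eta> \<in> (\<Pi>\<^sub>E X\<in>Obj C. extensional (carrier (AOb F X)))},
       mult = (\<lambda>(_, _, \<eta>) (_, _, \<theta>).
                (F, G, \<lambda>X\<in>Obj C. \<lambda>x\<in>carrier (AOb F X). \<eta> X x \<otimes>\<^bsub>AOb G X\<^esub> \<theta> X x)),
       one = (F, G, \<lambda>X\<in>Obj C. \<lambda>x\<in>carrier (AOb F X). \<one>\<^bsub>AOb G X\<^esub>)\<rparr>),
     Ide = (\<lambda>F. (F, F, \<lambda>X\<in>Obj C. \<lambda>x\<in>carrier (AOb F X). x)),
     Comp = (\<lambda>(G, H, \<theta>) (F, _, \<eta>). (F, H, \<lambda>X\<in>Obj C. \<lambda>x\<in>carrier (AOb F X). \<theta> X (\<eta> X x)))\<rparr>"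

definition def_objects :: "('o, 'm, 'z) tricat_scheme \<Rightarrow> 'o set \<Rightarrow> ('o, 'm, 'g) abfunctor set" where
  "def_objects T U = {F. finitely_presented (full_subcat T U) F \<and>
     (\<exists>Y X f. deflation T U Y X f \<and>
        abfunctor_iso (full_subcat T U) F
          (cokernel_functor (full_subcat T U) (representable (full_subcat T U) Y)
            (representable (full_subcat T U) X) (representable_map (full_subcat T U) f)))}"

definition lex_objects :: "('o, 'm, 'z) tricat_scheme \<Rightarrow> 'o set \<Rightarrow> ('o, 'm, 'g) abfunctor set" where
  "lex_objects T U = {F. finitely_presented (full_subcat T U) F \<and>
     (\<forall>Z Y X f g. conflation T U Z Y X f g \<longrightarrow>
        inj_on (AAr F g) (carrier (AOb F X)) \<and>
        AAr F g ` carrier (AOb F X) = kernel (AOb F Y) (AOb F Z) (AAr F f))}"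

end

theory Submission
  imports Defs
begin

text \<open>
  A functor \<open>F\<close> in \<open>mod U\<close> lies in \<open>def U\<close> iff it is effaceable: every element of \<open>F(W)\<close> dies along
  some deflation \<open>Y \<rightarrow> W\<close>. So deflations behave like the covers of a topology, in which \<open>lex U\<close>
  consists of the sheaves and the morphisms with kernel and cokernel in \<open>def U\<close> are the locally
  bijective ones; the sheaf argument shows that a left exact functor is local for these.
  The reflection of \<open>F = Cok U(-, f)\<close>, \<open>f: X1 \<rightarrow> X0\<close>, is represented by an object of \<open>T\<close>: if
  \<open>K[1]\<close> is the cone of \<open>f\<close>, choose approximations \<open>A \<rightarrow> K \<rightarrow> B[1]\<close> and \<open>A' \<rightarrow> A[1] \<rightarrow> I[1]\<close> with
  \<open>A, A'\<close> in \<open>U\<close> and \<open>B, I\<close> in \<open>V\<close>; then the cone of the composite \<open>A' \<rightarrow> A[1] \<rightarrow> K[1]\<close> will do.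
  Given reflections, morphisms in the Serre quotient from \<open>X\<close> to \<open>Y\<close> are identified with morphisms
  between the reflections of \<open>X\<close> and \<open>Y\<close>.
\<close>

section \<open>Arrows of additive categories\<close>

text \<open>On \<open>U\<close> the functor \<open>F\<close> is the image of \<open>T(-, X0)\<close>
  in \<open>T(-, K[1])\<close>. The latter is not left exact: an element killed by a deflation whose
  conflation starts at \<open>Z\<close> comes from a map \<open>Z[1] -> K[1]\<close>, hence from
  \<open>A[1] -> K[1]\<close>. Taking the cone \<open>B[2]\<close> of \<open>A[1] -> K[1]\<close>
  cures this, but a map from \<open>W\<close> to \<open>B[2]\<close> lifts to \<open>K[1]\<close>
  only up to an obstruction in \<open>T(W, A[2])\<close>, which deflations need not remove.
  Replacing \<open>A[1]\<close> by its approximation \<open>A'\<close> moves the obstruction into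
  \<open>T(W, A'[1])\<close>, where every element is the class of an extension of \<open>W\<close>
  by \<open>A'\<close> and so dies along a deflation. No map is lost, since maps from
  \<open>U\<close> to \<open>A[1]\<close> factor through \<open>A'\<close>. Membership in
  \<open>U\<close> is tested by orthogonality to \<open>V[1]\<close>, which turns the closure
  properties of deflations into arguments with exact sequences. The Serre quotient is given by
  classes of fractions, with operations that are unions over representatives. That it is an additive
  category is itself read off from the maps between reflections, so the reflections have to exist
  first.\<close>

text \<open>The category axioms speak only about morphisms between objects. Bundling both ends with
  the hom set lets a single premise feed every rule by \<open>OF\<close>.\<close>

definition arrow :: "('o, 'm, 'z) precat_scheme \<Rightarrow> 'm \<Rightarrow> 'o \<Rightarrow> 'o \<Rightarrow> bool" where
  "arrow C f X Y \<longleftrightarrow> X \<in> Obj C \<and> Y \<in> Obj C \<and> f \<in> Arr C X Y"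

lemma arrowD: "arrow C f X Y \<Longrightarrow> X \<in> Obj C" "arrow C f X Y \<Longrightarrow> Y \<in> Obj C" "arrow C f X Y \<Longrightarrow> f \<in> Arr C X Y"
  by (auto simp: arrow_def)

context preadditive_category
begin

lemma arrow_dom_cod: "arrow C f X Y \<Longrightarrow> Dom C f = X" "arrow C f X Y \<Longrightarrow> Cod C f = Y"
  using dom_cod by (auto simp: arrow_def)

lemma arrow_comp: "arrow C f X Y \<Longrightarrow> arrow C g Y Z \<Longrightarrow> arrow C (g \<cdot> f) X Z"
  using comp_hom_left[of X Y Z g] by (auto simp: arrow_def hom_def)

lemma arrow_assoc:
  "arrow C f W X \<Longrightarrow> arrow C g X Y \<Longrightarrow> arrow C h Y Z \<Longrightarrow> (h \<cdot> g) \<cdot> f = h \<cdot> (g \<cdot> f)"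
  unfolding arrow_def using comp_assoc by blast

lemma arrow_ide: "X \<in> Obj C \<Longrightarrow> arrow C (Ide C X) X X"
  using ide_in by (auto simp: arrow_def)

lemma arrow_ide_left: "arrow C f X Y \<Longrightarrow> Ide C Y \<cdot> f = f"
  unfolding arrow_def using ide_left by blast

lemma arrow_ide_right: "arrow C f X Y \<Longrightarrow> f \<cdot> Ide C X = f"
  unfolding arrow_def using ide_right by blast

lemma arrow_zero: "X \<in> Obj C \<Longrightarrow> Y \<in> Obj C \<Longrightarrow> arrow C (Zero C X Y) X Y"
  using hom_group by (auto simp: arrow_def comm_group.axioms(2) group.is_monoid intro!: monoid.one_closed)

lemma hom_is_group: "X \<in> Obj C \<Longrightarrow> Y \<in> Obj C \<Longrightarrow> group (Hom C X Y)"
  using hom_group comm_group.axioms(2) by blast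

lemma arrow_sum: "arrow C f X Y \<Longrightarrow> arrow C g X Y \<Longrightarrow> arrow C (f \<otimes>\<^bsub>Hom C X Y\<^esub> g) X Y"
  using monoid.m_closed[OF group.is_monoid[OF hom_is_group]] by (auto simp: arrow_def)

lemma arrow_neg: "arrow C f X Y \<Longrightarrow> arrow C (inv\<^bsub>Hom C X Y\<^esub> f) X Y"
  using group.inv_closed[OF hom_is_group] by (auto simp: arrow_def)

lemma group_hom_comp_right: "arrow C f X Y \<Longrightarrow> Z \<in> Obj C \<Longrightarrow> group_hom (Hom C Y Z) (Hom C X Z) (\<lambda>g. g \<cdot> f)"
  unfolding arrow_def
  by (metis comp_hom_right group_hom.intro group_hom_axioms.intro hom_is_group)

lemma group_hom_comp_left: "arrow C g Y Z \<Longrightarrow> X \<in> Obj C \<Longrightarrow> group_hom (Hom C X Y) (Hom C X Z) (\<lambda>f. g \<cdot> f)"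
  unfolding arrow_def
  by (metis comp_hom_left group_hom.intro group_hom_axioms.intro hom_is_group)

lemma zero_comp: "arrow C f X Y \<Longrightarrow> Z \<in> Obj C \<Longrightarrow> Zero C Y Z \<cdot> f = Zero C X Z"
  using group_hom.hom_one[OF group_hom_comp_right] .

lemma comp_zero: "arrow C g Y Z \<Longrightarrow> X \<in> Obj C \<Longrightarrow> g \<cdot> Zero C X Y = Zero C X Z"
  using group_hom.hom_one[OF group_hom_comp_left] .

lemma sum_comp: "arrow C f X Y \<Longrightarrow> arrow C g Y Z \<Longrightarrow> arrow C h Y Z \<Longrightarrow>
    (g \<otimes>\<^bsub>Hom C Y Z\<^esub> h) \<cdot> f = (g \<cdot> f) \<otimes>\<^bsub>Hom C X Z\<^esub> (h \<cdot> f)"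
  using group_hom.hom_mult[OF group_hom_comp_right] by (fastforce simp: arrow_def)

lemma comp_sum: "arrow C f X Y \<Longrightarrow> arrow C g X Y \<Longrightarrow> arrow C h Y Z \<Longrightarrow>
    h \<cdot> (f \<otimes>\<^bsub>Hom C X Y\<^esub> g) = (h \<cdot> f) \<otimes>\<^bsub>Hom C X Z\<^esub> (h \<cdot> g)"
  using group_hom.hom_mult[OF group_hom_comp_left] by (fastforce simp: arrow_def)

lemma neg_comp: "arrow C f X Y \<Longrightarrow> arrow C g Y Z \<Longrightarrow>
    (inv\<^bsub>Hom C Y Z\<^esub> g) \<cdot> f = inv\<^bsub>Hom C X Z\<^esub> (g \<cdot> f)"
  using group_hom.hom_inv[OF group_hom_comp_right] by (fastforce simp: arrow_def)

lemma comp_neg: "arrow C f X Y \<Longrightarrow> arrow C h Y Z \<Longrightarrow>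
    h \<cdot> (inv\<^bsub>Hom C X Y\<^esub> f) = inv\<^bsub>Hom C X Z\<^esub> (h \<cdot> f)"
  using group_hom.hom_inv[OF group_hom_comp_left] by (fastforce simp: arrow_def)

lemma diff_eq_zero_iff: "arrow C f X Y \<Longrightarrow> arrow C g X Y \<Longrightarrow>
    f \<otimes>\<^bsub>Hom C X Y\<^esub> inv\<^bsub>Hom C X Y\<^esub> g = Zero C X Y \<longleftrightarrow> f = g"
  unfolding arrow_def
  by (metis group.inv_closed group.inv_inv group.inv_equality group.r_inv hom_is_group)

lemma neg_eq_zero_iff: "arrow C f X Y \<Longrightarrow> inv\<^bsub>Hom C X Y\<^esub> f = Zero C X Y \<longleftrightarrow> f = Zero C X Y"
  unfolding arrow_def
  by (metis group.inv_eq_1_iff hom_is_group)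

lemma neg_neg: "arrow C f X Y \<Longrightarrow> inv\<^bsub>Hom C X Y\<^esub> (inv\<^bsub>Hom C X Y\<^esub> f) = f"
  unfolding arrow_def by (metis group.inv_inv hom_is_group)

lemma neg_zero: "X \<in> Obj C \<Longrightarrow> Y \<in> Obj C \<Longrightarrow> inv\<^bsub>Hom C X Y\<^esub> (Zero C X Y) = Zero C X Y"
  using neg_eq_zero_iff arrow_zero by blast

lemma sum_zero: "arrow C f X Y \<Longrightarrow> f \<otimes>\<^bsub>Hom C X Y\<^esub> Zero C X Y = f"
  "arrow C f X Y \<Longrightarrow> Zero C X Y \<otimes>\<^bsub>Hom C X Y\<^esub> f = f"
  unfolding arrow_def
  by (metis group.is_monoid hom_is_group monoid.r_one, metis group.is_monoid hom_is_group monoid.l_one)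

lemma arrow_to_zero: "zero_object C Z \<Longrightarrow> arrow C f X Z \<Longrightarrow> f = Zero C X Z"
  by (auto simp: zero_object_def arrow_def)

text \<open>Every arrow from or to \<open>Z\<close> factors through its identity.\<close>

lemma zero_objectI:
  assumes "Z \<in> Obj C" "Ide C Z = Zero C Z Z"
  shows "zero_object C Z"
proof -
  have "f = Zero C X Z" if "X \<in> Obj C" "f \<in> Arr C X Z" for X f
    using arrow_ide_left[of f X Z] zero_comp[of f X Z Z] that assms by (simp add: arrow_def)
  moreover have "f = Zero C Z X" if "X \<in> Obj C" "f \<in> Arr C Z X" for X f
    using arrow_ide_right[of f Z X] comp_zero[of f Z X Z] that assms by (simp add: arrow_def)
  ultimately show ?thesis
    using assms arrow_zero by (auto simp: zero_object_def arrow_def)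
qed

lemma isomorphismE:
  assumes "isomorphism C X Y f" "X \<in> Obj C" "Y \<in> Obj C"
  obtains g where "arrow C f X Y" "arrow C g Y X" "g \<cdot> f = Ide C X" "f \<cdot> g = Ide C Y"
  using assms by (auto simp: isomorphism_def arrow_def)

lemma isomorphismI:
  "arrow C f X Y \<Longrightarrow> arrow C g Y X \<Longrightarrow> g \<cdot> f = Ide C X \<Longrightarrow> f \<cdot> g = Ide C Y \<Longrightarrow> isomorphism C X Y f"
  by (auto simp: isomorphism_def arrow_def)

lemma isomorphism_ide: "X \<in> Obj C \<Longrightarrow> isomorphism C X X (Ide C X)"
  by (meson arrow_ide arrow_ide_left isomorphismI)

lemma iso_cancel_left:
  assumes "isomorphism C Y Z e" "arrow C f X Y" "arrow C g X Y" "Z \<in> Obj C" "e \<cdot> f = e \<cdot> g"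
  shows "f = g"
proof -
  obtain e' where e': "arrow C e Y Z" "arrow C e' Z Y" "e' \<cdot> e = Ide C Y"
    using isomorphismE assms arrowD(2) by metis
  have "f = e' \<cdot> (e \<cdot> f)" using arrow_assoc[OF assms(2) e'(1,2)] e'(3) arrow_ide_left assms(2) by simp
  also have "\<dots> = g" using arrow_assoc[OF assms(3) e'(1,2)] e'(3) arrow_ide_left assms(3,5) by simp
  finally show ?thesis .
qed

lemma iso_cancel_right:
  assumes "isomorphism C W X e" "arrow C f X Y" "arrow C g X Y" "W \<in> Obj C" "f \<cdot> e = g \<cdot> e"
  shows "f = g"
proof -
  obtain e' where e': "arrow C e W X" "arrow C e' X W" "e \<cdot> e' = Ide C X"
    using isomorphismE assms arrowD(1) by metis
  have "f = (f \<cdot> e) \<cdot> e'" using arrow_assoc[OF e'(2,1) assms(2)] e'(3) arrow_ide_right assms(2) by simp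
  also have "\<dots> = g" using arrow_assoc[OF e'(2,1) assms(3)] e'(3) arrow_ide_right assms(3,5) by simp
  finally show ?thesis .
qed

lemma biproductE:
  assumes "biproduct C X Y B"
  obtains i j p q where "arrow C i X B" "arrow C j Y B" "arrow C p B X" "arrow C q B Y"
    "p \<cdot> i = Ide C X" "q \<cdot> j = Ide C Y" "q \<cdot> i = Zero C X Y" "p \<cdot> j = Zero C Y X"
    "(i \<cdot> p) \<otimes>\<^bsub>Hom C B B\<^esub> (j \<cdot> q) = Ide C B"
  using assms unfolding biproduct_def arrow_def by blast

lemma biproductI:
  assumes "arrow C i X B" "arrow C j Y B" "arrow C p B X" "arrow C q B Y"
    "p \<cdot> i = Ide C X" "q \<cdot> j = Ide C Y" "q \<cdot> i = Zero C X Y" "p \<cdot> j = Zero C Y X"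
    "(i \<cdot> p) \<otimes>\<^bsub>Hom C B B\<^esub> (j \<cdot> q) = Ide C B"
  shows "biproduct C X Y B"
  using assms unfolding biproduct_def arrow_def by blast

end

section \<open>Full subcategories and additive functors\<close>

lemma full_subcat_simps [simp]:
  "Obj (full_subcat C U) = U" "Dom (full_subcat C U) = Dom C" "Cod (full_subcat C U) = Cod C"
  "Hom (full_subcat C U) = Hom C" "Ide (full_subcat C U) = Ide C" "Comp (full_subcat C U) = Comp C"
  by (simp_all add: full_subcat_def)

lemma arrow_full_subcat: "U \<subseteq> Obj C \<Longrightarrow> arrow (full_subcat C U) f X Y \<longleftrightarrow> X \<in> U \<and> Y \<in> U \<and> arrow C f X Y"
  by (auto simp: arrow_def)

lemma (in preadditive_category) preadditive_full_subcat:
  assumes "U \<subseteq> Obj C"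
  shows "preadditive_category (full_subcat C U)"
proof -
  have U: "X \<in> U \<Longrightarrow> X \<in> Obj C" for X using assms by blast
  show ?thesis
  proof (rule preadditive_category.intro, unfold full_subcat_simps)
    show "Dom C f = X \<and> Cod C f = Y" if "X \<in> U" "Y \<in> U" "f \<in> Arr C X Y" for X Y f
      using that U dom_cod by blast
    show "(h \<cdot> g) \<cdot> f = h \<cdot> (g \<cdot> f)" if "W \<in> U" "X \<in> U" "Y \<in> U" "Z \<in> U"
      "f \<in> Arr C W X" "g \<in> Arr C X Y" "h \<in> Arr C Y Z" for W X Y Z f g h
      using that U comp_assoc by blast
    show "Ide C Y \<cdot> f = f" "f \<cdot> Ide C X = f" if "X \<in> U" "Y \<in> U" "f \<in> Arr C X Y" for X Y f
      using ide_left[OF U[OF that(1)] U[OF that(2)] that(3)] ide_right[OF U[OF that(1)] U[OF that(2)] that(3)]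
      by blast+
  qed (simp_all add: U hom_group ide_in comp_hom_left comp_hom_right)
qed

text \<open>The hom groups are those of the ambient category, so a zero object or a biproduct found
  there keeps its equations; only its membership in \<open>U\<close> is at stake.\<close>

lemma (in preadditive_category) additive_full_subcat:
  assumes "U \<subseteq> Obj C" "zero_object C Z" "Z \<in> U"
    and bip: "\<And>X Y. X \<in> U \<Longrightarrow> Y \<in> U \<Longrightarrow> \<exists>B\<in>U. biproduct C X Y B"
  shows "additive_category (full_subcat C U)"
proof -
  interpret S: preadditive_category "full_subcat C U"
    using assms preadditive_full_subcat by blast
  show ?thesis
  proof
    show "\<exists>Z. zero_object (full_subcat C U) Z"
      using assms by (auto simp: zero_object_def intro!: exI[of _ Z])
    show "\<exists>B. biproduct (full_subcat C U) X Y B"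
      if "X \<in> Obj (full_subcat C U)" "Y \<in> Obj (full_subcat C U)" for X Y
      using bip[of X Y] that by (auto simp: biproduct_def; blast)
  qed
qed

context additive_functor
begin

lemma fun_arrow: "arrow C f X Y \<Longrightarrow> arrow D (FAr F f) (FOb F X) (FOb F Y)"
  using fun_hom fun_obj by (auto simp: arrow_def hom_def)

lemma fun_arrow_comp: "arrow C f X Y \<Longrightarrow> arrow C g Y Z \<Longrightarrow> FAr F (g \<cdot>\<^bsub>C\<^esub> f) = FAr F g \<cdot>\<^bsub>D\<^esub> FAr F f"
  unfolding arrow_def using fun_comp by blast

lemma fun_group_hom: "X \<in> Obj C \<Longrightarrow> Y \<in> Obj C \<Longrightarrow> group_hom (Hom C X Y) (Hom D (FOb F X) (FOb F Y)) (FAr F)"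
  using fun_hom fun_obj source.hom_is_group target.hom_is_group
  by (auto simp: group_hom_def group_hom_axioms_def)

lemma fun_zero: "X \<in> Obj C \<Longrightarrow> Y \<in> Obj C \<Longrightarrow> FAr F (Zero C X Y) = Zero D (FOb F X) (FOb F Y)"
  using group_hom.hom_one[OF fun_group_hom] .

lemma fun_sum: "arrow C f X Y \<Longrightarrow> arrow C g X Y \<Longrightarrow>
    FAr F (f \<otimes>\<^bsub>Hom C X Y\<^esub> g) = FAr F f \<otimes>\<^bsub>Hom D (FOb F X) (FOb F Y)\<^esub> FAr F g"
  unfolding arrow_def using group_hom.hom_mult[OF fun_group_hom] by blast

end

lemma (in additive_category) additive_incl_functor:
  assumes "U \<subseteq> Obj C" "additive_category (full_subcat C U)"
  shows "additive_functor (full_subcat C U) C incl_functor"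
proof -
  interpret S: additive_category "full_subcat C U" by fact
  show ?thesis
    using assms by unfold_locales (auto simp: incl_functor_def hom_def hom_is_group group.is_monoid monoid.m_closed subsetD)
qed

section \<open>Equivalences\<close>

lemma equivalenceE:
  assumes "equivalence C D F"
  obtains G \<eta> \<epsilon> where "additive_functor C D F" "additive_functor D C G"
    "\<And>X. X \<in> Obj C \<Longrightarrow> isomorphism C X (FOb G (FOb F X)) (\<eta> X)"
    "\<And>X Y f. arrow C f X Y \<Longrightarrow> \<eta> Y \<cdot>\<^bsub>C\<^esub> f = FAr G (FAr F f) \<cdot>\<^bsub>C\<^esub> \<eta> X"
    "\<And>X. X \<in> Obj D \<Longrightarrow> isomorphism D (FOb F (FOb G X)) X (\<epsilon> X)"
    "\<And>X Y f. arrow D f X Y \<Longrightarrow> \<epsilon> Y \<cdot>\<^bsub>D\<^esub> FAr F (FAr G f) = f \<cdot>\<^bsub>D\<^esub> \<epsilon> X"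
proof -
  obtain G where G: "additive_functor C D F" "additive_functor D C G"
    "naturally_isomorphic C C incl_functor (comp_functor G F)"
    "naturally_isomorphic D D (comp_functor F G) incl_functor"
    using assms unfolding equivalence_def by blast
  obtain \<eta> where "\<forall>X\<in>Obj C. isomorphism C X (FOb G (FOb F X)) (\<eta> X)"
      "\<forall>X\<in>Obj C. \<forall>Y\<in>Obj C. \<forall>f\<in>Arr C X Y. \<eta> Y \<cdot>\<^bsub>C\<^esub> f = FAr G (FAr F f) \<cdot>\<^bsub>C\<^esub> \<eta> X"
    using G(3) unfolding naturally_isomorphic_def incl_functor_def comp_functor_def by auto
  moreover obtain \<epsilon> where "\<forall>X\<in>Obj D. isomorphism D (FOb F (FOb G X)) X (\<epsilon> X)"
      "\<forall>X\<in>Obj D. \<forall>Y\<in>Obj D. \<forall>f\<in>Arr D X Y. \<epsilon> Y \<cdot>\<^bsub>D\<^esub> FAr F (FAr G f) = f \<cdot>\<^bsub>D\<^esub> \<epsilon> X"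
    using G(4) unfolding naturally_isomorphic_def incl_functor_def comp_functor_def by auto
  ultimately show ?thesis
    by (intro that[OF G(1,2), of \<eta> \<epsilon>]) (blast dest: arrowD)+
qed

text \<open>Naturality of the unit recovers \<open>f\<close> from \<open>F f\<close>, because its
  components can be cancelled.\<close>

lemma equivalence_faithful:
  assumes "equivalence C D F" "arrow C f X Y" "arrow C g X Y" "FAr F f = FAr F g"
  shows "f = g"
proof (rule equivalenceE[OF assms(1)])
  fix G \<eta> \<epsilon>
  assume G: "additive_functor C D F" "additive_functor D C G"
      "\<And>X. X \<in> Obj C \<Longrightarrow> isomorphism C X (FOb G (FOb F X)) (\<eta> X)"
      "\<And>X Y f. arrow C f X Y \<Longrightarrow> \<eta> Y \<cdot>\<^bsub>C\<^esub> f = FAr G (FAr F f) \<cdot>\<^bsub>C\<^esub> \<eta> X"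
      "\<And>X. X \<in> Obj D \<Longrightarrow> isomorphism D (FOb F (FOb G X)) X (\<epsilon> X)"
      "\<And>X Y f. arrow D f X Y \<Longrightarrow> \<epsilon> Y \<cdot>\<^bsub>D\<^esub> FAr F (FAr G f) = f \<cdot>\<^bsub>D\<^esub> \<epsilon> X"
  interpret F: additive_functor C D F by fact
  interpret G: additive_functor D C G by fact
  have "\<eta> Y \<cdot>\<^bsub>C\<^esub> f = \<eta> Y \<cdot>\<^bsub>C\<^esub> g" using G(4) assms by metis
  then show ?thesis
    using F.source.iso_cancel_left[OF G(3) assms(2,3)] assms(2) F.fun_obj G.fun_obj arrowD by metis
qed

lemma equivalence_surj:
  assumes "equivalence C D F" "Y \<in> Obj D"
  shows "\<exists>X\<in>Obj C. \<exists>e. isomorphism D (FOb F X) Y e"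
proof (rule equivalenceE[OF assms(1)])
  fix G \<eta> \<epsilon>
  assume G: "additive_functor C D F" "additive_functor D C G"
      "\<And>X. X \<in> Obj C \<Longrightarrow> isomorphism C X (FOb G (FOb F X)) (\<eta> X)"
      "\<And>X Y f. arrow C f X Y \<Longrightarrow> \<eta> Y \<cdot>\<^bsub>C\<^esub> f = FAr G (FAr F f) \<cdot>\<^bsub>C\<^esub> \<eta> X"
      "\<And>X. X \<in> Obj D \<Longrightarrow> isomorphism D (FOb F (FOb G X)) X (\<epsilon> X)"
      "\<And>X Y f. arrow D f X Y \<Longrightarrow> \<epsilon> Y \<cdot>\<^bsub>D\<^esub> FAr F (FAr G f) = f \<cdot>\<^bsub>D\<^esub> \<epsilon> X"
  interpret G: additive_functor D C G by fact
  show ?thesis using G(5) G.fun_obj assms(2) by blast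
qed

lemma equivalence_full:
  assumes "equivalence C D F" and XY: "X \<in> Obj C" "Y \<in> Obj C" and d: "arrow D d (FOb F X) (FOb F Y)"
  shows "\<exists>f. arrow C f X Y \<and> FAr F f = d"
proof (rule equivalenceE[OF assms(1)])
  fix G \<eta> \<epsilon>
  assume G: "additive_functor C D F" "additive_functor D C G"
      "\<And>X. X \<in> Obj C \<Longrightarrow> isomorphism C X (FOb G (FOb F X)) (\<eta> X)"
      "\<And>X Y f. arrow C f X Y \<Longrightarrow> \<eta> Y \<cdot>\<^bsub>C\<^esub> f = FAr G (FAr F f) \<cdot>\<^bsub>C\<^esub> \<eta> X"
      "\<And>X. X \<in> Obj D \<Longrightarrow> isomorphism D (FOb F (FOb G X)) X (\<epsilon> X)"
      "\<And>X Y f. arrow D f X Y \<Longrightarrow> \<epsilon> Y \<cdot>\<^bsub>D\<^esub> FAr F (FAr G f) = f \<cdot>\<^bsub>D\<^esub> \<epsilon> X"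
  interpret F: additive_functor C D F by fact
  interpret G: additive_functor D C G by fact
  \<comment> \<open>The counit makes \<open>G\<close> faithful by itself; at the end this turns an
    equality under \<open>G\<close> into one in \<open>D\<close>.\<close>
  have G_faithful: "b = b'" if "arrow D b X Y" "arrow D b' X Y" "FAr G b = FAr G b'" for b b' X Y
  proof -
    have "b \<cdot>\<^bsub>D\<^esub> \<epsilon> X = b' \<cdot>\<^bsub>D\<^esub> \<epsilon> X" using G(6) that by metis
    then show ?thesis
      using F.target.iso_cancel_right[OF G(5) that(1,2)] that(1) F.fun_obj G.fun_obj arrowD by metis
  qed
  let ?X = "FOb G (FOb F X)" and ?Y = "FOb G (FOb F Y)"
  have ob: "?X \<in> Obj C" "?Y \<in> Obj C" using XY F.fun_obj G.fun_obj by auto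
  obtain e' where e': "arrow C (\<eta> Y) Y ?Y" "arrow C e' ?Y Y" "e' \<cdot>\<^bsub>C\<^esub> \<eta> Y = Ide C Y" "\<eta> Y \<cdot>\<^bsub>C\<^esub> e' = Ide C ?Y"
    using F.source.isomorphismE[OF G(3)[OF XY(2)] XY(2) ob(2)] by blast
  have e: "arrow C (\<eta> X) X ?X"
    using F.source.isomorphismE[OF G(3)[OF XY(1)] XY(1) ob(1)] by blast
  have Gd: "arrow C (FAr G d) ?X ?Y" using G.fun_arrow d by blast
  \<comment> \<open>Naturality of the unit forces the preimage of \<open>d\<close>: it is
    \<open>G d\<close> conjugated by \<eta>.\<close>
  define f where "f = e' \<cdot>\<^bsub>C\<^esub> (FAr G d \<cdot>\<^bsub>C\<^esub> \<eta> X)"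
  have f: "arrow C f X Y" unfolding f_def using e e'(2) Gd F.source.arrow_comp by blast
  have "\<eta> Y \<cdot>\<^bsub>C\<^esub> f = FAr G d \<cdot>\<^bsub>C\<^esub> \<eta> X"
    unfolding f_def using F.source.arrow_assoc[OF F.source.arrow_comp[OF e Gd] e'(2,1)] e'(4)
      F.source.arrow_ide_left[OF F.source.arrow_comp[OF e Gd]] by simp
  then have "FAr G (FAr F f) \<cdot>\<^bsub>C\<^esub> \<eta> X = FAr G d \<cdot>\<^bsub>C\<^esub> \<eta> X" using G(4) f by metis
  then have "FAr G (FAr F f) = FAr G d"
    using F.source.iso_cancel_right[OF G(3)[OF XY(1)]] Gd XY(1) F.fun_arrow[OF f] G.fun_arrow by metis
  then have "FAr F f = d" using G_faithful F.fun_arrow[OF f] d by blast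
  then show "\<exists>f. arrow C f X Y \<and> FAr F f = d" using f by blast
qed

text \<open>Objects and arrows of a quasi-inverse are chosen along isomorphisms \<epsilon>.
  Faithfulness makes the choice of arrows unique, so functoriality reduces to checking
  squares.\<close>

lemma equivalenceI:
  assumes "additive_functor C D F"
    and faithful: "\<And>X Y f g. \<lbrakk>arrow C f X Y; arrow C g X Y; FAr F f = FAr F g\<rbrakk> \<Longrightarrow> f = g"
    and full: "\<And>X Y d. \<lbrakk>X \<in> Obj C; Y \<in> Obj C; arrow D d (FOb F X) (FOb F Y)\<rbrakk> \<Longrightarrow> \<exists>f. arrow C f X Y \<and> FAr F f = d"
    and surj: "\<And>Y. Y \<in> Obj D \<Longrightarrow> \<exists>X\<in>Obj C. \<exists>e. isomorphism D (FOb F X) Y e"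
  shows "equivalence C D F"
proof -
  interpret F: additive_functor C D F by fact
  obtain G0 \<epsilon> where G0: "\<And>Y. Y \<in> Obj D \<Longrightarrow> G0 Y \<in> Obj C"
      "\<And>Y. Y \<in> Obj D \<Longrightarrow> isomorphism D (FOb F (G0 Y)) Y (\<epsilon> Y)"
    using surj by metis
  then have "\<exists>\<delta>. arrow D (\<epsilon> Y) (FOb F (G0 Y)) Y \<and> arrow D \<delta> Y (FOb F (G0 Y)) \<and>
      \<delta> \<cdot>\<^bsub>D\<^esub> \<epsilon> Y = Ide D (FOb F (G0 Y)) \<and> \<epsilon> Y \<cdot>\<^bsub>D\<^esub> \<delta> = Ide D Y" if "Y \<in> Obj D" for Y
    using that F.target.isomorphismE[OF G0(2)] F.fun_obj by metis
  then obtain \<delta> where \<delta>: "\<And>Y. Y \<in> Obj D \<Longrightarrow> arrow D (\<epsilon> Y) (FOb F (G0 Y)) Y"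
      "\<And>Y. Y \<in> Obj D \<Longrightarrow> arrow D (\<delta> Y) Y (FOb F (G0 Y))"
      "\<And>Y. Y \<in> Obj D \<Longrightarrow> \<delta> Y \<cdot>\<^bsub>D\<^esub> \<epsilon> Y = Ide D (FOb F (G0 Y))"
      "\<And>Y. Y \<in> Obj D \<Longrightarrow> \<epsilon> Y \<cdot>\<^bsub>D\<^esub> \<delta> Y = Ide D Y"
    by metis
  \<comment> \<open>The arrow \<open>b\<close> is transported to the images of the chosen objects
    and then pulled back through \<open>F\<close>.\<close>
  define G1 where "G1 b = (SOME f. arrow C f (G0 (Dom D b)) (G0 (Cod D b)) \<and>
      FAr F f = \<delta> (Cod D b) \<cdot>\<^bsub>D\<^esub> (b \<cdot>\<^bsub>D\<^esub> \<epsilon> (Dom D b)))" for b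
  have G1: "arrow C (G1 b) (G0 X) (G0 Y)" "FAr F (G1 b) = \<delta> Y \<cdot>\<^bsub>D\<^esub> (b \<cdot>\<^bsub>D\<^esub> \<epsilon> X)" if b: "arrow D b X Y" for b X Y
  proof -
    have "Dom D b = X" "Cod D b = Y" using F.target.arrow_dom_cod b by auto
    moreover have "\<exists>f. arrow C f (G0 X) (G0 Y) \<and> FAr F f = \<delta> Y \<cdot>\<^bsub>D\<^esub> (b \<cdot>\<^bsub>D\<^esub> \<epsilon> X)"
      by (rule full[OF G0(1) G0(1) F.target.arrow_comp[OF F.target.arrow_comp[OF \<delta>(1) b] \<delta>(2)]])
        (use b in \<open>auto dest: arrowD\<close>)
    ultimately show "arrow C (G1 b) (G0 X) (G0 Y)" "FAr F (G1 b) = \<delta> Y \<cdot>\<^bsub>D\<^esub> (b \<cdot>\<^bsub>D\<^esub> \<epsilon> X)"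
      unfolding G1_def using someI_ex[of "\<lambda>f. arrow C f (G0 X) (G0 Y) \<and> FAr F f = \<delta> Y \<cdot>\<^bsub>D\<^esub> (b \<cdot>\<^bsub>D\<^esub> \<epsilon> X)"] by auto
  qed
  have nat: "\<epsilon> Y \<cdot>\<^bsub>D\<^esub> FAr F (G1 b) = b \<cdot>\<^bsub>D\<^esub> \<epsilon> X" if b: "arrow D b X Y" for b X Y
    unfolding G1(2)[OF b]
    using F.target.arrow_assoc[OF F.target.arrow_comp[OF \<delta>(1) b] \<delta>(2) \<delta>(1)] \<delta>(4)
      F.target.arrow_ide_left[OF F.target.arrow_comp[OF \<delta>(1) b]] b by (simp add: arrowD)
  \<comment> \<open>One square with \<epsilon> characterises \<open>G1 b\<close>; sums, identities
    and composites below are recognised by it.\<close>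
  have uniq: "g = G1 b" if "arrow D b X Y" "arrow C g (G0 X) (G0 Y)" "\<epsilon> Y \<cdot>\<^bsub>D\<^esub> FAr F g = b \<cdot>\<^bsub>D\<^esub> \<epsilon> X" for b X Y g
  proof (rule faithful[OF that(2) G1(1)[OF that(1)]])
    show "FAr F g = FAr F (G1 b)"
      by (rule F.target.iso_cancel_left[OF G0(2)[OF arrowD(2)[OF that(1)]]])
        (use that nat[OF that(1)] F.fun_arrow G1(1) in \<open>auto dest: arrowD\<close>)
  qed
  define G where "G = \<lparr>FOb = G0, FAr = G1\<rparr>"
  have GF: "additive_functor D C G"
  proof
    fix X Y assume XY: "X \<in> Obj D" "Y \<in> Obj D"
    show "FAr G \<in> hom (Hom D X Y) (Hom C (FOb G X) (FOb G Y))"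
    proof (rule homI)
      fix b assume "b \<in> Arr D X Y"
      then show "FAr G b \<in> Arr C (FOb G X) (FOb G Y)" using G1 XY by (auto simp: G_def arrow_def)
    next
      fix b c assume "b \<in> Arr D X Y" "c \<in> Arr D X Y"
      then have b: "arrow D b X Y" and c: "arrow D c X Y" using XY by (auto simp: arrow_def)
      have "G1 b \<otimes>\<^bsub>Hom C (G0 X) (G0 Y)\<^esub> G1 c = G1 (b \<otimes>\<^bsub>Hom D X Y\<^esub> c)"
      proof (rule uniq)
        show "arrow D (b \<otimes>\<^bsub>Hom D X Y\<^esub> c) X Y" using b c F.target.arrow_sum by blast
        show "arrow C (G1 b \<otimes>\<^bsub>Hom C (G0 X) (G0 Y)\<^esub> G1 c) (G0 X) (G0 Y)"
          using G1 b c F.source.arrow_sum by blast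
        have "\<epsilon> Y \<cdot>\<^bsub>D\<^esub> FAr F (G1 b \<otimes>\<^bsub>Hom C (G0 X) (G0 Y)\<^esub> G1 c)
          = (b \<cdot>\<^bsub>D\<^esub> \<epsilon> X) \<otimes>\<^bsub>Hom D (FOb F (G0 X)) Y\<^esub> (c \<cdot>\<^bsub>D\<^esub> \<epsilon> X)"
          using F.fun_sum[OF G1(1)[OF b] G1(1)[OF c]]
            F.target.comp_sum[OF F.fun_arrow[OF G1(1)[OF b]] F.fun_arrow[OF G1(1)[OF c]] \<delta>(1)[OF XY(2)]]
            nat[OF b] nat[OF c] by simp
        also have "\<dots> = (b \<otimes>\<^bsub>Hom D X Y\<^esub> c) \<cdot>\<^bsub>D\<^esub> \<epsilon> X"
          using F.target.sum_comp[OF \<delta>(1)[OF XY(1)] b c] by simp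
        finally show "\<epsilon> Y \<cdot>\<^bsub>D\<^esub> FAr F (G1 b \<otimes>\<^bsub>Hom C (G0 X) (G0 Y)\<^esub> G1 c) = (b \<otimes>\<^bsub>Hom D X Y\<^esub> c) \<cdot>\<^bsub>D\<^esub> \<epsilon> X" .
      qed
      then show "FAr G (b \<otimes>\<^bsub>Hom D X Y\<^esub> c) = FAr G b \<otimes>\<^bsub>Hom C (FOb G X) (FOb G Y)\<^esub> FAr G c"
        by (simp add: G_def)
    qed
  next
    fix X assume X: "X \<in> Obj D"
    show "FOb G X \<in> Obj C" using G0 X by (simp add: G_def)
    have "Ide C (G0 X) = G1 (Ide D X)"
      by (rule uniq[of _ X X])
        (use X G0 \<delta>(1)[OF X] F.target.arrow_ide_left F.target.arrow_ide_right F.fun_ide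
          F.source.arrow_ide F.target.arrow_ide in auto)
    then show "FAr G (Ide D X) = Ide C (FOb G X)" by (simp add: G_def)
  next
    fix X Y Z b c assume "X \<in> Obj D" "Y \<in> Obj D" "Z \<in> Obj D" "b \<in> Arr D X Y" "c \<in> Arr D Y Z"
    then have b: "arrow D b X Y" and c: "arrow D c Y Z" by (auto simp: arrow_def)
    have "G1 c \<cdot>\<^bsub>C\<^esub> G1 b = G1 (c \<cdot>\<^bsub>D\<^esub> b)"
    proof (rule uniq)
      show "arrow D (c \<cdot>\<^bsub>D\<^esub> b) X Z" "arrow C (G1 c \<cdot>\<^bsub>C\<^esub> G1 b) (G0 X) (G0 Z)"
        using F.target.arrow_comp[OF b c] F.source.arrow_comp[OF G1(1)[OF b] G1(1)[OF c]] by blast+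
      have Fb: "arrow D (FAr F (G1 b)) (FOb F (G0 X)) (FOb F (G0 Y))"
        and Fc: "arrow D (FAr F (G1 c)) (FOb F (G0 Y)) (FOb F (G0 Z))" using F.fun_arrow G1 b c by blast+
      have ee: "arrow D (\<epsilon> X) (FOb F (G0 X)) X" "arrow D (\<epsilon> Y) (FOb F (G0 Y)) Y" "arrow D (\<epsilon> Z) (FOb F (G0 Z)) Z"
        using \<delta> b c arrowD by metis+
      have "\<epsilon> Z \<cdot>\<^bsub>D\<^esub> FAr F (G1 c \<cdot>\<^bsub>C\<^esub> G1 b) = \<epsilon> Z \<cdot>\<^bsub>D\<^esub> (FAr F (G1 c) \<cdot>\<^bsub>D\<^esub> FAr F (G1 b))"
        using F.fun_arrow_comp G1 b c by metis
      also have "\<dots> = (c \<cdot>\<^bsub>D\<^esub> \<epsilon> Y) \<cdot>\<^bsub>D\<^esub> FAr F (G1 b)"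
        using F.target.arrow_assoc[OF Fb Fc ee(3)] nat[OF c] by simp
      also have "\<dots> = c \<cdot>\<^bsub>D\<^esub> (b \<cdot>\<^bsub>D\<^esub> \<epsilon> X)"
        using F.target.arrow_assoc[OF Fb ee(2) c] nat[OF b] by simp
      also have "\<dots> = (c \<cdot>\<^bsub>D\<^esub> b) \<cdot>\<^bsub>D\<^esub> \<epsilon> X"
        using F.target.arrow_assoc[OF ee(1) b c] by simp
      finally show "\<epsilon> Z \<cdot>\<^bsub>D\<^esub> FAr F (G1 c \<cdot>\<^bsub>C\<^esub> G1 b) = (c \<cdot>\<^bsub>D\<^esub> b) \<cdot>\<^bsub>D\<^esub> \<epsilon> X" .
    qed
    then show "FAr G (c \<cdot>\<^bsub>D\<^esub> b) = FAr G c \<cdot>\<^bsub>C\<^esub> FAr G b" by (simp add: G_def)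
  qed
  have "naturally_isomorphic D D (comp_functor F G) incl_functor"
    unfolding naturally_isomorphic_def
    by (rule exI[of _ \<epsilon>]) (use G0(2) nat in \<open>auto simp: G_def comp_functor_def incl_functor_def arrow_def\<close>)
  moreover have "naturally_isomorphic C C incl_functor (comp_functor G F)"
  proof -
    \<comment> \<open>The unit is the arrow lying over the inverse \<delta> of the counit at
      \<open>F X\<close>.\<close>
    have "\<exists>h. arrow C h X (G0 (FOb F X)) \<and> FAr F h = \<delta> (FOb F X)" if "X \<in> Obj C" for X
      by (rule full) (use that \<delta> G0 F.fun_obj in auto)
    then obtain \<eta> where \<eta>: "\<And>X. X \<in> Obj C \<Longrightarrow> arrow C (\<eta> X) X (G0 (FOb F X))"
        "\<And>X. X \<in> Obj C \<Longrightarrow> FAr F (\<eta> X) = \<delta> (FOb F X)" by metis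
    have "isomorphism C X (G0 (FOb F X)) (\<eta> X)" if X: "X \<in> Obj C" for X
    proof -
      have FX: "FOb F X \<in> Obj D" "G0 (FOb F X) \<in> Obj C" using X G0 F.fun_obj by auto
      obtain k where k: "arrow C k (G0 (FOb F X)) X" "FAr F k = \<epsilon> (FOb F X)"
        using full[of "G0 (FOb F X)" X] \<delta>(1) FX X by metis
      show ?thesis
      proof (rule F.source.isomorphismI[OF \<eta>(1)[OF X] k(1)])
        have "FAr F (k \<cdot>\<^bsub>C\<^esub> \<eta> X) = FAr F (Ide C X)"
          using F.fun_arrow_comp[OF \<eta>(1)[OF X] k(1)] k(2) \<eta>(2)[OF X] \<delta>(4)[OF FX(1)] F.fun_ide[OF X] by simp
        then show "k \<cdot>\<^bsub>C\<^esub> \<eta> X = Ide C X"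
          using faithful[OF F.source.arrow_comp[OF \<eta>(1)[OF X] k(1)] F.source.arrow_ide[OF X]] by blast
        have "FAr F (\<eta> X \<cdot>\<^bsub>C\<^esub> k) = FAr F (Ide C (G0 (FOb F X)))"
          using F.fun_arrow_comp[OF k(1) \<eta>(1)[OF X]] k(2) \<eta>(2)[OF X] \<delta>(3)[OF FX(1)] F.fun_ide[OF FX(2)] by simp
        then show "\<eta> X \<cdot>\<^bsub>C\<^esub> k = Ide C (G0 (FOb F X))"
          using faithful[OF F.source.arrow_comp[OF k(1) \<eta>(1)[OF X]] F.source.arrow_ide[OF FX(2)]] by blast
      qed
    qed
    moreover have "\<eta> Y \<cdot>\<^bsub>C\<^esub> f = G1 (FAr F f) \<cdot>\<^bsub>C\<^esub> \<eta> X" if f: "arrow C f X Y" for X Y f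
    proof (rule faithful)
      have FX: "FOb F X \<in> Obj D" "FOb F Y \<in> Obj D" using f F.fun_obj by (auto dest: arrowD)
      have Ff: "arrow D (FAr F f) (FOb F X) (FOb F Y)" using f F.fun_arrow by blast
      have \<eta>X: "arrow C (\<eta> X) X (G0 (FOb F X))" "arrow C (\<eta> Y) Y (G0 (FOb F Y))" using \<eta> f by (auto dest: arrowD)
      show "arrow C (\<eta> Y \<cdot>\<^bsub>C\<^esub> f) X (G0 (FOb F Y))" "arrow C (G1 (FAr F f) \<cdot>\<^bsub>C\<^esub> \<eta> X) X (G0 (FOb F Y))"
        using f \<eta>X G1(1)[OF Ff] F.source.arrow_comp by blast+
      have "FAr F (G1 (FAr F f) \<cdot>\<^bsub>C\<^esub> \<eta> X) = FAr F (G1 (FAr F f)) \<cdot>\<^bsub>D\<^esub> \<delta> (FOb F X)"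
        using F.fun_arrow_comp[OF \<eta>X(1) G1(1)[OF Ff]] \<eta>(2) f arrowD by metis
      also have "\<dots> = \<delta> (FOb F Y) \<cdot>\<^bsub>D\<^esub> ((FAr F f \<cdot>\<^bsub>D\<^esub> \<epsilon> (FOb F X)) \<cdot>\<^bsub>D\<^esub> \<delta> (FOb F X))"
        unfolding G1(2)[OF Ff]
        by (rule F.target.arrow_assoc[OF \<delta>(2)[OF FX(1)] F.target.arrow_comp[OF \<delta>(1)[OF FX(1)] Ff] \<delta>(2)[OF FX(2)]])
      also have "(FAr F f \<cdot>\<^bsub>D\<^esub> \<epsilon> (FOb F X)) \<cdot>\<^bsub>D\<^esub> \<delta> (FOb F X) = FAr F f"
        using F.target.arrow_assoc[OF \<delta>(2) \<delta>(1) Ff] \<delta>(4) F.target.arrow_ide_right[OF Ff] FX by simp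
      also have "\<delta> (FOb F Y) \<cdot>\<^bsub>D\<^esub> FAr F f = FAr F (\<eta> Y \<cdot>\<^bsub>C\<^esub> f)"
        using F.fun_arrow_comp[OF f \<eta>X(2)] \<eta>(2) f arrowD by metis
      finally show "FAr F (\<eta> Y \<cdot>\<^bsub>C\<^esub> f) = FAr F (G1 (FAr F f) \<cdot>\<^bsub>C\<^esub> \<eta> X)" by simp
    qed
    ultimately show ?thesis
      unfolding naturally_isomorphic_def
      by (intro exI[of _ \<eta>]) (auto simp: G_def comp_functor_def incl_functor_def arrow_def)
  qed
  ultimately show ?thesis
    unfolding equivalence_def using assms(1) GF by blast
qed

section \<open>Triangulated categories\<close>

context triangulated_category
begin

interpretation shift: additive_functor T T "Shift T"
  using shift_equiv by (simp add: equivalence_def)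

lemma shift_obj: "X \<in> Obj T \<Longrightarrow> shO T X \<in> Obj T"
  by (rule shift.fun_obj)

lemma shift_arrow: "arrow T f X Y \<Longrightarrow> arrow T (shA T f) (shO T X) (shO T Y)"
  by (rule shift.fun_arrow)

lemma shift_faithful: "arrow T f X Y \<Longrightarrow> arrow T g X Y \<Longrightarrow> shA T f = shA T g \<Longrightarrow> f = g"
  by (rule equivalence_faithful[OF shift_equiv])

lemma shift_full:
  assumes "arrow T d (shO T X) (shO T Y)" "X \<in> Obj T" "Y \<in> Obj T"
  obtains f where "arrow T f X Y" "shA T f = d"
  using equivalence_full[OF shift_equiv assms(2,3,1)] by blast

lemma shift_eq_zero: "arrow T f X Y \<Longrightarrow> shA T f = Zero T (shO T X) (shO T Y) \<Longrightarrow> f = Zero T X Y"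
  using shift_faithful[of f X Y "Zero T X Y"] shift.fun_zero arrow_zero by (simp add: arrowD)

lemma distinguishedD:
  assumes "distinguished T X Y Z f g h"
  shows "arrow T f X Y" "arrow T g Y Z" "arrow T h Z (shO T X)" "triangle T X Y Z f g h"
    "X \<in> Obj T" "Y \<in> Obj T" "Z \<in> Obj T"
  using assms shift_obj by (auto simp: distinguished_def triangle_def arrow_def)

lemma triangleI: "arrow T f X Y \<Longrightarrow> arrow T g Y Z \<Longrightarrow> arrow T h Z (shO T X) \<Longrightarrow> triangle T X Y Z f g h"
  by (auto simp: triangle_def arrow_def)

lemma rotate:
  "distinguished T X Y Z f g h \<Longrightarrow>
    distinguished T Y Z (shO T X) g h (inv\<^bsub>Hom T (shO T X) (shO T Y)\<^esub> (shA T f))"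
  using tri_rotate distinguishedD(4) by blast

lemma rotate_back:
  assumes "arrow T f X Y" "arrow T g Y Z" "arrow T h Z (shO T X)"
    "distinguished T Y Z (shO T X) g h (inv\<^bsub>Hom T (shO T X) (shO T Y)\<^esub> (shA T f))"
  shows "distinguished T X Y Z f g h"
  using tri_rotate triangleI assms by blast

lemma complete:
  assumes "arrow T f X Y"
  obtains Z g h where "distinguished T X Y Z f g h"
  using tri_complete[OF arrowD[OF assms]] by blast

lemma morphism:
  assumes "distinguished T X Y Z f g h" "distinguished T X' Y' Z' f' g' h'"
    "arrow T a X X'" "arrow T b Y Y'" "f' \<cdot> a = b \<cdot> f"
  obtains c where "arrow T c Z Z'" "g' \<cdot> b = c \<cdot> g" "h' \<cdot> c = shA T a \<cdot> h"
  using tri_morphism[OF assms(1,2) arrowD(3)[OF assms(3)] arrowD(3)[OF assms(4)] assms(5)]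
    distinguishedD(7)[OF assms(1)] distinguishedD(7)[OF assms(2)] by (auto simp: arrow_def)

lemma zero_shift: "zero_object T Z \<Longrightarrow> zero_object T (shO T Z)"
proof (rule zero_objectI)
  assume Z: "zero_object T Z"
  then have o: "Z \<in> Obj T" by (simp add: zero_object_def)
  then show "shO T Z \<in> Obj T" by (rule shift_obj)
  have "Ide T Z = Zero T Z Z" using arrow_to_zero[OF Z arrow_ide[OF o]] .
  then show "Ide T (shO T Z) = Zero T (shO T Z) (shO T Z)"
    using shift.fun_ide[OF o] shift.fun_zero[OF o o] by simp
qed

section \<open>Exactness of hom functors along a triangle\<close>

lemma triangle_comp_zero:
  assumes "distinguished T X Y Z f g h"
  shows "g \<cdot> f = Zero T X Z" "h \<cdot> g = Zero T Y (shO T X)"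
proof -
  have *: "g \<cdot> f = Zero T X Z" if d: "distinguished T X Y Z f g h" for X Y Z f g h
  proof -
    obtain N where N: "zero_object T N" using ex_zero by blast
    then have o: "N \<in> Obj T" by (simp add: zero_object_def)
    note D = distinguishedD[OF d]
    \<comment> \<open>The trivial triangle on \<open>X\<close> maps to the given one by the identity
      and \<open>f\<close>. The third component starts at a zero object, so
      \<open>g \<cdot> f\<close> factors through zero.\<close>
    obtain c where c: "arrow T c N Z" "g \<cdot> f = c \<cdot> Zero T X N"
      by (rule morphism[OF tri_ide[OF D(5) N] d arrow_ide[OF D(5)] D(1)]) auto
    then show ?thesis using comp_zero[OF c(1) D(5)] by simp
  qed
  show "g \<cdot> f = Zero T X Z" using *[OF assms] .
  show "h \<cdot> g = Zero T Y (shO T X)" using *[OF rotate[OF assms]] .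
qed

text \<open>Since \<open>g \<cdot> k\<close> vanishes, \<open>k\<close> and a zero map start a
  morphism from \<open>W -> 0 -> W[1]\<close> to the rotated triangle \<open>Y -> Z -> X[1]\<close>,
  whose third component is the shift of the lift. Both rotations carry a sign, and the two signs
  cancel.\<close>

lemma lift_first:
  assumes d: "distinguished T X Y Z f g h" and k: "arrow T k W Y" and gk: "g \<cdot> k = Zero T W Z"
  obtains l where "arrow T l W X" "f \<cdot> l = k"
proof -
  obtain N where N: "zero_object T N" using ex_zero by blast
  then have o: "N \<in> Obj T" by (simp add: zero_object_def)
  note D = distinguishedD[OF d] and W = arrowD(1)[OF k]
  have W1: "distinguished T W N (shO T W) (Zero T W N) (Zero T N (shO T W))
      (inv\<^bsub>Hom T (shO T W) (shO T W)\<^esub> (shA T (Ide T W)))"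
    by (rule rotate[OF tri_ide[OF W N]])
  have e: "g \<cdot> k = Zero T N Z \<cdot> Zero T W N"
    using gk zero_comp[OF arrow_zero[OF W o] D(7)] by simp
  obtain c where c: "arrow T c (shO T W) (shO T X)"
    "inv\<^bsub>Hom T (shO T X) (shO T Y)\<^esub> (shA T f) \<cdot> c = shA T k \<cdot> inv\<^bsub>Hom T (shO T W) (shO T W)\<^esub> (shA T (Ide T W))"
    by (rule morphism[OF W1 rotate[OF d] k arrow_zero[OF o D(7)] e])
  obtain l where l: "arrow T l W X" "shA T l = c"
    by (rule shift_full[OF c(1) W D(5)])
  have fl: "arrow T (f \<cdot> l) W Y" using arrow_comp[OF l(1) D(1)] .
  have "inv\<^bsub>Hom T (shO T W) (shO T Y)\<^esub> (shA T f \<cdot> c) = inv\<^bsub>Hom T (shO T W) (shO T Y)\<^esub> (shA T k)"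
    using c(2) neg_comp[OF c(1) shift_arrow[OF D(1)]]
      comp_neg[OF shift_arrow[OF arrow_ide[OF W]] shift_arrow[OF k]]
      arrow_ide_right[OF shift_arrow[OF k]] shift.fun_ide[OF W] by simp
  then have "shA T f \<cdot> c = shA T k"
    using neg_neg[OF shift_arrow[OF k]] neg_neg[OF arrow_comp[OF c(1) shift_arrow[OF D(1)]]] by simp
  then have "shA T (f \<cdot> l) = shA T k" using shift.fun_arrow_comp[OF l(1) D(1)] l(2) by simp
  then show thesis using that[OF l(1)] shift_faithful[OF fl k] by blast
qed

lemma lift_second:
  assumes d: "distinguished T X Y Z f g h" and k: "arrow T k W Z" and "h \<cdot> k = Zero T W (shO T X)"
  obtains l where "arrow T l W Y" "g \<cdot> l = k"
  by (rule lift_first[OF rotate[OF d] k assms(3)])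

text \<open>The dual comparison: the given triangle is mapped to \<open>0 -> W -> W -> 0[1]\<close>,
  and the third component is the extension.\<close>

lemma extend_second:
  assumes d: "distinguished T X Y Z f g h" and k: "arrow T k Y W" and kf: "k \<cdot> f = Zero T X W"
  obtains l where "arrow T l Z W" "l \<cdot> g = k"
proof -
  obtain N where N: "zero_object T N" using ex_zero by blast
  then have o: "N \<in> Obj T" by (simp add: zero_object_def)
  note D = distinguishedD[OF d] and W = arrowD(2)[OF k]
  \<comment> \<open>An identity triangle rotated back: the shift of a zero object is again zero, so
    \<open>tri_ide\<close> applies with that shift.\<close>
  have "distinguished T N W W (Zero T N W) (Ide T W) (Zero T W (shO T N))"
    by (rule rotate_back[OF arrow_zero[OF o W] arrow_ide[OF W] arrow_zero[OF W shift_obj[OF o]]])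
      (use tri_ide[OF W zero_shift[OF N]] shift.fun_zero[OF o W] neg_zero[OF shift_obj[OF o] shift_obj[OF W]] in simp)
  moreover have "Zero T N W \<cdot> Zero T X N = k \<cdot> f"
    using kf zero_comp[OF arrow_zero[OF D(5) o] W] by simp
  ultimately obtain c where c: "arrow T c Z W" "Ide T W \<cdot> k = c \<cdot> g"
    using morphism[OF d _ arrow_zero[OF D(5) o] k] by metis
  then show thesis using that[OF c(1)] arrow_ide_left[OF k] by simp
qed

lemma extend_third:
  assumes d: "distinguished T X Y Z f g h" and k: "arrow T k Z W" and "k \<cdot> g = Zero T Y W"
  obtains l where "arrow T l (shO T X) W" "l \<cdot> h = k"
  by (rule extend_second[OF rotate[OF d] k assms(3)])

text \<open>The axioms complete a map only to the right. The third object of that triangle is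
  isomorphic to a shift because the shift is essentially surjective, and after transport along this
  isomorphism the triangle can be rotated back. The sign in the choice of \<open>k\<close> absorbs
  the one that rotation introduces.\<close>

lemma cocone:
  assumes f: "arrow T f X Y"
  obtains K k h where "distinguished T K X Y k f h"
proof -
  obtain Z g h where d: "distinguished T X Y Z f g h" by (rule complete[OF f])
  note D = distinguishedD[OF d]
  obtain K e where K: "K \<in> Obj T" and e: "isomorphism T (shO T K) Z e"
    using equivalence_surj[OF shift_equiv D(7)] by blast
  obtain e' where e': "arrow T e (shO T K) Z" "arrow T e' Z (shO T K)"
      "e' \<cdot> e = Ide T (shO T K)" "e \<cdot> e' = Ide T Z"
    by (rule isomorphismE[OF e shift_obj[OF K] D(7)])
  have he: "arrow T (h \<cdot> e) (shO T K) (shO T X)" using arrow_comp[OF e'(1) D(3)] .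
  obtain k where k: "arrow T k K X" "shA T k = inv\<^bsub>Hom T (shO T K) (shO T X)\<^esub> (h \<cdot> e)"
    by (rule shift_full[OF arrow_neg[OF he] K D(5)])
  have "distinguished T X Y (shO T K) f (e' \<cdot> g) (h \<cdot> e)"
  proof (rule tri_iso[OF d triangleI[OF f arrow_comp[OF D(2) e'(2)] he]
        isomorphism_ide[OF D(5)] isomorphism_ide[OF D(6)] isomorphismI[OF e'(2,1,4,3)]])
    show "f \<cdot> Ide T X = Ide T Y \<cdot> f" using arrow_ide_left[OF f] arrow_ide_right[OF f] by simp
    show "e' \<cdot> g \<cdot> Ide T Y = e' \<cdot> g" using arrow_ide_right[OF arrow_comp[OF D(2) e'(2)]] .
    show "h \<cdot> e \<cdot> e' = shA T (Ide T X) \<cdot> h"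
      using arrow_assoc[OF e'(2) e'(1) D(3)] e'(4) arrow_ide_right[OF D(3)] arrow_ide_left[OF D(3)]
        shift.fun_ide[OF D(5)] by simp
  qed
  then have "distinguished T K X Y k f (e' \<cdot> g)"
    by (intro rotate_back[OF k(1) f arrow_comp[OF D(2) e'(2)]]) (simp add: k(2) neg_neg[OF he])
  then show thesis by (rule that)
qed

text \<open>Here the connecting morphism is prescribed: an element of \<open>T(W, Z[1])\<close>,
  read as an extension class, receives a middle term.\<close>

lemma cocone_connecting:
  assumes h: "arrow T h W (shO T Z)" and Z: "Z \<in> Obj T"
  obtains Y f g where "distinguished T Z Y W f g h"
proof -
  obtain K k e where d: "distinguished T K W (shO T Z) k h e" by (rule cocone[OF h])
  note D = distinguishedD[OF d]
  obtain f where f: "arrow T f Z K" "shA T f = inv\<^bsub>Hom T (shO T Z) (shO T K)\<^esub> e"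
    by (rule shift_full[OF arrow_neg[OF D(3)] Z D(5)])
  have "distinguished T Z K W f k h"
    by (rule rotate_back[OF f(1) D(1,2)]) (use d f(2) neg_neg[OF D(3)] in simp)
  then show thesis by (rule that)
qed

text \<open>Three rotations shift a triangle up to signs. The maps are left unnamed, since later
  arguments use only the objects and exactness.\<close>

lemma shift_triangle:
  assumes "distinguished T X Y Z f g h"
  obtains f' g' h' where "distinguished T (shO T X) (shO T Y) (shO T Z) f' g' h'"
  using rotate[OF rotate[OF rotate[OF assms]]] by blast

end

section \<open>Cotorsion pairs\<close>

locale cotorsion_category = triangulated_category T
  for T :: "('o, 'm, 'z) tricat_scheme" (structure) +
  fixes U V :: "'o set"
  assumes cotorsion: "cotorsion_pair T U V"
begin

interpretation shift: additive_functor T T "Shift T"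
  using shift_equiv by (simp add: equivalence_def)

lemma U_obj: "X \<in> U \<Longrightarrow> X \<in> Obj T"
  and V_obj: "X \<in> V \<Longrightarrow> X \<in> Obj T"
  using cotorsion unfolding cotorsion_pair_def additive_subcat_def by blast+

lemma zero_in_U: "zero_object T N \<Longrightarrow> N \<in> U"
  using cotorsion unfolding cotorsion_pair_def additive_subcat_def by blast

lemma orth: "A \<in> U \<Longrightarrow> B \<in> V \<Longrightarrow> arrow T f A (shO T B) \<Longrightarrow> f = Zero T A (shO T B)"
  using cotorsion by (auto simp: cotorsion_pair_def arrow_def)

text \<open>Test maps often arise after a rotation, one shift too far; fullness of the shift brings
  them back.\<close>

lemma orth_shift:
  assumes A: "A \<in> U" and B: "B \<in> V" and f: "arrow T f (shO T A) (shO T (shO T B))"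
  shows "f = Zero T (shO T A) (shO T (shO T B))"
proof -
  have o: "A \<in> Obj T" "shO T B \<in> Obj T" using A B U_obj V_obj shift_obj by auto
  obtain k where k: "arrow T k A (shO T B)" "shA T k = f" by (rule shift_full[OF f o])
  then show ?thesis using orth[OF A B k(1)] shift.fun_zero[OF o] by simp
qed

lemma approx:
  assumes "X \<in> Obj T"
  obtains A B f g h where "A \<in> U" "B \<in> V" "distinguished T A X (shO T B) f g h"
  using cotorsion assms unfolding cotorsion_pair_def by blast

text \<open>In an approximation \<open>A -> X -> B[1]\<close> the second map vanishes by hypothesis,
  so \<open>f\<close> splits and \<open>X\<close> is a summand of \<open>A\<close>. Closure under
  summands is phrased with biproducts, so the complement has to be produced: it is the cocone
  \<open>N\<close> of \<open>f\<close>.\<close>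

lemma in_U:
  assumes X: "X \<in> Obj T" and orth: "\<And>B f. B \<in> V \<Longrightarrow> arrow T f X (shO T B) \<Longrightarrow> f = Zero T X (shO T B)"
  shows "X \<in> U"
proof -
  obtain A B f g h where A: "A \<in> U" "B \<in> V" and d: "distinguished T A X (shO T B) f g h" by (rule approx[OF X])
  note D = distinguishedD[OF d]
  have g: "g = Zero T X (shO T B)" using orth[OF A(2) D(2)] .
  obtain s where s: "arrow T s X A" "f \<cdot> s = Ide T X"
    by (rule lift_first[OF d arrow_ide[OF X]]) (use g arrow_ide_right[OF D(2)] in auto)
  obtain N n e where dN: "distinguished T N A X n f e" by (rule cocone[OF D(1)])
  note N = distinguishedD[OF dN]
  \<comment> \<open>As \<open>f\<close> is split epi, the connecting map of its cocone is zero; this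
    makes \<open>n\<close> mono in the fact \<open>mono\<close> below.\<close>
  have "e = (e \<cdot> f) \<cdot> s" using arrow_assoc[OF s(1) D(1) N(3)] s(2) arrow_ide_right[OF N(3)] by simp
  then have e: "e = Zero T X (shO T N)" using triangle_comp_zero(2)[OF dN] zero_comp[OF s(1)] shift_obj[OF N(5)] by simp
  have mono: "k = Zero T W N" if k: "arrow T k W N" and nk: "n \<cdot> k = Zero T W A" for k W
  proof -
    note W = arrowD(1)[OF k]
    have "inv\<^bsub>Hom T (shO T N) (shO T A)\<^esub> (shA T n) \<cdot> shA T k = Zero T (shO T W) (shO T A)"
      using neg_comp[OF shift_arrow[OF k] shift_arrow[OF N(1)]] shift.fun_arrow_comp[OF k N(1)] nk
        shift.fun_zero[OF W N(6)] neg_zero[OF shift_obj[OF W] shift_obj[OF N(6)]] by simp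
    then obtain l where l: "arrow T l (shO T W) X" "e \<cdot> l = shA T k"
      using lift_first[OF rotate[OF rotate[OF dN]] shift_arrow[OF k]] by metis
    then have "shA T k = Zero T (shO T W) (shO T N)"
      using e zero_comp[OF l(1) shift_obj[OF N(5)]] by simp
    then show ?thesis using shift_eq_zero[OF k] by blast
  qed
  let ?sf = "s \<cdot> f" and ?H = "Hom T A A"
  have sf: "arrow T ?sf A A" using arrow_comp[OF D(1) s(1)] .
  have iA: "arrow T (Ide T A) A A" using arrow_ide D(5) by blast
  \<comment> \<open>The projection complementary to the idempotent \<open>s \<cdot> f\<close>. It is
    killed by \<open>f\<close>, so it factors through \<open>n\<close>, and the factor
    \<open>t\<close> is the second projection of the biproduct.\<close>
  define r where "r = Ide T A \<otimes>\<^bsub>?H\<^esub> inv\<^bsub>?H\<^esub> ?sf"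
  have r: "arrow T r A A" unfolding r_def using arrow_sum[OF iA arrow_neg[OF sf]] .
  have fsf: "f \<cdot> ?sf = f" using arrow_assoc[OF D(1) s(1) D(1)] s(2) arrow_ide_left[OF D(1)] by simp
  have "f \<cdot> r = Zero T A X"
    unfolding r_def using comp_sum[OF iA arrow_neg[OF sf] D(1)] comp_neg[OF sf D(1)] fsf arrow_ide_right[OF D(1)]
      diff_eq_zero_iff[OF D(1) D(1)] by simp
  then obtain t where t: "arrow T t A N" "n \<cdot> t = r"
    using lift_first[OF dN r] by metis
  have sum: "?sf \<otimes>\<^bsub>?H\<^esub> (n \<cdot> t) = Ide T A"
  proof -
    have "?sf \<otimes>\<^bsub>?H\<^esub> r = Ide T A"
      unfolding r_def using sf iA D(5) hom_group[OF D(5) D(5)]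
      by (simp add: arrow_def comm_group.axioms(2) group.inv_solve_left' group.is_monoid
          comm_group_def comm_monoid.m_lcomm group.inv_closed group.r_inv monoid.r_one)
    then show ?thesis using t(2) by simp
  qed
  have nt0: "n \<cdot> (t \<cdot> x) = Zero T W A" if x: "arrow T x W A" and "?sf \<cdot> x = x" for x W
  proof -
    have "n \<cdot> (t \<cdot> x) = r \<cdot> x" using arrow_assoc[OF x t(1) N(1)] t(2) by simp
    also have "\<dots> = x \<otimes>\<^bsub>Hom T W A\<^esub> inv\<^bsub>Hom T W A\<^esub> x"
      unfolding r_def using sum_comp[OF x iA arrow_neg[OF sf]] neg_comp[OF x sf] arrow_ide_left[OF x] that(2) by simp
    finally show ?thesis using diff_eq_zero_iff[OF x x] by simp
  qed
  \<comment> \<open>The two equations that involve \<open>t\<close> on the left are checked after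
    composing with the mono \<open>n\<close>.\<close>
  have "t \<cdot> s = Zero T X N"
    by (rule mono[OF arrow_comp[OF s(1) t(1)] nt0[OF s(1)]])
      (use arrow_assoc[OF s(1) D(1) s(1)] s(2) arrow_ide_right[OF s(1)] in simp)
  moreover have "t \<cdot> n = Ide T N"
  proof -
    have tn: "arrow T (t \<cdot> n) N N" and iN: "arrow T (Ide T N) N N"
      using arrow_comp[OF N(1) t(1)] arrow_ide[OF N(5)] by blast+
    have sfn: "?sf \<cdot> n = Zero T N A"
      using arrow_assoc[OF N(1) D(1) s(1)] triangle_comp_zero(1)[OF dN] comp_zero[OF s(1) N(5)] by simp
    have "n \<cdot> (t \<cdot> n) = r \<cdot> n" using arrow_assoc[OF N(1) t(1) N(1)] t(2) by simp
    also have "\<dots> = n"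
      unfolding r_def using sum_comp[OF N(1) iA arrow_neg[OF sf]] neg_comp[OF N(1) sf] arrow_ide_left[OF N(1)] sfn
        neg_zero[OF N(5) N(6)] sum_zero(1)[OF N(1)] by simp
    finally have "n \<cdot> (t \<cdot> n \<otimes>\<^bsub>Hom T N N\<^esub> inv\<^bsub>Hom T N N\<^esub> (Ide T N)) = Zero T N A"
      using comp_sum[OF tn arrow_neg[OF iN] N(1)] comp_neg[OF iN N(1)] arrow_ide_right[OF N(1)]
        diff_eq_zero_iff[OF N(1) N(1)] by simp
    then have "t \<cdot> n \<otimes>\<^bsub>Hom T N N\<^esub> inv\<^bsub>Hom T N N\<^esub> (Ide T N) = Zero T N N"
      by (rule mono[OF arrow_sum[OF tn arrow_neg[OF iN]]])
    then show ?thesis using diff_eq_zero_iff[OF tn iN] by blast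
  qed
  ultimately have "biproduct T X N A"
    using biproductI[OF s(1) N(1) D(1) t(1) s(2) _ _ triangle_comp_zero(1)[OF dN] sum] by blast
  then show ?thesis using cotorsion A(1) unfolding cotorsion_pair_def summand_closed_def by blast
qed

text \<open>A map from \<open>Y\<close> to \<open>V[1]\<close> vanishes on \<open>Z\<close>, so it
  comes from \<open>W\<close>, where it vanishes as well.\<close>

lemma extension_in_U:
  assumes "Z \<in> U" "W \<in> U" and d: "distinguished T Z Y W f g h"
  shows "Y \<in> U"
proof (rule in_U)
  note D = distinguishedD[OF d]
  show "Y \<in> Obj T" by (rule D(6))
  fix B k assume B: "B \<in> V" and k: "arrow T k Y (shO T B)"
  have "k \<cdot> f = Zero T Z (shO T B)" using orth[OF assms(1) B arrow_comp[OF D(1) k]] .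
  then obtain l where l: "arrow T l W (shO T B)" "l \<cdot> g = k" by (rule extend_second[OF d k])
  then show "k = Zero T Y (shO T B)"
    using orth[OF assms(2) B l(1)] zero_comp[OF D(2) shift_obj[OF V_obj[OF B]]] by simp
qed

section \<open>Deflations as covers\<close>

lemma deflationE:
  assumes "deflation T U Y X g"
  obtains Z f h where "Z \<in> U" "Y \<in> U" "X \<in> U" "distinguished T Z Y X f g h" "conflation T U Z Y X f g"
  using assms unfolding deflation_def conflation_def by blast

lemma deflation_arrow: "deflation T U Y X g \<Longrightarrow> arrow T g Y X"
  by (elim deflationE) (rule distinguishedD(2))

lemma deflationI: "Z \<in> U \<Longrightarrow> Y \<in> U \<Longrightarrow> X \<in> U \<Longrightarrow> distinguished T Z Y X f g h \<Longrightarrow> deflation T U Y X g"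
  unfolding deflation_def conflation_def by blast

text \<open>Read \<open>k\<close> as the class of an extension. Its middle term stays in
  \<open>U\<close>, and the class dies on it because consecutive maps of a triangle compose to
  zero.\<close>

lemma deflation_kill:
  assumes "W \<in> U" "Z \<in> U" and k: "arrow T k W (shO T Z)"
  obtains Y g where "deflation T U Y W g" "k \<cdot> g = Zero T Y (shO T Z)"
proof -
  obtain Y f g where d: "distinguished T Z Y W f g k" by (rule cocone_connecting[OF k U_obj[OF assms(2)]])
  show thesis
    by (rule that[OF deflationI[OF assms(2) extension_in_U[OF assms(2,1) d] assms(1) d] triangle_comp_zero(2)[OF d]])
qed

text \<open>A deflation \<open>g'\<close> kills the extension class \<open>h \<cdot> a\<close>; then
  \<open>a \<cdot> g'\<close> lifts through \<open>g\<close>. The square is merely commutative,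
  which is what stability of covers asks for.\<close>

lemma deflation_pullback:
  assumes g: "deflation T U Y X g" and X': "X' \<in> U" and a: "arrow T a X' X"
  obtains Y' g' b where "deflation T U Y' X' g'" "arrow T b Y' Y" "a \<cdot> g' = g \<cdot> b"
proof -
  obtain Z f h where Z: "Z \<in> U" and d: "distinguished T Z Y X f g h" by (rule deflationE[OF g])
  note D = distinguishedD[OF d]
  obtain Y' g' where g': "deflation T U Y' X' g'" "(h \<cdot> a) \<cdot> g' = Zero T Y' (shO T Z)"
    by (rule deflation_kill[OF X' Z arrow_comp[OF a D(3)]])
  note g'a = deflation_arrow[OF g'(1)]
  have "h \<cdot> (a \<cdot> g') = Zero T Y' (shO T Z)" using arrow_assoc[OF g'a a D(3)] g'(2) by simp
  then obtain b where "arrow T b Y' Y" "g \<cdot> b = a \<cdot> g'" by (rule lift_second[OF d arrow_comp[OF g'a a]])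
  then show thesis using that[OF g'(1)] by simp
qed

text \<open>The trivial cover, from the conflation \<open>0 -> X -> X\<close>.\<close>

lemma deflation_ide: "X \<in> U \<Longrightarrow> deflation T U X X (Ide T X)"
proof -
  assume X: "X \<in> U"
  obtain N where N: "zero_object T N" using ex_zero by blast
  then have NU: "N \<in> U" by (rule zero_in_U)
  note o = U_obj[OF NU] U_obj[OF X]
  have "distinguished T N X X (Zero T N X) (Ide T X) (Zero T X (shO T N))"
    by (rule rotate_back[OF arrow_zero[OF o] arrow_ide[OF o(2)] arrow_zero[OF o(2) shift_obj[OF o(1)]]])
      (use tri_ide[OF o(2) zero_shift[OF N]] shift.fun_zero[OF o] neg_zero[OF shift_obj[OF o(1)] shift_obj[OF o(2)]] in simp)
  then show ?thesis by (rule deflationI[OF NU X X])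
qed

text \<open>The octahedron exhibits the cocone \<open>K\<close> of the composite as an extension of
  \<open>Z2\<close> by \<open>Z1\<close>. Its triangle comes out shifted, so the test of
  \<open>in_U\<close> is made on shifted maps.\<close>

lemma deflation_comp:
  assumes g: "deflation T U Y X g" and g': "deflation T U X W g'"
  shows "deflation T U Y W (g' \<cdot> g)"
proof -
  obtain Z1 f1 h1 where 1: "Z1 \<in> U" "Y \<in> U" and d1: "distinguished T Z1 Y X f1 g h1" by (rule deflationE[OF g])
  obtain Z2 f2 h2 where 2: "Z2 \<in> U" "W \<in> U" and d2: "distinguished T Z2 X W f2 g' h2" by (rule deflationE[OF g'])
  obtain K k e where d: "distinguished T K Y W k (g' \<cdot> g) e"
    by (rule cocone[OF arrow_comp[OF deflation_arrow[OF g] deflation_arrow[OF g']]])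
  note K = distinguishedD(5)[OF d]
  obtain u v w where oct: "distinguished T (shO T Z1) (shO T K) (shO T Z2) u v w"
    using octahedral[OF rotate[OF d1] rotate[OF d2] rotate[OF d]] by blast
  note D = distinguishedD[OF oct]
  have "K \<in> U"
  proof (rule in_U[OF K])
    fix B p assume B: "B \<in> V" and p: "arrow T p K (shO T B)"
    have "shA T p \<cdot> u = Zero T (shO T Z1) (shO T (shO T B))"
      by (rule orth_shift[OF 1(1) B arrow_comp[OF D(1) shift_arrow[OF p]]])
    then obtain l where l: "arrow T l (shO T Z2) (shO T (shO T B))" "l \<cdot> v = shA T p"
      by (rule extend_second[OF oct shift_arrow[OF p]])
    then have "shA T p = Zero T (shO T K) (shO T (shO T B))"
      using orth_shift[OF 2(1) B l(1)] zero_comp[OF D(2) arrowD(2)[OF l(1)]] by simp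
    then show "p = Zero T K (shO T B)" by (rule shift_eq_zero[OF p])
  qed
  then show ?thesis using deflationI[OF _ 1(2) 2(2) d] by blast
qed

text \<open>The connecting map of \<open>f\<close> factors through that of
  \<open>f \<cdot> h\<close>. By orthogonality against \<open>Z\<close>, a shifted test map on the
  cocone \<open>K\<close> kills it, so the test map extends to \<open>X1[1]\<close> and vanishes by
  orthogonality against \<open>X1\<close>. This is what makes membership in \<open>def U\<close>
  visible on an arbitrary presentation.\<close>

lemma deflation_factor:
  assumes g: "deflation T U Y X (f \<cdot> h)" and X1: "X1 \<in> U" and f: "arrow T f X1 X" and h: "arrow T h Y X1"
  shows "deflation T U X1 X f"
proof -
  obtain Z i e where Z: "Z \<in> U" "X \<in> U" and d: "distinguished T Z Y X i (f \<cdot> h) e" by (rule deflationE[OF g])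
  obtain K k b where dK: "distinguished T K X1 X k f b" by (rule cocone[OF f])
  note D = distinguishedD[OF d] and E = distinguishedD[OF dK]
  have "f \<cdot> h = Ide T X \<cdot> (f \<cdot> h)" using arrow_ide_left[OF D(2)] by simp
  then obtain v where v: "arrow T v (shO T Z) (shO T K)" "b \<cdot> Ide T X = v \<cdot> e"
    using morphism[OF rotate[OF d] rotate[OF dK] h arrow_ide[OF D(7)]] by metis
  have "K \<in> U"
  proof (rule in_U[OF E(5)])
    fix B p assume B: "B \<in> V" and p: "arrow T p K (shO T B)"
    note P = shift_arrow[OF p]
    have pv: "shA T p \<cdot> v = Zero T (shO T Z) (shO T (shO T B))"
      by (rule orth_shift[OF Z(1) B arrow_comp[OF v(1) P]])
    have "shA T p \<cdot> b = (shA T p \<cdot> v) \<cdot> e"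
      using arrow_assoc[OF D(3) v(1) P] v(2) arrow_ide_right[OF E(3)] by simp
    then have "shA T p \<cdot> b = Zero T X (shO T (shO T B))"
      using pv zero_comp[OF D(3) arrowD(2)[OF P]] by simp
    then obtain l where l: "arrow T l (shO T X1) (shO T (shO T B))"
        "l \<cdot> inv\<^bsub>Hom T (shO T K) (shO T X1)\<^esub> (shA T k) = shA T p"
      by (rule extend_third[OF rotate[OF dK] P])
    then have "shA T p = Zero T (shO T K) (shO T (shO T B))"
      using orth_shift[OF X1 B l(1)] zero_comp[OF arrow_neg[OF shift_arrow[OF E(1)]] arrowD(2)[OF l(1)]] by simp
    then show "p = Zero T K (shO T B)" by (rule shift_eq_zero[OF p])
  qed
  then show ?thesis using deflationI[OF _ X1 Z(2) dK] by blast
qed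

section \<open>Approximations and weak kernels in \<open>U\<close>\<close>

lemma right_approximation:
  assumes "X \<in> Obj T"
  obtains A a where "A \<in> U" "arrow T a A X"
    "\<And>W k. W \<in> U \<Longrightarrow> arrow T k W X \<Longrightarrow> \<exists>l. arrow T l W A \<and> k = a \<cdot> l"
proof -
  obtain A B a b c where A: "A \<in> U" "B \<in> V" and d: "distinguished T A X (shO T B) a b c"
    by (rule approx[OF assms])
  note D = distinguishedD[OF d]
  show thesis
  proof (rule that[OF A(1) D(1)])
    fix W k assume W: "W \<in> U" and k: "arrow T k W X"
    \<comment> \<open>The composite to \<open>B[1]\<close> is the only obstruction to lifting
      \<open>k\<close>.\<close>
    have "b \<cdot> k = Zero T W (shO T B)" by (rule orth[OF W A(2) arrow_comp[OF k D(2)]])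
    then obtain l where "arrow T l W A" "a \<cdot> l = k" by (rule lift_first[OF d k])
    then show "\<exists>l. arrow T l W A \<and> k = a \<cdot> l" by blast
  qed
qed

text \<open>The cocone is a weak kernel in the whole triangulated category but need not lie in
  \<open>U\<close>; every map from \<open>U\<close> to it factors through its approximation.\<close>

lemma weak_kernel:
  assumes f: "arrow T f X Y"
  obtains A a where "A \<in> U" "arrow T a A X" "f \<cdot> a = Zero T A Y"
    "\<And>W k. W \<in> U \<Longrightarrow> arrow T k W X \<Longrightarrow> f \<cdot> k = Zero T W Y \<Longrightarrow> \<exists>l. arrow T l W A \<and> k = a \<cdot> l"
proof -
  obtain K i h where d: "distinguished T K X Y i f h" by (rule cocone[OF f])
  note D = distinguishedD[OF d]
  obtain A a where A: "A \<in> U" "arrow T a A K"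
      "\<And>W k. W \<in> U \<Longrightarrow> arrow T k W K \<Longrightarrow> \<exists>l. arrow T l W A \<and> k = a \<cdot> l"
    by (rule right_approximation[OF D(5)]) blast
  show thesis
  proof (rule that[OF A(1) arrow_comp[OF A(2) D(1)]])
    show "f \<cdot> (i \<cdot> a) = Zero T A Y"
      using arrow_assoc[OF A(2) D(1) f] triangle_comp_zero(1)[OF d] zero_comp[OF A(2) D(7)] by simp
    fix W k assume W: "W \<in> U" and k: "arrow T k W X" "f \<cdot> k = Zero T W Y"
    obtain l where l: "arrow T l W K" "i \<cdot> l = k" by (rule lift_first[OF d k])
    obtain m where m: "arrow T m W A" "l = a \<cdot> m" using A(3)[OF W l(1)] by blast
    show "\<exists>l. arrow T l W A \<and> k = i \<cdot> a \<cdot> l"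
      using m l(2) arrow_assoc[OF m(1) A(2) D(1)] by (intro exI[of _ m]) simp
  qed
qed

lemma additive_U: "additive_category (full_subcat T U)"
proof -
  have sub: "additive_subcat T U" using cotorsion by (simp add: cotorsion_pair_def)
  obtain N where N: "zero_object T N" using ex_zero by blast
  show ?thesis
  proof (rule additive_full_subcat[OF _ N])
    show "U \<subseteq> Obj T" "N \<in> U" using U_obj zero_in_U[OF N] by auto
    show "\<exists>B\<in>U. biproduct T X Y B" if "X \<in> U" "Y \<in> U" for X Y
      using ex_biproduct[OF U_obj[OF that(1)] U_obj[OF that(2)]] sub that unfolding additive_subcat_def by blast
  qed
qed

text \<open>
  The functor represented by \<open>C\<close> is the left exact reflection of the cokernel of \<open>T(-, f)\<close> on \<open>U\<close>:
  as the cone of \<open>A' \<rightarrow> A[1] \<rightarrow> K[1]\<close>, the object \<open>C\<close> is an extension of \<open>B[2]\<close> by \<open>I[1]\<close>, and a map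
  \<open>X \<rightarrow> Z[1] \<rightarrow> C\<close> with \<open>X, Z\<close> in \<open>U\<close> vanishes because \<open>Z[1] \<rightarrow> B[2]\<close> and \<open>X \<rightarrow> I[1]\<close> do.
\<close>

lemma reflection_object:
  assumes X: "X1 \<in> U" "X0 \<in> U" and f: "arrow T f X1 X0"
  obtains C e where "arrow T e X0 C" "e \<cdot> f = Zero T X1 C"
    "\<And>Z Y X p q k. \<lbrakk>conflation T U Z Y X p q; arrow T k X C; k \<cdot> q = Zero T Y C\<rbrakk> \<Longrightarrow> k = Zero T X C"
    "\<And>W k. \<lbrakk>W \<in> U; arrow T k W X0; e \<cdot> k = Zero T W C\<rbrakk> \<Longrightarrow>
       \<exists>Y g l. deflation T U Y W g \<and> arrow T l Y X1 \<and> k \<cdot> g = f \<cdot> l"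
    "\<And>W k. \<lbrakk>W \<in> U; arrow T k W C\<rbrakk> \<Longrightarrow> \<exists>Y g l. deflation T U Y W g \<and> arrow T l Y X0 \<and> k \<cdot> g = e \<cdot> l"
proof -
  obtain K i c where dK: "distinguished T K X1 X0 i f c" by (rule cocone[OF f])
  note K = distinguishedD[OF dK]
  obtain A B a b w where A: "A \<in> U" "B \<in> V" and dA: "distinguished T A K (shO T B) a b w" by (rule approx[OF K(5)])
  obtain a' b' w' where dA': "distinguished T (shO T A) (shO T K) (shO T (shO T B)) a' b' w'"
    by (rule shift_triangle[OF dA])
  note A' = distinguishedD[OF dA']
  obtain A2 I s t r where A2: "A2 \<in> U" "I \<in> V" and dS: "distinguished T A2 (shO T A) (shO T I) s t r"
    by (rule approx[OF A'(5)])
  note S = distinguishedD[OF dS]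
  have as: "arrow T (a' \<cdot> s) A2 (shO T K)" using arrow_comp[OF S(1) A'(1)] .
  obtain C d d' where dC: "distinguished T A2 (shO T K) C (a' \<cdot> s) d d'" by (rule complete[OF as])
  note D = distinguishedD[OF dC]
  \<comment> \<open>The octahedron on \<open>A2 -> A[1] -> K[1]\<close>: the three cones are
    \<open>I[1]\<close>, \<open>B[2]\<close> and \<open>C\<close>.\<close>
  obtain u v w'' where oct: "distinguished T (shO T I) C (shO T (shO T B)) u v w''"
    using octahedral[OF dS dA' dC] by blast
  note O = distinguishedD[OF oct]
  have dc: "arrow T (d \<cdot> c) X0 C" using arrow_comp[OF K(3) D(2)] .
  show thesis
  proof (rule that[OF dc])
    show "d \<cdot> c \<cdot> f = Zero T X1 C"
      using arrow_assoc[OF f K(3) D(2)] triangle_comp_zero(2)[OF dK] comp_zero[OF D(2) K(6)] by simp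
  next
    fix Z Y X p q k assume conf: "conflation T U Z Y X p q" and k: "arrow T k X C" "k \<cdot> q = Zero T Y C"
    obtain h where Z: "Z \<in> U" "X \<in> U" and h: "distinguished T Z Y X p q h" using conf unfolding conflation_def by blast
    note H = distinguishedD[OF h]
    obtain l where l: "arrow T l (shO T Z) C" "l \<cdot> h = k" by (rule extend_third[OF h k])
    have "v \<cdot> l = Zero T (shO T Z) (shO T (shO T B))" by (rule orth_shift[OF Z(1) A(2) arrow_comp[OF l(1) O(2)]])
    then obtain m where m: "arrow T m (shO T Z) (shO T I)" "u \<cdot> m = l" by (rule lift_first[OF oct l(1)])
    have "m \<cdot> h = Zero T X (shO T I)" by (rule orth[OF Z(2) A2(2) arrow_comp[OF H(3) m(1)]])
    then show "k = Zero T X C" using l(2) m(2) arrow_assoc[OF H(3) m(1) O(1)] comp_zero[OF O(1) H(7)] by simp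
  next
    fix W k assume W: "W \<in> U" and k: "arrow T k W X0" and "d \<cdot> c \<cdot> k = Zero T W C"
    then have "d \<cdot> (c \<cdot> k) = Zero T W C" using arrow_assoc[OF k K(3) D(2)] by simp
    then obtain m where m: "arrow T m W A2" "(a' \<cdot> s) \<cdot> m = c \<cdot> k" by (rule lift_first[OF dC arrow_comp[OF k K(3)]])
    have sm: "arrow T (s \<cdot> m) W (shO T A)" using arrow_comp[OF m(1) S(1)] .
    \<comment> \<open>The lift to \<open>A2\<close> gives a map from \<open>W\<close> to
      \<open>A[1]\<close>, that is, an extension class with \<open>A\<close> in \<open>U\<close>; a
      deflation kills it.\<close>
    obtain Y g where g: "deflation T U Y W g" "(s \<cdot> m) \<cdot> g = Zero T Y (shO T A)" by (rule deflation_kill[OF W A(1) sm])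
    note ga = deflation_arrow[OF g(1)]
    have "c \<cdot> (k \<cdot> g) = (c \<cdot> k) \<cdot> g" using arrow_assoc[OF ga k K(3)] by simp
    also have "\<dots> = (a' \<cdot> (s \<cdot> m)) \<cdot> g" using m(2) arrow_assoc[OF m(1) S(1) A'(1)] by simp
    also have "\<dots> = Zero T Y (shO T K)"
      using arrow_assoc[OF ga sm A'(1)] g(2) comp_zero[OF A'(1) arrowD(1)[OF ga]] by simp
    finally obtain l where "arrow T l Y X1" "f \<cdot> l = k \<cdot> g" by (rule lift_second[OF dK arrow_comp[OF ga k]])
    then show "\<exists>Y g l. deflation T U Y W g \<and> arrow T l Y X1 \<and> k \<cdot> g = f \<cdot> l" using g(1) by metis
  next
    fix W k assume W: "W \<in> U" and k: "arrow T k W C"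
    \<comment> \<open>First obstruction: the component in \<open>A2[1]\<close>, which prevents
      lifting \<open>k\<close> to \<open>K[1]\<close>.\<close>
    obtain Y g where g: "deflation T U Y W g" "(d' \<cdot> k) \<cdot> g = Zero T Y (shO T A2)"
      by (rule deflation_kill[OF W A2(1) arrow_comp[OF k D(3)]])
    note ga = deflation_arrow[OF g(1)]
    have Y: "Y \<in> U" using g(1) by (rule deflationE)
    have "d' \<cdot> (k \<cdot> g) = Zero T Y (shO T A2)" using arrow_assoc[OF ga k D(3)] g(2) by simp
    then obtain p where p: "arrow T p Y (shO T K)" "d \<cdot> p = k \<cdot> g" by (rule lift_second[OF dC arrow_comp[OF ga k]])
    let ?i = "inv\<^bsub>Hom T (shO T K) (shO T X1)\<^esub> (shA T i)"
    have i: "arrow T ?i (shO T K) (shO T X1)" using arrow_neg[OF shift_arrow[OF K(1)]] .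
    \<comment> \<open>Second obstruction: the component in \<open>X1[1]\<close>, which prevents
      lifting from \<open>K[1]\<close> to \<open>X0\<close>. The two deflations are composed at the
      end.\<close>
    obtain Y' g' where g': "deflation T U Y' Y g'" "(?i \<cdot> p) \<cdot> g' = Zero T Y' (shO T X1)"
      by (rule deflation_kill[OF Y X(1) arrow_comp[OF p(1) i]])
    note g'a = deflation_arrow[OF g'(1)]
    have "?i \<cdot> (p \<cdot> g') = Zero T Y' (shO T X1)" using arrow_assoc[OF g'a p(1) i] g'(2) by simp
    then obtain l where l: "arrow T l Y' X0" "c \<cdot> l = p \<cdot> g'"
      by (rule lift_second[OF rotate[OF dK] arrow_comp[OF g'a p(1)]])
    have "k \<cdot> (g \<cdot> g') = (d \<cdot> p) \<cdot> g'" using arrow_assoc[OF g'a ga k] p(2) by simp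
    also have "\<dots> = d \<cdot> c \<cdot> l" using arrow_assoc[OF g'a p(1) D(2)] arrow_assoc[OF l(1) K(3) D(2)] l(2) by simp
    finally show "\<exists>Y g l. deflation T U Y W g \<and> arrow T l Y X0 \<and> k \<cdot> g = d \<cdot> c \<cdot> l"
      using deflation_comp[OF g'(1) g(1)] l(1) by blast
  qed
qed

end

section \<open>Finitely presented functors in terms of elements\<close>

abbreviation El :: "('o, 'm, 'g) abfunctor \<Rightarrow> 'o \<Rightarrow> 'g set" where
  "El F X \<equiv> carrier (AOb F X)"

text \<open>By the Yoneda lemma, a presentation of \<open>F\<close> is a generator \<open>x0 \<in> F X0\<close> together with a
  map \<open>r\<close> through which exactly the relations satisfied by \<open>x0\<close> factor.\<close>

definition presents ::
  "('o, 'm, 'z) precat_scheme \<Rightarrow> ('o, 'm, 'g) abfunctor \<Rightarrow> 'o \<Rightarrow> 'g \<Rightarrow> 'o \<Rightarrow> 'm \<Rightarrow> bool" where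
  "presents C F X0 x0 X1 r \<longleftrightarrow> x0 \<in> El F X0 \<and> arrow C r X1 X0 \<and>
     (\<forall>W\<in>Obj C. \<forall>x\<in>El F W. \<exists>h. arrow C h W X0 \<and> x = AAr F h x0) \<and>
     (\<forall>W h. arrow C h W X0 \<longrightarrow>
        (AAr F h x0 = \<one>\<^bsub>AOb F W\<^esub> \<longleftrightarrow> (\<exists>k. arrow C k W X1 \<and> h = r \<cdot>\<^bsub>C\<^esub> k)))"

lemma presentsD:
  assumes "presents C F X0 x0 X1 r"
  shows "x0 \<in> El F X0" "arrow C r X1 X0" "X0 \<in> Obj C" "X1 \<in> Obj C"
    "\<And>W x. W \<in> Obj C \<Longrightarrow> x \<in> El F W \<Longrightarrow> \<exists>h. arrow C h W X0 \<and> x = AAr F h x0"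
    "\<And>W h. arrow C h W X0 \<Longrightarrow> AAr F h x0 = \<one>\<^bsub>AOb F W\<^esub> \<longleftrightarrow> (\<exists>k. arrow C k W X1 \<and> h = r \<cdot>\<^bsub>C\<^esub> k)"
  using assms unfolding presents_def by (auto dest: arrowD)

context preadditive_category
begin

lemma fun_comm_group: "additive_abfunctor C F \<Longrightarrow> X \<in> Obj C \<Longrightarrow> comm_group (AOb F X)"
  by (simp add: additive_abfunctor_def)

lemma fun_group: "additive_abfunctor C F \<Longrightarrow> X \<in> Obj C \<Longrightarrow> group (AOb F X)"
  using fun_comm_group comm_group.axioms(2) by blast

lemma fun_map_hom: "additive_abfunctor C F \<Longrightarrow> arrow C f X Y \<Longrightarrow> group_hom (AOb F Y) (AOb F X) (AAr F f)"
  using fun_group unfolding additive_abfunctor_def arrow_def group_hom_def group_hom_axioms_def by blast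

lemma fun_closed: "additive_abfunctor C F \<Longrightarrow> arrow C f X Y \<Longrightarrow> y \<in> El F Y \<Longrightarrow> AAr F f y \<in> El F X"
  by (rule group_hom.hom_closed[OF fun_map_hom])

lemma fun_mult: "additive_abfunctor C F \<Longrightarrow> arrow C f X Y \<Longrightarrow> x \<in> El F Y \<Longrightarrow> y \<in> El F Y \<Longrightarrow>
    AAr F f (x \<otimes>\<^bsub>AOb F Y\<^esub> y) = AAr F f x \<otimes>\<^bsub>AOb F X\<^esub> AAr F f y"
  by (rule group_hom.hom_mult[OF fun_map_hom])

lemma fun_one: "additive_abfunctor C F \<Longrightarrow> arrow C f X Y \<Longrightarrow> AAr F f \<one>\<^bsub>AOb F Y\<^esub> = \<one>\<^bsub>AOb F X\<^esub>"
  by (rule group_hom.hom_one[OF fun_map_hom])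

lemma fun_inv: "additive_abfunctor C F \<Longrightarrow> arrow C f X Y \<Longrightarrow> y \<in> El F Y \<Longrightarrow>
    AAr F f (inv\<^bsub>AOb F Y\<^esub> y) = inv\<^bsub>AOb F X\<^esub> (AAr F f y)"
  by (rule group_hom.hom_inv[OF fun_map_hom])

lemma fun_ide: "additive_abfunctor C F \<Longrightarrow> X \<in> Obj C \<Longrightarrow> x \<in> El F X \<Longrightarrow> AAr F (Ide C X) x = x"
  by (simp add: additive_abfunctor_def)

lemma fun_comp: "additive_abfunctor C F \<Longrightarrow> arrow C f X Y \<Longrightarrow> arrow C g Y Z \<Longrightarrow> z \<in> El F Z \<Longrightarrow>
    AAr F (g \<cdot> f) z = AAr F f (AAr F g z)"
  unfolding additive_abfunctor_def arrow_def by blast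

lemma fun_sum: "additive_abfunctor C F \<Longrightarrow> arrow C f X Y \<Longrightarrow> arrow C g X Y \<Longrightarrow> y \<in> El F Y \<Longrightarrow>
    AAr F (f \<otimes>\<^bsub>Hom C X Y\<^esub> g) y = AAr F f y \<otimes>\<^bsub>AOb F X\<^esub> AAr F g y"
  unfolding additive_abfunctor_def arrow_def by blast

lemma fun_one_closed: "additive_abfunctor C F \<Longrightarrow> X \<in> Obj C \<Longrightarrow> \<one>\<^bsub>AOb F X\<^esub> \<in> El F X"
  using fun_group group.is_monoid monoid.one_closed by blast

lemma fun_zero:
  assumes F: "additive_abfunctor C F" and X: "X \<in> Obj C" "Y \<in> Obj C" and y: "y \<in> El F Y"
  shows "AAr F (Zero C X Y) y = \<one>\<^bsub>AOb F X\<^esub>"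
proof -
  interpret G: group "AOb F X" using fun_group F X by blast
  note Z = arrow_zero[OF X]
  have a: "AAr F (Zero C X Y) y \<in> El F X" using fun_closed[OF F Z y] .
  have "AAr F (Zero C X Y) y = AAr F (Zero C X Y) y \<otimes>\<^bsub>AOb F X\<^esub> AAr F (Zero C X Y) y"
    using fun_sum[OF F Z Z y] sum_zero(1)[OF Z] by simp
  then show ?thesis using a G.l_cancel_one by metis
qed

lemma presents_relation:
  assumes F: "additive_abfunctor C F" and p: "presents C F X0 x0 X1 r" and k: "arrow C k W X1"
  shows "AAr F (r \<cdot> k) x0 = \<one>\<^bsub>AOb F W\<^esub>" "AAr F r x0 = \<one>\<^bsub>AOb F X1\<^esub>"
  using presentsD(6)[OF p arrow_comp[OF k presentsD(2)[OF p]]] k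
    presentsD(6)[OF p presentsD(2)[OF p]] arrow_ide[OF presentsD(4)[OF p]] arrow_ide_right[OF presentsD(2)[OF p]]
  by auto

lemma nt_hom: "natural_trans C F G \<eta> \<Longrightarrow> additive_abfunctor C F \<Longrightarrow> additive_abfunctor C G \<Longrightarrow> X \<in> Obj C \<Longrightarrow>
    group_hom (AOb F X) (AOb G X) (\<eta> X)"
  using fun_group[of F] fun_group[of G] unfolding natural_trans_def group_hom_def group_hom_axioms_def by blast

lemma nt_closed: "natural_trans C F G \<eta> \<Longrightarrow> X \<in> Obj C \<Longrightarrow> x \<in> El F X \<Longrightarrow> \<eta> X x \<in> El G X"
  by (auto simp: natural_trans_def hom_def)

lemma nt_mult: "natural_trans C F G \<eta> \<Longrightarrow> X \<in> Obj C \<Longrightarrow> x \<in> El F X \<Longrightarrow> y \<in> El F X \<Longrightarrow>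
    \<eta> X (x \<otimes>\<^bsub>AOb F X\<^esub> y) = \<eta> X x \<otimes>\<^bsub>AOb G X\<^esub> \<eta> X y"
  by (auto simp: natural_trans_def hom_def)

lemma nt_one: "natural_trans C F G \<eta> \<Longrightarrow> additive_abfunctor C F \<Longrightarrow> additive_abfunctor C G \<Longrightarrow> X \<in> Obj C \<Longrightarrow>
    \<eta> X \<one>\<^bsub>AOb F X\<^esub> = \<one>\<^bsub>AOb G X\<^esub>"
  using group_hom.hom_one[OF nt_hom] .

lemma nt_natural: "natural_trans C F G \<eta> \<Longrightarrow> arrow C f X Y \<Longrightarrow> y \<in> El F Y \<Longrightarrow>
    \<eta> X (AAr F f y) = AAr G f (\<eta> Y y)"
  unfolding natural_trans_def arrow_def by blast

lemma nt_inj: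
  assumes nt: "natural_trans C F G \<eta>" and F: "additive_abfunctor C F" and G: "additive_abfunctor C G"
    and X: "X \<in> Obj C" and ker: "\<And>x. x \<in> El F X \<Longrightarrow> \<eta> X x = \<one>\<^bsub>AOb G X\<^esub> \<Longrightarrow> x = \<one>\<^bsub>AOb F X\<^esub>"
    and xy: "x \<in> El F X" "y \<in> El F X" "\<eta> X x = \<eta> X y"
  shows "x = y"
proof -
  interpret group_hom "AOb F X" "AOb G X" "\<eta> X" using nt_hom nt F G X by blast
  have "inj_on (\<eta> X) (El F X)"
    using ker inj_iff_trivial_ker one_closed hom_one unfolding kernel_def by blast
  then show ?thesis using xy by (simp add: inj_on_def)
qed

lemma natural_transI:
  assumes "\<And>X x. X \<in> Obj C \<Longrightarrow> x \<in> El F X \<Longrightarrow> \<eta> X x \<in> El G X"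
    "\<And>X x y. X \<in> Obj C \<Longrightarrow> x \<in> El F X \<Longrightarrow> y \<in> El F X \<Longrightarrow> \<eta> X (x \<otimes>\<^bsub>AOb F X\<^esub> y) = \<eta> X x \<otimes>\<^bsub>AOb G X\<^esub> \<eta> X y"
    "\<And>X Y f y. arrow C f X Y \<Longrightarrow> y \<in> El F Y \<Longrightarrow> \<eta> X (AAr F f y) = AAr G f (\<eta> Y y)"
  shows "natural_trans C F G \<eta>"
  using assms by (auto simp: natural_trans_def arrow_def intro!: homI)

text \<open>A natural transformation is built from its graph: a total, additive and natural relation
  is single-valued as soon as it relates the unit only to the unit. The Yoneda lemma, the
  factorizations through kernels and cokernels, and the extension of maps into left exact functors
  are all obtained in this way.\<close>

lemma natural_trans_relation:
  assumes F: "additive_abfunctor C F" and G: "additive_abfunctor C G"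
    and closed: "\<And>W x y. W \<in> Obj C \<Longrightarrow> R W x y \<Longrightarrow> x \<in> El F W \<and> y \<in> El G W"
    and total: "\<And>W x. W \<in> Obj C \<Longrightarrow> x \<in> El F W \<Longrightarrow> \<exists>y. R W x y"
    and mult: "\<And>W x y x' y'. W \<in> Obj C \<Longrightarrow> R W x y \<Longrightarrow> R W x' y' \<Longrightarrow> R W (x \<otimes>\<^bsub>AOb F W\<^esub> x') (y \<otimes>\<^bsub>AOb G W\<^esub> y')"
    and nat: "\<And>W' W f x y. arrow C f W' W \<Longrightarrow> R W x y \<Longrightarrow> R W' (AAr F f x) (AAr G f y)"
    and one: "\<And>W y. W \<in> Obj C \<Longrightarrow> R W \<one>\<^bsub>AOb F W\<^esub> y \<Longrightarrow> y = \<one>\<^bsub>AOb G W\<^esub>"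
  shows "\<exists>\<eta>. natural_trans C F G \<eta> \<and> (\<forall>W\<in>Obj C. \<forall>x y. R W x y \<longleftrightarrow> x \<in> El F W \<and> y = \<eta> W x)"
proof -
  have uniq: "y = y'" if W: "W \<in> Obj C" and R: "R W x y" "R W x y'" for W x y y'
  proof -
    interpret FW: group "AOb F W" using fun_group F W by blast
    interpret GW: group "AOb G W" using fun_group G W by blast
    have x: "x \<in> El F W" "y \<in> El G W" "y' \<in> El G W" using closed W R by auto
    \<comment> \<open>If \<open>z\<close> is a value at the inverse of \<open>x\<close>, then
      \<open>y\<close> and \<open>y'\<close> are both inverse to \<open>z\<close>.\<close>
    obtain z where z: "R W (inv\<^bsub>AOb F W\<^esub> x) z" using total[OF W] x by blast
    have zc: "z \<in> El G W" using closed[OF W z] by blast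
    have "y \<otimes>\<^bsub>AOb G W\<^esub> z = \<one>\<^bsub>AOb G W\<^esub>" "y' \<otimes>\<^bsub>AOb G W\<^esub> z = \<one>\<^bsub>AOb G W\<^esub>"
      using mult[OF W R(1) z] mult[OF W R(2) z] one[OF W] unfolding FW.r_inv[OF x(1)] by blast+
    then show ?thesis using GW.right_cancel[OF zc x(2,3)] by simp
  qed
  define \<eta> where "\<eta> W x = (SOME y. R W x y)" for W x
  have \<eta>: "R W x (\<eta> W x)" if "W \<in> Obj C" "x \<in> El F W" for W x
    unfolding \<eta>_def using someI_ex[OF total[OF that]] .
  show ?thesis
  proof (intro exI[of _ \<eta>] conjI ballI allI)
    show "R W x y \<longleftrightarrow> x \<in> El F W \<and> y = \<eta> W x" if "W \<in> Obj C" for W x y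
      using uniq[OF that] \<eta>[OF that] closed[OF that] by blast
    show "natural_trans C F G \<eta>"
    proof (rule natural_transI)
      show "\<eta> X x \<in> El G X" if "X \<in> Obj C" "x \<in> El F X" for X x
        using closed[OF that(1) \<eta>[OF that]] by blast
      show "\<eta> X (x \<otimes>\<^bsub>AOb F X\<^esub> y) = \<eta> X x \<otimes>\<^bsub>AOb G X\<^esub> \<eta> X y" if "X \<in> Obj C" "x \<in> El F X" "y \<in> El F X" for X x y
        using uniq[OF that(1) \<eta>[OF that(1)] mult[OF that(1) \<eta>[OF that(1,2)] \<eta>[OF that(1,3)]]]
          closed[OF that(1) mult[OF that(1) \<eta>[OF that(1,2)] \<eta>[OF that(1,3)]]] by blast
      show "\<eta> X (AAr F f y) = AAr G f (\<eta> Y y)" if f: "arrow C f X Y" and y: "y \<in> El F Y" for X Y f y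
        using uniq[OF arrowD(1)[OF f] \<eta>[OF arrowD(1)[OF f] fun_closed[OF F f y]] nat[OF f \<eta>[OF arrowD(2)[OF f] y]]] .
    qed
  qed
qed

lemma nt_generator:
  assumes "natural_trans C F G \<eta>" "presents C F X0 x0 X1 r" "arrow C h W X0"
  shows "\<eta> W (AAr F h x0) = AAr G h (\<eta> X0 x0)"
  using nt_natural[OF assms(1,3) presentsD(1)[OF assms(2)]] .

lemma nt_eq_generator:
  assumes "natural_trans C F G \<eta>" "natural_trans C F G \<theta>" "presents C F X0 x0 X1 r" "\<eta> X0 x0 = \<theta> X0 x0"
    "W \<in> Obj C" "x \<in> El F W"
  shows "\<eta> W x = \<theta> W x"
  using presentsD(5)[OF assms(3,5,6)] nt_generator[OF assms(1,3)] nt_generator[OF assms(2,3)] assms(4) by auto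

text \<open>The graph pairs \<open>F h x0\<close> with \<open>G h y\<close>. An \<open>h\<close>
  that kills \<open>x0\<close> factors through \<open>r\<close>, and \<open>r\<close> kills
  \<open>y\<close>, so the unit is paired only with the unit.\<close>

lemma yoneda:
  assumes F: "additive_abfunctor C F" and G: "additive_abfunctor C G" and p: "presents C F X0 x0 X1 r"
    and y: "y \<in> El G X0" "AAr G r y = \<one>\<^bsub>AOb G X1\<^esub>"
  obtains \<eta> where "natural_trans C F G \<eta>" "\<eta> X0 x0 = y"
proof -
  note P = presentsD[OF p]
  define R where "R W x z \<longleftrightarrow> (\<exists>h. arrow C h W X0 \<and> x = AAr F h x0 \<and> z = AAr G h y)" for W x z
  have "\<exists>\<eta>. natural_trans C F G \<eta> \<and> (\<forall>W\<in>Obj C. \<forall>x z. R W x z \<longleftrightarrow> x \<in> El F W \<and> z = \<eta> W x)"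
  proof (rule natural_trans_relation[OF F G, of R])
    show "x \<in> El F W \<and> z \<in> El G W" if "R W x z" for W x z
      using that fun_closed[OF F _ P(1)] fun_closed[OF G _ y(1)] unfolding R_def by blast
    show "\<exists>z. R W x z" if "W \<in> Obj C" "x \<in> El F W" for W x
      using P(5)[OF that] unfolding R_def by blast
    show "R W (x \<otimes>\<^bsub>AOb F W\<^esub> x') (z \<otimes>\<^bsub>AOb G W\<^esub> z')" if "R W x z" "R W x' z'" for W x z x' z'
    proof -
      obtain h h' where h: "arrow C h W X0" "x = AAr F h x0" "z = AAr G h y"
        "arrow C h' W X0" "x' = AAr F h' x0" "z' = AAr G h' y"
        using \<open>R W x z\<close> \<open>R W x' z'\<close> unfolding R_def by blast
      then show ?thesis unfolding R_def
        using arrow_sum[OF h(1,4)] fun_sum[OF F h(1,4) P(1)] fun_sum[OF G h(1,4) y(1)] by auto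
    qed
    show "R W' (AAr F f x) (AAr G f z)" if f: "arrow C f W' W" and "R W x z" for W' W f x z
    proof -
      obtain h where h: "arrow C h W X0" "x = AAr F h x0" "z = AAr G h y"
        using \<open>R W x z\<close> unfolding R_def by blast
      then show ?thesis unfolding R_def
        using arrow_comp[OF f h(1)] fun_comp[OF F f h(1) P(1)] fun_comp[OF G f h(1) y(1)] by auto
    qed
    show "z = \<one>\<^bsub>AOb G W\<^esub>" if W: "W \<in> Obj C" and R: "R W \<one>\<^bsub>AOb F W\<^esub> z" for W z
    proof -
      obtain h where h: "arrow C h W X0" "\<one>\<^bsub>AOb F W\<^esub> = AAr F h x0" "z = AAr G h y"
        using R unfolding R_def by blast
      then obtain k where k: "arrow C k W X1" "h = r \<cdot> k" using P(6)[OF h(1)] by auto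
      show ?thesis using h(3) k(2) fun_comp[OF G k(1) P(2) y(1)] y(2) fun_one[OF G k(1)] by simp
    qed
  qed
  then obtain \<eta> where \<eta>: "natural_trans C F G \<eta>" "\<And>W x z. W \<in> Obj C \<Longrightarrow> R W x z \<longleftrightarrow> x \<in> El F W \<and> z = \<eta> W x"
    by auto
  have "R X0 x0 y" unfolding R_def using arrow_ide[OF P(3)] fun_ide[OF F P(3,1)] fun_ide[OF G P(3) y(1)] by metis
  then show thesis using that[OF \<eta>(1)] \<eta>(2)[OF P(3), of x0 y] by blast
qed

section \<open>Representable and finitely presented functors\<close>

lemma additive_abfunctor_full_subcat:
  assumes "additive_abfunctor C F" "U \<subseteq> Obj C"
  shows "additive_abfunctor (full_subcat C U) F"
  using assms unfolding additive_abfunctor_def full_subcat_simps by (intro conjI ballI) blast+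

lemma additive_representable: "X \<in> Obj C \<Longrightarrow> additive_abfunctor C (representable C X)"
  unfolding additive_abfunctor_def representable_def
  using hom_group comp_hom_right ide_right comp_assoc comp_sum by (auto simp: arrow_def)

lemma finitely_presented_iff:
  "finitely_presented C F \<longleftrightarrow> additive_abfunctor C F \<and> (\<exists>X0 x0 X1 r. presents C F X0 x0 X1 r)"
proof safe
  assume "finitely_presented C F"
  then obtain U1 U0 \<alpha> \<pi> where F: "additive_abfunctor C F" and U: "U1 \<in> Obj C" "U0 \<in> Obj C"
    and \<alpha>: "natural_trans C (representable C U1) (representable C U0) \<alpha>"
    and \<pi>: "natural_trans C (representable C U0) F \<pi>"
    and ex: "\<And>X. X \<in> Obj C \<Longrightarrow> \<alpha> X ` Arr C X U1 = kernel (Hom C X U0) (AOb F X) (\<pi> X)"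
      "\<And>X. X \<in> Obj C \<Longrightarrow> \<pi> X ` Arr C X U0 = El F X"
    unfolding finitely_presented_def by auto
  show "additive_abfunctor C F" by fact
  \<comment> \<open>By Yoneda both transformations are determined by the images of the
    identities.\<close>
  define r where "r = \<alpha> U1 (Ide C U1)"
  define x0 where "x0 = \<pi> U0 (Ide C U0)"
  have \<alpha>r: "\<alpha> W k = r \<cdot> k" if k: "arrow C k W U1" for W k
    using nt_natural[OF \<alpha> k, of "Ide C U1"] ide_in[OF U(1)] arrow_ide_left[OF k] by (simp add: representable_def r_def)
  have \<pi>x: "\<pi> W h = AAr F h x0" if h: "arrow C h W U0" for W h
    using nt_natural[OF \<pi> h, of "Ide C U0"] ide_in[OF U(2)] arrow_ide_left[OF h] by (simp add: representable_def x0_def)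
  have "presents C F U0 x0 U1 r"
    unfolding presents_def
  proof (intro conjI ballI allI impI)
    show "x0 \<in> El F U0" using ex(2)[OF U(2)] ide_in[OF U(2)] by (auto simp: x0_def)
    show "arrow C r U1 U0" using nt_closed[OF \<alpha> U(1)] ide_in[OF U(1)] U by (simp add: representable_def r_def arrow_def)
    show "\<exists>h. arrow C h W U0 \<and> x = AAr F h x0" if W: "W \<in> Obj C" and x: "x \<in> El F W" for W x
    proof -
      obtain h where "h \<in> Arr C W U0" "x = \<pi> W h" using ex(2)[OF W] x by blast
      then show ?thesis using \<pi>x[of h W] W U by (auto simp: arrow_def)
    qed
    show "AAr F h x0 = \<one>\<^bsub>AOb F W\<^esub> \<longleftrightarrow> (\<exists>k. arrow C k W U1 \<and> h = r \<cdot> k)" if h: "arrow C h W U0" for W h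
    proof -
      note W = arrowD(1)[OF h]
      have "AAr F h x0 = \<one>\<^bsub>AOb F W\<^esub> \<longleftrightarrow> h \<in> kernel (Hom C W U0) (AOb F W) (\<pi> W)"
        using \<pi>x[OF h] arrowD(3)[OF h] by (simp add: kernel_def)
      also have "\<dots> \<longleftrightarrow> h \<in> \<alpha> W ` Arr C W U1" using ex(1)[OF W] by simp
      also have "\<dots> \<longleftrightarrow> (\<exists>k. arrow C k W U1 \<and> h = r \<cdot> k)"
        using \<alpha>r W U(1) by (auto simp: arrow_def image_iff)
      finally show ?thesis .
    qed
  qed
  then show "\<exists>X0 x0 X1 r. presents C F X0 x0 X1 r" by blast
next
  fix X0 x0 X1 r assume F: "additive_abfunctor C F" and p: "presents C F X0 x0 X1 r"
  note P = presentsD[OF p]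
  have nt1: "natural_trans C (representable C X1) (representable C X0) (\<lambda>W k. r \<cdot> k)"
    by (rule natural_transI)
      (use P(2,3,4) arrow_comp[OF _ P(2)] comp_sum[OF _ _ P(2)] arrow_assoc[OF _ _ P(2)] in
        \<open>auto simp: representable_def arrow_def\<close>)
  have nt2: "natural_trans C (representable C X0) F (\<lambda>W h. AAr F h x0)"
    by (rule natural_transI)
      (use P(1,3) fun_closed[OF F _ P(1)] fun_sum[OF F _ _ P(1)] fun_comp[OF F _ _ P(1)] in
        \<open>auto simp: representable_def arrow_def\<close>)
  have "(\<lambda>k. r \<cdot> k) ` Arr C X X1 = kernel (Hom C X X0) (AOb F X) (\<lambda>h. AAr F h x0) \<and>
      (\<lambda>h. AAr F h x0) ` Arr C X X0 = El F X" if X: "X \<in> Obj C" for X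
  proof (intro conjI equalityI subsetI)
    show "h \<in> kernel (Hom C X X0) (AOb F X) (\<lambda>h. AAr F h x0)" if "h \<in> (\<lambda>k. r \<cdot> k) ` Arr C X X1" for h
    proof -
      obtain k where k: "arrow C k X X1" "h = r \<cdot> k"
        using \<open>h \<in> (\<lambda>k. r \<cdot> k) ` Arr C X X1\<close> X P(4) by (auto simp: arrow_def)
      then show ?thesis using presents_relation(1)[OF F p k(1)] arrow_comp[OF k(1) P(2)]
        by (simp add: kernel_def arrow_def)
    qed
    show "h \<in> (\<lambda>k. r \<cdot> k) ` Arr C X X1" if "h \<in> kernel (Hom C X X0) (AOb F X) (\<lambda>h. AAr F h x0)" for h
      using that P(6)[of h X] X P(3) by (auto simp: kernel_def arrow_def)
    show "x \<in> El F X" if "x \<in> (\<lambda>h. AAr F h x0) ` Arr C X X0" for x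
      using that fun_closed[OF F _ P(1)] X P(3) by (auto simp: arrow_def)
    show "x \<in> (\<lambda>h. AAr F h x0) ` Arr C X X0" if "x \<in> El F X" for x
      using P(5)[OF X that] by (auto simp: arrow_def)
  qed
  then show "finitely_presented C F"
    unfolding finitely_presented_def using F nt1 nt2 P(3,4) by blast
qed

lemma fp_additive: "finitely_presented C F \<Longrightarrow> additive_abfunctor C F"
  by (simp add: finitely_presented_iff)

lemma fp_presents:
  assumes "finitely_presented C F"
  obtains X0 x0 X1 r where "presents C F X0 x0 X1 r"
  using assms by (auto simp: finitely_presented_iff)

text \<open>Moves a presentation to a copy of the functor with elements of another type.\<close>

lemma presents_transfer:
  assumes F: "additive_abfunctor C F" and G: "additive_abfunctor C G" and \<eta>: "natural_trans C F G \<eta>"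
    and bij: "\<And>X. X \<in> Obj C \<Longrightarrow> bij_betw (\<eta> X) (El F X) (El G X)"
    and x0: "x0 \<in> El F X0" and X0: "X0 \<in> Obj C"
  shows "presents C F X0 x0 X1 r \<longleftrightarrow> presents C G X0 (\<eta> X0 x0) X1 r"
proof -
  have y0: "\<eta> X0 x0 \<in> El G X0" using nt_closed[OF \<eta> X0 x0] .
  have g: "AAr G h (\<eta> X0 x0) = \<eta> W (AAr F h x0)" if "arrow C h W X0" for h W
    using nt_natural[OF \<eta> that x0] by simp
  have inj: "\<eta> W a = \<eta> W b \<longleftrightarrow> a = b" if "W \<in> Obj C" "a \<in> El F W" "b \<in> El F W" for W a b
    using bij_betw_imp_inj_on[OF bij[OF that(1)]] that by (auto simp: inj_on_def)
  have 1: "AAr G h (\<eta> X0 x0) = \<one>\<^bsub>AOb G W\<^esub> \<longleftrightarrow> AAr F h x0 = \<one>\<^bsub>AOb F W\<^esub>" if h: "arrow C h W X0" for h W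
    using g[OF h] inj[OF arrowD(1)[OF h] fun_closed[OF F h x0] fun_one_closed[OF F arrowD(1)[OF h]]]
      nt_one[OF \<eta> F G arrowD(1)[OF h]] by simp
  have 2: "(\<forall>x\<in>El F W. \<exists>h. arrow C h W X0 \<and> x = AAr F h x0) \<longleftrightarrow>
      (\<forall>y\<in>El G W. \<exists>h. arrow C h W X0 \<and> y = AAr G h (\<eta> X0 x0))" if W: "W \<in> Obj C" for W
  proof -
    have "(\<forall>y\<in>El G W. \<exists>h. arrow C h W X0 \<and> y = AAr G h (\<eta> X0 x0)) \<longleftrightarrow>
      (\<forall>x\<in>El F W. \<exists>h. arrow C h W X0 \<and> \<eta> W x = \<eta> W (AAr F h x0))"
      using bij_betw_imp_surj_on[OF bij[OF W]] g by fastforce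
    also have "\<dots> \<longleftrightarrow> (\<forall>x\<in>El F W. \<exists>h. arrow C h W X0 \<and> x = AAr F h x0)"
      using inj[OF W] fun_closed[OF F _ x0] by metis
    finally show ?thesis by simp
  qed
  show ?thesis unfolding presents_def using x0 y0 1 2 by simp
qed

text \<open>On both sides \<open>r\<close> alone decides which \<open>h\<close> kill the generator,
  so the Yoneda map is injective; it is surjective because \<open>y0\<close> generates.\<close>

lemma presents_isomorphic:
  assumes F: "additive_abfunctor C F" and G: "additive_abfunctor C G"
    and p: "presents C F X0 x0 X1 r" and q: "presents C G X0 y0 X1 r"
  shows "abfunctor_iso C F G"
proof -
  note P = presentsD[OF p] and Q = presentsD[OF q]
  obtain \<eta> where \<eta>: "natural_trans C F G \<eta>" "\<eta> X0 x0 = y0"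
    by (rule yoneda[OF F G p Q(1) presents_relation(2)[OF G q arrow_ide[OF P(4)]]])
  have gen: "\<eta> W (AAr F h x0) = AAr G h y0" if "arrow C h W X0" for W h
    using nt_generator[OF \<eta>(1) p that] \<eta>(2) by simp
  have "\<eta> X \<in> iso (AOb F X) (AOb G X)" if X: "X \<in> Obj C" for X
  proof (rule isoI)
    show "\<eta> X \<in> hom (AOb F X) (AOb G X)" using \<eta>(1) X by (simp add: natural_trans_def)
    show "bij_betw (\<eta> X) (El F X) (El G X)"
    proof (rule bij_betw_imageI)
      show "inj_on (\<eta> X) (El F X)"
      proof (rule inj_onI, rule nt_inj[OF \<eta>(1) F G X])
        fix x assume x: "x \<in> El F X" "\<eta> X x = \<one>\<^bsub>AOb G X\<^esub>"
        obtain h where h: "arrow C h X X0" "x = AAr F h x0" using P(5)[OF X x(1)] by blast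
        then show "x = \<one>\<^bsub>AOb F X\<^esub>" using x(2) gen[OF h(1)] P(6)[OF h(1)] Q(6)[OF h(1)] by simp
      qed
      show "\<eta> X ` El F X = El G X"
      proof (intro equalityI subsetI)
        show "y \<in> El G X" if "y \<in> \<eta> X ` El F X" for y using that nt_closed[OF \<eta>(1) X] by blast
        fix y assume "y \<in> El G X"
        then obtain h where h: "arrow C h X X0" "y = AAr G h y0" using Q(5)[OF X] by blast
        then show "y \<in> \<eta> X ` El F X" using gen[OF h(1)] fun_closed[OF F h(1) P(1)] by (auto intro!: image_eqI)
      qed
    qed
  qed
  then show ?thesis unfolding abfunctor_iso_def using \<eta>(1) by blast
qed

section \<open>Cokernels of maps between representable functors\<close>

abbreviation coker :: "'m \<Rightarrow> 'o \<Rightarrow> 'o \<Rightarrow> ('o, 'm, 'm set) abfunctor" where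
  "coker r X1 X0 \<equiv> cokernel_functor C (representable C X1) (representable C X0) (representable_map C r)"

text \<open>The generator is the coset of the identity. This connects the literal quotient functor
  in \<open>def_objects\<close> with presentations.\<close>

lemma coker_presents:
  assumes r: "arrow C r X1 X0"
  shows "additive_abfunctor C (coker r X1 X0)"
    and "presents C (coker r X1 X0) X0 (((\<lambda>k. r \<cdot> k) ` Arr C X0 X1) #>\<^bsub>Hom C X0 X0\<^esub> Ide C X0) X1 r"
proof -
  note X = arrowD(1,2)[OF r]
  define I where "I W = (\<lambda>k. r \<cdot> k) ` Arr C W X1" for W
  define cl where "cl W g = I W #>\<^bsub>Hom C W X0\<^esub> g" for W g
  have ob: "AOb (coker r X1 X0) W = Hom C W X0 Mod I W" for W
    by (simp add: cokernel_functor_def representable_def representable_map_def I_def)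
  have sub: "subgroup (I W) (Hom C W X0)" if "W \<in> Obj C" for W
    unfolding I_def using group_hom.img_is_subgroup[OF group_hom_comp_left[OF r that]] .
  have normal: "I W \<lhd> Hom C W X0" if "W \<in> Obj C" for W
    using comm_group.subgroup_imp_normal[OF hom_group[OF that X(2)] sub[OF that]] .
  have car: "El (coker r X1 X0) W = cl W ` Arr C W X0" if "W \<in> Obj C" for W
    by (auto simp: ob FactGroup_def RCOSETS_def cl_def)
  have mult: "cl W g \<otimes>\<^bsub>AOb (coker r X1 X0) W\<^esub> cl W h = cl W (g \<otimes>\<^bsub>Hom C W X0\<^esub> h)"
    if "arrow C g W X0" "arrow C h W X0" for W g h
    using normal.rcos_sum[OF normal[OF arrowD(1)[OF that(1)]]] that
    by (simp add: ob cl_def FactGroup_def arrow_def)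
  have one: "\<one>\<^bsub>AOb (coker r X1 X0) W\<^esub> = I W" for W by (simp add: ob FactGroup_def)
  have mem: "g' \<in> cl W g \<longleftrightarrow> (\<exists>k. arrow C k W X1 \<and> g' = (r \<cdot> k) \<otimes>\<^bsub>Hom C W X0\<^esub> g)" if "W \<in> Obj C" for W g g'
    using that X by (auto simp: cl_def I_def r_coset_def arrow_def)
  have self: "g \<in> cl W g" if "arrow C g W X0" for W g
    using group.rcos_self[OF hom_is_group[OF arrowD(1,2)[OF that]] arrowD(3)[OF that] sub[OF arrowD(1)[OF that]]]
    by (simp add: cl_def)
  have repr: "cl W g' = cl W g" if g: "arrow C g W X0" "g' \<in> cl W g" for W g g'
    using group.repr_independence[OF hom_is_group[OF arrowD(1,2)[OF g(1)]] _ arrowD(3)[OF g(1)] sub[OF arrowD(1)[OF g(1)]]] g(2)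
    unfolding cl_def by blast
  have cl_one: "cl W g = I W \<longleftrightarrow> (\<exists>k. arrow C k W X1 \<and> g = r \<cdot> k)" if g: "arrow C g W X0" for W g
  proof -
    have "cl W g = I W \<longleftrightarrow> g \<in> I W"
      unfolding cl_def using group.coset_join1 group.coset_join2 hom_is_group[OF arrowD(1,2)[OF g]] arrowD(3)[OF g]
        sub[OF arrowD(1)[OF g]] by metis
    then show ?thesis using arrowD(1)[OF g] X by (auto simp: I_def arrow_def)
  qed
  have map: "AAr (coker r X1 X0) f (cl Y g) = cl W (g \<cdot> f)" if f: "arrow C f W Y" and g: "arrow C g Y X0" for f g W Y
  proof -
    have gf: "arrow C (g \<cdot> f) W X0" using arrow_comp[OF f g] .
    have "cl W (y \<cdot> f) = cl W (g \<cdot> f)" if y: "y \<in> cl Y g" for y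
    proof -
      obtain k where k: "arrow C k Y X1" "y = (r \<cdot> k) \<otimes>\<^bsub>Hom C Y X0\<^esub> g" using mem[OF arrowD(2)[OF f]] y by blast
      have "y \<cdot> f = (r \<cdot> (k \<cdot> f)) \<otimes>\<^bsub>Hom C W X0\<^esub> (g \<cdot> f)"
        using k(2) sum_comp[OF f arrow_comp[OF k(1) r] g] arrow_assoc[OF f k(1) r] by simp
      then have "y \<cdot> f \<in> cl W (g \<cdot> f)" using mem[OF arrowD(1)[OF f]] arrow_comp[OF f k(1)] by blast
      then show ?thesis using repr[OF gf] by blast
    qed
    moreover have "g \<in> cl Y g" using self[OF g] .
    \<comment> \<open>The action on a coset is a union over its representatives; they all give the
      same coset, and \<open>g\<close> shows that there is one.\<close>
    ultimately have "(\<Union>y\<in>cl Y g. cl W (y \<cdot> f)) = cl W (g \<cdot> f)" by blast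
    then show ?thesis
      using arrow_dom_cod(1)[OF f]
      by (simp add: cokernel_functor_def representable_def representable_map_def cl_def I_def)
  qed
  have ar: "\<exists>g. arrow C g W X0 \<and> c = cl W g" if "W \<in> Obj C" "c \<in> El (coker r X1 X0) W" for W c
    using that car X by (auto simp: arrow_def)
  have cl_in: "cl W g \<in> El (coker r X1 X0) W" if "arrow C g W X0" for W g
    using that car by (auto simp: arrow_def)
  show A: "additive_abfunctor C (coker r X1 X0)"
    unfolding additive_abfunctor_def
  proof (intro conjI ballI)
    fix W assume W: "W \<in> Obj C"
    show "comm_group (AOb (coker r X1 X0) W)"
      unfolding ob using comm_group.abelian_FactGroup[OF hom_group[OF W X(2)] sub[OF W]] .
    show "AAr (coker r X1 X0) (Ide C W) c = c" if "c \<in> El (coker r X1 X0) W" for c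
      using ar[OF W that] map[OF arrow_ide[OF W]] arrow_ide_right by metis
    fix Y assume Y: "Y \<in> Obj C"
    show "AAr (coker r X1 X0) f \<in> hom (AOb (coker r X1 X0) Y) (AOb (coker r X1 X0) W)" if "f \<in> Arr C W Y" for f
    proof (rule homI)
      have f: "arrow C f W Y" using that W Y by (simp add: arrow_def)
      fix c assume "c \<in> El (coker r X1 X0) Y"
      then obtain g where g: "arrow C g Y X0" "c = cl Y g" using ar[OF Y] by blast
      then show "AAr (coker r X1 X0) f c \<in> El (coker r X1 X0) W"
        using map[OF f g(1)] cl_in[OF arrow_comp[OF f g(1)]] by simp
      fix d assume "d \<in> El (coker r X1 X0) Y"
      then obtain h where h: "arrow C h Y X0" "d = cl Y h" using ar[OF Y] by blast
      show "AAr (coker r X1 X0) f (c \<otimes>\<^bsub>AOb (coker r X1 X0) Y\<^esub> d) =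
          AAr (coker r X1 X0) f c \<otimes>\<^bsub>AOb (coker r X1 X0) W\<^esub> AAr (coker r X1 X0) f d"
        unfolding g(2) h(2) mult[OF g(1) h(1)] map[OF f g(1)] map[OF f h(1)] map[OF f arrow_sum[OF g(1) h(1)]]
          mult[OF arrow_comp[OF f g(1)] arrow_comp[OF f h(1)]] sum_comp[OF f g(1) h(1)] ..
    qed
    show "AAr (coker r X1 X0) (f \<otimes>\<^bsub>Hom C W Y\<^esub> f') c =
        AAr (coker r X1 X0) f c \<otimes>\<^bsub>AOb (coker r X1 X0) W\<^esub> AAr (coker r X1 X0) f' c"
      if "f \<in> Arr C W Y" "f' \<in> Arr C W Y" "c \<in> El (coker r X1 X0) Y" for f f' c
    proof -
      have f: "arrow C f W Y" "arrow C f' W Y" using that W Y by (simp_all add: arrow_def)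
      obtain g where g: "arrow C g Y X0" "c = cl Y g" using ar[OF Y \<open>c \<in> El (coker r X1 X0) Y\<close>] by blast
      show ?thesis
        unfolding g(2) map[OF f(1) g(1)] map[OF f(2) g(1)] map[OF arrow_sum[OF f] g(1)]
          mult[OF arrow_comp[OF f(1) g(1)] arrow_comp[OF f(2) g(1)]] comp_sum[OF f g(1)] ..
    qed
    fix Z assume Z: "Z \<in> Obj C"
    show "AAr (coker r X1 X0) (h \<cdot> f) c = AAr (coker r X1 X0) f (AAr (coker r X1 X0) h c)"
      if "f \<in> Arr C W Y" "h \<in> Arr C Y Z" "c \<in> El (coker r X1 X0) Z" for f h c
    proof -
      have f: "arrow C f W Y" "arrow C h Y Z" using that W Y Z by (simp_all add: arrow_def)
      obtain g where g: "arrow C g Z X0" "c = cl Z g" using ar[OF Z \<open>c \<in> El (coker r X1 X0) Z\<close>] by blast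
      show ?thesis
        unfolding g(2) map[OF f(2) g(1)] map[OF f(1) arrow_comp[OF f(2) g(1)]] map[OF arrow_comp[OF f] g(1)]
          arrow_assoc[OF f g(1)] ..
    qed
  qed
  have gen: "AAr (coker r X1 X0) h (cl X0 (Ide C X0)) = cl W h" if h: "arrow C h W X0" for h W
    using map[OF h arrow_ide[OF X(2)]] arrow_ide_left[OF h] by simp
  have "presents C (coker r X1 X0) X0 (cl X0 (Ide C X0)) X1 r"
    unfolding presents_def
  proof (intro conjI ballI allI impI)
    show "cl X0 (Ide C X0) \<in> El (coker r X1 X0) X0" using cl_in arrow_ide[OF X(2)] by blast
    show "arrow C r X1 X0" by fact
    show "\<exists>h. arrow C h W X0 \<and> x = AAr (coker r X1 X0) h (cl X0 (Ide C X0))"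
      if "W \<in> Obj C" "x \<in> El (coker r X1 X0) W" for W x
      using ar[OF that] gen by metis
    show "(AAr (coker r X1 X0) h (cl X0 (Ide C X0)) = \<one>\<^bsub>AOb (coker r X1 X0) W\<^esub>) \<longleftrightarrow>
        (\<exists>k. arrow C k W X1 \<and> h = r \<cdot> k)" if "arrow C h W X0" for W h
      using gen[OF that] cl_one[OF that] one by simp
  qed
  then show "presents C (coker r X1 X0) X0 (((\<lambda>k. r \<cdot> k) ` Arr C X0 X1) #>\<^bsub>Hom C X0 X0\<^esub> Ide C X0) X1 r"
    by (simp add: cl_def I_def)
qed

end

section \<open>Copies of a functor on another type of elements\<close>

definition copy_group :: "('g \<Rightarrow> 'h) \<Rightarrow> 'g monoid \<Rightarrow> 'h monoid" where
  "copy_group \<iota> G = \<lparr>carrier = \<iota> ` carrier G,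
     mult = (\<lambda>a b. \<iota> (inv_into (carrier G) \<iota> a \<otimes>\<^bsub>G\<^esub> inv_into (carrier G) \<iota> b)), one = \<iota> \<one>\<^bsub>G\<^esub>\<rparr>"

lemma copy_group_iso:
  assumes "inj_on \<iota> (carrier G)" "comm_group G"
  shows "comm_group (copy_group \<iota> G)" "\<iota> \<in> hom G (copy_group \<iota> G)"
proof -
  interpret G: comm_group G by fact
  show hom: "\<iota> \<in> hom G (copy_group \<iota> G)"
    using assms(1) by (intro homI) (simp_all add: copy_group_def)
  have "\<iota> \<in> iso G (copy_group \<iota> G)"
    using hom assms(1) by (intro isoI) (simp_all add: copy_group_def bij_betw_def)
  moreover have "monoid (copy_group \<iota> G)"
    using assms(1) by unfold_locales (auto simp: copy_group_def G.m_assoc)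
  ultimately show "comm_group (copy_group \<iota> G)"
    using G.iso_imp_comm_group is_isoI by blast
qed

text \<open>Represented functors and cokernels have morphisms or sets of morphisms as elements,
  while the module category fixes one type of elements; pointwise injections carry the structure
  over.\<close>

definition copy_functor :: "('o, 'm, 'z) precat_scheme \<Rightarrow> ('o \<Rightarrow> 'g \<Rightarrow> 'h) \<Rightarrow> ('o, 'm, 'g) abfunctor
    \<Rightarrow> ('o, 'm, 'h) abfunctor" where
  "copy_functor C \<iota> F = \<lparr>AOb = (\<lambda>X. copy_group (\<iota> X) (AOb F X)),
     AAr = (\<lambda>f y. \<iota> (Dom C f) (AAr F f (inv_into (El F (Cod C f)) (\<iota> (Cod C f)) y)))\<rparr>"

lemma (in preadditive_category) copy_functor:
  assumes F: "additive_abfunctor C F" and inj: "\<And>X. X \<in> Obj C \<Longrightarrow> inj_on (\<iota> X) (El F X)"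
  shows "additive_abfunctor C (copy_functor C \<iota> F)" "natural_trans C F (copy_functor C \<iota> F) \<iota>"
    "\<And>X. X \<in> Obj C \<Longrightarrow> bij_betw (\<iota> X) (El F X) (El (copy_functor C \<iota> F) X)"
proof -
  let ?F = "copy_functor C \<iota> F"
  have El: "El ?F X = \<iota> X ` El F X" for X by (simp add: copy_functor_def copy_group_def)
  have map: "AAr ?F f (\<iota> Y y) = \<iota> X (AAr F f y)" if "arrow C f X Y" "y \<in> El F Y" for f X Y y
    using arrow_dom_cod[OF that(1)] inj[OF arrowD(2)[OF that(1)]] that(2) by (simp add: copy_functor_def)
  have hom: "\<iota> X \<in> hom (AOb F X) (AOb ?F X)" "comm_group (AOb ?F X)" if "X \<in> Obj C" for X
    using copy_group_iso[OF inj[OF that] fun_comm_group[OF F that]] by (simp_all add: copy_functor_def)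
  have mult: "\<iota> X (x \<otimes>\<^bsub>AOb F X\<^esub> y) = \<iota> X x \<otimes>\<^bsub>AOb ?F X\<^esub> \<iota> X y" if "X \<in> Obj C" "x \<in> El F X" "y \<in> El F X" for X x y
    using hom(1)[OF that(1)] that by (simp add: hom_mult)
  show nt: "natural_trans C F ?F \<iota>"
    by (rule natural_transI) (use mult map in \<open>auto simp: El\<close>)
  show "bij_betw (\<iota> X) (El F X) (El ?F X)" if "X \<in> Obj C" for X
    using inj[OF that] by (simp add: bij_betw_def El)
  show "additive_abfunctor C ?F"
    unfolding additive_abfunctor_def
  proof (intro conjI ballI)
    fix X assume X: "X \<in> Obj C"
    show "comm_group (AOb ?F X)" using hom(2)[OF X] .
    show "AAr ?F (Ide C X) x = x" if "x \<in> El ?F X" for x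
      using that map[OF arrow_ide[OF X]] fun_ide[OF F X] by (auto simp: El)
    fix Y assume Y: "Y \<in> Obj C"
    show "AAr ?F f \<in> hom (AOb ?F Y) (AOb ?F X)" if "f \<in> Arr C X Y" for f
    proof (rule homI)
      have f: "arrow C f X Y" using that X Y by (simp add: arrow_def)
      fix a assume "a \<in> El ?F Y"
      then obtain y where y: "y \<in> El F Y" "a = \<iota> Y y" by (auto simp: El)
      show "AAr ?F f a \<in> El ?F X" using map[OF f y(1)] fun_closed[OF F f y(1)] y(2) by (simp add: El)
      fix b assume "b \<in> El ?F Y"
      then obtain z where z: "z \<in> El F Y" "b = \<iota> Y z" by (auto simp: El)
      have "AAr ?F f (a \<otimes>\<^bsub>AOb ?F Y\<^esub> b) = \<iota> X (AAr F f (y \<otimes>\<^bsub>AOb F Y\<^esub> z))"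
        using mult[OF Y y(1) z(1)] map[OF f] y z monoid.m_closed[OF group.is_monoid[OF fun_group[OF F Y]] y(1) z(1)] by metis
      also have "\<dots> = AAr ?F f a \<otimes>\<^bsub>AOb ?F X\<^esub> AAr ?F f b"
        using fun_mult[OF F f y(1) z(1)] mult[OF X fun_closed[OF F f y(1)] fun_closed[OF F f z(1)]]
          map[OF f y(1)] map[OF f z(1)] y(2) z(2) by simp
      finally show "AAr ?F f (a \<otimes>\<^bsub>AOb ?F Y\<^esub> b) = AAr ?F f a \<otimes>\<^bsub>AOb ?F X\<^esub> AAr ?F f b" .
    qed
    show "AAr ?F (f \<otimes>\<^bsub>Hom C X Y\<^esub> g) a = AAr ?F f a \<otimes>\<^bsub>AOb ?F X\<^esub> AAr ?F g a"
      if "f \<in> Arr C X Y" "g \<in> Arr C X Y" "a \<in> El ?F Y" for f g a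
    proof -
      have f: "arrow C f X Y" "arrow C g X Y" using that X Y by (simp_all add: arrow_def)
      obtain y where y: "y \<in> El F Y" "a = \<iota> Y y" using \<open>a \<in> El ?F Y\<close> by (auto simp: El)
      show ?thesis
        using map[OF arrow_sum[OF f] y(1)] fun_sum[OF F f y(1)] map[OF f(1) y(1)] map[OF f(2) y(1)]
          mult[OF X fun_closed[OF F f(1) y(1)] fun_closed[OF F f(2) y(1)]] y(2) by simp
    qed
    fix Z assume Z: "Z \<in> Obj C"
    show "AAr ?F (g \<cdot> f) a = AAr ?F f (AAr ?F g a)" if "f \<in> Arr C X Y" "g \<in> Arr C Y Z" "a \<in> El ?F Z" for f g a
    proof -
      have f: "arrow C f X Y" "arrow C g Y Z" using that X Y Z by (simp_all add: arrow_def)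
      obtain z where z: "z \<in> El F Z" "a = \<iota> Z z" using \<open>a \<in> El ?F Z\<close> by (auto simp: El)
      show ?thesis
        using map[OF arrow_comp[OF f] z(1)] fun_comp[OF F f z(1)] map[OF f(2) z(1)]
          map[OF f(1) fun_closed[OF F f(2) z(1)]] z(2) by simp
    qed
  qed
qed

section \<open>The category of finitely presented functors\<close>

context preadditive_category
begin

lemma kernel_unique:
  assumes X: "X \<in> Obj C" "Y \<in> Obj C" and k: "is_kernel C X Y f K k" "is_kernel C X Y f K' k'"
  obtains u u' where "arrow C u K K'" "arrow C u' K' K" "k' \<cdot> u = k" "k \<cdot> u' = k'" "u' \<cdot> u = Ide C K" "u \<cdot> u' = Ide C K'"
proof -
  have "arrow C k K X \<and> arrow C k' K' X"
    and univ: "\<And>W g. arrow C g W X \<Longrightarrow> f \<cdot> g = Zero C W Y \<Longrightarrow> \<exists>!u. arrow C u W K \<and> k \<cdot> u = g"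
      "\<And>W g. arrow C g W X \<Longrightarrow> f \<cdot> g = Zero C W Y \<Longrightarrow> \<exists>!u. arrow C u W K' \<and> k' \<cdot> u = g"
    and z: "f \<cdot> k = Zero C K Y" "f \<cdot> k' = Zero C K' Y"
    using k X unfolding is_kernel_def by (auto simp: arrow_def)
  then have a: "arrow C k K X" "arrow C k' K' X" by auto
  obtain u where u: "arrow C u K K'" "k' \<cdot> u = k" using univ(2)[OF a(1) z(1)] by blast
  obtain u' where u': "arrow C u' K' K" "k \<cdot> u' = k'" using univ(1)[OF a(2) z(2)] by blast
  have i: "arrow C (Ide C K) K K" "k \<cdot> Ide C K = k" "arrow C (Ide C K') K' K'" "k' \<cdot> Ide C K' = k'"
    using arrow_ide[OF arrowD(1)[OF a(1)]] arrow_ide[OF arrowD(1)[OF a(2)]] arrow_ide_right[OF a(1)] arrow_ide_right[OF a(2)] by auto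
  have "k \<cdot> (u' \<cdot> u) = k" using arrow_assoc[OF u(1) u'(1) a(1)] u u' by simp
  then have 1: "u' \<cdot> u = Ide C K" using univ(1)[OF a(1) z(1)] arrow_comp[OF u(1) u'(1)] i by blast
  have "k' \<cdot> (u \<cdot> u') = k'" using arrow_assoc[OF u'(1) u(1) a(2)] u u' by simp
  then have 2: "u \<cdot> u' = Ide C K'" using univ(2)[OF a(2) z(2)] arrow_comp[OF u'(1) u(1)] i by blast
  show thesis by (rule that[OF u(1) u'(1) u(2) u'(2) 1 2])
qed

lemma cokernel_unique:
  assumes X: "X \<in> Obj C" "Y \<in> Obj C" and k: "is_cokernel C X Y f L l" "is_cokernel C X Y f L' l'"
  obtains u u' where "arrow C u L L'" "arrow C u' L' L" "u \<cdot> l = l'" "u' \<cdot> l' = l" "u' \<cdot> u = Ide C L" "u \<cdot> u' = Ide C L'"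
proof -
  have "arrow C l Y L \<and> arrow C l' Y L'"
    and univ: "\<And>W g. arrow C g Y W \<Longrightarrow> g \<cdot> f = Zero C X W \<Longrightarrow> \<exists>!u. arrow C u L W \<and> u \<cdot> l = g"
      "\<And>W g. arrow C g Y W \<Longrightarrow> g \<cdot> f = Zero C X W \<Longrightarrow> \<exists>!u. arrow C u L' W \<and> u \<cdot> l' = g"
    and z: "l \<cdot> f = Zero C X L" "l' \<cdot> f = Zero C X L'"
    using k X unfolding is_cokernel_def by (auto simp: arrow_def)
  then have a: "arrow C l Y L" "arrow C l' Y L'" by auto
  obtain u where u: "arrow C u L L'" "u \<cdot> l = l'" using univ(1)[OF a(2) z(2)] by blast
  obtain u' where u': "arrow C u' L' L" "u' \<cdot> l' = l" using univ(2)[OF a(1) z(1)] by blast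
  have i: "arrow C (Ide C L) L L" "Ide C L \<cdot> l = l" "arrow C (Ide C L') L' L'" "Ide C L' \<cdot> l' = l'"
    using arrow_ide[OF arrowD(2)[OF a(1)]] arrow_ide[OF arrowD(2)[OF a(2)]] arrow_ide_left[OF a(1)] arrow_ide_left[OF a(2)] by auto
  have "(u' \<cdot> u) \<cdot> l = l" using arrow_assoc[OF a(1) u(1) u'(1)] u u' by simp
  then have 1: "u' \<cdot> u = Ide C L" using univ(1)[OF a(1) z(1)] arrow_comp[OF u(1) u'(1)] i by blast
  have "(u \<cdot> u') \<cdot> l' = l'" using arrow_assoc[OF a(2) u'(1) u(1)] u u' by simp
  then have 2: "u \<cdot> u' = Ide C L'" using univ(2)[OF a(2) z(2)] arrow_comp[OF u'(1) u(1)] i by blast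
  show thesis by (rule that[OF u(1) u'(1) u(2) u'(2) 1 2])
qed

text \<open>The copairing comes with its formula because relations that pass through a biproduct are
  later split into their two components.\<close>

lemma biproduct_pairing:
  assumes "biproduct C X Y B"
  obtains i j p q where "arrow C i X B" "arrow C j Y B" "arrow C p B X" "arrow C q B Y"
    "p \<cdot> i = Ide C X" "q \<cdot> j = Ide C Y" "q \<cdot> i = Zero C X Y" "p \<cdot> j = Zero C Y X"
    "(i \<cdot> p) \<otimes>\<^bsub>Hom C B B\<^esub> (j \<cdot> q) = Ide C B"
    "\<And>W a b. arrow C a W X \<Longrightarrow> arrow C b W Y \<Longrightarrow> \<exists>h. arrow C h W B \<and> p \<cdot> h = a \<and> q \<cdot> h = b"
    "\<And>W a b. arrow C a X W \<Longrightarrow> arrow C b Y W \<Longrightarrow> \<exists>h. arrow C h B W \<and> h \<cdot> i = a \<and> h \<cdot> j = b \<and>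
        h = (a \<cdot> p) \<otimes>\<^bsub>Hom C B W\<^esub> (b \<cdot> q)"
proof -
  obtain i j p q where ij: "arrow C i X B" "arrow C j Y B" "arrow C p B X" "arrow C q B Y"
    and e: "p \<cdot> i = Ide C X" "q \<cdot> j = Ide C Y" "q \<cdot> i = Zero C X Y" "p \<cdot> j = Zero C Y X"
    "(i \<cdot> p) \<otimes>\<^bsub>Hom C B B\<^esub> (j \<cdot> q) = Ide C B"
    by (rule biproductE[OF assms])
  show thesis
  proof (rule that[OF ij e])
    fix W a b assume a: "arrow C a W X" and b: "arrow C b W Y"
    note ia = arrow_comp[OF a ij(1)] and jb = arrow_comp[OF b ij(2)] and W = arrowD(1)[OF a]
    note X = arrowD(1)[OF ij(1)] and Y = arrowD(1)[OF ij(2)]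
    have "p \<cdot> ((i \<cdot> a) \<otimes>\<^bsub>Hom C W B\<^esub> (j \<cdot> b)) = a"
      using comp_sum[OF ia jb ij(3)] arrow_assoc[OF a ij(1,3)] arrow_assoc[OF b ij(2,3)] e(1,4)
        arrow_ide_left[OF a] zero_comp[OF b X] sum_zero(1)[OF a] by simp
    moreover have "q \<cdot> ((i \<cdot> a) \<otimes>\<^bsub>Hom C W B\<^esub> (j \<cdot> b)) = b"
      using comp_sum[OF ia jb ij(4)] arrow_assoc[OF a ij(1,4)] arrow_assoc[OF b ij(2,4)] e(2,3)
        arrow_ide_left[OF b] zero_comp[OF a Y] sum_zero(2)[OF b] by simp
    ultimately show "\<exists>h. arrow C h W B \<and> p \<cdot> h = a \<and> q \<cdot> h = b" using arrow_sum[OF ia jb] by blast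
  next
    fix W a b assume a: "arrow C a X W" and b: "arrow C b Y W"
    note ap = arrow_comp[OF ij(3) a] and bq = arrow_comp[OF ij(4) b] and W = arrowD(2)[OF a]
    note X = arrowD(1)[OF ij(1)] and Y = arrowD(1)[OF ij(2)]
    have "((a \<cdot> p) \<otimes>\<^bsub>Hom C B W\<^esub> (b \<cdot> q)) \<cdot> i = a"
      using sum_comp[OF ij(1) ap bq] arrow_assoc[OF ij(1,3) a] arrow_assoc[OF ij(1,4) b] e(1,3)
        arrow_ide_right[OF a] comp_zero[OF b X] sum_zero(1)[OF a] by simp
    moreover have "((a \<cdot> p) \<otimes>\<^bsub>Hom C B W\<^esub> (b \<cdot> q)) \<cdot> j = b"
      using sum_comp[OF ij(2) ap bq] arrow_assoc[OF ij(2,3) a] arrow_assoc[OF ij(2,4) b] e(2,4)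
        arrow_ide_right[OF b] comp_zero[OF a Y] sum_zero(2)[OF b] by simp
    ultimately show "\<exists>h. arrow C h B W \<and> h \<cdot> i = a \<and> h \<cdot> j = b \<and> h = (a \<cdot> p) \<otimes>\<^bsub>Hom C B W\<^esub> (b \<cdot> q)"
      using arrow_sum[OF ap bq] by blast
  qed
qed

end

section \<open>Morphisms of functors, computed on elements\<close>

definition cmp :: "('o, 'm, 'g) nattrans \<Rightarrow> 'o \<Rightarrow> 'g \<Rightarrow> 'g" where
  "cmp a = snd (snd a)"

definition nat_arrow :: "('o, 'm, 'z) precat_scheme \<Rightarrow> ('o, 'm, 'g) abfunctor \<Rightarrow> ('o, 'm, 'g) abfunctor
    \<Rightarrow> ('o \<Rightarrow> 'g \<Rightarrow> 'g) \<Rightarrow> ('o, 'm, 'g) nattrans" where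
  "nat_arrow C F G \<eta> = (F, G, \<lambda>X\<in>Obj C. \<lambda>x\<in>El F X. \<eta> X x)"

lemma cmp_nat_arrow: "X \<in> Obj C \<Longrightarrow> x \<in> El F X \<Longrightarrow> cmp (nat_arrow C F G \<eta>) X x = \<eta> X x"
  by (simp add: cmp_def nat_arrow_def)

text \<open>Weak kernels in \<open>C\<close> are what closes finitely presented functors under
  kernels. The assumption \<open>small\<close> bounds their elements: each value of such a functor
  is a quotient of a hom set, so it embeds into \<open>'g\<close>.\<close>

locale module_category = additive_category C for C :: "('o, 'm, 'z) precat_scheme" (structure) +
  fixes A :: "(('o, 'm, 'g) abfunctor, ('o, 'm, 'g) nattrans) precat"
  assumes A_def: "A = mod_cat C"
    and ex_weak_kernel: "arrow C f X Y \<Longrightarrow> \<exists>K k. arrow C k K X \<and> f \<cdot> k = Zero C K Y \<and>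
        (\<forall>W h. arrow C h W X \<longrightarrow> f \<cdot> h = Zero C W Y \<longrightarrow> (\<exists>l. arrow C l W K \<and> h = k \<cdot> l))"
    and small: "X \<in> Obj C \<Longrightarrow> Y \<in> Obj C \<Longrightarrow> \<exists>\<iota> :: 'm \<Rightarrow> 'g. inj_on \<iota> (Arr C X Y)"
begin

lemma Obj_A: "F \<in> Obj A \<longleftrightarrow> finitely_presented C F"
  by (simp add: A_def mod_cat_def)

lemma additive_Obj: "F \<in> Obj A \<Longrightarrow> additive_abfunctor C F"
  by (simp add: Obj_A fp_additive)

lemma arrow_natural: "arrow A a F G \<Longrightarrow> natural_trans C F G (cmp a)"
  and arrow_shape: "arrow A a F G \<Longrightarrow> fst a = F \<and> fst (snd a) = G \<and>
    cmp a \<in> extensional (Obj C) \<and> (\<forall>X\<in>Obj C. cmp a X \<in> extensional (El F X))"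
  by (auto simp: arrow_def A_def mod_cat_def cmp_def PiE_def)

lemma nat_arrow_in: "F \<in> Obj A \<Longrightarrow> G \<in> Obj A \<Longrightarrow> natural_trans C F G \<eta> \<Longrightarrow> arrow A (nat_arrow C F G \<eta>) F G"
proof -
  assume FG: "F \<in> Obj A" "G \<in> Obj A" and \<eta>: "natural_trans C F G \<eta>"
  let ?\<theta> = "\<lambda>X\<in>Obj C. \<lambda>x\<in>El F X. \<eta> X x"
  note F = additive_Obj[OF FG(1)]
  have "natural_trans C F G ?\<theta>"
  proof (rule natural_transI)
    show "?\<theta> X x \<in> El G X" if "X \<in> Obj C" "x \<in> El F X" for X x
      using that nt_closed[OF \<eta>] by simp
    show "?\<theta> X (x \<otimes>\<^bsub>AOb F X\<^esub> y) = ?\<theta> X x \<otimes>\<^bsub>AOb G X\<^esub> ?\<theta> X y" if "X \<in> Obj C" "x \<in> El F X" "y \<in> El F X" for X x y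
      using that nt_mult[OF \<eta>] monoid.m_closed[OF group.is_monoid[OF fun_group[OF F that(1)]]] by simp
    show "?\<theta> X (AAr F f y) = AAr G f (?\<theta> Y y)" if f: "arrow C f X Y" and y: "y \<in> El F Y" for f X Y y
      using nt_natural[OF \<eta> f y] fun_closed[OF F f y] y arrowD(1,2)[OF f] by simp
  qed
  then show ?thesis using FG by (auto simp: arrow_def A_def mod_cat_def nat_arrow_def)
qed

lemma arrow_eqI:
  assumes a: "arrow A a F G" and b: "arrow A b F G"
    and eq: "\<And>X x. X \<in> Obj C \<Longrightarrow> x \<in> El F X \<Longrightarrow> cmp a X x = cmp b X x"
  shows "a = b"
proof -
  note A = arrow_shape[OF a] and B = arrow_shape[OF b]
  have "cmp a X = cmp b X" if X: "X \<in> Obj C" for X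
    using extensionalityI[of "cmp a X" "El F X" "cmp b X"] A B X eq by blast
  then have "cmp a = cmp b" using extensionalityI[of "cmp a" "Obj C" "cmp b"] A B by blast
  then show ?thesis using A B by (simp add: cmp_def prod_eq_iff)
qed

lemma arrow_objects: "arrow A a F G \<Longrightarrow> additive_abfunctor C F" "arrow A a F G \<Longrightarrow> additive_abfunctor C G"
  using additive_Obj by (auto simp: arrow_def)

lemma cmp_closed: "arrow A a F G \<Longrightarrow> X \<in> Obj C \<Longrightarrow> x \<in> El F X \<Longrightarrow> cmp a X x \<in> El G X"
  using nt_closed[OF arrow_natural] .

lemma cmp_mult: "arrow A a F G \<Longrightarrow> X \<in> Obj C \<Longrightarrow> x \<in> El F X \<Longrightarrow> y \<in> El F X \<Longrightarrow>
    cmp a X (x \<otimes>\<^bsub>AOb F X\<^esub> y) = cmp a X x \<otimes>\<^bsub>AOb G X\<^esub> cmp a X y"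
  using nt_mult[OF arrow_natural] .

lemma cmp_one: "arrow A a F G \<Longrightarrow> X \<in> Obj C \<Longrightarrow> cmp a X \<one>\<^bsub>AOb F X\<^esub> = \<one>\<^bsub>AOb G X\<^esub>"
  using nt_one[OF arrow_natural arrow_objects] .

lemma cmp_natural: "arrow A a F G \<Longrightarrow> arrow C f X Y \<Longrightarrow> y \<in> El F Y \<Longrightarrow> cmp a X (AAr F f y) = AAr G f (cmp a Y y)"
  using nt_natural[OF arrow_natural] .

lemma arrow_tuple: "arrow A a F G \<Longrightarrow> a = (F, G, cmp a)"
  using arrow_shape by (metis cmp_def prod.collapse)

lemma comp_mod:
  assumes a: "arrow A a F G" and b: "arrow A b G H"
  shows "b \<cdot>\<^bsub>A\<^esub> a = nat_arrow C F H (\<lambda>X x. cmp b X (cmp a X x))"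
  unfolding nat_arrow_def by (subst arrow_tuple[OF a], subst arrow_tuple[OF b]) (simp add: A_def mod_cat_def)

lemma sum_mod:
  assumes a: "arrow A a F G" and b: "arrow A b F G"
  shows "a \<otimes>\<^bsub>Hom A F G\<^esub> b = nat_arrow C F G (\<lambda>X x. cmp a X x \<otimes>\<^bsub>AOb G X\<^esub> cmp b X x)"
  unfolding nat_arrow_def by (subst arrow_tuple[OF a], subst arrow_tuple[OF b]) (simp add: A_def mod_cat_def)

lemma zero_mod: "Zero A F G = nat_arrow C F G (\<lambda>X x. \<one>\<^bsub>AOb G X\<^esub>)"
  by (simp add: nat_arrow_def A_def mod_cat_def)

lemma ide_mod: "Ide A F = nat_arrow C F F (\<lambda>X x. x)"
  by (simp add: nat_arrow_def A_def mod_cat_def)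

lemma natural_comp: "arrow A a F G \<Longrightarrow> arrow A b G H \<Longrightarrow> natural_trans C F H (\<lambda>X x. cmp b X (cmp a X x))"
  by (rule natural_transI) (simp_all add: cmp_closed[of a F G] cmp_closed[of b G H] cmp_mult[of a F G] cmp_mult[of b G H]
    cmp_natural[of a F G] cmp_natural[of b G H] arrowD)

lemma natural_sum:
  assumes a: "arrow A a F G" and b: "arrow A b F G"
  shows "natural_trans C F G (\<lambda>X x. cmp a X x \<otimes>\<^bsub>AOb G X\<^esub> cmp b X x)"
proof (rule natural_transI)
  note G = arrow_objects(2)[OF a]
  fix X x assume X: "X \<in> Obj C" and x: "x \<in> El F X"
  interpret comm_group "AOb G X" using fun_comm_group[OF G X] .
  show "cmp a X x \<otimes>\<^bsub>AOb G X\<^esub> cmp b X x \<in> El G X" using cmp_closed a b X x by simp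
  fix y assume y: "y \<in> El F X"
  show "cmp a X (x \<otimes>\<^bsub>AOb F X\<^esub> y) \<otimes>\<^bsub>AOb G X\<^esub> cmp b X (x \<otimes>\<^bsub>AOb F X\<^esub> y) =
      cmp a X x \<otimes>\<^bsub>AOb G X\<^esub> cmp b X x \<otimes>\<^bsub>AOb G X\<^esub> (cmp a X y \<otimes>\<^bsub>AOb G X\<^esub> cmp b X y)"
    using cmp_mult[OF a X x y] cmp_mult[OF b X x y] cmp_closed[OF a X] cmp_closed[OF b X] x y by (simp add: m_ac)
next
  fix f X Y y assume f: "arrow C f X Y" and y: "y \<in> El F Y"
  show "cmp a X (AAr F f y) \<otimes>\<^bsub>AOb G X\<^esub> cmp b X (AAr F f y) = AAr G f (cmp a Y y \<otimes>\<^bsub>AOb G Y\<^esub> cmp b Y y)"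
    using cmp_natural[OF a f y] cmp_natural[OF b f y]
      fun_mult[OF arrow_objects(2)[OF a] f cmp_closed[OF a arrowD(2)[OF f] y] cmp_closed[OF b arrowD(2)[OF f] y]] by simp
qed

lemma natural_inv:
  assumes a: "arrow A a F G"
  shows "natural_trans C F G (\<lambda>X x. inv\<^bsub>AOb G X\<^esub> (cmp a X x))"
proof (rule natural_transI)
  note G = arrow_objects(2)[OF a]
  fix X x assume X: "X \<in> Obj C" and x: "x \<in> El F X"
  interpret comm_group "AOb G X" using fun_comm_group[OF G X] .
  show "inv\<^bsub>AOb G X\<^esub> (cmp a X x) \<in> El G X" using cmp_closed a X x by simp
  fix y assume y: "y \<in> El F X"
  show "inv\<^bsub>AOb G X\<^esub> (cmp a X (x \<otimes>\<^bsub>AOb F X\<^esub> y)) =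
      inv\<^bsub>AOb G X\<^esub> (cmp a X x) \<otimes>\<^bsub>AOb G X\<^esub> inv\<^bsub>AOb G X\<^esub> (cmp a X y)"
    using cmp_mult[OF a X x y] cmp_closed[OF a X] x y by (simp add: inv_mult)
next
  fix f X Y y assume f: "arrow C f X Y" and y: "y \<in> El F Y"
  show "inv\<^bsub>AOb G X\<^esub> (cmp a X (AAr F f y)) = AAr G f (inv\<^bsub>AOb G Y\<^esub> (cmp a Y y))"
    using cmp_natural[OF a f y] fun_inv[OF arrow_objects(2)[OF a] f cmp_closed[OF a arrowD(2)[OF f] y]] by simp
qed

lemma natural_zero:
  assumes F: "additive_abfunctor C F" and G: "additive_abfunctor C G"
  shows "natural_trans C F G (\<lambda>X x. \<one>\<^bsub>AOb G X\<^esub>)"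
  by (rule natural_transI)
    (simp_all add: fun_one_closed[OF G] fun_one[OF G] group.is_monoid[OF fun_group[OF G]])

lemma natural_ide: "natural_trans C F F (\<lambda>X x. x)"
  by (rule natural_transI) simp_all

lemma mod_comp: "arrow A a F G \<Longrightarrow> arrow A b G H \<Longrightarrow> arrow A (b \<cdot>\<^bsub>A\<^esub> a) F H"
  unfolding comp_mod by (rule nat_arrow_in[OF _ _ natural_comp]) (simp_all add: arrowD)

lemma cmp_comp: "arrow A a F G \<Longrightarrow> arrow A b G H \<Longrightarrow> X \<in> Obj C \<Longrightarrow> x \<in> El F X \<Longrightarrow>
    cmp (b \<cdot>\<^bsub>A\<^esub> a) X x = cmp b X (cmp a X x)"
  by (simp add: comp_mod cmp_nat_arrow)

lemma mod_sum: "arrow A a F G \<Longrightarrow> arrow A b F G \<Longrightarrow> arrow A (a \<otimes>\<^bsub>Hom A F G\<^esub> b) F G"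
  using sum_mod nat_arrow_in[OF _ _ natural_sum] by (simp add: arrow_def)

lemma cmp_sum: "arrow A a F G \<Longrightarrow> arrow A b F G \<Longrightarrow> X \<in> Obj C \<Longrightarrow> x \<in> El F X \<Longrightarrow>
    cmp (a \<otimes>\<^bsub>Hom A F G\<^esub> b) X x = cmp a X x \<otimes>\<^bsub>AOb G X\<^esub> cmp b X x"
  by (simp add: sum_mod cmp_nat_arrow)

lemma mod_zero: "F \<in> Obj A \<Longrightarrow> G \<in> Obj A \<Longrightarrow> arrow A (Zero A F G) F G"
  unfolding zero_mod by (intro nat_arrow_in natural_zero additive_Obj)

lemma cmp_zero: "X \<in> Obj C \<Longrightarrow> x \<in> El F X \<Longrightarrow> cmp (Zero A F G) X x = \<one>\<^bsub>AOb G X\<^esub>"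
  by (simp add: zero_mod cmp_nat_arrow)

lemma mod_ide: "F \<in> Obj A \<Longrightarrow> arrow A (Ide A F) F F"
  unfolding ide_mod by (intro nat_arrow_in natural_ide)

lemma cmp_ide: "X \<in> Obj C \<Longrightarrow> x \<in> El F X \<Longrightarrow> cmp (Ide A F) X x = x"
  by (simp add: ide_mod cmp_nat_arrow)

text \<open>Arrows are compared on elements, where each law becomes one of the value groups or of
  application of maps.\<close>

lemma preadditive_A: "preadditive_category A"
proof (rule preadditive_category.intro)
  fix F G assume FG: "F \<in> Obj A" "G \<in> Obj A"
  have ar: "a \<in> Arr A F G \<longleftrightarrow> arrow A a F G" for a using FG by (simp add: arrow_def)
  have G: "comm_group (AOb G X)" if "X \<in> Obj C" for X using fun_comm_group additive_Obj FG that by blast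
  note Gs = comm_group.axioms(1)[OF G] comm_monoid.axioms(1)[OF comm_group.axioms(1)[OF G]]
  show "comm_group (Hom A F G)"
  proof (rule comm_groupI; (unfold ar)?)
    show "arrow A (\<one>\<^bsub>Hom A F G\<^esub>) F G" using mod_zero FG by blast
    fix a assume a: "arrow A a F G"
    show "\<one>\<^bsub>Hom A F G\<^esub> \<otimes>\<^bsub>Hom A F G\<^esub> a = a"
      by (rule arrow_eqI[OF mod_sum[OF mod_zero[OF FG] a] a])
        (simp add: cmp_sum[OF mod_zero[OF FG] a] cmp_zero cmp_closed[OF a] monoid.l_one[OF Gs(2)])
    show "\<exists>b\<in>Arr A F G. b \<otimes>\<^bsub>Hom A F G\<^esub> a = \<one>\<^bsub>Hom A F G\<^esub>"
    proof
      let ?b = "nat_arrow C F G (\<lambda>X x. inv\<^bsub>AOb G X\<^esub> (cmp a X x))"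
      have b: "arrow A ?b F G" by (rule nat_arrow_in[OF FG natural_inv[OF a]])
      then show "?b \<in> Arr A F G" by (simp add: arrow_def)
      show "?b \<otimes>\<^bsub>Hom A F G\<^esub> a = \<one>\<^bsub>Hom A F G\<^esub>"
        by (rule arrow_eqI[OF mod_sum[OF b a] mod_zero[OF FG]])
          (simp add: cmp_sum[OF b a] cmp_zero cmp_nat_arrow cmp_closed[OF a] group.l_inv[OF comm_group.axioms(2)[OF G]])
    qed
    fix b assume b: "arrow A b F G"
    show "arrow A (a \<otimes>\<^bsub>Hom A F G\<^esub> b) F G" using mod_sum[OF a b] .
    show "a \<otimes>\<^bsub>Hom A F G\<^esub> b = b \<otimes>\<^bsub>Hom A F G\<^esub> a"
      by (rule arrow_eqI[OF mod_sum[OF a b] mod_sum[OF b a]])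
        (simp add: cmp_sum[OF a b] cmp_sum[OF b a] cmp_closed[OF a] cmp_closed[OF b] comm_monoid.m_comm[OF Gs(1)])
    fix c assume c: "arrow A c F G"
    show "a \<otimes>\<^bsub>Hom A F G\<^esub> b \<otimes>\<^bsub>Hom A F G\<^esub> c = a \<otimes>\<^bsub>Hom A F G\<^esub> (b \<otimes>\<^bsub>Hom A F G\<^esub> c)"
      by (rule arrow_eqI[OF mod_sum[OF mod_sum[OF a b] c] mod_sum[OF a mod_sum[OF b c]]])
        (simp add: cmp_sum[OF a b] cmp_sum[OF b c] cmp_sum[OF mod_sum[OF a b] c] cmp_sum[OF a mod_sum[OF b c]]
          cmp_closed[OF a] cmp_closed[OF b] cmp_closed[OF c] monoid.m_assoc[OF Gs(2)])
  qed
  fix a assume "a \<in> Arr A F G"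
  then have a: "arrow A a F G" using ar by simp
  show "Dom A a = F \<and> Cod A a = G" using arrow_shape[OF a] by (auto simp: A_def mod_cat_def split: prod.splits)
  show "Ide A G \<cdot>\<^bsub>A\<^esub> a = a"
    by (rule arrow_eqI[OF mod_comp[OF a mod_ide[OF FG(2)]] a])
      (simp add: cmp_comp[OF a mod_ide[OF FG(2)]] cmp_ide cmp_closed[OF a])
  show "a \<cdot>\<^bsub>A\<^esub> Ide A F = a"
    by (rule arrow_eqI[OF mod_comp[OF mod_ide[OF FG(1)] a] a])
      (simp add: cmp_comp[OF mod_ide[OF FG(1)] a] cmp_ide)
next
  show "Ide A F \<in> Arr A F F" if "F \<in> Obj A" for F using mod_ide[OF that] by (simp add: arrow_def)
  fix F G H assume FG: "F \<in> Obj A" "G \<in> Obj A" "H \<in> Obj A"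
  show "(\<lambda>b. b \<cdot>\<^bsub>A\<^esub> a) \<in> hom (Hom A G H) (Hom A F H)" if "a \<in> Arr A F G" for a
  proof (rule homI)
    have a: "arrow A a F G" using that FG by (simp add: arrow_def)
    fix b assume "b \<in> Arr A G H"
    then have b: "arrow A b G H" using FG by (simp add: arrow_def)
    show "b \<cdot>\<^bsub>A\<^esub> a \<in> Arr A F H" using mod_comp[OF a b] by (simp add: arrow_def)
    fix c assume "c \<in> Arr A G H"
    then have c: "arrow A c G H" using FG by (simp add: arrow_def)
    show "(b \<otimes>\<^bsub>Hom A G H\<^esub> c) \<cdot>\<^bsub>A\<^esub> a = (b \<cdot>\<^bsub>A\<^esub> a) \<otimes>\<^bsub>Hom A F H\<^esub> (c \<cdot>\<^bsub>A\<^esub> a)"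
      by (rule arrow_eqI[OF mod_comp[OF a mod_sum[OF b c]] mod_sum[OF mod_comp[OF a b] mod_comp[OF a c]]])
        (simp add: cmp_comp[OF a mod_sum[OF b c]] cmp_comp[OF a b] cmp_comp[OF a c] cmp_sum[OF b c]
          cmp_sum[OF mod_comp[OF a b] mod_comp[OF a c]] cmp_closed[OF a])
  qed
  show "(\<lambda>b. a \<cdot>\<^bsub>A\<^esub> b) \<in> hom (Hom A F G) (Hom A F H)" if "a \<in> Arr A G H" for a
  proof (rule homI)
    have a: "arrow A a G H" using that FG by (simp add: arrow_def)
    fix b assume "b \<in> Arr A F G"
    then have b: "arrow A b F G" using FG by (simp add: arrow_def)
    show "a \<cdot>\<^bsub>A\<^esub> b \<in> Arr A F H" using mod_comp[OF b a] by (simp add: arrow_def)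
    fix c assume "c \<in> Arr A F G"
    then have c: "arrow A c F G" using FG by (simp add: arrow_def)
    show "a \<cdot>\<^bsub>A\<^esub> (b \<otimes>\<^bsub>Hom A F G\<^esub> c) = (a \<cdot>\<^bsub>A\<^esub> b) \<otimes>\<^bsub>Hom A F H\<^esub> (a \<cdot>\<^bsub>A\<^esub> c)"
      by (rule arrow_eqI[OF mod_comp[OF mod_sum[OF b c] a] mod_sum[OF mod_comp[OF b a] mod_comp[OF c a]]])
        (simp add: cmp_comp[OF mod_sum[OF b c] a] cmp_comp[OF b a] cmp_comp[OF c a] cmp_sum[OF b c]
          cmp_sum[OF mod_comp[OF b a] mod_comp[OF c a]] cmp_closed[OF b] cmp_closed[OF c] cmp_mult[OF a])
  qed
next
  fix E F G H a b c assume "E \<in> Obj A" "F \<in> Obj A" "G \<in> Obj A" "H \<in> Obj A"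
    "a \<in> Arr A E F" "b \<in> Arr A F G" "c \<in> Arr A G H"
  then have a: "arrow A a E F" and b: "arrow A b F G" and c: "arrow A c G H" by (simp_all add: arrow_def)
  show "c \<cdot>\<^bsub>A\<^esub> b \<cdot>\<^bsub>A\<^esub> a = c \<cdot>\<^bsub>A\<^esub> (b \<cdot>\<^bsub>A\<^esub> a)"
    by (rule arrow_eqI[OF mod_comp[OF a mod_comp[OF b c]] mod_comp[OF mod_comp[OF a b] c]])
      (simp add: cmp_comp[OF a mod_comp[OF b c]] cmp_comp[OF mod_comp[OF a b] c] cmp_comp[OF a b] cmp_comp[OF b c]
        cmp_closed[OF a])
qed

interpretation A: preadditive_category A by (rule preadditive_A)

text \<open>Every element of \<open>F X\<close> is \<open>F h x0\<close> for some \<open>h\<close>.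
  Choosing such an \<open>h\<close> embeds \<open>F X\<close> into a hom set, and from there into
  \<open>'g\<close>.\<close>

lemma small_copy:
  fixes F :: "('o, 'm, 'h) abfunctor"
  assumes F: "additive_abfunctor C F" and p: "presents C F X0 x0 X1 r"
  obtains G :: "('o, 'm, 'g) abfunctor" and \<eta> where "G \<in> Obj A" "natural_trans C F G \<eta>"
    "\<And>X. X \<in> Obj C \<Longrightarrow> bij_betw (\<eta> X) (El F X) (El G X)" "presents C G X0 (\<eta> X0 x0) X1 r"
proof -
  note P = presentsD[OF p]
  have "\<exists>\<iota> :: 'h \<Rightarrow> 'g. inj_on \<iota> (El F X)" if X: "X \<in> Obj C" for X
  proof -
    obtain \<iota> :: "'m \<Rightarrow> 'g" where \<iota>: "inj_on \<iota> (Arr C X X0)" using small[OF X P(3)] by blast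
    have "\<forall>x\<in>El F X. \<exists>h. h \<in> Arr C X X0 \<and> x = AAr F h x0" using P(5)[OF X] by (auto simp: arrow_def)
    then obtain c where c: "\<And>x. x \<in> El F X \<Longrightarrow> c x \<in> Arr C X X0 \<and> x = AAr F (c x) x0" by metis
    have "inj_on (\<lambda>x. \<iota> (c x)) (El F X)"
    proof (rule inj_onI)
      fix x y assume xy: "x \<in> El F X" "y \<in> El F X" "\<iota> (c x) = \<iota> (c y)"
      then have "c x = c y" using \<iota> c by (simp add: inj_on_def)
      then show "x = y" using c xy by metis
    qed
    then show ?thesis by blast
  qed
  then obtain \<iota> :: "'o \<Rightarrow> 'h \<Rightarrow> 'g" where \<iota>: "\<And>X. X \<in> Obj C \<Longrightarrow> inj_on (\<iota> X) (El F X)" by metis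
  note cp = copy_functor[OF F \<iota>]
  have pc: "presents C (copy_functor C \<iota> F) X0 (\<iota> X0 x0) X1 r"
    using presents_transfer[OF F cp(1,2,3) P(1,3)] p by blast
  then have "copy_functor C \<iota> F \<in> Obj A" using cp(1) by (auto simp: Obj_A finitely_presented_iff)
  then show thesis using that[OF _ cp(2,3) pc] by blast
qed

lemma ex_presented:
  assumes "arrow C r X1 X0"
  obtains F x0 where "F \<in> Obj A" "presents C F X0 x0 X1 r"
  by (rule small_copy[OF coker_presents[OF assms]]) (rule that)

text \<open>Take a weak kernel of the difference of \<open>f \<cdot> p\<close> and
  \<open>g \<cdot> q\<close> on the biproduct of \<open>X\<close> and \<open>Y\<close>.\<close>

lemma ex_weak_pullback:
  assumes f: "arrow C f X Z" and g: "arrow C g Y Z"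
  obtains P p q where "arrow C p P X" "arrow C q P Y" "f \<cdot> p = g \<cdot> q"
    "\<And>W a b. arrow C a W X \<Longrightarrow> arrow C b W Y \<Longrightarrow> f \<cdot> a = g \<cdot> b \<Longrightarrow> \<exists>l. arrow C l W P \<and> a = p \<cdot> l \<and> b = q \<cdot> l"
proof -
  obtain B where "biproduct C X Y B" using ex_biproduct arrowD f g by metis
  then obtain i j p q where pq: "arrow C p B X" "arrow C q B Y"
    "\<And>W a b. arrow C a W X \<Longrightarrow> arrow C b W Y \<Longrightarrow> \<exists>h. arrow C h W B \<and> p \<cdot> h = a \<and> q \<cdot> h = b"
    by (rule biproduct_pairing) blast
  note fp = arrow_comp[OF pq(1) f] and gq = arrow_comp[OF pq(2) g]
  let ?d = "(f \<cdot> p) \<otimes>\<^bsub>Hom C B Z\<^esub> inv\<^bsub>Hom C B Z\<^esub> (g \<cdot> q)"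
  have d: "arrow C ?d B Z" using arrow_sum[OF fp arrow_neg[OF gq]] .
  have d0: "?d \<cdot> h = Zero C W Z \<longleftrightarrow> f \<cdot> (p \<cdot> h) = g \<cdot> (q \<cdot> h)" if h: "arrow C h W B" for h W
    using sum_comp[OF h fp arrow_neg[OF gq]] neg_comp[OF h gq] arrow_assoc[OF h pq(1) f] arrow_assoc[OF h pq(2) g]
      diff_eq_zero_iff[OF arrow_comp[OF arrow_comp[OF h pq(1)] f] arrow_comp[OF arrow_comp[OF h pq(2)] g]] by simp
  obtain K k where k: "arrow C k K B" "?d \<cdot> k = Zero C K Z"
    "\<And>W h. arrow C h W B \<Longrightarrow> ?d \<cdot> h = Zero C W Z \<Longrightarrow> \<exists>l. arrow C l W K \<and> h = k \<cdot> l"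
    using ex_weak_kernel[OF d] by blast
  show thesis
  proof (rule that[OF arrow_comp[OF k(1) pq(1)] arrow_comp[OF k(1) pq(2)]])
    show "f \<cdot> (p \<cdot> k) = g \<cdot> (q \<cdot> k)" using d0[OF k(1)] k(2) by simp
    fix W a b assume a: "arrow C a W X" and b: "arrow C b W Y" and ab: "f \<cdot> a = g \<cdot> b"
    obtain h where h: "arrow C h W B" "p \<cdot> h = a" "q \<cdot> h = b" using pq(3)[OF a b] by blast
    obtain l where l: "arrow C l W K" "h = k \<cdot> l" using k(3)[OF h(1)] d0[OF h(1)] h ab by auto
    show "\<exists>l. arrow C l W K \<and> a = p \<cdot> k \<cdot> l \<and> b = q \<cdot> k \<cdot> l"
      using l h(2,3) arrow_assoc[OF l(1) k(1) pq(1)] arrow_assoc[OF l(1) k(1) pq(2)] by (intro exI[of _ l]) simp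
  qed
qed

section \<open>Pointwise injectivity, surjectivity and exactness\<close>

definition pinj :: "('o, 'm, 'g) nattrans \<Rightarrow> ('o, 'm, 'g) abfunctor \<Rightarrow> ('o, 'm, 'g) abfunctor \<Rightarrow> bool" where
  "pinj a F G \<longleftrightarrow> (\<forall>X\<in>Obj C. \<forall>x\<in>El F X. cmp a X x = \<one>\<^bsub>AOb G X\<^esub> \<longrightarrow> x = \<one>\<^bsub>AOb F X\<^esub>)"

definition psurj :: "('o, 'm, 'g) nattrans \<Rightarrow> ('o, 'm, 'g) abfunctor \<Rightarrow> ('o, 'm, 'g) abfunctor \<Rightarrow> bool" where
  "psurj a F G \<longleftrightarrow> (\<forall>X\<in>Obj C. \<forall>y\<in>El G X. \<exists>x\<in>El F X. y = cmp a X x)"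

definition pexact :: "('o, 'm, 'g) nattrans \<Rightarrow> ('o, 'm, 'g) nattrans
    \<Rightarrow> ('o, 'm, 'g) abfunctor \<Rightarrow> ('o, 'm, 'g) abfunctor \<Rightarrow> ('o, 'm, 'g) abfunctor \<Rightarrow> bool" where
  "pexact a b F G H \<longleftrightarrow> (\<forall>X\<in>Obj C. \<forall>y\<in>El G X. cmp b X y = \<one>\<^bsub>AOb H X\<^esub> \<longleftrightarrow> (\<exists>x\<in>El F X. y = cmp a X x))"

lemma pinj_eq: "arrow A a F G \<Longrightarrow> pinj a F G \<Longrightarrow> X \<in> Obj C \<Longrightarrow> x \<in> El F X \<Longrightarrow> y \<in> El F X \<Longrightarrow>
    cmp a X x = cmp a X y \<Longrightarrow> x = y"
  unfolding pinj_def using nt_inj[OF arrow_natural arrow_objects, of a F G] by blast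

text \<open>The graph pairs \<open>w\<close> with the \<open>x\<close> for which
  \<open>g w = k x\<close>; injectivity of \<open>k\<close> makes it single-valued.\<close>

lemma pinj_factor:
  assumes k: "arrow A k K F" and inj: "pinj k K F" and g: "arrow A g W F"
    and im: "\<And>X w. X \<in> Obj C \<Longrightarrow> w \<in> El W X \<Longrightarrow> \<exists>x\<in>El K X. cmp g X w = cmp k X x"
  obtains u where "arrow A u W K" "k \<cdot>\<^bsub>A\<^esub> u = g"
proof -
  define R where "R X w x \<longleftrightarrow> w \<in> El W X \<and> x \<in> El K X \<and> cmp g X w = cmp k X x" for X w x
  note W = arrow_objects(1)[OF g] and K = arrow_objects(1)[OF k] and F = arrow_objects(2)[OF k]
  have "\<exists>\<eta>. natural_trans C W K \<eta> \<and> (\<forall>X\<in>Obj C. \<forall>w x. R X w x \<longleftrightarrow> w \<in> El W X \<and> x = \<eta> X w)"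
  proof (rule natural_trans_relation[OF W K])
    show "w \<in> El W X \<and> x \<in> El K X" if "R X w x" for X w x using that by (simp add: R_def)
    show "\<exists>x. R X w x" if "X \<in> Obj C" "w \<in> El W X" for X w using im[OF that] that by (auto simp: R_def)
    show "R X (w \<otimes>\<^bsub>AOb W X\<^esub> w') (x \<otimes>\<^bsub>AOb K X\<^esub> x')" if "X \<in> Obj C" "R X w x" "R X w' x'" for X w x w' x'
      using that cmp_mult[OF g] cmp_mult[OF k] monoid.m_closed[OF group.is_monoid[OF fun_group[OF W]]]
        monoid.m_closed[OF group.is_monoid[OF fun_group[OF K]]] by (simp add: R_def)
    show "R X' (AAr W f w) (AAr K f x)" if "arrow C f X' X" "R X w x" for X X' f w x
      using that fun_closed[OF W] fun_closed[OF K] cmp_natural[OF g] cmp_natural[OF k] by (simp add: R_def)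
    show "x = \<one>\<^bsub>AOb K X\<^esub>" if "X \<in> Obj C" "R X \<one>\<^bsub>AOb W X\<^esub> x" for X x
      using that inj cmp_one[OF g] by (simp add: R_def pinj_def)
  qed
  then obtain \<eta> where \<eta>: "natural_trans C W K \<eta>" "\<And>X w. X \<in> Obj C \<Longrightarrow> w \<in> El W X \<Longrightarrow> R X w (\<eta> X w)" by auto
  have u: "arrow A (nat_arrow C W K \<eta>) W K" using nat_arrow_in[OF _ _ \<eta>(1)] g k by (simp add: arrow_def)
  have "k \<cdot>\<^bsub>A\<^esub> nat_arrow C W K \<eta> = g"
    by (rule arrow_eqI[OF mod_comp[OF u k] g])
      (use \<eta>(2) in \<open>simp add: cmp_comp[OF u k] cmp_nat_arrow R_def\<close>)
  then show thesis using that u by blast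
qed

text \<open>The graph pairs \<open>l y\<close> with \<open>g y\<close>; it is single-valued because
  \<open>g\<close> vanishes wherever \<open>l\<close> does.\<close>

lemma psurj_factor:
  assumes l: "arrow A l G L" and surj: "psurj l G L" and g: "arrow A g G W"
    and ker: "\<And>X y. X \<in> Obj C \<Longrightarrow> y \<in> El G X \<Longrightarrow> cmp l X y = \<one>\<^bsub>AOb L X\<^esub> \<Longrightarrow> cmp g X y = \<one>\<^bsub>AOb W X\<^esub>"
  obtains u where "arrow A u L W" "u \<cdot>\<^bsub>A\<^esub> l = g"
proof -
  define R where "R X z w \<longleftrightarrow> (\<exists>y\<in>El G X. z = cmp l X y \<and> w = cmp g X y)" for X z w
  note W = arrow_objects(2)[OF g] and L = arrow_objects(2)[OF l] and G = arrow_objects(1)[OF l]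
  have "\<exists>\<eta>. natural_trans C L W \<eta> \<and> (\<forall>X\<in>Obj C. \<forall>z w. R X z w \<longleftrightarrow> z \<in> El L X \<and> w = \<eta> X z)"
  proof (rule natural_trans_relation[OF L W])
    show "z \<in> El L X \<and> w \<in> El W X" if "X \<in> Obj C" "R X z w" for X z w
      using that cmp_closed[OF l] cmp_closed[OF g] by (auto simp: R_def)
    show "\<exists>w. R X z w" if "X \<in> Obj C" "z \<in> El L X" for X z using surj that unfolding R_def psurj_def by metis
    show "R X (z \<otimes>\<^bsub>AOb L X\<^esub> z') (w \<otimes>\<^bsub>AOb W X\<^esub> w')" if X: "X \<in> Obj C" and R: "R X z w" "R X z' w'" for X z w z' w'
    proof -
      obtain y y' where y: "y \<in> El G X" "y' \<in> El G X" "z = cmp l X y" "w = cmp g X y" "z' = cmp l X y'" "w' = cmp g X y'"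
        using R by (auto simp: R_def)
      then show ?thesis unfolding R_def
        using cmp_mult[OF g X y(1,2)] cmp_mult[OF l X y(1,2)] monoid.m_closed[OF group.is_monoid[OF fun_group[OF G X]] y(1,2)]
        by (intro bexI[of _ "y \<otimes>\<^bsub>AOb G X\<^esub> y'"]) auto
    qed
    show "R X' (AAr L f z) (AAr W f w)" if "arrow C f X' X" "R X z w" for X X' f z w
      using that fun_closed[OF G] cmp_natural[OF g] cmp_natural[OF l] unfolding R_def by metis
    show "w = \<one>\<^bsub>AOb W X\<^esub>" if "X \<in> Obj C" "R X \<one>\<^bsub>AOb L X\<^esub> w" for X w
      using that ker unfolding R_def by metis
  qed
  then obtain \<eta> where \<eta>: "natural_trans C L W \<eta>" "\<And>X z w. X \<in> Obj C \<Longrightarrow> R X z w \<Longrightarrow> w = \<eta> X z" by auto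
  have u: "arrow A (nat_arrow C L W \<eta>) L W" using nat_arrow_in[OF _ _ \<eta>(1)] g l by (simp add: arrow_def)
  have "nat_arrow C L W \<eta> \<cdot>\<^bsub>A\<^esub> l = g"
  proof (rule arrow_eqI[OF mod_comp[OF l u] g])
    fix X y assume X: "X \<in> Obj C" and y: "y \<in> El G X"
    have "R X (cmp l X y) (cmp g X y)" using y by (auto simp: R_def)
    then show "cmp (nat_arrow C L W \<eta> \<cdot>\<^bsub>A\<^esub> l) X y = cmp g X y"
      using \<eta>(2)[OF X] cmp_comp[OF l u X y] cmp_nat_arrow[OF X cmp_closed[OF l X y]] by simp
  qed
  then show thesis using that u by blast
qed

lemma comp_eq_zero_iff:
  assumes a: "arrow A a F G" and b: "arrow A b G H"
  shows "b \<cdot>\<^bsub>A\<^esub> a = Zero A F H \<longleftrightarrow> (\<forall>X\<in>Obj C. \<forall>x\<in>El F X. cmp b X (cmp a X x) = \<one>\<^bsub>AOb H X\<^esub>)"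
proof
  assume "b \<cdot>\<^bsub>A\<^esub> a = Zero A F H"
  then show "\<forall>X\<in>Obj C. \<forall>x\<in>El F X. cmp b X (cmp a X x) = \<one>\<^bsub>AOb H X\<^esub>" using cmp_comp[OF a b] cmp_zero by metis
next
  assume "\<forall>X\<in>Obj C. \<forall>x\<in>El F X. cmp b X (cmp a X x) = \<one>\<^bsub>AOb H X\<^esub>"
  then show "b \<cdot>\<^bsub>A\<^esub> a = Zero A F H"
    using arrow_eqI[OF mod_comp[OF a b] mod_zero[OF arrowD(1)[OF a] arrowD(2)[OF b]]]
    by (simp add: cmp_comp[OF a b] cmp_zero)
qed

text \<open>Pointwise exactness supplies the preimages that \<open>pinj_factor\<close> asks for, and
  injectivity gives uniqueness.\<close>

lemma is_kernelI:
  assumes s: "arrow A s F G" and k: "arrow A k K F" and inj: "pinj k K F" and ex: "pexact k s K F G"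
  shows "is_kernel A F G s K k"
  unfolding is_kernel_def
proof (intro conjI ballI impI)
  show "K \<in> Obj A" "k \<in> Arr A K F" using k by (auto simp: arrow_def)
  have "\<forall>X\<in>Obj C. \<forall>x\<in>El K X. cmp s X (cmp k X x) = \<one>\<^bsub>AOb G X\<^esub>"
    using ex cmp_closed[OF k] unfolding pexact_def by blast
  then show "s \<cdot>\<^bsub>A\<^esub> k = Zero A K G" using comp_eq_zero_iff[OF k s] by blast
  fix W g assume W: "W \<in> Obj A" "g \<in> Arr A W F" and z: "s \<cdot>\<^bsub>A\<^esub> g = Zero A W G"
  have g: "arrow A g W F" using W k by (simp add: arrow_def)
  obtain u where u: "arrow A u W K" "k \<cdot>\<^bsub>A\<^esub> u = g"
  proof (rule pinj_factor[OF k inj g])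
    show "\<exists>x\<in>El K X. cmp g X w = cmp k X x" if "X \<in> Obj C" "w \<in> El W X" for X w
      using that z comp_eq_zero_iff[OF g s] ex cmp_closed[OF g] unfolding pexact_def by blast
  qed
  have uniq: "u' = u" if u': "arrow A u' W K" "k \<cdot>\<^bsub>A\<^esub> u' = g" for u'
  proof (rule arrow_eqI[OF u'(1) u(1)])
    fix X w assume X: "X \<in> Obj C" and w: "w \<in> El W X"
    have "cmp k X (cmp u' X w) = cmp k X (cmp u X w)"
      using cmp_comp[OF u(1) k X w] cmp_comp[OF u'(1) k X w] u(2) u'(2) by simp
    then show "cmp u' X w = cmp u X w"
      using pinj_eq[OF k inj X] cmp_closed[OF u(1) X w] cmp_closed[OF u'(1) X w] by blast
  qed
  show "\<exists>!u. u \<in> Arr A W K \<and> k \<cdot>\<^bsub>A\<^esub> u = g"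
  proof (rule ex1I[of _ u])
    show "u \<in> Arr A W K \<and> k \<cdot>\<^bsub>A\<^esub> u = g" using u by (simp add: arrow_def)
    show "u' = u" if "u' \<in> Arr A W K \<and> k \<cdot>\<^bsub>A\<^esub> u' = g" for u'
      using uniq[of u'] that arrowD(1,2)[OF u(1)] by (simp add: arrow_def)
  qed
qed

lemma is_cokernelI:
  assumes s: "arrow A s F G" and l: "arrow A l G L" and surj: "psurj l G L" and ex: "pexact s l F G L"
  shows "is_cokernel A F G s L l"
  unfolding is_cokernel_def
proof (intro conjI ballI impI)
  show "L \<in> Obj A" "l \<in> Arr A G L" using l by (auto simp: arrow_def)
  have "\<forall>X\<in>Obj C. \<forall>x\<in>El F X. cmp l X (cmp s X x) = \<one>\<^bsub>AOb L X\<^esub>"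
    using ex cmp_closed[OF s] unfolding pexact_def by blast
  then show "l \<cdot>\<^bsub>A\<^esub> s = Zero A F L" using comp_eq_zero_iff[OF s l] by blast
  fix W g assume W: "W \<in> Obj A" "g \<in> Arr A G W" and z: "g \<cdot>\<^bsub>A\<^esub> s = Zero A F W"
  have g: "arrow A g G W" using W l by (simp add: arrow_def)
  obtain u where u: "arrow A u L W" "u \<cdot>\<^bsub>A\<^esub> l = g"
  proof (rule psurj_factor[OF l surj g])
    show "cmp g X y = \<one>\<^bsub>AOb W X\<^esub>" if X: "X \<in> Obj C" "y \<in> El G X" "cmp l X y = \<one>\<^bsub>AOb L X\<^esub>" for X y
    proof -
      obtain x where "x \<in> El F X" "y = cmp s X x" using ex X unfolding pexact_def by blast
      then show ?thesis using z comp_eq_zero_iff[OF s g] X by blast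
    qed
  qed
  have uniq: "u' = u" if u': "arrow A u' L W" "u' \<cdot>\<^bsub>A\<^esub> l = g" for u'
  proof (rule arrow_eqI[OF u'(1) u(1)])
    fix X z assume X: "X \<in> Obj C" and z: "z \<in> El L X"
    obtain y where y: "y \<in> El G X" "z = cmp l X y" using surj X z unfolding psurj_def by blast
    then show "cmp u' X z = cmp u X z"
      using cmp_comp[OF l u(1) X y(1)] cmp_comp[OF l u'(1) X y(1)] u(2) u'(2) by simp
  qed
  show "\<exists>!u. u \<in> Arr A L W \<and> u \<cdot>\<^bsub>A\<^esub> l = g"
  proof (rule ex1I[of _ u])
    show "u \<in> Arr A L W \<and> u \<cdot>\<^bsub>A\<^esub> l = g" using u by (simp add: arrow_def)
    show "u' = u" if "u' \<in> Arr A L W \<and> u' \<cdot>\<^bsub>A\<^esub> l = g" for u'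
      using uniq[of u'] that arrowD(1,2)[OF u(1)] by (simp add: arrow_def)
  qed
qed

section \<open>Kernels and cokernels of finitely presented functors\<close>

definition kernel_functor :: "('o, 'm, 'g) nattrans \<Rightarrow> ('o, 'm, 'g) abfunctor \<Rightarrow> ('o, 'm, 'g) abfunctor \<Rightarrow> ('o, 'm, 'g) abfunctor"
  where "kernel_functor s F G = \<lparr>AOb = (\<lambda>X. (AOb F X)\<lparr>carrier := kernel (AOb F X) (AOb G X) (cmp s X)\<rparr>), AAr = AAr F\<rparr>"

lemma kernel_functor_simps [simp]:
  "El (kernel_functor s F G) X = kernel (AOb F X) (AOb G X) (cmp s X)"
  "\<one>\<^bsub>AOb (kernel_functor s F G) X\<^esub> = \<one>\<^bsub>AOb F X\<^esub>"
  "x \<otimes>\<^bsub>AOb (kernel_functor s F G) X\<^esub> y = x \<otimes>\<^bsub>AOb F X\<^esub> y"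
  "AAr (kernel_functor s F G) = AAr F"
  by (simp_all add: kernel_functor_def)

text \<open>An element \<open>F k x0\<close> is killed by \<open>s\<close> exactly when
  \<open>h \<cdot> k\<close> factors through the relation \<open>q\<close> of \<open>G\<close>, so a
  weak pullback of \<open>h\<close> and \<open>q\<close> provides a generator of the kernel. A
  second weak pullback, against the relation \<open>r\<close> of \<open>F\<close>, provides its
  relations.\<close>

lemma kernel_functor:
  assumes s: "arrow A s F G"
  shows "kernel_functor s F G \<in> Obj A"
proof -
  let ?K = "kernel_functor s F G"
  note F = arrow_objects(1)[OF s] and G = arrow_objects(2)[OF s]
  have mem: "x \<in> El ?K X \<longleftrightarrow> x \<in> El F X \<and> cmp s X x = \<one>\<^bsub>AOb G X\<^esub>" for X x by (simp add: kernel_def)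
  have closed: "AAr F f y \<in> El ?K X" if f: "arrow C f X Y" and y: "y \<in> El ?K Y" for f X Y y
    using y fun_closed[OF F f] cmp_natural[OF s f] fun_one[OF G f] unfolding mem by simp
  have add: "additive_abfunctor C ?K"
    unfolding additive_abfunctor_def
  proof (intro conjI ballI)
    fix X assume X: "X \<in> Obj C"
    have "subgroup (kernel (AOb F X) (AOb G X) (cmp s X)) (AOb F X)"
      using group_hom.subgroup_kernel[OF nt_hom[OF arrow_natural[OF s] F G X]] .
    then show "comm_group (AOb ?K X)"
      unfolding kernel_functor_def abfunctor.simps
      by (intro group.group_comm_groupI subgroup.subgroup_is_group[OF _ fun_group[OF F X]])
        (simp_all add: kernel_def comm_monoid.m_comm[OF comm_group.axioms(1)[OF fun_comm_group[OF F X]]])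
    show "AAr ?K (Ide C X) x = x" if "x \<in> El ?K X" for x using fun_ide[OF F X] that unfolding mem by simp
    fix Y assume Y: "Y \<in> Obj C"
    show "AAr ?K f \<in> hom (AOb ?K Y) (AOb ?K X)" if "f \<in> Arr C X Y" for f
    proof (rule homI)
      have f: "arrow C f X Y" using that X Y by (simp add: arrow_def)
      show "AAr ?K f y \<in> El ?K X" if "y \<in> El ?K Y" for y using closed[OF f that] by simp
      show "AAr ?K f (y \<otimes>\<^bsub>AOb ?K Y\<^esub> y') = AAr ?K f y \<otimes>\<^bsub>AOb ?K X\<^esub> AAr ?K f y'"
        if "y \<in> El ?K Y" "y' \<in> El ?K Y" for y y' using fun_mult[OF F f] that unfolding mem by simp
    qed
    show "AAr ?K (f \<otimes>\<^bsub>Hom C X Y\<^esub> g) y = AAr ?K f y \<otimes>\<^bsub>AOb ?K X\<^esub> AAr ?K g y"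
      if "f \<in> Arr C X Y" "g \<in> Arr C X Y" "y \<in> El ?K Y" for f g y
      using that fun_sum[OF F, of f X Y g y] X Y unfolding mem by (simp add: arrow_def)
    fix Z assume Z: "Z \<in> Obj C"
    show "AAr ?K (g \<cdot> f) z = AAr ?K f (AAr ?K g z)"
      if "f \<in> Arr C X Y" "g \<in> Arr C Y Z" "z \<in> El ?K Z" for f g z
      using that fun_comp[OF F, of f X Y g Z z] X Y Z unfolding mem by (simp add: arrow_def)
  qed
  obtain X0 x0 X1 r where p: "presents C F X0 x0 X1 r" using s Obj_A fp_presents by (metis arrowD(1))
  obtain Y0 y0 Y1 q where p': "presents C G Y0 y0 Y1 q" using s Obj_A fp_presents by (metis arrowD(2))
  note P = presentsD[OF p] and P' = presentsD[OF p']
  obtain h where h: "arrow C h X0 Y0" "cmp s X0 x0 = AAr G h y0"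
    using P'(5)[OF P(3) cmp_closed[OF s P(3,1)]] by blast
  have zero: "cmp s W (AAr F k x0) = \<one>\<^bsub>AOb G W\<^esub> \<longleftrightarrow> (\<exists>l. arrow C l W Y1 \<and> h \<cdot> k = q \<cdot> l)" if k: "arrow C k W X0" for k W
    using cmp_natural[OF s k P(1)] h(2) fun_comp[OF G k h(1) P'(1)] P'(6)[OF arrow_comp[OF k h(1)]] by simp
  obtain Q a b where Q: "arrow C a Q X0" "arrow C b Q Y1" "h \<cdot> a = q \<cdot> b"
    "\<And>W k l. arrow C k W X0 \<Longrightarrow> arrow C l W Y1 \<Longrightarrow> h \<cdot> k = q \<cdot> l \<Longrightarrow> \<exists>m. arrow C m W Q \<and> k = a \<cdot> m \<and> l = b \<cdot> m"
    by (rule ex_weak_pullback[OF h(1) P'(2)]) blast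
  obtain Q' c d where Q': "arrow C c Q' Q" "arrow C d Q' X1" "a \<cdot> c = r \<cdot> d"
    "\<And>W k l. arrow C k W Q \<Longrightarrow> arrow C l W X1 \<Longrightarrow> a \<cdot> k = r \<cdot> l \<Longrightarrow> \<exists>m. arrow C m W Q' \<and> k = c \<cdot> m \<and> l = d \<cdot> m"
    by (rule ex_weak_pullback[OF Q(1) P(2)]) blast
  have "presents C ?K Q (AAr F a x0) Q' c"
    unfolding presents_def
  proof (intro conjI ballI allI impI)
    show "AAr F a x0 \<in> El ?K Q" unfolding mem using fun_closed[OF F Q(1) P(1)] zero[OF Q(1)] Q by blast
    show "arrow C c Q' Q" by fact
    show "\<exists>m. arrow C m W Q \<and> x = AAr ?K m (AAr F a x0)" if W: "W \<in> Obj C" and x: "x \<in> El ?K W" for W x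
    proof -
      obtain k where k: "arrow C k W X0" "x = AAr F k x0" using P(5)[OF W] x unfolding mem by blast
      then obtain l where "arrow C l W Y1" "h \<cdot> k = q \<cdot> l" using zero[OF k(1)] x unfolding mem by blast
      then obtain m where "arrow C m W Q" "k = a \<cdot> m" using Q(4)[OF k(1)] by blast
      then show ?thesis using k(2) fun_comp[OF F _ Q(1) P(1)] by auto
    qed
    show "AAr ?K m (AAr F a x0) = \<one>\<^bsub>AOb ?K W\<^esub> \<longleftrightarrow> (\<exists>k. arrow C k W Q' \<and> m = c \<cdot> k)" if m: "arrow C m W Q" for W m
    proof -
      have "AAr ?K m (AAr F a x0) = \<one>\<^bsub>AOb ?K W\<^esub> \<longleftrightarrow> (\<exists>l. arrow C l W X1 \<and> a \<cdot> m = r \<cdot> l)"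
        using fun_comp[OF F m Q(1) P(1)] P(6)[OF arrow_comp[OF m Q(1)]] by simp
      also have "\<dots> \<longleftrightarrow> (\<exists>k. arrow C k W Q' \<and> m = c \<cdot> k)"
      proof
        show "\<exists>k. arrow C k W Q' \<and> m = c \<cdot> k" if "\<exists>l. arrow C l W X1 \<and> a \<cdot> m = r \<cdot> l"
          using that Q'(4)[OF m] by blast
        assume "\<exists>k. arrow C k W Q' \<and> m = c \<cdot> k"
        then obtain k where k: "arrow C k W Q'" "m = c \<cdot> k" by blast
        show "\<exists>l. arrow C l W X1 \<and> a \<cdot> m = r \<cdot> l"
          using k(2) arrow_assoc[OF k(1) Q'(1) Q(1)] arrow_assoc[OF k(1) Q'(2) P(2)] Q'(3) arrow_comp[OF k(1) Q'(2)] by auto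
      qed
      finally show ?thesis .
    qed
  qed
  then show ?thesis using add by (auto simp: Obj_A finitely_presented_iff)
qed

lemma pointwise_kernel:
  assumes s: "arrow A s F G"
  obtains K k where "arrow A k K F" "pinj k K F" "pexact k s K F G"
proof -
  let ?K = "kernel_functor s F G"
  let ?k = "nat_arrow C ?K F (\<lambda>X x. x)"
  have k: "arrow A ?k ?K F"
  proof (rule nat_arrow_in[OF kernel_functor[OF s] arrowD(1)[OF s]], rule natural_transI)
    show "x \<in> El F X" if "x \<in> El ?K X" for X x using that by (simp add: kernel_def)
  qed simp_all
  have c: "cmp ?k X x = x" if "X \<in> Obj C" "x \<in> El ?K X" for X x using cmp_nat_arrow[OF that] .
  have "pinj ?k ?K F" using c by (simp add: pinj_def)
  moreover have "pexact ?k s ?K F G" using c unfolding pexact_def by (auto simp: kernel_def)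
  ultimately show thesis using that[OF k] by blast
qed

text \<open>The cokernel keeps the generator \<open>y0\<close> of \<open>G\<close> and has two kinds
  of relations: \<open>q\<close>, those of \<open>G\<close>, and \<open>h\<close>, the image of the
  generator of \<open>F\<close>. Together they form one map from the biproduct of \<open>X0\<close>
  and \<open>Y1\<close>.\<close>

lemma pointwise_cokernel:
  assumes s: "arrow A s F G"
  obtains L l where "arrow A l G L" "psurj l G L" "pexact s l F G L"
proof -
  note F = arrow_objects(1)[OF s] and G = arrow_objects(2)[OF s]
  obtain X0 x0 X1 r where p: "presents C F X0 x0 X1 r" using s Obj_A fp_presents by (metis arrowD(1))
  obtain Y0 y0 Y1 q where p': "presents C G Y0 y0 Y1 q" using s Obj_A fp_presents by (metis arrowD(2))
  note P = presentsD[OF p] and P' = presentsD[OF p']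
  obtain h where h: "arrow C h X0 Y0" "cmp s X0 x0 = AAr G h y0"
    using P'(5)[OF P(3) cmp_closed[OF s P(3,1)]] by blast
  obtain B where "biproduct C X0 Y1 B" using ex_biproduct P(3) P'(4) by blast
  then obtain i j p1 p2 where b: "arrow C i X0 B" "arrow C j Y1 B" "arrow C p1 B X0" "arrow C p2 B Y1"
    "\<And>W a b. arrow C a X0 W \<Longrightarrow> arrow C b Y1 W \<Longrightarrow> \<exists>h. arrow C h B W \<and> h \<cdot> i = a \<and> h \<cdot> j = b \<and>
        h = (a \<cdot> p1) \<otimes>\<^bsub>Hom C B W\<^esub> (b \<cdot> p2)"
    by (rule biproduct_pairing) blast
  obtain c where c: "arrow C c B Y0" "c \<cdot> i = h" "c \<cdot> j = q" "c = (h \<cdot> p1) \<otimes>\<^bsub>Hom C B Y0\<^esub> (q \<cdot> p2)"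
    using b(5)[OF h(1) P'(2)] by blast
  obtain L l0 where L: "L \<in> Obj A" "presents C L Y0 l0 B c" by (rule ex_presented[OF c(1)])
  note Ladd = additive_Obj[OF L(1)] and PL = presentsD[OF L(2)]
  obtain \<eta> where \<eta>: "natural_trans C G L \<eta>" "\<eta> Y0 y0 = l0"
  proof (rule yoneda[OF G Ladd p' PL(1)])
    show "AAr L q l0 = \<one>\<^bsub>AOb L Y1\<^esub>" using presents_relation(1)[OF Ladd L(2) b(2)] c(3) by simp
  qed
  let ?l = "nat_arrow C G L \<eta>"
  have l: "arrow A ?l G L" using nat_arrow_in[OF arrowD(2)[OF s] L(1) \<eta>(1)] .
  have gen: "cmp ?l W (AAr G k y0) = AAr L k l0" if k: "arrow C k W Y0" for W k
    using cmp_nat_arrow[OF arrowD(1)[OF k] fun_closed[OF G k P'(1)]] nt_generator[OF \<eta>(1) p' k] \<eta>(2) by simp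
  have ks: "cmp s W (AAr F k x0) = AAr G (h \<cdot> k) y0" if k: "arrow C k W X0" for W k
    using cmp_natural[OF s k P(1)] h(2) fun_comp[OF G k h(1) P'(1)] by simp
  show thesis
  proof (rule that[OF l])
    show "psurj ?l G L"
      unfolding psurj_def
    proof (intro ballI)
      fix X z assume X: "X \<in> Obj C" and z: "z \<in> El L X"
      obtain k where k: "arrow C k X Y0" "z = AAr L k l0" using PL(5)[OF X z] by blast
      then show "\<exists>x\<in>El G X. z = cmp ?l X x" using gen[OF k(1)] fun_closed[OF G k(1) P'(1)] by metis
    qed
    show "pexact s ?l F G L"
      unfolding pexact_def
    proof (intro ballI iffI)
      fix X y assume X: "X \<in> Obj C" and y: "y \<in> El G X"
      obtain k where k: "arrow C k X Y0" "y = AAr G k y0" using P'(5)[OF X y] by blast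
      {
        assume "cmp ?l X y = \<one>\<^bsub>AOb L X\<^esub>"
        then obtain m where m: "arrow C m X B" "k = c \<cdot> m" using gen[OF k(1)] k(2) PL(6)[OF k(1)] by auto
        have p1m: "arrow C (p1 \<cdot> m) X X0" and p2m: "arrow C (p2 \<cdot> m) X Y1" using arrow_comp m(1) b by blast+
        \<comment> \<open>A relation of \<open>L\<close> splits into a part in the image of
          \<open>s\<close> and a relation of \<open>G\<close>.\<close>
        have "k = (h \<cdot> (p1 \<cdot> m)) \<otimes>\<^bsub>Hom C X Y0\<^esub> (q \<cdot> (p2 \<cdot> m))"
          using m(2) c(4) sum_comp[OF m(1) arrow_comp[OF b(3) h(1)] arrow_comp[OF b(4) P'(2)]]
            arrow_assoc[OF m(1) b(3) h(1)] arrow_assoc[OF m(1) b(4) P'(2)] by simp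
        then have "y = AAr G (h \<cdot> (p1 \<cdot> m)) y0 \<otimes>\<^bsub>AOb G X\<^esub> \<one>\<^bsub>AOb G X\<^esub>"
          using k(2) fun_sum[OF G arrow_comp[OF p1m h(1)] arrow_comp[OF p2m P'(2)] P'(1)]
            presents_relation(1)[OF G p' p2m] by simp
        then have "y = cmp s X (AAr F (p1 \<cdot> m) x0)"
          using ks[OF p1m] fun_closed[OF G arrow_comp[OF p1m h(1)] P'(1)] monoid.r_one[OF group.is_monoid[OF fun_group[OF G X]]] by simp
        then show "\<exists>x\<in>El F X. y = cmp s X x" using fun_closed[OF F p1m P(1)] by blast
      next
        assume "\<exists>x\<in>El F X. y = cmp s X x"
        then obtain x where x: "x \<in> El F X" "y = cmp s X x" by blast
        obtain k' where k': "arrow C k' X X0" "x = AAr F k' x0" using P(5)[OF X x(1)] by blast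
        have "cmp ?l X y = AAr L (h \<cdot> k') l0" using x(2) k'(2) ks[OF k'(1)] gen[OF arrow_comp[OF k'(1) h(1)]] by simp
        also have "h \<cdot> k' = c \<cdot> (i \<cdot> k')" using c(2) arrow_assoc[OF k'(1) b(1) c(1)] by simp
        finally show "cmp ?l X y = \<one>\<^bsub>AOb L X\<^esub>" using presents_relation(1)[OF Ladd L(2) arrow_comp[OF k'(1) b(1)]] by simp
      }
    qed
  qed
qed

text \<open>Any kernel is isomorphic to the pointwise one, so its elements can be computed pointwise
  although it was given by a universal property.\<close>

lemma is_kernel_iff:
  assumes s: "arrow A s F G"
  shows "is_kernel A F G s K k \<longleftrightarrow> arrow A k K F \<and> pinj k K F \<and> pexact k s K F G"
proof
  assume ker: "is_kernel A F G s K k"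
  have k: "arrow A k K F" using ker s by (auto simp: is_kernel_def arrow_def)
  obtain K' k' where k': "arrow A k' K' F" "pinj k' K' F" "pexact k' s K' F G" by (rule pointwise_kernel[OF s])
  obtain u u' where u: "arrow A u K K'" "arrow A u' K' K" "k' \<cdot>\<^bsub>A\<^esub> u = k" "k \<cdot>\<^bsub>A\<^esub> u' = k'"
      "u' \<cdot>\<^bsub>A\<^esub> u = Ide A K" "u \<cdot>\<^bsub>A\<^esub> u' = Ide A K'"
    by (rule A.kernel_unique[OF arrowD(1,2)[OF s] ker is_kernelI[OF s k']])
  have "pinj k K F"
    unfolding pinj_def
  proof (intro ballI impI)
    fix X x assume X: "X \<in> Obj C" and x: "x \<in> El K X" "cmp k X x = \<one>\<^bsub>AOb F X\<^esub>"
    have "cmp u X x = \<one>\<^bsub>AOb K' X\<^esub>"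
      using k'(2) X x cmp_comp[OF u(1) k'(1) X x(1)] u(3) cmp_closed[OF u(1) X x(1)] unfolding pinj_def by simp
    then have "cmp (u' \<cdot>\<^bsub>A\<^esub> u) X x = \<one>\<^bsub>AOb K X\<^esub>" using cmp_comp[OF u(1,2) X x(1)] cmp_one[OF u(2) X] by simp
    then show "x = \<one>\<^bsub>AOb K X\<^esub>" using u(5) cmp_ide[OF X x(1)] by simp
  qed
  moreover have "pexact k s K F G"
    unfolding pexact_def
  proof (intro ballI iffI)
    fix X y assume X: "X \<in> Obj C" and y: "y \<in> El F X"
    {
      assume "cmp s X y = \<one>\<^bsub>AOb G X\<^esub>"
      then obtain x where x: "x \<in> El K' X" "y = cmp k' X x" using k'(3) X y unfolding pexact_def by blast
      then show "\<exists>x\<in>El K X. y = cmp k X x"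
        using cmp_comp[OF u(2) k X x(1)] u(4) cmp_closed[OF u(2) X x(1)] by auto
    next
      assume "\<exists>x\<in>El K X. y = cmp k X x"
      then show "cmp s X y = \<one>\<^bsub>AOb G X\<^esub>" using ker comp_eq_zero_iff[OF k s] X by (auto simp: is_kernel_def)
    }
  qed
  ultimately show "arrow A k K F \<and> pinj k K F \<and> pexact k s K F G" using k by blast
qed (use is_kernelI[OF s] in blast)

lemma is_cokernel_iff:
  assumes s: "arrow A s F G"
  shows "is_cokernel A F G s L l \<longleftrightarrow> arrow A l G L \<and> psurj l G L \<and> pexact s l F G L"
proof
  assume cok: "is_cokernel A F G s L l"
  have l: "arrow A l G L" using cok s by (auto simp: is_cokernel_def arrow_def)
  obtain L' l' where l': "arrow A l' G L'" "psurj l' G L'" "pexact s l' F G L'" by (rule pointwise_cokernel[OF s])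
  obtain u u' where u: "arrow A u L L'" "arrow A u' L' L" "u \<cdot>\<^bsub>A\<^esub> l = l'" "u' \<cdot>\<^bsub>A\<^esub> l' = l"
      "u' \<cdot>\<^bsub>A\<^esub> u = Ide A L" "u \<cdot>\<^bsub>A\<^esub> u' = Ide A L'"
    by (rule A.cokernel_unique[OF arrowD(1,2)[OF s] cok is_cokernelI[OF s l']])
  have "psurj l G L"
    unfolding psurj_def
  proof (intro ballI)
    fix X z assume X: "X \<in> Obj C" and z: "z \<in> El L X"
    obtain y where y: "y \<in> El G X" "cmp u X z = cmp l' X y"
      using l'(2) X cmp_closed[OF u(1) X z] unfolding psurj_def by blast
    have "z = cmp u' X (cmp u X z)" using cmp_comp[OF u(1,2) X z] u(5) cmp_ide[OF X z] by simp
    also have "\<dots> = cmp l X y" using y cmp_comp[OF l'(1) u(2) X y(1)] u(4) by simp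
    finally show "\<exists>x\<in>El G X. z = cmp l X x" using y(1) by blast
  qed
  moreover have "pexact s l F G L"
    unfolding pexact_def
  proof (intro ballI iffI)
    fix X y assume X: "X \<in> Obj C" and y: "y \<in> El G X"
    {
      assume "cmp l X y = \<one>\<^bsub>AOb L X\<^esub>"
      then have "cmp l' X y = \<one>\<^bsub>AOb L' X\<^esub>" using cmp_comp[OF l u(1) X y] u(3) cmp_one[OF u(1) X] by simp
      then show "\<exists>x\<in>El F X. y = cmp s X x" using l'(3) X y unfolding pexact_def by blast
    next
      assume "\<exists>x\<in>El F X. y = cmp s X x"
      then show "cmp l X y = \<one>\<^bsub>AOb L X\<^esub>" using cok comp_eq_zero_iff[OF s l] X by (auto simp: is_cokernel_def)
    }
  qed
  ultimately show "arrow A l G L \<and> psurj l G L \<and> pexact s l F G L" using l by blast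
qed (use is_cokernelI[OF s] in blast)

section \<open>Zero object, biproducts and the abelian structure\<close>

lemma zero_functor:
  obtains N where "zero_object A N"
proof -
  obtain Z where Z: "zero_object C Z" using ex_zero by blast
  then have o: "Z \<in> Obj C" by (simp add: zero_object_def)
  \<comment> \<open>Presented by an identity map, so every multiple of the generator is a
    relation.\<close>
  obtain N n where N: "N \<in> Obj A" "presents C N Z n Z (Ide C Z)" by (rule ex_presented[OF arrow_ide[OF o]])
  note P = presentsD[OF N(2)]
  have "x = \<one>\<^bsub>AOb N X\<^esub>" if "X \<in> Obj C" "x \<in> El N X" for X x
    using P(5)[OF that] P(6) arrow_ide_left by metis
  then have "Ide A N = Zero A N N"
    by (intro arrow_eqI[OF mod_ide[OF N(1)] mod_zero[OF N(1) N(1)]]) (simp add: cmp_ide cmp_zero)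
  then show thesis using that A.zero_objectI[OF N(1)] by blast
qed

lemma yoneda_arrow:
  assumes "F \<in> Obj A" "G \<in> Obj A" "presents C F X0 x0 X1 r" "y \<in> El G X0" "AAr G r y = \<one>\<^bsub>AOb G X1\<^esub>"
  obtains a where "arrow A a F G" "cmp a X0 x0 = y"
proof -
  obtain \<eta> where \<eta>: "natural_trans C F G \<eta>" "\<eta> X0 x0 = y"
    by (rule yoneda[OF additive_Obj[OF assms(1)] additive_Obj[OF assms(2)] assms(3,4,5)])
  show thesis
    by (rule that[OF nat_arrow_in[OF assms(1,2) \<eta>(1)]])
      (simp add: cmp_nat_arrow[OF presentsD(3,1)[OF assms(3)]] \<eta>(2))
qed

lemma arrow_eq_generator:
  assumes "arrow A a F G" "arrow A b F G" "presents C F X0 x0 X1 r" "cmp a X0 x0 = cmp b X0 x0"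
  shows "a = b"
  by (rule arrow_eqI[OF assms(1,2)]) (rule nt_eq_generator[OF arrow_natural[OF assms(1)] arrow_natural[OF assms(2)] assms(3,4)])

text \<open>The biproduct is presented by \<open>t = r \<oplus> q\<close> between biproducts of the
  presenting objects. Its structure maps are given by the images of generators, and each equation is
  checked on a generator.\<close>

lemma ex_biproduct_A:
  assumes F: "F \<in> Obj A" and G: "G \<in> Obj A"
  shows "\<exists>D. biproduct A F G D"
proof -
  note Fa = additive_Obj[OF F] and Ga = additive_Obj[OF G]
  obtain X0 x0 X1 r where p: "presents C F X0 x0 X1 r" using F Obj_A fp_presents by metis
  obtain Y0 y0 Y1 q where p': "presents C G Y0 y0 Y1 q" using G Obj_A fp_presents by metis
  note P = presentsD[OF p] and P' = presentsD[OF p']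
  obtain B0 where "biproduct C X0 Y0 B0" using ex_biproduct P(3) P'(3) by blast
  then obtain i0 j0 p0 q0 where b: "arrow C i0 X0 B0" "arrow C j0 Y0 B0" "arrow C p0 B0 X0" "arrow C q0 B0 Y0"
    and e: "p0 \<cdot> i0 = Ide C X0" "q0 \<cdot> j0 = Ide C Y0" "q0 \<cdot> i0 = Zero C X0 Y0" "p0 \<cdot> j0 = Zero C Y0 X0"
    "(i0 \<cdot> p0) \<otimes>\<^bsub>Hom C B0 B0\<^esub> (j0 \<cdot> q0) = Ide C B0"
    by (rule biproductE)
  obtain B1 where "biproduct C X1 Y1 B1" using ex_biproduct P(4) P'(4) by blast
  then obtain i1 j1 p1 q1 where c: "arrow C i1 X1 B1" "arrow C j1 Y1 B1" "arrow C p1 B1 X1" "arrow C q1 B1 Y1"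
    and e1: "p1 \<cdot> i1 = Ide C X1" "q1 \<cdot> j1 = Ide C Y1" "q1 \<cdot> i1 = Zero C X1 Y1" "p1 \<cdot> j1 = Zero C Y1 X1"
    and cop: "\<And>W a b. arrow C a X1 W \<Longrightarrow> arrow C b Y1 W \<Longrightarrow> \<exists>h. arrow C h B1 W \<and> h \<cdot> i1 = a \<and> h \<cdot> j1 = b \<and>
        h = (a \<cdot> p1) \<otimes>\<^bsub>Hom C B1 W\<^esub> (b \<cdot> q1)"
    by (rule biproduct_pairing) blast
  note ir = arrow_comp[OF P(2) b(1)] and jq = arrow_comp[OF P'(2) b(2)]
  obtain t where t: "arrow C t B1 B0" "t \<cdot> i1 = i0 \<cdot> r" "t \<cdot> j1 = j0 \<cdot> q"
      "t = (i0 \<cdot> r \<cdot> p1) \<otimes>\<^bsub>Hom C B1 B0\<^esub> (j0 \<cdot> q \<cdot> q1)"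
    using cop[OF ir jq] by blast
  note irp = arrow_comp[OF c(3) ir] and jqq = arrow_comp[OF c(4) jq]
  \<comment> \<open>The projections commute with the relation maps, so by Yoneda they define maps
    out of the functor presented by \<open>t\<close>.\<close>
  have pt: "p0 \<cdot> t = r \<cdot> p1"
  proof -
    have "p0 \<cdot> (i0 \<cdot> r \<cdot> p1) = r \<cdot> p1"
      using arrow_assoc[OF c(3) ir b(3)] arrow_assoc[OF P(2) b(1) b(3)] e(1) arrow_ide_left[OF P(2)] by simp
    moreover have "p0 \<cdot> (j0 \<cdot> q \<cdot> q1) = Zero C B1 X0"
      using arrow_assoc[OF c(4) jq b(3)] arrow_assoc[OF P'(2) b(2) b(3)] e(4) zero_comp[OF P'(2) P(3)]
        zero_comp[OF c(4) P(3)] by simp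
    ultimately show ?thesis
      unfolding t(4) comp_sum[OF irp jqq b(3)] using sum_zero(1)[OF arrow_comp[OF c(3) P(2)]] by simp
  qed
  have qt: "q0 \<cdot> t = q \<cdot> q1"
  proof -
    have "q0 \<cdot> (j0 \<cdot> q \<cdot> q1) = q \<cdot> q1"
      using arrow_assoc[OF c(4) jq b(4)] arrow_assoc[OF P'(2) b(2) b(4)] e(2) arrow_ide_left[OF P'(2)] by simp
    moreover have "q0 \<cdot> (i0 \<cdot> r \<cdot> p1) = Zero C B1 Y0"
      using arrow_assoc[OF c(3) ir b(4)] arrow_assoc[OF P(2) b(1) b(4)] e(3) zero_comp[OF P(2) P'(3)]
        zero_comp[OF c(3) P'(3)] by simp
    ultimately show ?thesis
      unfolding t(4) comp_sum[OF irp jqq b(4)] using sum_zero(2)[OF arrow_comp[OF c(4) P'(2)]] by simp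
  qed
  obtain D d where D: "D \<in> Obj A" "presents C D B0 d B1 t" by (rule ex_presented[OF t(1)])
  note Da = additive_Obj[OF D(1)] and PD = presentsD[OF D(2)]
  obtain i where i: "arrow A i F D" "cmp i X0 x0 = AAr D i0 d"
  proof (rule yoneda_arrow[OF F D(1) p fun_closed[OF Da b(1) PD(1)]])
    show "AAr D r (AAr D i0 d) = \<one>\<^bsub>AOb D X1\<^esub>"
      using fun_comp[OF Da P(2) b(1) PD(1)] t(2) presents_relation(1)[OF Da D(2) c(1)] by simp
  qed
  obtain j where j: "arrow A j G D" "cmp j Y0 y0 = AAr D j0 d"
  proof (rule yoneda_arrow[OF G D(1) p' fun_closed[OF Da b(2) PD(1)]])
    show "AAr D q (AAr D j0 d) = \<one>\<^bsub>AOb D Y1\<^esub>"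
      using fun_comp[OF Da P'(2) b(2) PD(1)] t(3) presents_relation(1)[OF Da D(2) c(2)] by simp
  qed
  obtain pp where pp: "arrow A pp D F" "cmp pp B0 d = AAr F p0 x0"
  proof (rule yoneda_arrow[OF D(1) F D(2) fun_closed[OF Fa b(3) P(1)]])
    show "AAr F t (AAr F p0 x0) = \<one>\<^bsub>AOb F B1\<^esub>"
      using fun_comp[OF Fa t(1) b(3) P(1)] pt presents_relation(1)[OF Fa p c(3)] by simp
  qed
  obtain qq where qq: "arrow A qq D G" "cmp qq B0 d = AAr G q0 y0"
  proof (rule yoneda_arrow[OF D(1) G D(2) fun_closed[OF Ga b(4) P'(1)]])
    show "AAr G t (AAr G q0 y0) = \<one>\<^bsub>AOb G B1\<^esub>"
      using fun_comp[OF Ga t(1) b(4) P'(1)] qt presents_relation(1)[OF Ga p' c(4)] by simp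
  qed
  have "biproduct A F G D"
  proof (rule A.biproductI[OF i(1) j(1) pp(1) qq(1)])
    show "pp \<cdot>\<^bsub>A\<^esub> i = Ide A F"
      by (rule arrow_eq_generator[OF mod_comp[OF i(1) pp(1)] mod_ide[OF F] p])
        (simp add: cmp_comp[OF i(1) pp(1) P(3,1)] i(2) cmp_natural[OF pp(1) b(1) PD(1)] pp(2)
          fun_comp[OF Fa b(1) b(3) P(1), symmetric] e(1) fun_ide[OF Fa P(3,1)] cmp_ide[OF P(3,1)])
    show "qq \<cdot>\<^bsub>A\<^esub> j = Ide A G"
      by (rule arrow_eq_generator[OF mod_comp[OF j(1) qq(1)] mod_ide[OF G] p'])
        (simp add: cmp_comp[OF j(1) qq(1) P'(3,1)] j(2) cmp_natural[OF qq(1) b(2) PD(1)] qq(2)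
          fun_comp[OF Ga b(2) b(4) P'(1), symmetric] e(2) fun_ide[OF Ga P'(3,1)] cmp_ide[OF P'(3,1)])
    show "qq \<cdot>\<^bsub>A\<^esub> i = Zero A F G"
      by (rule arrow_eq_generator[OF mod_comp[OF i(1) qq(1)] mod_zero[OF F G] p])
        (simp add: cmp_comp[OF i(1) qq(1) P(3,1)] i(2) cmp_natural[OF qq(1) b(1) PD(1)] qq(2)
          fun_comp[OF Ga b(1) b(4) P'(1), symmetric] e(3) fun_zero[OF Ga P(3) P'(3,1)] cmp_zero[OF P(3,1)])
    show "pp \<cdot>\<^bsub>A\<^esub> j = Zero A G F"
      by (rule arrow_eq_generator[OF mod_comp[OF j(1) pp(1)] mod_zero[OF G F] p'])
        (simp add: cmp_comp[OF j(1) pp(1) P'(3,1)] j(2) cmp_natural[OF pp(1) b(2) PD(1)] pp(2)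
          fun_comp[OF Fa b(2) b(3) P(1), symmetric] e(4) fun_zero[OF Fa P'(3) P(3,1)] cmp_zero[OF P'(3,1)])
    note ip = mod_comp[OF pp(1) i(1)] and jqA = mod_comp[OF qq(1) j(1)]
    have "cmp (i \<cdot>\<^bsub>A\<^esub> pp) B0 d = AAr D (i0 \<cdot> p0) d"
      by (simp add: cmp_comp[OF pp(1) i(1) PD(3,1)] pp(2) cmp_natural[OF i(1) b(3) P(1)] i(2)
          fun_comp[OF Da b(3) b(1) PD(1)])
    moreover have "cmp (j \<cdot>\<^bsub>A\<^esub> qq) B0 d = AAr D (j0 \<cdot> q0) d"
      by (simp add: cmp_comp[OF qq(1) j(1) PD(3,1)] qq(2) cmp_natural[OF j(1) b(4) P'(1)] j(2)
          fun_comp[OF Da b(4) b(2) PD(1)])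
    ultimately have "cmp ((i \<cdot>\<^bsub>A\<^esub> pp) \<otimes>\<^bsub>Hom A D D\<^esub> (j \<cdot>\<^bsub>A\<^esub> qq)) B0 d = cmp (Ide A D) B0 d"
      by (simp add: cmp_sum[OF ip jqA PD(3,1)] cmp_ide[OF PD(3,1)] fun_ide[OF Da PD(3,1)]
          fun_sum[OF Da arrow_comp[OF b(3) b(1)] arrow_comp[OF b(4) b(2)] PD(1), symmetric] e(5))
    then show "(i \<cdot>\<^bsub>A\<^esub> pp) \<otimes>\<^bsub>Hom A D D\<^esub> (j \<cdot>\<^bsub>A\<^esub> qq) = Ide A D"
      by (rule arrow_eq_generator[OF A.arrow_sum[OF ip jqA] mod_ide[OF D(1)] D(2)])
  qed
  then show ?thesis by blast
qed

text \<open>A monic has zero kernel, hence is pointwise injective, hence is the kernel of its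
  pointwise cokernel; dually for epics.\<close>

lemma abelian_A: "abelian_category A"
proof
  show "\<exists>Z. zero_object A Z" using zero_functor by blast
  show "\<exists>B. biproduct A F G B" if "F \<in> Obj A" "G \<in> Obj A" for F G using ex_biproduct_A[OF that] .
  fix F G s assume FG: "F \<in> Obj A" "G \<in> Obj A"
  show "\<exists>K k. is_kernel A F G s K k" if "s \<in> Arr A F G"
  proof -
    have s: "arrow A s F G" using that FG by (simp add: arrow_def)
    show ?thesis using pointwise_kernel[OF s] is_kernelI[OF s] by metis
  qed
  show "\<exists>L l. is_cokernel A F G s L l" if "s \<in> Arr A F G"
  proof -
    have s: "arrow A s F G" using that FG by (simp add: arrow_def)
    show ?thesis using pointwise_cokernel[OF s] is_cokernelI[OF s] by metis
  qed
  show "\<exists>Z\<in>Obj A. \<exists>g\<in>Arr A G Z. is_kernel A G Z g F s" if "monic A F G s"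
  proof -
    have s: "arrow A s F G" using that FG by (simp add: arrow_def monic_def)
    obtain K k where k: "arrow A k K F" "pinj k K F" "pexact k s K F G" by (rule pointwise_kernel[OF s])
    have K: "K \<in> Obj A" using k(1) by (rule arrowD)
    have "s \<cdot>\<^bsub>A\<^esub> k = Zero A K G" using is_kernelI[OF s k] by (simp add: is_kernel_def)
    also have "\<dots> = s \<cdot>\<^bsub>A\<^esub> Zero A K F" using A.comp_zero[OF s K] by simp
    finally have "k = Zero A K F"
      using that K k(1) A.arrow_zero[OF K FG(1)] unfolding monic_def arrow_def by blast
    then have inj: "pinj s F G"
      using k(3) cmp_zero[of _ _ K F] unfolding pexact_def pinj_def by metis
    obtain L l where l: "arrow A l G L" "psurj l G L" "pexact s l F G L" by (rule pointwise_cokernel[OF s])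
    show ?thesis using is_kernelI[OF l(1) s inj l(3)] l(1) by (auto simp: arrow_def)
  qed
  show "\<exists>W\<in>Obj A. \<exists>g\<in>Arr A W F. is_cokernel A W F g G s" if "epic A F G s"
  proof -
    have s: "arrow A s F G" using that FG by (simp add: arrow_def epic_def)
    obtain L l where l: "arrow A l G L" "psurj l G L" "pexact s l F G L" by (rule pointwise_cokernel[OF s])
    have L: "L \<in> Obj A" using l(1) by (rule arrowD)
    have "l \<cdot>\<^bsub>A\<^esub> s = Zero A F L" using is_cokernelI[OF s l] by (simp add: is_cokernel_def)
    also have "\<dots> = Zero A G L \<cdot>\<^bsub>A\<^esub> s" using A.zero_comp[OF s L] by simp
    finally have "l = Zero A G L"
      using that L l(1) A.arrow_zero[OF FG(2) L] unfolding epic_def arrow_def by blast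
    then have surj: "psurj s F G"
      using l(3) cmp_zero[of _ _ G L] unfolding pexact_def psurj_def by metis
    obtain K k where k: "arrow A k K F" "pinj k K F" "pexact k s K F G" by (rule pointwise_kernel[OF s])
    show ?thesis using is_cokernelI[OF k(1) s surj k(3)] k(1) by (auto simp: arrow_def)
  qed
qed

end

section \<open>Reflective localizations of abelian categories\<close>

text \<open>Meant for the hom sets of the Serre quotient, whose group laws are not known beforehand:
  they are inherited along a surjective multiplicative map from the hom groups between
  reflections.\<close>

lemma comm_group_transport:
  assumes G: "comm_group G" and bij: "e ` carrier G = carrier H"
    and mult: "\<And>x y. x \<in> carrier G \<Longrightarrow> y \<in> carrier G \<Longrightarrow> e x \<otimes>\<^bsub>H\<^esub> e y = e (x \<otimes>\<^bsub>G\<^esub> y)"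
    and one: "\<one>\<^bsub>H\<^esub> = e \<one>\<^bsub>G\<^esub>"
  shows "comm_group H"
proof -
  interpret G: comm_group G by fact
  show ?thesis
  proof (rule comm_groupI, unfold bij[symmetric])
    show "\<one>\<^bsub>H\<^esub> \<in> e ` carrier G" using one by blast
    fix x assume "x \<in> e ` carrier G"
    then obtain a where a: "a \<in> carrier G" "x = e a" by blast
    show "\<one>\<^bsub>H\<^esub> \<otimes>\<^bsub>H\<^esub> x = x" using a one mult by simp
    show "\<exists>y\<in>e ` carrier G. y \<otimes>\<^bsub>H\<^esub> x = \<one>\<^bsub>H\<^esub>"
      using a one mult[OF G.inv_closed[OF a(1)] a(1)] by (intro bexI[of _ "e (inv\<^bsub>G\<^esub> a)"]) auto
    fix y assume "y \<in> e ` carrier G"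
    then obtain b where b: "b \<in> carrier G" "y = e b" by blast
    show "x \<otimes>\<^bsub>H\<^esub> y \<in> e ` carrier G" using a b mult by simp
    show "x \<otimes>\<^bsub>H\<^esub> y = y \<otimes>\<^bsub>H\<^esub> x" using a b mult G.m_comm by simp
    fix z assume "z \<in> e ` carrier G"
    then obtain c where c: "c \<in> carrier G" "z = e c" by blast
    show "x \<otimes>\<^bsub>H\<^esub> y \<otimes>\<^bsub>H\<^esub> z = x \<otimes>\<^bsub>H\<^esub> (y \<otimes>\<^bsub>H\<^esub> z)" using a b c mult G.m_assoc by simp
  qed
qed

lemma adjunctionI:
  assumes "additive_functor C D F" "additive_functor D C G"
    and "\<And>X Y. X \<in> Obj C \<Longrightarrow> Y \<in> Obj D \<Longrightarrow> bij_betw (\<phi> X Y) (Arr D (FOb F X) Y) (Arr C X (FOb G Y))"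
    and nat: "\<And>X' X Y Y' a f b. arrow C a X' X \<Longrightarrow> arrow D f (FOb F X) Y \<Longrightarrow> arrow D b Y Y' \<Longrightarrow>
      \<phi> X' Y' (b \<cdot>\<^bsub>D\<^esub> f \<cdot>\<^bsub>D\<^esub> FAr F a) = FAr G b \<cdot>\<^bsub>C\<^esub> \<phi> X Y f \<cdot>\<^bsub>C\<^esub> a"
  shows "adjunction C D F G"
  unfolding adjunction_def
proof (intro conjI exI[of _ \<phi>] ballI)
  show "\<phi> X' Y' (b \<cdot>\<^bsub>D\<^esub> f \<cdot>\<^bsub>D\<^esub> FAr F a) = FAr G b \<cdot>\<^bsub>C\<^esub> \<phi> X Y f \<cdot>\<^bsub>C\<^esub> a"
    if "X' \<in> Obj C" "X \<in> Obj C" "Y \<in> Obj D" "Y' \<in> Obj D" "a \<in> Arr C X' X" "f \<in> Arr D (FOb F X) Y" "b \<in> Arr D Y Y'"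
    for X' X Y Y' a f b
    using nat[of a X' X f Y b Y'] that additive_functor.fun_obj[OF assms(1) that(2)] by (simp add: arrow_def)
qed (use assms(1-3) in auto)

text \<open>The assumptions combine a calculus of fractions for the morphisms with kernel and
  cokernel in \<open>S\<close> with a reflection of every object to a local one. In this form the
  passage to the Serre quotient involves neither triangles nor functors on \<open>U\<close>.\<close>

locale reflective_localization = abelian_category A for A :: "('o, 'm, 'z) precat_scheme" (structure) +
  fixes S B :: "'o set"
  assumes serre: "serre_subcat A S"
    and S_additive: "additive_category (full_subcat A S)"
    and B_sub: "B \<subseteq> Obj A"
    and B_additive: "additive_category (full_subcat A B)"
    and serre_iso_ide: "X \<in> Obj A \<Longrightarrow> serre_iso A S X X (Ide A X)"
    and serre_iso_comp: "\<lbrakk>X \<in> Obj A; Y \<in> Obj A; Z \<in> Obj A; serre_iso A S X Y s; serre_iso A S Y Z t\<rbrakk>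
      \<Longrightarrow> serre_iso A S X Z (t \<cdot> s)"
    and ore: "\<lbrakk>arrow A f W Y; arrow A s V Y; serre_iso A S V Y s\<rbrakk>
      \<Longrightarrow> \<exists>P t f'. arrow A t P W \<and> serre_iso A S P W t \<and> arrow A f' P V \<and> f \<cdot> t = s \<cdot> f'"
    and cancel: "\<lbrakk>arrow A h P Y; arrow A s Y L; serre_iso A S Y L s; s \<cdot> h = Zero A P L\<rbrakk>
      \<Longrightarrow> \<exists>K k. arrow A k K P \<and> serre_iso A S K P k \<and> h \<cdot> k = Zero A K Y"
    and reflect: "X \<in> Obj A \<Longrightarrow> \<exists>L\<in>B. \<exists>s. serre_iso A S X L s"
    and local: "\<lbrakk>L \<in> B; arrow A s X Y; serre_iso A S X Y s; arrow A p X L\<rbrakk> \<Longrightarrow> \<exists>!q. arrow A q Y L \<and> q \<cdot> s = p"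
begin

section \<open>The reflection functor and its adjunction\<close>

definition weq :: "'m \<Rightarrow> 'o \<Rightarrow> 'o \<Rightarrow> bool" where
  "weq s X Y \<longleftrightarrow> arrow A s X Y \<and> serre_iso A S X Y s"

lemma weq_arrow: "weq s X Y \<Longrightarrow> arrow A s X Y"
  by (simp add: weq_def)

lemma weq_comp: "weq s X Y \<Longrightarrow> weq t Y Z \<Longrightarrow> weq (t \<cdot> s) X Z"
  unfolding weq_def using arrow_comp serre_iso_comp by (blast dest: arrowD)

lemma weq_ide: "X \<in> Obj A \<Longrightarrow> weq (Ide A X) X X"
  by (simp add: weq_def arrow_ide serre_iso_ide)

lemma B_obj: "L \<in> B \<Longrightarrow> L \<in> Obj A"
  using B_sub by blast

lemma S_obj: "M \<in> S \<Longrightarrow> M \<in> Obj A"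
  using serre by (auto simp: serre_subcat_def)

lemma local_ex:
  assumes "L \<in> B" "weq s X Y" "arrow A p X L"
  obtains q where "arrow A q Y L" "q \<cdot> s = p"
  using local[of L s X Y p] assms by (auto simp: weq_def)

lemma local_eq: "\<lbrakk>L \<in> B; weq s X Y; arrow A q Y L; arrow A q' Y L; q \<cdot> s = q' \<cdot> s\<rbrakk> \<Longrightarrow> q = q'"
  using local[of L s X Y "q \<cdot> s"] arrow_comp[of s X Y q L] by (auto simp: weq_def)

definition Lo :: "'o \<Rightarrow> 'o" where
  "Lo X = (SOME L. L \<in> B \<and> (\<exists>s. serre_iso A S X L s))"

definition un :: "'o \<Rightarrow> 'm" where
  "un X = (SOME s. serre_iso A S X (Lo X) s)"

lemma Lo_in: "X \<in> Obj A \<Longrightarrow> Lo X \<in> B"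
  and un_weq: "X \<in> Obj A \<Longrightarrow> weq (un X) X (Lo X)"
proof -
  assume X: "X \<in> Obj A"
  then have "\<exists>L. L \<in> B \<and> (\<exists>s. serre_iso A S X L s)" using reflect by blast
  from someI_ex[OF this] have L: "Lo X \<in> B" "\<exists>s. serre_iso A S X (Lo X) s" by (simp_all add: Lo_def)
  from someI_ex[OF L(2)] have "serre_iso A S X (Lo X) (un X)" by (simp add: un_def)
  then show "weq (un X) X (Lo X)" using X B_obj[OF L(1)] by (simp add: weq_def serre_iso_def arrow_def)
  show "Lo X \<in> B" by (rule L(1))
qed

lemma un_arrow: "X \<in> Obj A \<Longrightarrow> arrow A (un X) X (Lo X)"
  using un_weq weq_arrow by blast

lemma Lo_obj: "X \<in> Obj A \<Longrightarrow> Lo X \<in> Obj A"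
  using Lo_in B_obj by blast

definition Q :: "('o, 'm, 'o, 'm) cat_functor" where
  "Q = \<lparr>FOb = Lo, FAr = (\<lambda>f. THE h. arrow A h (Lo (Dom A f)) (Lo (Cod A f)) \<and> h \<cdot> un (Dom A f) = un (Cod A f) \<cdot> f)\<rparr>"

lemma FOb_Q [simp]: "FOb Q = Lo"
  by (simp add: Q_def)

text \<open>A map from \<open>Lo X\<close> to an object of \<open>B\<close> is determined by its
  composite with the unit, so each functor law for \<open>Q\<close> is one square to check.\<close>

lemma Q_unique:
  assumes f: "arrow A f X Y" and h: "arrow A h (Lo X) (Lo Y)" "h \<cdot> un X = un Y \<cdot> f"
  shows "FAr Q f = h"
proof -
  note X = arrowD(1,2)[OF f]
  have "(THE h. arrow A h (Lo X) (Lo Y) \<and> h \<cdot> un X = un Y \<cdot> f) = h"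
  proof (rule the_equality)
    show "arrow A h (Lo X) (Lo Y) \<and> h \<cdot> un X = un Y \<cdot> f" using h by blast
    show "h' = h" if "arrow A h' (Lo X) (Lo Y) \<and> h' \<cdot> un X = un Y \<cdot> f" for h'
      using local_eq[OF Lo_in[OF X(2)] un_weq[OF X(1)], of h' h] that h by simp
  qed
  then show ?thesis using arrow_dom_cod[OF f] by (simp add: Q_def)
qed

lemma Q_arrow: "arrow A f X Y \<Longrightarrow> arrow A (FAr Q f) (Lo X) (Lo Y)"
  and Q_natural: "arrow A f X Y \<Longrightarrow> FAr Q f \<cdot> un X = un Y \<cdot> f"
proof -
  assume f: "arrow A f X Y"
  note X = arrowD(1,2)[OF f]
  obtain h where h: "arrow A h (Lo X) (Lo Y)" "h \<cdot> un X = un Y \<cdot> f"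
    by (rule local_ex[OF Lo_in[OF X(2)] un_weq[OF X(1)] arrow_comp[OF f un_arrow[OF X(2)]]])
  then show "arrow A (FAr Q f) (Lo X) (Lo Y)" "FAr Q f \<cdot> un X = un Y \<cdot> f" using Q_unique[OF f h] by simp_all
qed

lemma Q_sum:
  assumes f: "arrow A f X Y" and g: "arrow A g X Y"
  shows "FAr Q (f \<otimes>\<^bsub>Hom A X Y\<^esub> g) = FAr Q f \<otimes>\<^bsub>Hom A (Lo X) (Lo Y)\<^esub> FAr Q g"
proof (rule Q_unique[OF arrow_sum[OF f g] arrow_sum[OF Q_arrow[OF f] Q_arrow[OF g]]])
  note X = arrowD(1,2)[OF f]
  show "(FAr Q f \<otimes>\<^bsub>Hom A (Lo X) (Lo Y)\<^esub> FAr Q g) \<cdot> un X = un Y \<cdot> (f \<otimes>\<^bsub>Hom A X Y\<^esub> g)"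
    using sum_comp[OF un_arrow[OF X(1)] Q_arrow[OF f] Q_arrow[OF g]] comp_sum[OF f g un_arrow[OF X(2)]]
      Q_natural[OF f] Q_natural[OF g] by simp
qed

lemma Q_comp:
  assumes f: "arrow A f X Y" and g: "arrow A g Y Z"
  shows "FAr Q (g \<cdot> f) = FAr Q g \<cdot> FAr Q f"
proof (rule Q_unique[OF arrow_comp[OF f g] arrow_comp[OF Q_arrow[OF f] Q_arrow[OF g]]])
  note u = un_arrow[OF arrowD(1)[OF f]] un_arrow[OF arrowD(2)[OF f]] un_arrow[OF arrowD(2)[OF g]]
  show "FAr Q g \<cdot> FAr Q f \<cdot> un X = un Z \<cdot> (g \<cdot> f)"
    using arrow_assoc[OF u(1) Q_arrow[OF f] Q_arrow[OF g]] arrow_assoc[OF f u(2) Q_arrow[OF g]]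
      arrow_assoc[OF f g u(3)] Q_natural[OF f] Q_natural[OF g] by simp
qed

lemma Q_ide: "X \<in> Obj A \<Longrightarrow> FAr Q (Ide A X) = Ide A (Lo X)"
  by (rule Q_unique[OF arrow_ide arrow_ide[OF Lo_obj]])
    (simp_all add: arrow_ide_left[OF un_arrow] arrow_ide_right[OF un_arrow])

lemma arrow_B: "arrow (full_subcat A B) f X Y \<longleftrightarrow> X \<in> B \<and> Y \<in> B \<and> arrow A f X Y"
  by (rule arrow_full_subcat[OF B_sub])

lemma additive_Q: "additive_functor A (full_subcat A B) Q"
proof -
  interpret BB: additive_category "full_subcat A B" by (rule B_additive)
  show ?thesis
  proof
    show "FOb Q X \<in> Obj (full_subcat A B)" if "X \<in> Obj A" for X using Lo_in[OF that] by simp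
    show "FAr Q (Ide A X) = Ide (full_subcat A B) (FOb Q X)" if "X \<in> Obj A" for X using Q_ide[OF that] by simp
    fix X Y assume X: "X \<in> Obj A" "Y \<in> Obj A"
    show "FAr Q \<in> hom (Hom A X Y) (Hom (full_subcat A B) (FOb Q X) (FOb Q Y))"
      by (rule homI) (use X Q_arrow[of _ X Y] Q_sum[of _ X Y] in \<open>simp_all add: arrow_def\<close>)
    fix Z f g assume "Z \<in> Obj A" "f \<in> Arr A X Y" "g \<in> Arr A Y Z"
    then show "FAr Q (g \<cdot> f) = FAr Q g \<cdot>\<^bsub>full_subcat A B\<^esub> FAr Q f"
      using Q_comp[of f X Y g Z] X by (simp add: arrow_def)
  qed
qed

text \<open>The adjunction bijection is composition with the unit; that it is bijective is exactly
  locality of the objects of \<open>B\<close>.\<close>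

lemma adjunction_Q: "adjunction A (full_subcat A B) Q incl_functor"
proof -
  have bij: "bij_betw (\<lambda>f. f \<cdot> un X) (Arr A (Lo X) Y) (Arr A X Y)" if X: "X \<in> Obj A" and Y: "Y \<in> B" for X Y
  proof (rule bij_betw_imageI)
    have ar: "f \<in> Arr A (Lo X) Y \<longleftrightarrow> arrow A f (Lo X) Y" "f \<in> Arr A X Y \<longleftrightarrow> arrow A f X Y" for f
      using X Y Lo_obj B_obj by (simp_all add: arrow_def)
    show "inj_on (\<lambda>f. f \<cdot> un X) (Arr A (Lo X) Y)"
      using local_eq[OF Y un_weq[OF X]] by (intro inj_onI) (simp add: ar)
    show "(\<lambda>f. f \<cdot> un X) ` Arr A (Lo X) Y = Arr A X Y"
    proof (intro equalityI subsetI)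
      show "g \<in> Arr A X Y" if "g \<in> (\<lambda>f. f \<cdot> un X) ` Arr A (Lo X) Y" for g
        using that arrow_comp[OF un_arrow[OF X]] by (auto simp: ar)
      fix g assume "g \<in> Arr A X Y"
      then have g: "arrow A g X Y" by (simp add: ar)
      obtain f where "arrow A f (Lo X) Y" "f \<cdot> un X = g" by (rule local_ex[OF Y un_weq[OF X] g])
      then show "g \<in> (\<lambda>f. f \<cdot> un X) ` Arr A (Lo X) Y" by (auto simp: ar)
    qed
  qed
  have nat: "(b \<cdot> f \<cdot> FAr Q a) \<cdot> un X' = b \<cdot> (f \<cdot> un X) \<cdot> a"
    if a: "arrow A a X' X" and f: "arrow A f (Lo X) Y" and b: "arrow A b Y Y'" for X' X Y Y' a f b
  proof -
    note u = un_arrow[OF arrowD(1)[OF a]] un_arrow[OF arrowD(2)[OF a]]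
    have bf: "arrow A (b \<cdot> f) (Lo X) Y'" using arrow_comp[OF f b] .
    have "(b \<cdot> f \<cdot> FAr Q a) \<cdot> un X' = (b \<cdot> f) \<cdot> (un X \<cdot> a)"
      using arrow_assoc[OF u(1) Q_arrow[OF a] bf] Q_natural[OF a] by simp
    also have "\<dots> = b \<cdot> f \<cdot> un X \<cdot> a" using arrow_assoc[OF a u(2) bf] by simp
    also have "b \<cdot> f \<cdot> un X = b \<cdot> (f \<cdot> un X)" using arrow_assoc[OF u(2) f b] .
    finally show ?thesis .
  qed
  show ?thesis
    by (intro adjunctionI[OF additive_Q additive_incl_functor[OF B_sub B_additive], of "\<lambda>X Y f. f \<cdot> un X"])
      (auto simp: incl_functor_def arrow_B bij intro: nat)
qed

text \<open>The fractions that represent a given morphism of reflections: composition with the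
  units turns the calculus of fractions into composition in \<open>B\<close>.\<close>

definition cl :: "'o \<Rightarrow> 'o \<Rightarrow> 'm \<Rightarrow> ('o \<times> 'm \<times> 'm) set" where
  "cl X Y h = {(W, s, f). weq s W X \<and> arrow A f W Y \<and> h \<cdot> (un X \<cdot> s) = un Y \<cdot> f}"

lemma cl_iff: "(W, s, f) \<in> cl X Y h \<longleftrightarrow> weq s W X \<and> arrow A f W Y \<and> h \<cdot> (un X \<cdot> s) = un Y \<cdot> f"
  by (simp add: cl_def)

section \<open>Classes of fractions as maps of reflections\<close>

lemma fractions_iff:
  "X \<in> Obj A \<Longrightarrow> Y \<in> Obj A \<Longrightarrow> (W, s, f) \<in> fractions A S X Y \<longleftrightarrow> weq s W X \<and> arrow A f W Y"
  by (auto simp: fractions_def weq_def arrow_def serre_iso_def)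

lemma weq_un: "weq s W X \<Longrightarrow> weq (un X \<cdot> s) W (Lo X)"
  using weq_comp un_weq weq_arrow arrowD by metis

text \<open>Since \<open>un X \<cdot> s\<close> is a weak equivalence and \<open>Lo Y\<close> is
  local, \<open>un Y \<cdot> f\<close> extends along it.\<close>

lemma fraction_morphism:
  assumes s: "weq s W X" and f: "arrow A f W Y"
  obtains h where "arrow A h (Lo X) (Lo Y)" "(W, s, f) \<in> cl X Y h"
proof -
  note Y = arrowD(2)[OF f]
  obtain h where "arrow A h (Lo X) (Lo Y)" "h \<cdot> (un X \<cdot> s) = un Y \<cdot> f"
    by (rule local_ex[OF Lo_in[OF Y] weq_un[OF s] arrow_comp[OF f un_arrow[OF Y]]])
  then show thesis using that s f by (simp add: cl_iff)
qed

lemma cl_unique: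
  assumes h: "arrow A h (Lo X) (Lo Y)" "arrow A h' (Lo X) (Lo Y)" and r: "(W, s, f) \<in> cl X Y h" "(W, s, f) \<in> cl X Y h'"
  shows "h = h'"
proof -
  have "Y \<in> Obj A" "weq s W X" using r by (auto simp: cl_iff dest: arrowD)
  then show ?thesis using local_eq[OF Lo_in weq_un h] r by (simp add: cl_iff)
qed

lemma ore_weq:
  assumes "arrow A f W Y" "weq s V Y"
  obtains P t f' where "weq t P W" "arrow A f' P V" "f \<cdot> t = s \<cdot> f'"
  using ore[OF assms(1) weq_arrow[OF assms(2)]] assms(2) unfolding weq_def by blast

lemma cl_restrict:
  assumes r: "(W, s, f) \<in> cl X Y h" and h: "arrow A h (Lo X) (Lo Y)" and t: "weq t P W"
  shows "(P, s \<cdot> t, f \<cdot> t) \<in> cl X Y h"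
proof -
  have s: "weq s W X" and f: "arrow A f W Y" and e: "h \<cdot> (un X \<cdot> s) = un Y \<cdot> f" using r by (auto simp: cl_iff)
  note sa = weq_arrow[OF s] and ta = weq_arrow[OF t]
  note u = un_arrow[OF arrowD(2)[OF sa]] un_arrow[OF arrowD(2)[OF f]]
  have "h \<cdot> (un X \<cdot> (s \<cdot> t)) = un Y \<cdot> (f \<cdot> t)"
    using arrow_assoc[OF ta sa u(1)] arrow_assoc[OF ta arrow_comp[OF sa u(1)] h] arrow_assoc[OF ta f u(2)] e by simp
  then show ?thesis using weq_comp[OF t s] arrow_comp[OF ta f] by (simp add: cl_iff)
qed

text \<open>The fraction belongs to some \<open>h'\<close>; its restriction then belongs to both
  \<open>h\<close> and \<open>h'\<close>, and one fraction determines its morphism. As in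
  \<open>frac_eq\<close>, it is \<open>s \<cdot> t\<close>, and not \<open>t\<close> alone, that is
  a weak equivalence.\<close>

lemma cl_restrictD:
  assumes s: "weq s W X" and f: "arrow A f W Y" and h: "arrow A h (Lo X) (Lo Y)" and t: "arrow A t P W"
    and st: "weq (s \<cdot> t) P X" and r: "(P, s \<cdot> t, f \<cdot> t) \<in> cl X Y h"
  shows "(W, s, f) \<in> cl X Y h"
proof -
  obtain h' where h': "arrow A h' (Lo X) (Lo Y)" "(W, s, f) \<in> cl X Y h'" by (rule fraction_morphism[OF s f])
  note sa = weq_arrow[OF s]
  note u = un_arrow[OF arrowD(2)[OF sa]] un_arrow[OF arrowD(2)[OF f]]
  have "h' \<cdot> (un X \<cdot> (s \<cdot> t)) = un Y \<cdot> (f \<cdot> t)"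
    using arrow_assoc[OF t sa u(1)] arrow_assoc[OF t arrow_comp[OF sa u(1)] h'(1)] arrow_assoc[OF t f u(2)] h'(2)
    by (simp add: cl_iff)
  then have "(P, s \<cdot> t, f \<cdot> t) \<in> cl X Y h'" using st arrow_comp[OF t f] by (simp add: cl_iff)
  then show ?thesis using cl_unique[OF h h'(1) r] h'(2) by simp
qed

text \<open>From a common refinement, \<open>cl_restrictD\<close> returns to the second fraction.
  Conversely an Ore square gives a common denominator on which the numerators agree after the unit,
  and \<open>cancel\<close> makes them agree on a further refinement.\<close>

lemma frac_eq_iff:
  assumes h: "arrow A h (Lo X) (Lo Y)" and r: "(W, s, f) \<in> cl X Y h" and t: "weq t W' X" and g: "arrow A g W' Y"
  shows "frac_eq A S X (W, s, f) (W', t, g) \<longleftrightarrow> (W', t, g) \<in> cl X Y h"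
proof
  have s: "weq s W X" and f: "arrow A f W Y" and e: "h \<cdot> (un X \<cdot> s) = un Y \<cdot> f" using r by (auto simp: cl_iff)
  note sa = weq_arrow[OF s] and ta = weq_arrow[OF t]
  note X = arrowD(2)[OF sa] and Y = arrowD(2)[OF f]
  {
    assume "frac_eq A S X (W, s, f) (W', t, g)"
    then obtain P u v where P: "P \<in> Obj A" "u \<in> Arr A P W" "v \<in> Arr A P W'" and "serre_iso A S P X (s \<cdot> u)"
      and eq: "s \<cdot> u = t \<cdot> v" "f \<cdot> u = g \<cdot> v" by (auto simp: frac_eq_def)
    then have su: "weq (s \<cdot> u) P X" and tv: "weq (t \<cdot> v) P X" and u: "arrow A u P W" and v: "arrow A v P W'"
      using X arrowD(1)[OF sa] arrowD(1)[OF ta] by (simp_all add: weq_def arrow_def serre_iso_def)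
    have uX: "arrow A (un X) X (Lo X)" "arrow A (un Y) Y (Lo Y)" using un_arrow X Y by auto
    have "h \<cdot> (un X \<cdot> (s \<cdot> u)) = un Y \<cdot> (f \<cdot> u)"
      using arrow_assoc[OF u sa uX(1)] arrow_assoc[OF u arrow_comp[OF sa uX(1)] h] arrow_assoc[OF u f uX(2)] e by simp
    then have "(P, t \<cdot> v, g \<cdot> v) \<in> cl X Y h" using eq tv arrow_comp[OF v g] by (simp add: cl_iff)
    then show "(W', t, g) \<in> cl X Y h" by (rule cl_restrictD[OF t g h v tv])
  next
    assume r': "(W', t, g) \<in> cl X Y h"
    obtain P u v where u: "weq u P W" and v: "arrow A v P W'" and eq: "s \<cdot> u = t \<cdot> v" by (rule ore_weq[OF sa t])
    note ua = weq_arrow[OF u]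
    note fu = arrow_comp[OF ua f] and gv = arrow_comp[OF v g]
    have uX: "arrow A (un X) X (Lo X)" "arrow A (un Y) Y (Lo Y)" using un_arrow X Y by auto
    have "un Y \<cdot> (f \<cdot> u) = h \<cdot> (un X \<cdot> (s \<cdot> u))"
      using arrow_assoc[OF ua sa uX(1)] arrow_assoc[OF ua arrow_comp[OF sa uX(1)] h] arrow_assoc[OF ua f uX(2)] e by simp
    also have "\<dots> = un Y \<cdot> (g \<cdot> v)"
      using eq arrow_assoc[OF v ta uX(1)] arrow_assoc[OF v arrow_comp[OF ta uX(1)] h] arrow_assoc[OF v g uX(2)] r'
      by (simp add: cl_iff)
    finally have *: "un Y \<cdot> (f \<cdot> u) = un Y \<cdot> (g \<cdot> v)" .
    \<comment> \<open>\<open>cancel\<close> speaks of a map killed by a weak equivalence, so it is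
      applied to the difference of the numerators.\<close>
    let ?d = "(f \<cdot> u) \<otimes>\<^bsub>Hom A P Y\<^esub> inv\<^bsub>Hom A P Y\<^esub> (g \<cdot> v)"
    have d: "arrow A ?d P Y" using arrow_sum[OF fu arrow_neg[OF gv]] .
    have "un Y \<cdot> ?d = Zero A P (Lo Y)"
      using comp_sum[OF fu arrow_neg[OF gv] uX(2)] comp_neg[OF gv uX(2)] *
        diff_eq_zero_iff[OF arrow_comp[OF gv uX(2)] arrow_comp[OF gv uX(2)]] by simp
    then obtain K k where k: "weq k K P" "?d \<cdot> k = Zero A K Y"
      using cancel[OF d uX(2)] un_weq[OF Y] by (auto simp: weq_def)
    note ka = weq_arrow[OF k(1)]
    have "(f \<cdot> u \<cdot> k) \<otimes>\<^bsub>Hom A K Y\<^esub> inv\<^bsub>Hom A K Y\<^esub> (g \<cdot> v \<cdot> k) = Zero A K Y"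
      using k(2) sum_comp[OF ka fu arrow_neg[OF gv]] neg_comp[OF ka gv] by simp
    then have fg: "f \<cdot> u \<cdot> k = g \<cdot> v \<cdot> k"
      using diff_eq_zero_iff[OF arrow_comp[OF ka fu] arrow_comp[OF ka gv]] by simp
    have "weq (s \<cdot> (u \<cdot> k)) K X" using weq_comp[OF weq_comp[OF k(1) u] s] .
    moreover have "s \<cdot> (u \<cdot> k) = t \<cdot> (v \<cdot> k)"
      using arrow_assoc[OF ka ua sa] arrow_assoc[OF ka v ta] eq by simp
    moreover have "f \<cdot> (u \<cdot> k) = g \<cdot> (v \<cdot> k)" using fg arrow_assoc[OF ka ua f] arrow_assoc[OF ka v g] by simp
    ultimately show "frac_eq A S X (W, s, f) (W', t, g)"
      unfolding frac_eq_def prod.case using arrow_comp[OF ka ua] arrow_comp[OF ka v]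
      by (intro bexI[of _ K] bexI[of _ "u \<cdot> k"] bexI[of _ "v \<cdot> k"] conjI) (auto simp: weq_def arrow_def)
  }
qed

lemma frac_class_cl:
  assumes h: "arrow A h (Lo X) (Lo Y)" and r: "(W, s, f) \<in> cl X Y h"
  shows "frac_class A S X Y (W, s, f) = cl X Y h"
proof -
  have X: "X \<in> Obj A" "Y \<in> Obj A" using r weq_arrow[of s W X] by (auto simp: cl_iff dest: arrowD)
  have "r' \<in> frac_class A S X Y (W, s, f) \<longleftrightarrow> r' \<in> cl X Y h" for r'
  proof (cases r')
    case (fields W' t g)
    show ?thesis unfolding fields
      using fractions_iff[OF X] frac_eq_iff[OF h r] by (auto simp: frac_class_def cl_iff)
  qed
  then show ?thesis by blast
qed

text \<open>An Ore square for \<open>h \<cdot> un X\<close> against the weak equivalence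
  \<open>un Y\<close> writes \<open>h\<close> as a fraction.\<close>

lemma cl_nonempty:
  assumes X: "X \<in> Obj A" "Y \<in> Obj A" and h: "arrow A h (Lo X) (Lo Y)"
  obtains W s f where "(W, s, f) \<in> cl X Y h"
proof -
  obtain P s f where s: "weq s P X" and f: "arrow A f P Y" and e: "h \<cdot> un X \<cdot> s = un Y \<cdot> f"
    by (rule ore_weq[OF arrow_comp[OF un_arrow[OF X(1)] h] un_weq[OF X(2)]])
  have "h \<cdot> (un X \<cdot> s) = un Y \<cdot> f" using e arrow_assoc[OF weq_arrow[OF s] un_arrow[OF X(1)] h] by simp
  then show thesis using that s f by (simp add: cl_iff)
qed

text \<open>An Ore square for the two denominators provides the common one, and both numerators are
  restricted to it.\<close>

lemma cl_common:
  assumes X: "X \<in> Obj A" "Y \<in> Obj A" and h: "arrow A h (Lo X) (Lo Y)" "arrow A h' (Lo X) (Lo Y)"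
  obtains W s f g where "(W, s, f) \<in> cl X Y h" "(W, s, g) \<in> cl X Y h'"
proof -
  obtain W s f where r: "(W, s, f) \<in> cl X Y h" by (rule cl_nonempty[OF X h(1)])
  obtain W' t g where r': "(W', t, g) \<in> cl X Y h'" by (rule cl_nonempty[OF X h(2)])
  have s: "weq s W X" "weq t W' X" "arrow A g W' Y" using r r' by (auto simp: cl_iff)
  obtain P u v where u: "weq u P W" and v: "arrow A v P W'" and eq: "s \<cdot> u = t \<cdot> v"
    by (rule ore_weq[OF weq_arrow[OF s(1)] s(2)])
  have tv: "weq (t \<cdot> v) P X" using weq_comp[OF u s(1)] eq by simp
  note u' = un_arrow[OF X(1)] un_arrow[OF X(2)] and ta = weq_arrow[OF s(2)]
  have "h' \<cdot> (un X \<cdot> (t \<cdot> v)) = un Y \<cdot> (g \<cdot> v)"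
    using arrow_assoc[OF v ta u'(1)] arrow_assoc[OF v arrow_comp[OF ta u'(1)] h(2)] arrow_assoc[OF v s(3) u'(2)] r'
    by (simp add: cl_iff)
  then have "(P, s \<cdot> u, g \<cdot> v) \<in> cl X Y h'" using eq tv arrow_comp[OF v s(3)] by (simp add: cl_iff)
  then show thesis by (rule that[OF cl_restrict[OF r h(1) u]])
qed

lemma cl_inj:
  assumes "X \<in> Obj A" "Y \<in> Obj A" "arrow A h (Lo X) (Lo Y)" "arrow A h' (Lo X) (Lo Y)" "cl X Y h = cl X Y h'"
  shows "h = h'"
  by (rule cl_nonempty[OF assms(1,2,3)]) (use cl_unique[OF assms(3,4)] assms(5) in blast)

lemma frac_add_cl:
  assumes X: "X \<in> Obj A" "Y \<in> Obj A" and h: "arrow A h (Lo X) (Lo Y)" "arrow A h' (Lo X) (Lo Y)"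
  shows "frac_add A S X Y (cl X Y h) (cl X Y h') = cl X Y (h \<otimes>\<^bsub>Hom A (Lo X) (Lo Y)\<^esub> h')"
proof -
  note hh = arrow_sum[OF h]
  have *: "frac_class A S X Y (W, s, f \<otimes>\<^bsub>Hom A W Y\<^esub> g) = cl X Y (h \<otimes>\<^bsub>Hom A (Lo X) (Lo Y)\<^esub> h')"
    if r: "(W, s, f) \<in> cl X Y h" "(W, s, g) \<in> cl X Y h'" for W s f g
  proof (rule frac_class_cl[OF hh])
    have s: "weq s W X" "arrow A f W Y" "arrow A g W Y" using r by (auto simp: cl_iff)
    have us: "arrow A (un X \<cdot> s) W (Lo X)" using weq_arrow[OF weq_un[OF s(1)]] .
    show "(W, s, f \<otimes>\<^bsub>Hom A W Y\<^esub> g) \<in> cl X Y (h \<otimes>\<^bsub>Hom A (Lo X) (Lo Y)\<^esub> h')"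
      using s arrow_sum[OF s(2,3)] sum_comp[OF us h] comp_sum[OF s(2,3) un_arrow[OF X(2)]] r by (simp add: cl_iff)
  qed
  \<comment> \<open>The union in \<open>frac_add\<close> runs over copies of one class; a common
    denominator shows that it is not the empty union.\<close>
  obtain W s f g where "(W, s, f) \<in> cl X Y h" "(W, s, g) \<in> cl X Y h'" by (rule cl_common[OF X h])
  then have "{frac_class A S X Y (W, s, f \<otimes>\<^bsub>Hom A W Y\<^esub> g) | W s f g. (W, s, f) \<in> cl X Y h \<and> (W, s, g) \<in> cl X Y h'}
    = {cl X Y (h \<otimes>\<^bsub>Hom A (Lo X) (Lo Y)\<^esub> h')}" using * by blast
  then show ?thesis by (simp add: frac_add_def)
qed

lemma frac_comp_cl:
  assumes X: "X \<in> Obj A" "Y \<in> Obj A" "Z \<in> Obj A" and h: "arrow A h (Lo X) (Lo Y)" and h': "arrow A h' (Lo Y) (Lo Z)"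
  shows "frac_comp A S X Z (cl Y Z h') (cl X Y h) = cl X Z (h' \<cdot> h)"
proof -
  note hh = arrow_comp[OF h h']
  have *: "frac_class A S X Z (P, s \<cdot> t', g \<cdot> f') = cl X Z (h' \<cdot> h)"
    if r: "(W, s, f) \<in> cl X Y h" "(V, t, g) \<in> cl Y Z h'" and P: "P \<in> Obj A" "serre_iso A S P W t'" "f' \<in> Arr A P V"
      and e: "f \<cdot> t' = t \<cdot> f'" for P W V s f t g t' f'
  proof (rule frac_class_cl[OF hh])
    have s: "weq s W X" "arrow A f W Y" "weq t V Y" "arrow A g V Z" using r by (auto simp: cl_iff)
    have t': "weq t' P W" and f': "arrow A f' P V"
      using P arrowD(1)[OF s(2)] arrowD(1)[OF s(4)] by (auto simp: weq_def serre_iso_def arrow_def)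
    note t'a = weq_arrow[OF t'] and sa = weq_arrow[OF s(1)] and ta = weq_arrow[OF s(3)]
    note u = un_arrow[OF X(1)] un_arrow[OF X(2)] un_arrow[OF X(3)]
    have "(h' \<cdot> h) \<cdot> (un X \<cdot> (s \<cdot> t')) = h' \<cdot> (h \<cdot> (un X \<cdot> (s \<cdot> t')))"
      using arrow_assoc[OF arrow_comp[OF arrow_comp[OF t'a sa] u(1)] h h'] .
    also have "h \<cdot> (un X \<cdot> (s \<cdot> t')) = un Y \<cdot> (f \<cdot> t')"
      using cl_restrict[OF r(1) h t'] by (simp add: cl_iff)
    also have "\<dots> = (un Y \<cdot> t) \<cdot> f'" using e arrow_assoc[OF f' ta u(2)] by simp
    also have "h' \<cdot> \<dots> = (un Z \<cdot> g) \<cdot> f'"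
      using arrow_assoc[OF f' arrow_comp[OF ta u(2)] h'] r(2) by (simp add: cl_iff)
    also have "\<dots> = un Z \<cdot> (g \<cdot> f')" using arrow_assoc[OF f' s(4) u(3)] .
    finally show "(P, s \<cdot> t', g \<cdot> f') \<in> cl X Z (h' \<cdot> h)"
      using weq_comp[OF t' s(1)] arrow_comp[OF f' s(4)] by (simp add: cl_iff)
  qed
  \<comment> \<open>As for sums, all choices give one class, and an Ore square shows that at least
    one choice exists.\<close>
  obtain W s f where r: "(W, s, f) \<in> cl X Y h" by (rule cl_nonempty[OF X(1,2) h])
  obtain V t g where r': "(V, t, g) \<in> cl Y Z h'" by (rule cl_nonempty[OF X(2,3) h'])
  have s: "arrow A f W Y" "weq t V Y" using r r' by (auto simp: cl_iff)
  obtain P t' f' where "weq t' P W" "arrow A f' P V" "f \<cdot> t' = t \<cdot> f'" by (rule ore_weq[OF s])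
  then have "P \<in> Obj A" "serre_iso A S P W t'" "f' \<in> Arr A P V" "f \<cdot> t' = t \<cdot> f'"
    by (auto simp: weq_def arrow_def)
  then have "{frac_class A S X Z (P, s \<cdot> t', g \<cdot> f') | P W V s f t g t' f'.
           (W, s, f) \<in> cl X Y h \<and> (V, t, g) \<in> cl Y Z h' \<and> P \<in> Obj A \<and>
           serre_iso A S P W t' \<and> f' \<in> Arr A P V \<and> f \<cdot> t' = t \<cdot> f'} = {cl X Z (h' \<cdot> h)}"
    using * r r' by blast
  then show ?thesis by (simp add: frac_comp_def)
qed

section \<open>The Serre quotient as an additive category\<close>

abbreviation D :: "('o, ('o, 'm) frac_mor) precat" where
  "D \<equiv> serre_quotient A S"

definition qa :: "'o \<Rightarrow> 'o \<Rightarrow> 'm \<Rightarrow> ('o, 'm) frac_mor" where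
  "qa X Y h = (X, Y, cl X Y h)"

lemma Obj_D: "Obj D = Obj A"
  by (simp add: serre_quotient_def)

lemma cl_ide:
  assumes "arrow A f X Y"
  shows "(X, Ide A X, f) \<in> cl X Y (FAr Q f)"
  using assms arrowD(1,2)[OF assms] Q_natural[OF assms] weq_ide arrow_ide_right[OF un_arrow] by (simp add: cl_iff)

text \<open>Each class of fractions is \<open>cl X Y h\<close> for the map \<open>h\<close> that it
  induces; computing in the quotient becomes computing with maps of reflections.\<close>

lemma Arr_D:
  assumes X: "X \<in> Obj A" "Y \<in> Obj A"
  shows "Arr D X Y = qa X Y ` {h. arrow A h (Lo X) (Lo Y)}"
proof (intro equalityI subsetI)
  fix a assume "a \<in> Arr D X Y"
  then obtain W s f where a: "a = (X, Y, frac_class A S X Y (W, s, f))" "(W, s, f) \<in> fractions A S X Y"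
    by (auto simp: serre_quotient_def)
  then have s: "weq s W X" "arrow A f W Y" using fractions_iff[OF X] by auto
  obtain h where "arrow A h (Lo X) (Lo Y)" "(W, s, f) \<in> cl X Y h" by (rule fraction_morphism[OF s])
  then show "a \<in> qa X Y ` {h. arrow A h (Lo X) (Lo Y)}" using frac_class_cl a(1) by (auto simp: qa_def)
next
  fix a assume "a \<in> qa X Y ` {h. arrow A h (Lo X) (Lo Y)}"
  then obtain h where h: "arrow A h (Lo X) (Lo Y)" "a = (X, Y, cl X Y h)" by (auto simp: qa_def)
  obtain W s f where r: "(W, s, f) \<in> cl X Y h" by (rule cl_nonempty[OF X h(1)])
  then have "(W, s, f) \<in> fractions A S X Y" using fractions_iff[OF X] by (simp add: cl_iff)
  then show "a \<in> Arr D X Y" using frac_class_cl[OF h(1) r] h(2) unfolding serre_quotient_def by force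
qed

lemma arrow_D_iff: "arrow D a X Y \<longleftrightarrow> X \<in> Obj A \<and> Y \<in> Obj A \<and> (\<exists>h. arrow A h (Lo X) (Lo Y) \<and> a = qa X Y h)"
  using Arr_D[of X Y] by (auto simp: arrow_def[of D] Obj_D)

lemma arrow_qa: "X \<in> Obj A \<Longrightarrow> Y \<in> Obj A \<Longrightarrow> arrow A h (Lo X) (Lo Y) \<Longrightarrow> arrow D (qa X Y h) X Y"
  by (auto simp: arrow_D_iff)

lemma qa_sum: "\<lbrakk>X \<in> Obj A; Y \<in> Obj A; arrow A h (Lo X) (Lo Y); arrow A h' (Lo X) (Lo Y)\<rbrakk> \<Longrightarrow>
    qa X Y h \<otimes>\<^bsub>Hom D X Y\<^esub> qa X Y h' = qa X Y (h \<otimes>\<^bsub>Hom A (Lo X) (Lo Y)\<^esub> h')"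
  using frac_add_cl by (simp add: qa_def serre_quotient_def)

lemma qa_comp: "\<lbrakk>X \<in> Obj A; Y \<in> Obj A; Z \<in> Obj A; arrow A h (Lo X) (Lo Y); arrow A h' (Lo Y) (Lo Z)\<rbrakk> \<Longrightarrow>
    qa Y Z h' \<cdot>\<^bsub>D\<^esub> qa X Y h = qa X Z (h' \<cdot> h)"
  using frac_comp_cl by (simp add: qa_def serre_quotient_def)

lemma Q_zero: "X \<in> Obj A \<Longrightarrow> Y \<in> Obj A \<Longrightarrow> FAr Q (Zero A X Y) = Zero A (Lo X) (Lo Y)"
  by (rule Q_unique[OF arrow_zero arrow_zero[OF Lo_obj Lo_obj]])
    (simp_all add: zero_comp[OF un_arrow] comp_zero[OF un_arrow] Lo_obj)

lemma qa_zero: "X \<in> Obj A \<Longrightarrow> Y \<in> Obj A \<Longrightarrow> Zero D X Y = qa X Y (Zero A (Lo X) (Lo Y))"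
  using frac_class_cl[OF Q_arrow cl_ide, OF arrow_zero arrow_zero] Q_zero by (simp add: qa_def serre_quotient_def)

lemma qa_ide: "X \<in> Obj A \<Longrightarrow> Ide D X = qa X X (Ide A (Lo X))"
  using frac_class_cl[OF Q_arrow cl_ide, OF arrow_ide arrow_ide] Q_ide by (simp add: qa_def serre_quotient_def)

text \<open>\<open>qa\<close> carries sums and composites of maps of reflections to those of
  classes, so the axioms are inherited from \<open>A\<close>.\<close>

lemma preadditive_D: "preadditive_category D"
proof (rule preadditive_category.intro, unfold Obj_D)
  fix X Y assume X: "X \<in> Obj A" "Y \<in> Obj A"
  have ar: "a \<in> Arr D X Y \<longleftrightarrow> arrow D a X Y" for a using X by (simp add: arrow_def Obj_D)
  have car: "h \<in> Arr A (Lo X) (Lo Y) \<longleftrightarrow> arrow A h (Lo X) (Lo Y)" for h using X Lo_obj by (simp add: arrow_def)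
  show "comm_group (Hom D X Y)"
  proof (rule comm_group_transport[OF hom_group[OF Lo_obj[OF X(1)] Lo_obj[OF X(2)]], of "qa X Y"])
    show "qa X Y ` Arr A (Lo X) (Lo Y) = Arr D X Y" using Arr_D[OF X] car by auto
    show "qa X Y h \<otimes>\<^bsub>Hom D X Y\<^esub> qa X Y h' = qa X Y (h \<otimes>\<^bsub>Hom A (Lo X) (Lo Y)\<^esub> h')"
      if "h \<in> Arr A (Lo X) (Lo Y)" "h' \<in> Arr A (Lo X) (Lo Y)" for h h' using qa_sum[OF X] that car by simp
    show "Zero D X Y = qa X Y (Zero A (Lo X) (Lo Y))" using qa_zero[OF X] .
  qed
  fix a assume "a \<in> Arr D X Y"
  then obtain h where h: "arrow A h (Lo X) (Lo Y)" "a = qa X Y h" using Arr_D[OF X] by auto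
  show "Dom D a = X \<and> Cod D a = Y" using h(2) by (simp add: qa_def serre_quotient_def)
  show "Ide D Y \<cdot>\<^bsub>D\<^esub> a = a"
    unfolding h(2) qa_ide[OF X(2)] qa_comp[OF X(1,2,2) h(1) arrow_ide[OF Lo_obj[OF X(2)]]] arrow_ide_left[OF h(1)] ..
  show "a \<cdot>\<^bsub>D\<^esub> Ide D X = a"
    unfolding h(2) qa_ide[OF X(1)] qa_comp[OF X(1,1,2) arrow_ide[OF Lo_obj[OF X(1)]] h(1)] arrow_ide_right[OF h(1)] ..
next
  show "Ide D X \<in> Arr D X X" if X: "X \<in> Obj A" for X
    unfolding qa_ide[OF X] using arrow_qa[OF X X arrow_ide[OF Lo_obj[OF X]]] by (rule arrowD)
  fix X Y Z assume X: "X \<in> Obj A" "Y \<in> Obj A" "Z \<in> Obj A"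
  have closed: "b \<cdot>\<^bsub>D\<^esub> a \<in> Arr D X Z" if "a \<in> Arr D X Y" "b \<in> Arr D Y Z" for a b
    using that arrow_qa[OF X(1,3)] qa_comp[OF X] arrow_comp unfolding Arr_D[OF X(1,2)] Arr_D[OF X(2,3)] arrow_def[of D]
    by fastforce
  show "(\<lambda>b. b \<cdot>\<^bsub>D\<^esub> a) \<in> hom (Hom D Y Z) (Hom D X Z)" if a: "a \<in> Arr D X Y" for a
  proof (rule homI)
    obtain h where h: "arrow A h (Lo X) (Lo Y)" "a = qa X Y h" using a Arr_D[OF X(1,2)] by auto
    fix b assume b: "b \<in> Arr D Y Z"
    then obtain k where k: "arrow A k (Lo Y) (Lo Z)" "b = qa Y Z k" using Arr_D[OF X(2,3)] by auto
    show "b \<cdot>\<^bsub>D\<^esub> a \<in> Arr D X Z" using closed[OF a b] .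
    fix c assume c: "c \<in> Arr D Y Z"
    then obtain l where l: "arrow A l (Lo Y) (Lo Z)" "c = qa Y Z l" using Arr_D[OF X(2,3)] by auto
    show "(b \<otimes>\<^bsub>Hom D Y Z\<^esub> c) \<cdot>\<^bsub>D\<^esub> a = (b \<cdot>\<^bsub>D\<^esub> a) \<otimes>\<^bsub>Hom D X Z\<^esub> (c \<cdot>\<^bsub>D\<^esub> a)"
      unfolding h(2) k(2) l(2) qa_sum[OF X(2,3) k(1) l(1)] qa_comp[OF X h(1) k(1)] qa_comp[OF X h(1) l(1)]
        qa_comp[OF X h(1) arrow_sum[OF k(1) l(1)]] qa_sum[OF X(1,3) arrow_comp[OF h(1) k(1)] arrow_comp[OF h(1) l(1)]]
        sum_comp[OF h(1) k(1) l(1)] ..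
  qed
  show "(\<lambda>b. a \<cdot>\<^bsub>D\<^esub> b) \<in> hom (Hom D X Y) (Hom D X Z)" if a: "a \<in> Arr D Y Z" for a
  proof (rule homI)
    obtain h where h: "arrow A h (Lo Y) (Lo Z)" "a = qa Y Z h" using a Arr_D[OF X(2,3)] by auto
    fix b assume b: "b \<in> Arr D X Y"
    then obtain k where k: "arrow A k (Lo X) (Lo Y)" "b = qa X Y k" using Arr_D[OF X(1,2)] by auto
    show "a \<cdot>\<^bsub>D\<^esub> b \<in> Arr D X Z" using closed[OF b a] .
    fix c assume c: "c \<in> Arr D X Y"
    then obtain l where l: "arrow A l (Lo X) (Lo Y)" "c = qa X Y l" using Arr_D[OF X(1,2)] by auto
    show "a \<cdot>\<^bsub>D\<^esub> (b \<otimes>\<^bsub>Hom D X Y\<^esub> c) = (a \<cdot>\<^bsub>D\<^esub> b) \<otimes>\<^bsub>Hom D X Z\<^esub> (a \<cdot>\<^bsub>D\<^esub> c)"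
      unfolding h(2) k(2) l(2) qa_sum[OF X(1,2) k(1) l(1)] qa_comp[OF X k(1) h(1)] qa_comp[OF X l(1) h(1)]
        qa_comp[OF X arrow_sum[OF k(1) l(1)] h(1)] qa_sum[OF X(1,3) arrow_comp[OF k(1) h(1)] arrow_comp[OF l(1) h(1)]]
        comp_sum[OF k(1) l(1) h(1)] ..
  qed
next
  fix W X Y Z a b c assume X: "W \<in> Obj A" "X \<in> Obj A" "Y \<in> Obj A" "Z \<in> Obj A"
    and "a \<in> Arr D W X" "b \<in> Arr D X Y" "c \<in> Arr D Y Z"
  then obtain h k l where h: "arrow A h (Lo W) (Lo X)" "a = qa W X h" and k: "arrow A k (Lo X) (Lo Y)" "b = qa X Y k"
    and l: "arrow A l (Lo Y) (Lo Z)" "c = qa Y Z l"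
    using Arr_D by auto
  show "c \<cdot>\<^bsub>D\<^esub> b \<cdot>\<^bsub>D\<^esub> a = c \<cdot>\<^bsub>D\<^esub> (b \<cdot>\<^bsub>D\<^esub> a)"
    unfolding h(2) k(2) l(2) qa_comp[OF X(2,3,4) k(1) l(1)] qa_comp[OF X(1,2,3) h(1) k(1)]
      qa_comp[OF X(1,2,4) h(1) arrow_comp[OF k(1) l(1)]] qa_comp[OF X(1,3,4) arrow_comp[OF h(1) k(1)] l(1)]
      arrow_assoc[OF h(1) k(1) l(1)] ..
qed

lemma additive_D: "additive_category D"
proof -
  interpret D: preadditive_category D by (rule preadditive_D)
  show ?thesis
  proof (rule additive_category.intro[OF preadditive_D], rule additive_category_axioms.intro, unfold Obj_D)
    obtain Z where Z: "zero_object A Z" using ex_zero by blast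
    then have o: "Z \<in> Obj A" by (simp add: zero_object_def)
    have "Ide A Z = Zero A Z Z" using arrow_to_zero[OF Z arrow_ide[OF o]] .
    then have "Ide D Z = Zero D Z Z" using qa_ide[OF o] qa_zero[OF o o] Q_ide[OF o] Q_zero[OF o o] by simp
    then show "\<exists>Z. zero_object D Z" using D.zero_objectI[of Z] o by (auto simp: Obj_D)
  next
    fix X Y assume X: "X \<in> Obj A" "Y \<in> Obj A"
    obtain B' where "biproduct A X Y B'" using ex_biproduct[OF X] by blast
    then obtain i j p q where b: "arrow A i X B'" "arrow A j Y B'" "arrow A p B' X" "arrow A q B' Y"
      and e: "p \<cdot> i = Ide A X" "q \<cdot> j = Ide A Y" "q \<cdot> i = Zero A X Y" "p \<cdot> j = Zero A Y X"
      "(i \<cdot> p) \<otimes>\<^bsub>Hom A B' B'\<^esub> (j \<cdot> q) = Ide A B'"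
      by (rule biproductE)
    have o: "B' \<in> Obj A" using b(1) by (rule arrowD)
    note Qb = Q_arrow[OF b(1)] Q_arrow[OF b(2)] Q_arrow[OF b(3)] Q_arrow[OF b(4)]
    note ip = arrow_comp[OF b(3,1)] and jq = arrow_comp[OF b(4,2)]
    \<comment> \<open>The object is the biproduct in \<open>A\<close>; its structure maps are the
      classes of the images under \<open>Q\<close>, and additivity of \<open>Q\<close> preserves the
      equations.\<close>
    have "biproduct D X Y B'"
    proof (rule D.biproductI[OF arrow_qa[OF X(1) o Qb(1)] arrow_qa[OF X(2) o Qb(2)] arrow_qa[OF o X(1) Qb(3)] arrow_qa[OF o X(2) Qb(4)]])
      show "qa B' X (FAr Q p) \<cdot>\<^bsub>D\<^esub> qa X B' (FAr Q i) = Ide D X"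
        using qa_comp[OF X(1) o X(1) Qb(1,3)] Q_comp[OF b(1,3)] e(1) Q_ide[OF X(1)] qa_ide[OF X(1)] by simp
      show "qa B' Y (FAr Q q) \<cdot>\<^bsub>D\<^esub> qa Y B' (FAr Q j) = Ide D Y"
        using qa_comp[OF X(2) o X(2) Qb(2,4)] Q_comp[OF b(2,4)] e(2) Q_ide[OF X(2)] qa_ide[OF X(2)] by simp
      show "qa B' Y (FAr Q q) \<cdot>\<^bsub>D\<^esub> qa X B' (FAr Q i) = Zero D X Y"
        using qa_comp[OF X(1) o X(2) Qb(1,4)] Q_comp[OF b(1,4)] e(3) Q_zero[OF X] qa_zero[OF X] by simp
      show "qa B' X (FAr Q p) \<cdot>\<^bsub>D\<^esub> qa Y B' (FAr Q j) = Zero D Y X"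
        using qa_comp[OF X(2) o X(1) Qb(2,3)] Q_comp[OF b(2,3)] e(4) Q_zero[OF X(2,1)] qa_zero[OF X(2,1)] by simp
      show "(qa X B' (FAr Q i) \<cdot>\<^bsub>D\<^esub> qa B' X (FAr Q p)) \<otimes>\<^bsub>Hom D B' B'\<^esub> (qa Y B' (FAr Q j) \<cdot>\<^bsub>D\<^esub> qa B' Y (FAr Q q)) = Ide D B'"
        using qa_comp[OF o X(1) o Qb(3,1)] qa_comp[OF o X(2) o Qb(4,2)] Q_comp[OF b(3,1)] Q_comp[OF b(4,2)]
          qa_sum[OF o o Q_arrow[OF ip] Q_arrow[OF jq]] Q_sum[OF ip jq] e(5) Q_ide[OF o] qa_ide[OF o] by simp
    qed
    then show "\<exists>B'. biproduct D X Y B'" by blast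
  qed
qed

text \<open>On arrows this inverts \<open>qa\<close>; by \<open>cl_inj\<close> a class determines
  its map of reflections.\<close>

definition E :: "('o, ('o, 'm) frac_mor, 'o, 'm) cat_functor" where
  "E = \<lparr>FOb = Lo, FAr = (\<lambda>(X, Y, c). THE h. arrow A h (Lo X) (Lo Y) \<and> c = cl X Y h)\<rparr>"

lemma E_qa: "X \<in> Obj A \<Longrightarrow> Y \<in> Obj A \<Longrightarrow> arrow A h (Lo X) (Lo Y) \<Longrightarrow> FAr E (qa X Y h) = h"
  unfolding E_def qa_def using cl_inj by (auto intro!: the_equality)

lemma equivalence_E: "equivalence D (full_subcat A B) E"
proof (rule equivalenceI)
  interpret D: additive_category D by (rule additive_D)
  interpret BB: additive_category "full_subcat A B" by (rule B_additive)
  have FOb: "FOb E X = Lo X" for X by (simp add: E_def)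
  show "additive_functor D (full_subcat A B) E"
  proof
    fix X assume "X \<in> Obj D"
    then have X: "X \<in> Obj A" by (simp add: Obj_D)
    show "FOb E X \<in> Obj (full_subcat A B)" using Lo_in[OF X] by (simp add: FOb)
    show "FAr E (Ide D X) = Ide (full_subcat A B) (FOb E X)"
      using qa_ide[OF X] E_qa[OF X X arrow_ide[OF Lo_obj[OF X]]] by (simp add: FOb)
    fix Y assume "Y \<in> Obj D"
    then have Y: "Y \<in> Obj A" by (simp add: Obj_D)
    show "FAr E \<in> hom (Hom D X Y) (Hom (full_subcat A B) (FOb E X) (FOb E Y))"
    proof (rule homI)
      fix a assume "a \<in> Arr D X Y"
      then obtain h where h: "arrow A h (Lo X) (Lo Y)" "a = qa X Y h" using Arr_D[OF X Y] by auto
      show "FAr E a \<in> Arr (full_subcat A B) (FOb E X) (FOb E Y)"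
        using h E_qa[OF X Y h(1)] by (simp add: FOb arrow_def)
      fix b assume "b \<in> Arr D X Y"
      then obtain k where k: "arrow A k (Lo X) (Lo Y)" "b = qa X Y k" using Arr_D[OF X Y] by auto
      show "FAr E (a \<otimes>\<^bsub>Hom D X Y\<^esub> b) = FAr E a \<otimes>\<^bsub>Hom (full_subcat A B) (FOb E X) (FOb E Y)\<^esub> FAr E b"
        using h k E_qa[OF X Y h(1)] E_qa[OF X Y k(1)] qa_sum[OF X Y h(1) k(1)] E_qa[OF X Y arrow_sum[OF h(1) k(1)]]
        by (simp add: FOb)
    qed
    fix Z a b assume "Z \<in> Obj D" "a \<in> Arr D X Y" "b \<in> Arr D Y Z"
    then obtain h k where Z: "Z \<in> Obj A" and h: "arrow A h (Lo X) (Lo Y)" "a = qa X Y h"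
      and k: "arrow A k (Lo Y) (Lo Z)" "b = qa Y Z k"
      using Arr_D X Y by (auto simp: Obj_D)
    show "FAr E (b \<cdot>\<^bsub>D\<^esub> a) = FAr E b \<cdot>\<^bsub>full_subcat A B\<^esub> FAr E a"
      using h k E_qa[OF X Y h(1)] E_qa[OF Y Z k(1)] qa_comp[OF X Y Z h(1) k(1)] E_qa[OF X Z arrow_comp[OF h(1) k(1)]]
      by simp
  qed
  show "a = b" if ab: "arrow D a X Y" "arrow D b X Y" "FAr E a = FAr E b" for X Y a b
  proof -
    obtain h k where "X \<in> Obj A" "Y \<in> Obj A" "arrow A h (Lo X) (Lo Y)" "a = qa X Y h"
      "arrow A k (Lo X) (Lo Y)" "b = qa X Y k" using ab(1,2) by (auto simp: arrow_D_iff)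
    then show ?thesis using ab(3) E_qa by simp
  qed
  show "\<exists>a. arrow D a X Y \<and> FAr E a = d" if "X \<in> Obj D" "Y \<in> Obj D" "arrow (full_subcat A B) d (FOb E X) (FOb E Y)" for X Y d
  proof -
    have X: "X \<in> Obj A" "Y \<in> Obj A" and d: "arrow A d (Lo X) (Lo Y)"
      using that by (simp_all add: Obj_D FOb arrow_B)
    show ?thesis using arrow_qa[OF X d] E_qa[OF X d] by blast
  qed
  show "\<exists>X\<in>Obj D. \<exists>e. isomorphism (full_subcat A B) (FOb E X) Y e" if "Y \<in> Obj (full_subcat A B)" for Y
  proof -
    have Y: "Y \<in> B" using that by simp
    note o = B_obj[OF Y]
    note u = un_arrow[OF o]
    \<comment> \<open>A local object is its own reflection: the identity extends along the unit, and
      uniqueness gives the other composite.\<close>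
    obtain v where v: "arrow A v (Lo Y) Y" "v \<cdot> un Y = Ide A Y" by (rule local_ex[OF Y un_weq[OF o] arrow_ide[OF o]])
    have "un Y \<cdot> v = Ide A (Lo Y)"
    proof (rule local_eq[OF Lo_in[OF o] un_weq[OF o] arrow_comp[OF v(1) u] arrow_ide[OF Lo_obj[OF o]]])
      show "un Y \<cdot> v \<cdot> un Y = Ide A (Lo Y) \<cdot> un Y"
        using arrow_assoc[OF u v(1) u] v(2) arrow_ide_right[OF u] arrow_ide_left[OF u] by simp
    qed
    then have "isomorphism (full_subcat A B) (Lo Y) Y v"
      unfolding isomorphism_def using v u by (auto simp: arrow_def)
    then show ?thesis using o by (auto simp: Obj_D FOb)
  qed
qed

text \<open>The two functors agree on objects and on arrows, so identities form the natural
  isomorphism.\<close>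

lemma factor_Q: "naturally_isomorphic A (full_subcat A B) (comp_functor E (quotient_functor A S)) Q"
proof -
  interpret BB: preadditive_category "full_subcat A B"
    using B_additive additive_category.axioms(1) by blast
  have "FAr E (FAr (quotient_functor A S) f) = FAr Q f" if f: "arrow A f X Y" for f X Y
  proof -
    have "FAr (quotient_functor A S) f = qa X Y (FAr Q f)"
      using arrow_dom_cod[OF f] frac_class_cl[OF Q_arrow[OF f] cl_ide[OF f]] by (simp add: quotient_functor_def qa_def)
    then show ?thesis using E_qa[OF arrowD(1,2)[OF f] Q_arrow[OF f]] by simp
  qed
  then have "Ide A (Lo Y) \<cdot> FAr E (FAr (quotient_functor A S) f) = FAr Q f \<cdot> Ide A (Lo X)" if "arrow A f X Y" for f X Y
    using that Q_arrow[OF that] arrow_ide_left arrow_ide_right by simp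
  moreover have "isomorphism (full_subcat A B) (Lo X) (Lo X) (Ide A (Lo X))" if "X \<in> Obj A" for X
    using BB.isomorphism_ide[of "Lo X"] Lo_in[OF that] by simp
  ultimately show ?thesis
    unfolding naturally_isomorphic_def
    by (intro exI[of _ "\<lambda>X. Ide A (Lo X)"])
      (simp add: comp_functor_def quotient_functor_def E_def arrow_def)
qed

section \<open>The right adjoint of the inclusion of \<open>S\<close>\<close>

lemma S_to_B_zero:
  assumes M: "M \<in> S" and L: "L \<in> B" and f: "arrow A f M L"
  shows "f = Zero A M L"
proof -
  interpret SS: additive_category "full_subcat A S" by (rule S_additive)
  obtain Z where Zs: "zero_object (full_subcat A S) Z" using SS.ex_zero by blast
  then have ZS: "Z \<in> S" by (simp add: zero_object_def)
  note o = S_obj[OF ZS] S_obj[OF M] B_obj[OF L]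
  have "Ide A Z = Zero A Z Z" using SS.arrow_to_zero[OF Zs SS.arrow_ide[of Z]] ZS by simp
  then have Z: "zero_object A Z" using zero_objectI[OF o(1)] by blast
  \<comment> \<open>The zero map to \<open>M\<close> has kernel \<open>Z\<close> and cokernel
    \<open>M\<close>, both in \<open>S\<close>, so it is a weak equivalence. Along it
    \<open>f\<close> agrees with zero, and locality of \<open>L\<close> gives the claim.\<close>
  let ?z = "Zero A Z M"
  have z: "arrow A ?z Z M" using arrow_zero o by blast
  have "is_kernel A Z M ?z Z (Ide A Z)"
    unfolding is_kernel_def
  proof (intro conjI ballI impI)
    show "?z \<cdot> Ide A Z = Zero A Z M" using arrow_ide_right[OF z] .
    fix W g assume "W \<in> Obj A" "g \<in> Arr A W Z"
    then show "\<exists>!u. u \<in> Arr A W Z \<and> Ide A Z \<cdot> u = g" using ide_left[of W Z] o(1) by auto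
  qed (use o ide_in in auto)
  moreover have "is_cokernel A Z M ?z M (Ide A M)"
    unfolding is_cokernel_def
  proof (intro conjI ballI impI)
    show "Ide A M \<cdot> ?z = Zero A Z M" using arrow_ide_left[OF z] .
    fix W g assume "W \<in> Obj A" "g \<in> Arr A M W"
    then show "\<exists>!u. u \<in> Arr A M W \<and> u \<cdot> Ide A M = g" using ide_right[of M W] o(2) by auto
  qed (use o ide_in in auto)
  ultimately have "weq ?z Z M" using z ZS M unfolding weq_def serre_iso_def by (auto dest: arrowD)
  moreover have "f \<cdot> ?z = Zero A M L \<cdot> ?z" using comp_zero[OF f o(1)] zero_comp[OF z o(3)] by simp
  ultimately show ?thesis by (rule local_eq[OF L _ f arrow_zero[OF o(2,3)]])
qed

text \<open>The adjoint sends \<open>X\<close> to a kernel of its unit. The kernel can be chosen in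
  \<open>S\<close> because the unit is a weak equivalence, and maps from \<open>S\<close> to
  \<open>X\<close> factor through it because they vanish in \<open>Lo X\<close>.\<close>

lemma torsion_adjoint: "\<exists>J. adjunction (full_subcat A S) A incl_functor J"
proof -
  have Ssub: "S \<subseteq> Obj A" using S_obj by blast
  interpret SS: additive_category "full_subcat A S" by (rule S_additive)
  have arS: "arrow (full_subcat A S) f X Y \<longleftrightarrow> X \<in> S \<and> Y \<in> S \<and> arrow A f X Y" for f X Y
    by (rule arrow_full_subcat[OF Ssub])
  have "\<exists>K\<in>S. \<exists>k. is_kernel A X (Lo X) (un X) K k" if "X \<in> Obj A" for X
    using un_weq[OF that] by (simp add: weq_def serre_iso_def)
  then obtain Jo k where J: "\<And>X. X \<in> Obj A \<Longrightarrow> Jo X \<in> S" "\<And>X. X \<in> Obj A \<Longrightarrow> is_kernel A X (Lo X) (un X) (Jo X) (k X)"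
    by metis
  have k: "arrow A (k X) (Jo X) X" "un X \<cdot> k X = Zero A (Jo X) (Lo X)" if "X \<in> Obj A" for X
    using J(2)[OF that] that by (auto simp: is_kernel_def arrow_def)
  have univ: "\<exists>!u. arrow A u W (Jo X) \<and> k X \<cdot> u = g" if g: "arrow A g W X" "un X \<cdot> g = Zero A W (Lo X)" for g W X
    using J(2)[OF arrowD(2)[OF g(1)]] g unfolding is_kernel_def arrow_def by metis
  \<comment> \<open>Kernel maps are monic, so the laws of the functor and of the adjunction are
    checked after composing with \<open>k\<close>.\<close>
  have mono: "u = u'" if "X \<in> Obj A" "arrow A u W (Jo X)" "arrow A u' W (Jo X)" "k X \<cdot> u = k X \<cdot> u'" for u u' W X
  proof -
    note kX = k[OF that(1)]
    have "un X \<cdot> (k X \<cdot> u) = Zero A W (Lo X)"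
      using arrow_assoc[OF that(2) kX(1) un_arrow[OF that(1)]] kX(2) zero_comp[OF that(2) Lo_obj[OF that(1)]] by simp
    then show ?thesis using univ[OF arrow_comp[OF that(2) kX(1)]] that by metis
  qed
  define lift where "lift W X g = (THE u. arrow A u W (Jo X) \<and> k X \<cdot> u = g)" for W X g
  have lift: "arrow A (lift W X g) W (Jo X)" "k X \<cdot> lift W X g = g" if "arrow A g W X" "un X \<cdot> g = Zero A W (Lo X)" for g W X
    using theI'[OF univ[OF that]] by (simp_all add: lift_def)
  have liftS: "arrow A (lift W X g) W (Jo X)" "k X \<cdot> lift W X g = g" if "W \<in> S" "arrow A g W X" for g W X
    using lift[OF that(2) S_to_B_zero[OF that(1) Lo_in arrow_comp[OF that(2) un_arrow]]] arrowD(2)[OF that(2)] by simp_all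
  define Ja where "Ja b = lift (Jo (Dom A b)) (Cod A b) (b \<cdot> k (Dom A b))" for b
  have Ja: "arrow A (Ja b) (Jo X) (Jo Y)" "k Y \<cdot> Ja b = b \<cdot> k X" if b: "arrow A b X Y" for b X Y
    using liftS[OF J(1)[OF arrowD(1)[OF b]] arrow_comp[OF k(1)[OF arrowD(1)[OF b]] b]] arrow_dom_cod[OF b]
    by (simp_all add: Ja_def)
  define JJ where "JJ = \<lparr>FOb = Jo, FAr = Ja\<rparr>"
  have addJ: "additive_functor A (full_subcat A S) JJ"
  proof
    fix X assume X: "X \<in> Obj A"
    show "FOb JJ X \<in> Obj (full_subcat A S)" using J(1)[OF X] by (simp add: JJ_def)
    note kX = k(1)[OF X] and i = arrow_ide[OF X]
    have "Ja (Ide A X) = Ide A (Jo X)"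
      by (rule mono[OF X Ja(1)[OF i] arrow_ide[OF S_obj[OF J(1)[OF X]]]])
        (simp add: Ja(2)[OF i] arrow_ide_left[OF kX] arrow_ide_right[OF kX])
    then show "FAr JJ (Ide A X) = Ide (full_subcat A S) (FOb JJ X)" by (simp add: JJ_def)
    fix Y assume Y: "Y \<in> Obj A"
    note kY = k(1)[OF Y]
    show "FAr JJ \<in> hom (Hom A X Y) (Hom (full_subcat A S) (FOb JJ X) (FOb JJ Y))"
    proof (rule homI)
      fix a assume "a \<in> Arr A X Y"
      then have a: "arrow A a X Y" using X Y by (simp add: arrow_def)
      show "FAr JJ a \<in> Arr (full_subcat A S) (FOb JJ X) (FOb JJ Y)" using Ja(1)[OF a] by (simp add: JJ_def arrow_def)
      fix b assume "b \<in> Arr A X Y"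
      then have b: "arrow A b X Y" using X Y by (simp add: arrow_def)
      have "Ja (a \<otimes>\<^bsub>Hom A X Y\<^esub> b) = Ja a \<otimes>\<^bsub>Hom A (Jo X) (Jo Y)\<^esub> Ja b"
        by (rule mono[OF Y Ja(1)[OF arrow_sum[OF a b]] arrow_sum[OF Ja(1)[OF a] Ja(1)[OF b]]])
          (simp add: Ja(2)[OF arrow_sum[OF a b]] sum_comp[OF kX a b] comp_sum[OF Ja(1)[OF a] Ja(1)[OF b] kY]
            Ja(2)[OF a] Ja(2)[OF b])
      then show "FAr JJ (a \<otimes>\<^bsub>Hom A X Y\<^esub> b) = FAr JJ a \<otimes>\<^bsub>Hom (full_subcat A S) (FOb JJ X) (FOb JJ Y)\<^esub> FAr JJ b"
        by (simp add: JJ_def)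
    qed
    fix Z a b assume "Z \<in> Obj A" "a \<in> Arr A X Y" "b \<in> Arr A Y Z"
    then have Z: "Z \<in> Obj A" and a: "arrow A a X Y" and b: "arrow A b Y Z" using X Y by (simp_all add: arrow_def)
    note kZ = k(1)[OF Z]
    have "Ja (b \<cdot> a) = Ja b \<cdot> Ja a"
      by (rule mono[OF Z Ja(1)[OF arrow_comp[OF a b]] arrow_comp[OF Ja(1)[OF a] Ja(1)[OF b]]])
        (simp add: Ja(2)[OF arrow_comp[OF a b]] arrow_assoc[OF Ja(1)[OF a] Ja(1)[OF b] kZ, symmetric] Ja(2)[OF b]
          arrow_assoc[OF Ja(1)[OF a] kY b] Ja(2)[OF a] arrow_assoc[OF kX a b])
    then show "FAr JJ (b \<cdot> a) = FAr JJ b \<cdot>\<^bsub>full_subcat A S\<^esub> FAr JJ a" by (simp add: JJ_def)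
  qed
  have bij: "bij_betw (lift M X) (Arr A M X) (Arr A M (Jo X))" if M: "M \<in> S" and X: "X \<in> Obj A" for M X
  proof (rule bij_betw_imageI)
    have ar: "f \<in> Arr A M X \<longleftrightarrow> arrow A f M X" "f \<in> Arr A M (Jo X) \<longleftrightarrow> arrow A f M (Jo X)" for f
      using S_obj[OF M] X S_obj[OF J(1)[OF X]] by (simp_all add: arrow_def)
    show "inj_on (lift M X) (Arr A M X)" using liftS(2)[OF M] by (intro inj_onI) (metis ar(1))
    show "lift M X ` Arr A M X = Arr A M (Jo X)"
    proof (intro equalityI subsetI)
      show "u \<in> Arr A M (Jo X)" if "u \<in> lift M X ` Arr A M X" for u using that liftS(1)[OF M] by (auto simp: ar)
      fix u assume "u \<in> Arr A M (Jo X)"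
      then have u: "arrow A u M (Jo X)" by (simp add: ar)
      have ku: "arrow A (k X \<cdot> u) M X" using arrow_comp[OF u k(1)[OF X]] .
      have "u = lift M X (k X \<cdot> u)" by (rule mono[OF X u liftS(1)[OF M ku]]) (simp add: liftS(2)[OF M ku])
      then show "u \<in> lift M X ` Arr A M X" using ku by (auto simp: ar)
    qed
  qed
  have nat: "lift M' Y (b \<cdot> f \<cdot> a) = Ja b \<cdot> lift M X f \<cdot> a"
    if M: "M' \<in> S" "M \<in> S" and a: "arrow A a M' M" and f: "arrow A f M X" and b: "arrow A b X Y" for M' M X Y a f b
  proof (rule mono[OF arrowD(2)[OF b]])
    note X = arrowD(1,2)[OF b]
    have bfa: "arrow A (b \<cdot> f \<cdot> a) M' Y" using arrow_comp[OF a arrow_comp[OF f b]] .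
    note l = liftS[OF M(2) f]
    note Jl = arrow_comp[OF l(1) Ja(1)[OF b]]
    show "arrow A (lift M' Y (b \<cdot> f \<cdot> a)) M' (Jo Y)" using liftS(1)[OF M(1) bfa] .
    show "arrow A (Ja b \<cdot> lift M X f \<cdot> a) M' (Jo Y)" using arrow_comp[OF a Jl] .
    have "k Y \<cdot> (Ja b \<cdot> lift M X f \<cdot> a) = (k Y \<cdot> (Ja b \<cdot> lift M X f)) \<cdot> a"
      using arrow_assoc[OF a Jl k(1)[OF X(2)]] by simp
    also have "k Y \<cdot> (Ja b \<cdot> lift M X f) = b \<cdot> f"
      using arrow_assoc[OF l(1) Ja(1)[OF b] k(1)[OF X(2)]] Ja(2)[OF b] arrow_assoc[OF l(1) k(1)[OF X(1)] b] l(2) by simp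
    finally show "k Y \<cdot> lift M' Y (b \<cdot> f \<cdot> a) = k Y \<cdot> (Ja b \<cdot> lift M X f \<cdot> a)" using liftS(2)[OF M(1) bfa] by simp
  qed
  have "adjunction (full_subcat A S) A incl_functor JJ"
    by (intro adjunctionI[OF additive_incl_functor[OF Ssub S_additive] addJ, of lift])
      (simp_all add: incl_functor_def JJ_def arS bij nat)
  then show ?thesis by blast
qed

theorem localization: "localization_sequence A S (full_subcat A B) Q"
  unfolding localization_sequence_def
  using abelian_category_axioms serre additive_Q equivalence_E factor_Q torsion_adjoint adjunction_Q by blast

end

section \<open>Effaceable and left exact functors on the left half of a cotorsion pair\<close>

locale cotorsion_modules = cotorsion_category T U V
  for T :: "('o, 'm, 'z) tricat_scheme" (structure) and U V +
  fixes A :: "(('o, 'm, 'g) abfunctor, ('o, 'm, 'g) nattrans) precat"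
  assumes A_mod: "A = mod_cat (full_subcat T U)"
    and small_U: "X \<in> U \<Longrightarrow> Y \<in> U \<Longrightarrow> \<exists>\<iota> :: 'm \<Rightarrow> 'g. inj_on \<iota> (Arr T X Y)"
begin

abbreviation C :: "('o, 'm) precat" where
  "C \<equiv> full_subcat T U"

lemma arrow_C: "arrow C f X Y \<longleftrightarrow> X \<in> U \<and> Y \<in> U \<and> arrow T f X Y"
  using U_obj by (intro arrow_full_subcat) blast

lemma module_category_C: "module_category C A"
proof -
  interpret CC: additive_category C by (rule additive_U)
  show ?thesis
  proof
    show "A = mod_cat C" by (rule A_mod)
    show "\<exists>\<iota> :: 'm \<Rightarrow> 'g. inj_on \<iota> (Arr C X Y)" if "X \<in> Obj C" "Y \<in> Obj C" for X Y
      using small_U that by simp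
    show "\<exists>K k. arrow C k K X \<and> f \<cdot>\<^bsub>C\<^esub> k = Zero C K Y \<and>
        (\<forall>W h. arrow C h W X \<longrightarrow> f \<cdot>\<^bsub>C\<^esub> h = Zero C W Y \<longrightarrow> (\<exists>l. arrow C l W K \<and> h = k \<cdot>\<^bsub>C\<^esub> l))"
      if "arrow C f X Y" for f X Y
    proof -
      have f: "arrow T f X Y" "X \<in> U" using that by (simp_all add: arrow_C)
      obtain K k where k: "K \<in> U" "arrow T k K X" "f \<cdot> k = Zero T K Y"
        and u: "\<And>W h. W \<in> U \<Longrightarrow> arrow T h W X \<Longrightarrow> f \<cdot> h = Zero T W Y \<Longrightarrow> \<exists>l. arrow T l W K \<and> h = k \<cdot> l"
        by (rule weak_kernel[OF f(1)]) blast
      show ?thesis using k f(2) u by (intro exI[of _ K] exI[of _ k]) (auto simp: arrow_C)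
    qed
  qed
qed

interpretation M: module_category C A by (rule module_category_C)
interpretation A: abelian_category A by (rule M.abelian_A)

abbreviation defU :: "('o, 'm, 'g) abfunctor set" where "defU \<equiv> def_objects T U"
abbreviation lexU :: "('o, 'm, 'g) abfunctor set" where "lexU \<equiv> lex_objects T U"

lemma deflation_arrow_C: "deflation T U Y X g \<Longrightarrow> arrow C g Y X"
  using deflation_arrow by (auto simp: arrow_C elim: deflationE)

section \<open>Effaceable functors\<close>

definition effaceable :: "('o, 'm, 'g) abfunctor \<Rightarrow> bool" where
  "effaceable F \<longleftrightarrow> (\<forall>W\<in>U. \<forall>x\<in>El F W. \<exists>Y g. deflation T U Y W g \<and> AAr F g x = \<one>\<^bsub>AOb F Y\<^esub>)"

lemma effaceableE:
  assumes "effaceable F" "W \<in> U" "x \<in> El F W"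
  obtains Y g where "deflation T U Y W g" "AAr F g x = \<one>\<^bsub>AOb F Y\<^esub>"
  using assms unfolding effaceable_def by blast

text \<open>An isomorphism with the quotient functor matches a generator with the coset of the
  identity, and conversely functors presented by the same relation map are isomorphic.\<close>

lemma def_presents:
  assumes F: "F \<in> Obj A" and g: "deflation T U Y X f"
  shows "abfunctor_iso C F (M.coker f Y X) \<longleftrightarrow> (\<exists>x0. presents C F X x0 Y f)"
proof
  have fa: "arrow C f Y X" using deflation_arrow_C[OF g] .
  note Fa = M.additive_Obj[OF F] and K = M.coker_presents[OF fa]
  note PK = presentsD[OF K(2)]
  show "\<exists>x0. presents C F X x0 Y f" if iso: "abfunctor_iso C F (M.coker f Y X)"
  proof -
    obtain \<eta> where \<eta>: "natural_trans C F (M.coker f Y X) \<eta>"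
      and i: "\<And>X'. X' \<in> Obj C \<Longrightarrow> \<eta> X' \<in> iso (AOb F X') (AOb (M.coker f Y X) X')"
      using iso unfolding abfunctor_iso_def by blast
    have bij: "bij_betw (\<eta> X') (El F X') (El (M.coker f Y X) X')" if "X' \<in> Obj C" for X'
      using i[OF that] by (simp add: iso_def)
    have "((\<lambda>k. f \<cdot>\<^bsub>C\<^esub> k) ` Arr C X Y) #>\<^bsub>Hom C X X\<^esub> Ide C X \<in> \<eta> X ` El F X"
      unfolding bij_betw_imp_surj_on[OF bij[OF PK(3)]] by (rule PK(1))
    then obtain x0 where x0: "x0 \<in> El F X" "((\<lambda>k. f \<cdot>\<^bsub>C\<^esub> k) ` Arr C X Y) #>\<^bsub>Hom C X X\<^esub> Ide C X = \<eta> X x0"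
      by (rule imageE)
    then show ?thesis using M.presents_transfer[OF Fa K(1) \<eta> bij x0(1) PK(3)] K(2) by metis
  qed
  show "abfunctor_iso C F (M.coker f Y X)" if "\<exists>x0. presents C F X x0 Y f"
    using that M.presents_isomorphic[OF Fa K(1) _ K(2)] by blast
qed

text \<open>If the deflation \<open>f\<close> presents \<open>F\<close>, pulling \<open>f\<close>
  back along \<open>h\<close> gives a deflation on which \<open>F h x0\<close> dies. Conversely a
  deflation that effaces the generator factors through the relation map \<open>r\<close>, and
  \<open>deflation_factor\<close> makes \<open>r\<close> itself a deflation.\<close>

lemma def_iff: "F \<in> defU \<longleftrightarrow> F \<in> Obj A \<and> effaceable F"
proof
  assume "F \<in> defU"
  then obtain Y X f where F: "F \<in> Obj A" and f: "deflation T U Y X f" "abfunctor_iso C F (M.coker f Y X)"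
    by (auto simp: def_objects_def M.Obj_A)
  note Fa = M.additive_Obj[OF F]
  obtain x0 where p: "presents C F X x0 Y f" using def_presents[OF F f(1)] f(2) by blast
  note P = presentsD[OF p]
  have "\<exists>Y g. deflation T U Y W g \<and> AAr F g x = \<one>\<^bsub>AOb F Y\<^esub>" if W: "W \<in> U" and x: "x \<in> El F W" for W x
  proof -
    obtain h where h: "arrow C h W X" "x = AAr F h x0" using P(5)[of W x] W x by auto
    obtain Y' g b where g: "deflation T U Y' W g" "arrow T b Y' Y" "h \<cdot> g = f \<cdot> b"
      using deflation_pullback[OF f(1) W] h(1) arrow_C by metis
    note ga = deflation_arrow_C[OF g(1)]
    have b: "arrow C b Y' Y" using g(2) ga P(4) by (simp add: arrow_C)
    have "AAr F g x = AAr F (f \<cdot>\<^bsub>C\<^esub> b) x0" using h(2) M.fun_comp[OF Fa ga h(1) P(1)] g(3) by simp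
    then show ?thesis using M.presents_relation(1)[OF Fa p b] g(1) by auto
  qed
  then show "F \<in> Obj A \<and> effaceable F" using F by (simp add: effaceable_def)
next
  assume "F \<in> Obj A \<and> effaceable F"
  then have F: "F \<in> Obj A" and eff: "effaceable F" by auto
  obtain X0 x0 X1 r where p: "presents C F X0 x0 X1 r" using F M.Obj_A M.fp_presents by metis
  note P = presentsD[OF p]
  have X: "X0 \<in> U" "X1 \<in> U" using P(3,4) by auto
  obtain Y g where g: "deflation T U Y X0 g" "AAr F g x0 = \<one>\<^bsub>AOb F Y\<^esub>" by (rule effaceableE[OF eff X(1) P(1)])
  then obtain k where k: "arrow C k Y X1" "g = r \<cdot> k" using P(6)[OF deflation_arrow_C[OF g(1)]] by auto
  have "deflation T U X1 X0 r" by (rule deflation_factor[of Y X0 r k]) (use g k P(2) X in \<open>auto simp: arrow_C\<close>)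
  then show "F \<in> defU" using def_presents[OF F] p F unfolding def_objects_def M.Obj_A by blast
qed

section \<open>Left exact functors\<close>

lemma lex_iff: "L \<in> lexU \<longleftrightarrow> L \<in> Obj A \<and>
    (\<forall>Y X g. deflation T U Y X g \<longrightarrow> (\<forall>x\<in>El L X. AAr L g x = \<one>\<^bsub>AOb L Y\<^esub> \<longrightarrow> x = \<one>\<^bsub>AOb L X\<^esub>)) \<and>
    (\<forall>Z Y X f g. conflation T U Z Y X f g \<longrightarrow>
      (\<forall>y\<in>El L Y. AAr L f y = \<one>\<^bsub>AOb L Z\<^esub> \<longrightarrow> (\<exists>x\<in>El L X. y = AAr L g x)))"
  (is "_ \<longleftrightarrow> _ \<and> ?inj \<and> ?ex")
proof (cases "L \<in> Obj A")
  case False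
  then show ?thesis by (simp add: lex_objects_def M.Obj_A)
next
  case True
  note La = M.additive_Obj[OF True]
  have "inj_on (AAr L g) (El L X) \<and> AAr L g ` El L X = kernel (AOb L Y) (AOb L Z) (AAr L f) \<longleftrightarrow>
      (\<forall>x\<in>El L X. AAr L g x = \<one>\<^bsub>AOb L Y\<^esub> \<longrightarrow> x = \<one>\<^bsub>AOb L X\<^esub>) \<and>
      (\<forall>y\<in>El L Y. AAr L f y = \<one>\<^bsub>AOb L Z\<^esub> \<longrightarrow> (\<exists>x\<in>El L X. y = AAr L g x))"
    if conf: "conflation T U Z Y X f g" for Z Y X f g
  proof -
    obtain h where d: "distinguished T Z Y X f g h" and z: "Z \<in> U" "Y \<in> U" "X \<in> U"
      using conf by (auto simp: conflation_def)
    have f: "arrow C f Z Y" and g: "arrow C g Y X" using distinguishedD[OF d] z by (simp_all add: arrow_C)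
    interpret gh: group_hom "AOb L X" "AOb L Y" "AAr L g" by (rule M.fun_map_hom[OF La g])
    have "inj_on (AAr L g) (El L X) \<longleftrightarrow> (\<forall>x\<in>El L X. AAr L g x = \<one>\<^bsub>AOb L Y\<^esub> \<longrightarrow> x = \<one>\<^bsub>AOb L X\<^esub>)"
      using gh.inj_on_one_iff by blast
    \<comment> \<open>The image lies in the kernel for every additive functor, as
      \<open>g \<cdot> f\<close> is zero; only the reverse inclusion remains in the
      criterion.\<close>
    moreover have "AAr L f (AAr L g x) = \<one>\<^bsub>AOb L Z\<^esub>" if x: "x \<in> El L X" for x
    proof -
      have "AAr L f (AAr L g x) = AAr L (Zero C Z X) x"
        using M.fun_comp[OF La f g x] triangle_comp_zero(1)[OF d] by simp
      then show ?thesis using M.fun_zero[OF La _ _ x, of Z] z by simp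
    qed
    then have "AAr L g ` El L X = kernel (AOb L Y) (AOb L Z) (AAr L f) \<longleftrightarrow>
        (\<forall>y\<in>El L Y. AAr L f y = \<one>\<^bsub>AOb L Z\<^esub> \<longrightarrow> (\<exists>x\<in>El L X. y = AAr L g x))"
      unfolding kernel_def using gh.hom_closed by blast
    ultimately show ?thesis by blast
  qed
  then have "L \<in> lexU \<longleftrightarrow> (\<forall>Z Y X f g. conflation T U Z Y X f g \<longrightarrow>
      (\<forall>x\<in>El L X. AAr L g x = \<one>\<^bsub>AOb L Y\<^esub> \<longrightarrow> x = \<one>\<^bsub>AOb L X\<^esub>) \<and>
      (\<forall>y\<in>El L Y. AAr L f y = \<one>\<^bsub>AOb L Z\<^esub> \<longrightarrow> (\<exists>x\<in>El L X. y = AAr L g x)))"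
    using True by (auto simp: lex_objects_def M.Obj_A)
  then show ?thesis using True unfolding deflation_def by blast
qed

lemma lexD:
  assumes "L \<in> lexU"
  shows "L \<in> Obj A"
    "\<And>Y X g x. deflation T U Y X g \<Longrightarrow> x \<in> El L X \<Longrightarrow> AAr L g x = \<one>\<^bsub>AOb L Y\<^esub> \<Longrightarrow> x = \<one>\<^bsub>AOb L X\<^esub>"
    "\<And>Z Y X f g y. conflation T U Z Y X f g \<Longrightarrow> y \<in> El L Y \<Longrightarrow> AAr L f y = \<one>\<^bsub>AOb L Z\<^esub> \<Longrightarrow> \<exists>x\<in>El L X. y = AAr L g x"
  using assms unfolding lex_iff by blast+

text \<open>The elementwise form of \<open>serre_iso\<close> for \<open>def U\<close>: deflations play the role of covers, the
  morphisms in question are the locally bijective ones, and left exact functors are the sheaves.\<close>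

definition wiso :: "('o, 'm, 'g) nattrans \<Rightarrow> ('o, 'm, 'g) abfunctor \<Rightarrow> ('o, 'm, 'g) abfunctor \<Rightarrow> bool" where
  "wiso s F G \<longleftrightarrow>
    (\<forall>W\<in>U. \<forall>x\<in>El F W. cmp s W x = \<one>\<^bsub>AOb G W\<^esub> \<longrightarrow> (\<exists>Y g. deflation T U Y W g \<and> AAr F g x = \<one>\<^bsub>AOb F Y\<^esub>)) \<and>
    (\<forall>W\<in>U. \<forall>y\<in>El G W. \<exists>Y g x. deflation T U Y W g \<and> x \<in> El F Y \<and> AAr G g y = cmp s Y x)"

lemma wisoD:
  assumes "wiso s F G" "W \<in> U"
  shows "\<And>x. x \<in> El F W \<Longrightarrow> cmp s W x = \<one>\<^bsub>AOb G W\<^esub> \<Longrightarrow> \<exists>Y g. deflation T U Y W g \<and> AAr F g x = \<one>\<^bsub>AOb F Y\<^esub>"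
    "\<And>y. y \<in> El G W \<Longrightarrow> \<exists>Y g x. deflation T U Y W g \<and> x \<in> El F Y \<and> AAr G g y = cmp s Y x"
  using assms by (auto simp: wiso_def)

section \<open>Locally bijective morphisms and the calculus of fractions\<close>

lemma deflation_U: "deflation T U Y W g \<Longrightarrow> Y \<in> U" "deflation T U Y W g \<Longrightarrow> W \<in> U"
  by (auto elim: deflationE)

text \<open>Kernels and cokernels are pointwise, so effaceability of the kernel is local injectivity
  and effaceability of the cokernel is local surjectivity.\<close>

lemma serre_iso_iff:
  assumes s: "arrow A s F G"
  shows "serre_iso A defU F G s \<longleftrightarrow> wiso s F G"
proof
  assume "serre_iso A defU F G s"
  then obtain K k L l where K: "K \<in> defU" "is_kernel A F G s K k" and L: "L \<in> defU" "is_cokernel A F G s L l"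
    by (auto simp: serre_iso_def)
  have k: "arrow A k K F" "M.pinj k K F" "M.pexact k s K F G" using K(2) M.is_kernel_iff[OF s] by auto
  have l: "arrow A l G L" "M.psurj l G L" "M.pexact s l F G L"
    using L(2) M.is_cokernel_iff[OF s] by auto
  show "wiso s F G"
    unfolding wiso_def
  proof (intro conjI ballI impI)
    fix W x assume W: "W \<in> U" and x: "x \<in> El F W" "cmp s W x = \<one>\<^bsub>AOb G W\<^esub>"
    obtain z where z: "z \<in> El K W" "x = cmp k W z" using k(3) W x unfolding M.pexact_def by auto
    obtain Y g where g: "deflation T U Y W g" "AAr K g z = \<one>\<^bsub>AOb K Y\<^esub>"
      using effaceableE[OF _ W z(1)] K(1) def_iff by blast
    then have "AAr F g x = \<one>\<^bsub>AOb F Y\<^esub>"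
      using M.cmp_natural[OF k(1) deflation_arrow_C[OF g(1)] z(1)] z(2) M.cmp_one[OF k(1)] deflation_U(1)[OF g(1)] by simp
    then show "\<exists>Y g. deflation T U Y W g \<and> AAr F g x = \<one>\<^bsub>AOb F Y\<^esub>" using g(1) by blast
  next
    fix W y assume W: "W \<in> U" and y: "y \<in> El G W"
    have ly: "cmp l W y \<in> El L W" using M.cmp_closed[OF l(1)] W y by simp
    obtain Y g where g: "deflation T U Y W g" "AAr L g (cmp l W y) = \<one>\<^bsub>AOb L Y\<^esub>"
      using effaceableE[OF _ W ly] L(1) def_iff by blast
    note ga = deflation_arrow_C[OF g(1)]
    have "cmp l Y (AAr G g y) = \<one>\<^bsub>AOb L Y\<^esub>" using M.cmp_natural[OF l(1) ga y] g(2) by simp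
    moreover have "AAr G g y \<in> El G Y" using M.fun_closed[OF M.arrow_objects(2)[OF s] ga y] .
    ultimately show "\<exists>Y g x. deflation T U Y W g \<and> x \<in> El F Y \<and> AAr G g y = cmp s Y x"
      using l(3) deflation_U(1)[OF g(1)] g(1) unfolding M.pexact_def by auto
  qed
next
  assume w: "wiso s F G"
  obtain K k where k: "arrow A k K F" "M.pinj k K F" "M.pexact k s K F G" by (rule M.pointwise_kernel[OF s])
  obtain L l where l: "arrow A l G L" "M.psurj l G L" "M.pexact s l F G L" by (rule M.pointwise_cokernel[OF s])
  have "effaceable K"
    unfolding effaceable_def
  proof (intro ballI)
    fix W z assume W: "W \<in> U" and z: "z \<in> El K W"
    have kz: "cmp k W z \<in> El F W" using M.cmp_closed[OF k(1)] W z by simp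
    moreover have "cmp s W (cmp k W z) = \<one>\<^bsub>AOb G W\<^esub>" using k(3) W z kz unfolding M.pexact_def by auto
    ultimately obtain Y g where g: "deflation T U Y W g" "AAr F g (cmp k W z) = \<one>\<^bsub>AOb F Y\<^esub>"
      using wisoD(1)[OF w W] by blast
    note ga = deflation_arrow_C[OF g(1)]
    have "cmp k Y (AAr K g z) = \<one>\<^bsub>AOb F Y\<^esub>" using M.cmp_natural[OF k(1) ga z] g(2) by simp
    then have "AAr K g z = \<one>\<^bsub>AOb K Y\<^esub>"
      using k(2) deflation_U(1)[OF g(1)] M.fun_closed[OF M.arrow_objects(1)[OF k(1)] ga z] unfolding M.pinj_def by simp
    then show "\<exists>Y g. deflation T U Y W g \<and> AAr K g z = \<one>\<^bsub>AOb K Y\<^esub>" using g(1) by blast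
  qed
  then have "K \<in> defU" using k(1) def_iff by (auto dest: arrowD)
  moreover have "effaceable L"
    unfolding effaceable_def
  proof (intro ballI)
    fix W z assume W: "W \<in> U" and z: "z \<in> El L W"
    obtain y where y: "y \<in> El G W" "z = cmp l W y" using l(2) W z unfolding M.psurj_def by auto
    obtain Y g x where g: "deflation T U Y W g" "x \<in> El F Y" "AAr G g y = cmp s Y x" using wisoD(2)[OF w W y(1)] by blast
    note ga = deflation_arrow_C[OF g(1)]
    have "AAr L g z = cmp l Y (AAr G g y)" using y(2) M.cmp_natural[OF l(1) ga y(1)] by simp
    also have "\<dots> = \<one>\<^bsub>AOb L Y\<^esub>"
      using l(3) g(2,3) deflation_U(1)[OF g(1)] M.fun_closed[OF M.arrow_objects(2)[OF s] ga y(1)]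
      unfolding M.pexact_def by auto
    finally show "\<exists>Y g. deflation T U Y W g \<and> AAr L g z = \<one>\<^bsub>AOb L Y\<^esub>" using g(1) by blast
  qed
  then have "L \<in> defU" using l(1) def_iff by (auto dest: arrowD)
  ultimately show "serre_iso A defU F G s"
    using M.is_kernelI[OF s k] M.is_cokernelI[OF s l] arrowD(3)[OF s] unfolding serre_iso_def by blast
qed

lemma serre_isoE:
  assumes "serre_iso A defU F G s" "F \<in> Obj A" "G \<in> Obj A"
  shows "arrow A s F G" "wiso s F G"
proof -
  show s: "arrow A s F G" using assms by (simp add: serre_iso_def arrow_def)
  show "wiso s F G" using assms(1) serre_iso_iff[OF s] by blast
qed

text \<open>Both conditions are passed on by refining a cover twice, which is possible because
  deflations compose.\<close>

lemma wiso_comp: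
  assumes s: "arrow A s F G" "wiso s F G" and t: "arrow A t G H" "wiso t G H"
  shows "wiso (t \<cdot>\<^bsub>A\<^esub> s) F H"
  unfolding wiso_def
proof (intro conjI ballI impI)
  note F = M.arrow_objects(1)[OF s(1)] and H = M.arrow_objects(2)[OF t(1)]
  fix W x assume W: "W \<in> U" and x: "x \<in> El F W" "cmp (t \<cdot>\<^bsub>A\<^esub> s) W x = \<one>\<^bsub>AOb H W\<^esub>"
  have "cmp t W (cmp s W x) = \<one>\<^bsub>AOb H W\<^esub>" "cmp s W x \<in> El G W"
    using M.cmp_comp[OF s(1) t(1)] M.cmp_closed[OF s(1)] W x by simp_all
  then obtain Y g where g: "deflation T U Y W g" "AAr G g (cmp s W x) = \<one>\<^bsub>AOb G Y\<^esub>" using wisoD(1)[OF t(2) W] by blast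
  note ga = deflation_arrow_C[OF g(1)]
  have "cmp s Y (AAr F g x) = \<one>\<^bsub>AOb G Y\<^esub>" "AAr F g x \<in> El F Y"
    using M.cmp_natural[OF s(1) ga x(1)] g(2) M.fun_closed[OF F ga x(1)] by simp_all
  then obtain Y' g' where g': "deflation T U Y' Y g'" "AAr F g' (AAr F g x) = \<one>\<^bsub>AOb F Y'\<^esub>"
    using wisoD(1)[OF s(2) deflation_U(1)[OF g(1)]] by blast
  then show "\<exists>Y g. deflation T U Y W g \<and> AAr F g x = \<one>\<^bsub>AOb F Y\<^esub>"
    using deflation_comp[OF g'(1) g(1)] M.fun_comp[OF F deflation_arrow_C[OF g'(1)] ga x(1)] by auto
next
  note F = M.arrow_objects(1)[OF s(1)] and H = M.arrow_objects(2)[OF t(1)]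
  fix W z assume W: "W \<in> U" and z: "z \<in> El H W"
  obtain Y g y where g: "deflation T U Y W g" "y \<in> El G Y" "AAr H g z = cmp t Y y" using wisoD(2)[OF t(2) W z] by blast
  obtain Y' g' x where g': "deflation T U Y' Y g'" "x \<in> El F Y'" "AAr G g' y = cmp s Y' x"
    using wisoD(2)[OF s(2) deflation_U(1)[OF g(1)] g(2)] by blast
  note ga = deflation_arrow_C[OF g(1)] and g'a = deflation_arrow_C[OF g'(1)]
  have "AAr H (g \<cdot> g') z = AAr H g' (cmp t Y y)" using M.fun_comp[OF H g'a ga z] g(3) by simp
  also have "\<dots> = cmp (t \<cdot>\<^bsub>A\<^esub> s) Y' x"
    using M.cmp_natural[OF t(1) g'a g(2)] g'(3) M.cmp_comp[OF s(1) t(1) _ g'(2)] deflation_U(1)[OF g'(1)] by simp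
  finally show "\<exists>Y g x. deflation T U Y W g \<and> x \<in> El F Y \<and> AAr H g z = cmp (t \<cdot>\<^bsub>A\<^esub> s) Y x"
    using deflation_comp[OF g'(1) g(1)] g'(2) by blast
qed

lemma wiso_ide:
  assumes F: "F \<in> Obj A"
  shows "wiso (Ide A F) F F"
  unfolding wiso_def
proof (intro conjI ballI impI)
  fix W x assume W: "W \<in> U" and x: "x \<in> El F W"
  have *: "AAr F (Ide T W) x = x" "cmp (Ide A F) W x = x"
    using M.fun_ide[OF M.additive_Obj[OF F], of W x] M.cmp_ide[of W x F] W x by simp_all
  show "\<exists>Y g. deflation T U Y W g \<and> AAr F g x = \<one>\<^bsub>AOb F Y\<^esub>" if "cmp (Ide A F) W x = \<one>\<^bsub>AOb F W\<^esub>"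
    using deflation_ide[OF W] * that by metis
  show "\<exists>Y g y. deflation T U Y W g \<and> y \<in> El F Y \<and> AAr F g x = cmp (Ide A F) Y y"
    using deflation_ide[OF W] * x by metis
qed

text \<open>The square is the pullback, formed as the kernel of the difference of \<open>f\<close>
  and \<open>s\<close> on the biproduct. Its projection to \<open>W\<close> inherits local
  injectivity and local surjectivity from \<open>s\<close>.\<close>

lemma wiso_ore:
  assumes f: "arrow A f W Y" and s: "arrow A s V' Y" "wiso s V' Y"
  obtains P t f' where "arrow A t P W" "wiso t P W" "arrow A f' P V'" "f \<cdot>\<^bsub>A\<^esub> t = s \<cdot>\<^bsub>A\<^esub> f'"
proof -
  note o = arrowD(1,2)[OF f] arrowD(1)[OF s(1)]
  note Wa = M.additive_Obj[OF o(1)] and Ya = M.additive_Obj[OF o(2)] and Va = M.additive_Obj[OF o(3)]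
  obtain D where "biproduct A W V' D" using A.ex_biproduct[OF o(1,3)] by blast
  then obtain i j p q where b: "arrow A i W D" "arrow A j V' D" "arrow A p D W" "arrow A q D V'"
    and e: "p \<cdot>\<^bsub>A\<^esub> i = Ide A W" "q \<cdot>\<^bsub>A\<^esub> j = Ide A V'" "q \<cdot>\<^bsub>A\<^esub> i = Zero A W V'" "p \<cdot>\<^bsub>A\<^esub> j = Zero A V' W"
    "(i \<cdot>\<^bsub>A\<^esub> p) \<otimes>\<^bsub>Hom A D D\<^esub> (j \<cdot>\<^bsub>A\<^esub> q) = Ide A D"
    by (rule A.biproductE)
  note Da = M.arrow_objects(2)[OF b(1)]
  note fp = M.mod_comp[OF b(3) f] and sq = M.mod_comp[OF b(4) s(1)]
  let ?d = "(f \<cdot>\<^bsub>A\<^esub> p) \<otimes>\<^bsub>Hom A D Y\<^esub> inv\<^bsub>Hom A D Y\<^esub> (s \<cdot>\<^bsub>A\<^esub> q)"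
  have d: "arrow A ?d D Y" using A.arrow_sum[OF fp A.arrow_neg[OF sq]] .
  \<comment> \<open>Elements of the biproduct are handled as pairs: this builds one from its
    components, and \<open>split\<close> detects the unit on components.\<close>
  have pair: "cmp p X (cmp i X w \<otimes>\<^bsub>AOb D X\<^esub> cmp j X v) = w" "cmp q X (cmp i X w \<otimes>\<^bsub>AOb D X\<^esub> cmp j X v) = v"
    "cmp i X w \<otimes>\<^bsub>AOb D X\<^esub> cmp j X v \<in> El D X"
    if X: "X \<in> U" and w: "w \<in> El W X" and v: "v \<in> El V' X" for X w v
  proof -
    have XC: "X \<in> Obj C" using X by simp
    interpret GD: group "AOb D X" using M.fun_group[OF Da XC] .
    interpret GW: group "AOb W X" using M.fun_group[OF Wa XC] .
    interpret GV: group "AOb V' X" using M.fun_group[OF Va XC] .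
    have iw: "cmp i X w \<in> El D X" and jv: "cmp j X v \<in> El D X" using M.cmp_closed b XC w v by blast+
    then show "cmp i X w \<otimes>\<^bsub>AOb D X\<^esub> cmp j X v \<in> El D X" by simp
    have "cmp p X (cmp i X w) = w" "cmp p X (cmp j X v) = \<one>\<^bsub>AOb W X\<^esub>"
      using M.cmp_comp[OF b(1,3) XC w] M.cmp_comp[OF b(2,3) XC v] e(1,4) M.cmp_ide[OF XC w] M.cmp_zero[OF XC v]
      by metis+
    then show "cmp p X (cmp i X w \<otimes>\<^bsub>AOb D X\<^esub> cmp j X v) = w"
      using M.cmp_mult[OF b(3) XC iw jv] w by simp
    have "cmp q X (cmp j X v) = v" "cmp q X (cmp i X w) = \<one>\<^bsub>AOb V' X\<^esub>"
      using M.cmp_comp[OF b(1,4) XC w] M.cmp_comp[OF b(2,4) XC v] e(2,3) M.cmp_ide[OF XC v] M.cmp_zero[OF XC w]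
      by metis+
    then show "cmp q X (cmp i X w \<otimes>\<^bsub>AOb D X\<^esub> cmp j X v) = v"
      using M.cmp_mult[OF b(4) XC iw jv] v by simp
  qed
  have split: "x = \<one>\<^bsub>AOb D X\<^esub>" if X: "X \<in> U" and x: "x \<in> El D X" "cmp p X x = \<one>\<^bsub>AOb W X\<^esub>" "cmp q X x = \<one>\<^bsub>AOb V' X\<^esub>" for X x
  proof -
    have XC: "X \<in> Obj C" using X by simp
    have "x = cmp (Ide A D) X x" using M.cmp_ide[OF XC x(1)] by simp
    also have "\<dots> = cmp i X (cmp p X x) \<otimes>\<^bsub>AOb D X\<^esub> cmp j X (cmp q X x)"
      using M.cmp_sum[OF M.mod_comp[OF b(3,1)] M.mod_comp[OF b(4,2)] XC x(1)] M.cmp_comp[OF b(3,1) XC x(1)]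
        M.cmp_comp[OF b(4,2) XC x(1)] e(5) by simp
    also have "\<dots> = \<one>\<^bsub>AOb D X\<^esub>"
      using x M.cmp_one[OF b(1) XC] M.cmp_one[OF b(2) XC] monoid.r_one[OF group.is_monoid[OF M.fun_group[OF Da XC]]]
        M.fun_one_closed[OF Da XC] by simp
    finally show ?thesis .
  qed
  have dz: "cmp ?d X x = \<one>\<^bsub>AOb Y X\<^esub> \<longleftrightarrow> cmp f X (cmp p X x) = cmp s X (cmp q X x)" if X: "X \<in> U" and x: "x \<in> El D X" for X x
  proof -
    have XC: "X \<in> Obj C" using X by simp
    interpret GY: group "AOb Y X" using M.fun_group[OF Ya XC] .
    have px: "cmp f X (cmp p X x) \<in> El Y X" and qx: "cmp s X (cmp q X x) \<in> El Y X"
      using M.cmp_closed[OF f XC] M.cmp_closed[OF s(1) XC] M.cmp_closed[OF b(3) XC x] M.cmp_closed[OF b(4) XC x] by blast+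
    have neg: "cmp (inv\<^bsub>Hom A D Y\<^esub> (s \<cdot>\<^bsub>A\<^esub> q)) X x = inv\<^bsub>AOb Y X\<^esub> (cmp (s \<cdot>\<^bsub>A\<^esub> q) X x)"
    proof -
      have "cmp (inv\<^bsub>Hom A D Y\<^esub> (s \<cdot>\<^bsub>A\<^esub> q)) X x \<otimes>\<^bsub>AOb Y X\<^esub> cmp (s \<cdot>\<^bsub>A\<^esub> q) X x = \<one>\<^bsub>AOb Y X\<^esub>"
        using M.cmp_sum[OF A.arrow_neg[OF sq] sq XC x] M.cmp_zero[OF XC x]
          group.l_inv[OF A.hom_is_group arrowD(3)[OF sq]] arrowD(1,2)[OF sq] by simp
      then show ?thesis
        using GY.inv_equality M.cmp_closed[OF sq XC x] M.cmp_closed[OF A.arrow_neg[OF sq] XC x] by metis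
    qed
    have "cmp ?d X x = cmp f X (cmp p X x) \<otimes>\<^bsub>AOb Y X\<^esub> inv\<^bsub>AOb Y X\<^esub> (cmp s X (cmp q X x))"
      using M.cmp_sum[OF fp A.arrow_neg[OF sq] XC x] neg M.cmp_comp[OF b(3) f XC x] M.cmp_comp[OF b(4) s(1) XC x] by simp
    then show ?thesis using px qx GY.inv_equality GY.r_inv GY.inv_inv GY.inv_closed by metis
  qed
  obtain P k where k: "arrow A k P D" "M.pinj k P D" "M.pexact k ?d P D Y" by (rule M.pointwise_kernel[OF d])
  note Pa = M.arrow_objects(1)[OF k(1)]
  have kd: "cmp f X (cmp p X (cmp k X z)) = cmp s X (cmp q X (cmp k X z))" if X: "X \<in> U" and z: "z \<in> El P X" for X z
    using dz[OF X] k(3) X z M.cmp_closed[OF k(1), of X z] unfolding M.pexact_def by auto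
  note t = M.mod_comp[OF k(1) b(3)] and f' = M.mod_comp[OF k(1) b(4)]
  have "f \<cdot>\<^bsub>A\<^esub> (p \<cdot>\<^bsub>A\<^esub> k) = s \<cdot>\<^bsub>A\<^esub> (q \<cdot>\<^bsub>A\<^esub> k)"
    by (rule M.arrow_eqI[OF M.mod_comp[OF t f] M.mod_comp[OF f' s(1)]])
      (simp add: M.cmp_comp[OF t f] M.cmp_comp[OF f' s(1)] M.cmp_comp[OF k(1) b(3)] M.cmp_comp[OF k(1) b(4)] kd)
  moreover have "wiso (p \<cdot>\<^bsub>A\<^esub> k) P W"
    unfolding wiso_def
  proof (intro conjI ballI impI)
    fix X z assume X: "X \<in> U" and z: "z \<in> El P X" "cmp (p \<cdot>\<^bsub>A\<^esub> k) X z = \<one>\<^bsub>AOb W X\<^esub>"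
    have XC: "X \<in> Obj C" using X by simp
    have kz: "cmp k X z \<in> El D X" using M.cmp_closed[OF k(1) XC z(1)] .
    have pz: "cmp p X (cmp k X z) = \<one>\<^bsub>AOb W X\<^esub>" using M.cmp_comp[OF k(1) b(3) XC z(1)] z(2) by simp
    have "cmp s X (cmp q X (cmp k X z)) = \<one>\<^bsub>AOb Y X\<^esub>" using kd[OF X z(1)] pz M.cmp_one[OF f XC] by simp
    then obtain X' g where g: "deflation T U X' X g" "AAr V' g (cmp q X (cmp k X z)) = \<one>\<^bsub>AOb V' X'\<^esub>"
      using wisoD(1)[OF s(2) X] M.cmp_closed[OF b(4) XC kz] by blast
    note ga = deflation_arrow_C[OF g(1)]
    have X': "X' \<in> U" "X' \<in> Obj C" using deflation_U(1)[OF g(1)] by auto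
    have "AAr D g (cmp k X z) = \<one>\<^bsub>AOb D X'\<^esub>"
      by (rule split[OF X'(1) M.fun_closed[OF Da ga kz]])
        (use M.cmp_natural[OF b(3) ga kz] M.cmp_natural[OF b(4) ga kz] pz g(2) M.fun_one[OF Wa ga] in simp_all)
    then have "AAr P g z = \<one>\<^bsub>AOb P X'\<^esub>"
      using k(2) M.cmp_natural[OF k(1) ga z(1)] M.fun_closed[OF Pa ga z(1)] X'(2) unfolding M.pinj_def by simp
    then show "\<exists>X' g. deflation T U X' X g \<and> AAr P g z = \<one>\<^bsub>AOb P X'\<^esub>" using g(1) by blast
  next
    fix X w assume X: "X \<in> U" and w: "w \<in> El W X"
    have XC: "X \<in> Obj C" using X by simp
    obtain X' g v where g: "deflation T U X' X g" "v \<in> El V' X'" "AAr Y g (cmp f X w) = cmp s X' v"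
      using wisoD(2)[OF s(2) X M.cmp_closed[OF f XC w]] by blast
    note ga = deflation_arrow_C[OF g(1)]
    have X': "X' \<in> U" "X' \<in> Obj C" using deflation_U(1)[OF g(1)] by auto
    have gw: "AAr W g w \<in> El W X'" using M.fun_closed[OF Wa ga w] .
    note pr = pair[OF X'(1) gw g(2)]
    have "cmp f X' (AAr W g w) = cmp s X' v" using M.cmp_natural[OF f ga w] g(3) by simp
    then obtain z where z: "z \<in> El P X'" "cmp i X' (AAr W g w) \<otimes>\<^bsub>AOb D X'\<^esub> cmp j X' v = cmp k X' z"
      using dz[OF X'(1) pr(3)] pr k(3) X'(2) unfolding M.pexact_def by auto
    then have "AAr W g w = cmp (p \<cdot>\<^bsub>A\<^esub> k) X' z" using M.cmp_comp[OF k(1) b(3) X'(2) z(1)] pr(1) by simp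
    then show "\<exists>X' g z. deflation T U X' X g \<and> z \<in> El P X' \<and> AAr W g w = cmp (p \<cdot>\<^bsub>A\<^esub> k) X' z" using g(1) z(1) by blast
  qed
  ultimately show thesis using that[OF t _ f'] by blast
qed

text \<open>Take the kernel of \<open>h\<close>. Its inclusion is injective, and it is locally
  surjective because \<open>h y\<close> is killed by \<open>s\<close> and hence locally
  zero.\<close>

lemma wiso_cancel:
  assumes h: "arrow A h P Y" and s: "arrow A s Y L" "wiso s Y L" and z: "s \<cdot>\<^bsub>A\<^esub> h = Zero A P L"
  obtains K k where "arrow A k K P" "wiso k K P" "h \<cdot>\<^bsub>A\<^esub> k = Zero A K Y"
proof -
  obtain K k where k: "arrow A k K P" "M.pinj k K P" "M.pexact k h K P Y" by (rule M.pointwise_kernel[OF h])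
  note Ka = M.arrow_objects(1)[OF k(1)] and Pa = M.arrow_objects(1)[OF h]
  have "wiso k K P"
    unfolding wiso_def
  proof (intro conjI ballI impI)
    fix W x assume W: "W \<in> U" and x: "x \<in> El K W" "cmp k W x = \<one>\<^bsub>AOb P W\<^esub>"
    then have "AAr K (Ide T W) x = \<one>\<^bsub>AOb K W\<^esub>" using k(2) M.fun_ide[OF Ka, of W x] unfolding M.pinj_def by simp
    then show "\<exists>Y g. deflation T U Y W g \<and> AAr K g x = \<one>\<^bsub>AOb K Y\<^esub>" using deflation_ide[OF W] by blast
  next
    fix W y assume W: "W \<in> U" and y: "y \<in> El P W"
    have "cmp s W (cmp h W y) = \<one>\<^bsub>AOb L W\<^esub>" "cmp h W y \<in> El Y W"
      using z M.comp_eq_zero_iff[OF h s(1)] M.cmp_closed[OF h _ y] W y by simp_all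
    then obtain X g where g: "deflation T U X W g" "AAr Y g (cmp h W y) = \<one>\<^bsub>AOb Y X\<^esub>"
      using wisoD(1)[OF s(2) W] by blast
    note ga = deflation_arrow_C[OF g(1)]
    have "cmp h X (AAr P g y) = \<one>\<^bsub>AOb Y X\<^esub>" using M.cmp_natural[OF h ga y] g(2) by simp
    then show "\<exists>X g x. deflation T U X W g \<and> x \<in> El K X \<and> AAr P g y = cmp k X x"
      using k(3) deflation_U(1)[OF g(1)] M.fun_closed[OF Pa ga y] g(1) unfolding M.pexact_def by auto
  qed
  moreover have "h \<cdot>\<^bsub>A\<^esub> k = Zero A K Y" using M.is_kernelI[OF h k] by (simp add: is_kernel_def)
  ultimately show thesis using that k(1) by blast
qed

text \<open>Descent: an element of \<open>G\<close> lifts locally through \<open>s\<close>, and the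
  images of the local lifts under \<open>p\<close> glue in \<open>L\<close>. The relation
  \<open>R\<close> pairs an element with a glued value, leaving the cover and the lift free.\<close>

lemma lex_local:
  assumes L: "L \<in> lexU" and s: "arrow A s F G" "wiso s F G" and p: "arrow A p F L"
  shows "\<exists>!q. arrow A q G L \<and> q \<cdot>\<^bsub>A\<^esub> s = p"
proof -
  note Fa = M.arrow_objects(1)[OF s(1)] and Ga = M.arrow_objects(2)[OF s(1)] and La = M.arrow_objects(2)[OF p]
  define R where "R W x l \<longleftrightarrow> x \<in> El G W \<and> l \<in> El L W \<and>
    (\<exists>Y g y. deflation T U Y W g \<and> y \<in> El F Y \<and> AAr G g x = cmp s Y y \<and> AAr L g l = cmp p Y y)" for W x l
  have "\<exists>\<eta>. natural_trans C G L \<eta> \<and> (\<forall>W\<in>Obj C. \<forall>x l. R W x l \<longleftrightarrow> x \<in> El G W \<and> l = \<eta> W x)"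
  proof (rule M.natural_trans_relation[OF Ga La])
    show "x \<in> El G W \<and> l \<in> El L W" if "R W x l" for W x l using that by (simp add: R_def)
    show "\<exists>l. R W x l" if "W \<in> Obj C" and x: "x \<in> El G W" for W x
    proof -
      have W: "W \<in> U" using that by simp
      obtain Y g y where g: "deflation T U Y W g" "y \<in> El F Y" "AAr G g x = cmp s Y y"
        using wisoD(2)[OF s(2) W x] by blast
      obtain Z f h where Z: "Z \<in> U" "Y \<in> U" and d: "distinguished T Z Y W f g h" and conf: "conflation T U Z Y W f g"
        by (rule deflationE[OF g(1)])
      note ga = deflation_arrow_C[OF g(1)]
      have f: "arrow C f Z Y" using distinguishedD(1)[OF d] Z by (simp add: arrow_C)
      have fy: "AAr F f y \<in> El F Z" using M.fun_closed[OF Fa f g(2)] .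
      \<comment> \<open>Gluing condition: restricted to \<open>Z\<close>, the lift \<open>y\<close>
        is killed by \<open>s\<close>, so it is locally zero. In \<open>L\<close> a locally zero
        element is zero, so \<open>p y\<close> restricts to zero on \<open>Z\<close> and descends to
        \<open>W\<close>.\<close>
      have "cmp s Z (AAr F f y) = AAr G (g \<cdot> f) x"
        using M.cmp_natural[OF s(1) f g(2)] g(3) M.fun_comp[OF Ga f ga x] by simp
      also have "\<dots> = \<one>\<^bsub>AOb G Z\<^esub>" using triangle_comp_zero(1)[OF d] M.fun_zero[OF Ga _ _ x, of Z] Z W by simp
      finally obtain Z' g' where g': "deflation T U Z' Z g'" "AAr F g' (AAr F f y) = \<one>\<^bsub>AOb F Z'\<^esub>"
        using wisoD(1)[OF s(2) Z(1) fy] by blast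
      note g'a = deflation_arrow_C[OF g'(1)]
      have py: "cmp p Y y \<in> El L Y" using M.cmp_closed[OF p _ g(2)] Z by simp
      have fpy: "AAr L f (cmp p Y y) = cmp p Z (AAr F f y)" using M.cmp_natural[OF p f g(2)] by simp
      have "AAr L g' (AAr L f (cmp p Y y)) = \<one>\<^bsub>AOb L Z'\<^esub>"
        using fpy M.cmp_natural[OF p g'a fy] g'(2) M.cmp_one[OF p] deflation_U(1)[OF g'(1)] by simp
      then have "AAr L f (cmp p Y y) = \<one>\<^bsub>AOb L Z\<^esub>" by (rule lexD(2)[OF L g'(1) M.fun_closed[OF La f py]])
      then obtain l where "l \<in> El L W" "AAr L g l = cmp p Y y" using lexD(3)[OF L conf py] by metis
      then show ?thesis using g x unfolding R_def by blast
    qed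
    show "R W (x \<otimes>\<^bsub>AOb G W\<^esub> x') (l \<otimes>\<^bsub>AOb L W\<^esub> l')" if "W \<in> Obj C" and R: "R W x l" "R W x' l'" for W x l x' l'
    proof -
      have W: "W \<in> U" using that by simp
      have xl: "x \<in> El G W" "l \<in> El L W" "x' \<in> El G W" "l' \<in> El L W" using R by (auto simp: R_def)
      obtain Y g y where g: "deflation T U Y W g" "y \<in> El F Y" "AAr G g x = cmp s Y y" "AAr L g l = cmp p Y y"
        using R(1) by (auto simp: R_def)
      obtain Y' g' y' where g': "deflation T U Y' W g'" "y' \<in> El F Y'" "AAr G g' x' = cmp s Y' y'" "AAr L g' l' = cmp p Y' y'"
        using R(2) by (auto simp: R_def)
      note ga = deflation_arrow_C[OF g(1)] and g'a = deflation_arrow_C[OF g'(1)]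
      \<comment> \<open>The two lifts live on different covers; a pullback of deflations gives a
        common refinement.\<close>
      obtain Y'' u b where u: "deflation T U Y'' Y u" "arrow T b Y'' Y'" "g \<cdot> u = g' \<cdot> b"
        by (rule deflation_pullback[OF g'(1) deflation_U(1)[OF g(1)] deflation_arrow[OF g(1)]])
      note ua = deflation_arrow_C[OF u(1)]
      have Y'': "Y'' \<in> Obj C" using deflation_U(1)[OF u(1)] by simp
      have b: "arrow C b Y'' Y'" using u(2) deflation_U(1)[OF u(1)] deflation_U(1)[OF g'(1)] by (simp add: arrow_C)
      have gu: "deflation T U Y'' W (g \<cdot> u)" "arrow C (g \<cdot> u) Y'' W"
        using deflation_comp[OF u(1) g(1)] deflation_arrow_C by auto
      let ?y = "AAr F u y \<otimes>\<^bsub>AOb F Y''\<^esub> AAr F b y'"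
      have yy: "AAr F u y \<in> El F Y''" "AAr F b y' \<in> El F Y''" using M.fun_closed[OF Fa ua g(2)] M.fun_closed[OF Fa b g'(2)] .
      then have y: "?y \<in> El F Y''" using monoid.m_closed[OF group.is_monoid[OF M.fun_group[OF Fa Y'']]] by blast
      have "AAr G (g \<cdot> u) x = cmp s Y'' (AAr F u y)" "AAr L (g \<cdot> u) l = cmp p Y'' (AAr F u y)"
        using M.fun_comp[OF Ga ua ga xl(1)] M.fun_comp[OF La ua ga xl(2)] g(3,4) M.cmp_natural[OF s(1) ua g(2)]
          M.cmp_natural[OF p ua g(2)] by simp_all
      moreover have "AAr G (g \<cdot> u) x' = cmp s Y'' (AAr F b y')" "AAr L (g \<cdot> u) l' = cmp p Y'' (AAr F b y')"
        using M.fun_comp[OF Ga b g'a xl(3)] M.fun_comp[OF La b g'a xl(4)] g'(3,4) M.cmp_natural[OF s(1) b g'(2)]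
          M.cmp_natural[OF p b g'(2)] u(3) by simp_all
      ultimately have "AAr G (g \<cdot> u) (x \<otimes>\<^bsub>AOb G W\<^esub> x') = cmp s Y'' ?y" "AAr L (g \<cdot> u) (l \<otimes>\<^bsub>AOb L W\<^esub> l') = cmp p Y'' ?y"
        using M.fun_mult[OF Ga gu(2) xl(1,3)] M.fun_mult[OF La gu(2) xl(2,4)] M.cmp_mult[OF s(1) Y'' yy]
          M.cmp_mult[OF p Y'' yy] by simp_all
      moreover have "x \<otimes>\<^bsub>AOb G W\<^esub> x' \<in> El G W" "l \<otimes>\<^bsub>AOb L W\<^esub> l' \<in> El L W"
        using monoid.m_closed[OF group.is_monoid[OF M.fun_group[OF Ga \<open>W \<in> Obj C\<close>]] xl(1,3)]
          monoid.m_closed[OF group.is_monoid[OF M.fun_group[OF La \<open>W \<in> Obj C\<close>]] xl(2,4)] .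
      ultimately show ?thesis unfolding R_def using gu(1) y by blast
    qed
    show "R W' (AAr G f x) (AAr L f l)" if f: "arrow C f W' W" and R: "R W x l" for W' W f x l
    proof -
      have W: "W' \<in> U" "arrow T f W' W" using f by (auto simp: arrow_C)
      have xl: "x \<in> El G W" "l \<in> El L W" using R by (auto simp: R_def)
      obtain Y g y where g: "deflation T U Y W g" "y \<in> El F Y" "AAr G g x = cmp s Y y" "AAr L g l = cmp p Y y"
        using R by (auto simp: R_def)
      obtain Y' g' b where u: "deflation T U Y' W' g'" "arrow T b Y' Y" "f \<cdot> g' = g \<cdot> b"
        by (rule deflation_pullback[OF g(1) W])
      note ga = deflation_arrow_C[OF g(1)] and g'a = deflation_arrow_C[OF u(1)]
      have b: "arrow C b Y' Y" using u(2) deflation_U(1)[OF u(1)] deflation_U(1)[OF g(1)] by (simp add: arrow_C)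
      have "AAr G g' (AAr G f x) = cmp s Y' (AAr F b y)" "AAr L g' (AAr L f l) = cmp p Y' (AAr F b y)"
        using M.fun_comp[OF Ga g'a f xl(1)] M.fun_comp[OF Ga b ga xl(1)] M.fun_comp[OF La g'a f xl(2)]
          M.fun_comp[OF La b ga xl(2)] u(3) g(3,4) M.cmp_natural[OF s(1) b g(2)] M.cmp_natural[OF p b g(2)] by simp_all
      then show ?thesis unfolding R_def
        using u(1) M.fun_closed[OF Fa b g(2)] M.fun_closed[OF Ga f xl(1)] M.fun_closed[OF La f xl(2)] by blast
    qed
    show "l = \<one>\<^bsub>AOb L W\<^esub>" if "W \<in> Obj C" and R: "R W \<one>\<^bsub>AOb G W\<^esub> l" for W l
    proof -
      obtain Y g y where l: "l \<in> El L W" and g: "deflation T U Y W g" "y \<in> El F Y"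
        "AAr G g \<one>\<^bsub>AOb G W\<^esub> = cmp s Y y" "AAr L g l = cmp p Y y"
        using R by (auto simp: R_def)
      have Y: "Y \<in> U" "Y \<in> Obj C" using deflation_U(1)[OF g(1)] by auto
      \<comment> \<open>A lift of the unit is locally zero. Injectivity of \<open>L\<close> along
        \<open>g'\<close> makes its value zero, and injectivity along \<open>g\<close> makes
        \<open>l\<close> zero.\<close>
      have "cmp s Y y = \<one>\<^bsub>AOb G Y\<^esub>" using g(3) M.fun_one[OF Ga deflation_arrow_C[OF g(1)]] by simp
      then obtain Y' g' where g': "deflation T U Y' Y g'" "AAr F g' y = \<one>\<^bsub>AOb F Y'\<^esub>" using wisoD(1)[OF s(2) Y(1) g(2)] by blast
      have "AAr L g' (cmp p Y y) = \<one>\<^bsub>AOb L Y'\<^esub>"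
        using M.cmp_natural[OF p deflation_arrow_C[OF g'(1)] g(2)] g'(2) M.cmp_one[OF p] deflation_U(1)[OF g'(1)] by simp
      then have "cmp p Y y = \<one>\<^bsub>AOb L Y\<^esub>" by (rule lexD(2)[OF L g'(1) M.cmp_closed[OF p Y(2) g(2)]])
      then show ?thesis using lexD(2)[OF L g(1) l] g(4) by simp
    qed
  qed
  then obtain \<eta> where \<eta>: "natural_trans C G L \<eta>" "\<And>W x l. W \<in> Obj C \<Longrightarrow> R W x l \<Longrightarrow> l = \<eta> W x" by auto
  let ?q = "nat_arrow C G L \<eta>"
  have q: "arrow A ?q G L" using M.nat_arrow_in[OF arrowD(2)[OF s(1)] arrowD(2)[OF p] \<eta>(1)] .
  have qs: "?q \<cdot>\<^bsub>A\<^esub> s = p"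
  proof (rule M.arrow_eqI[OF M.mod_comp[OF s(1) q] p])
    fix W y assume W: "W \<in> Obj C" and y: "y \<in> El F W"
    have WU: "W \<in> U" using W by simp
    have sy: "cmp s W y \<in> El G W" "cmp p W y \<in> El L W" using M.cmp_closed[OF s(1) W y] M.cmp_closed[OF p W y] .
    have "R W (cmp s W y) (cmp p W y)"
      unfolding R_def using sy deflation_ide[OF WU] y M.fun_ide[OF Ga W sy(1)] M.fun_ide[OF La W sy(2)]
      by (intro conjI exI[of _ W] exI[of _ "Ide T W"] exI[of _ y]) auto
    then show "cmp (?q \<cdot>\<^bsub>A\<^esub> s) W y = cmp p W y"
      using \<eta>(2)[OF W] M.cmp_comp[OF s(1) q W y] cmp_nat_arrow[OF W sy(1)] by simp
  qed
  \<comment> \<open>Two extensions agree on a cover where \<open>x\<close> lifts, and restriction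
    along a deflation is injective on \<open>L\<close>.\<close>
  have uniq: "q1 = q2" if q1: "arrow A q1 G L" "q1 \<cdot>\<^bsub>A\<^esub> s = p" and q2: "arrow A q2 G L" "q2 \<cdot>\<^bsub>A\<^esub> s = p" for q1 q2
  proof (rule M.arrow_eqI[OF q1(1) q2(1)])
    fix W x assume W: "W \<in> Obj C" and x: "x \<in> El G W"
    have WU: "W \<in> U" using W by simp
    obtain Y g y where g: "deflation T U Y W g" "y \<in> El F Y" "AAr G g x = cmp s Y y" using wisoD(2)[OF s(2) WU x] by blast
    have Y: "Y \<in> Obj C" using deflation_U(1)[OF g(1)] by simp
    note ga = deflation_arrow_C[OF g(1)]
    interpret gh: group_hom "AOb L W" "AOb L Y" "AAr L g" by (rule M.fun_map_hom[OF La ga])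
    have "AAr L g (cmp q1 W x) = cmp p Y y" "AAr L g (cmp q2 W x) = cmp p Y y"
      using M.cmp_natural[OF q1(1) ga x] M.cmp_natural[OF q2(1) ga x] g(3) M.cmp_comp[OF s(1) q1(1) Y g(2)]
        M.cmp_comp[OF s(1) q2(1) Y g(2)] q1(2) q2(2) by simp_all
    moreover have "inj_on (AAr L g) (El L W)" using gh.inj_on_one_iff lexD(2)[OF L g(1)] by blast
    ultimately show "cmp q1 W x = cmp q2 W x"
      using M.cmp_closed[OF q1(1) W x] M.cmp_closed[OF q2(1) W x] by (simp add: inj_on_def)
  qed
  show ?thesis using q qs uniq by (intro ex1I[of _ ?q]) blast+
qed

section \<open>Reflections as represented functors\<close>

lemma additive_represented:
  assumes X: "X \<in> Obj T"
  shows "additive_abfunctor C (representable T X)"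
  using additive_abfunctor_full_subcat[OF additive_representable[OF X]] U_obj by blast

text \<open>A right approximation of \<open>X\<close> is a generator, and a weak kernel of it gives
  the relations.\<close>

lemma represented_presents:
  assumes X: "X \<in> Obj T"
  obtains A1 a A2 r where "presents C (representable T X) A1 a A2 r"
proof -
  obtain A1 a where A1: "A1 \<in> U" "arrow T a A1 X" and fac: "\<And>W k. W \<in> U \<Longrightarrow> arrow T k W X \<Longrightarrow> \<exists>l. arrow T l W A1 \<and> k = a \<cdot> l"
    by (rule right_approximation[OF X]) blast
  obtain A2 r where A2: "A2 \<in> U" "arrow T r A2 A1" "a \<cdot> r = Zero T A2 X"
    and wk: "\<And>W k. W \<in> U \<Longrightarrow> arrow T k W A1 \<Longrightarrow> a \<cdot> k = Zero T W X \<Longrightarrow> \<exists>l. arrow T l W A2 \<and> k = r \<cdot> l"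
    by (rule weak_kernel[OF A1(2)]) blast
  have zero: "a \<cdot> (r \<cdot> k) = Zero T W X" if "arrow T k W A2" for k W
    using arrow_assoc[OF that A2(2) A1(2)] A2(3) zero_comp[OF that X] by simp
  have "presents C (representable T X) A1 a A2 r"
    unfolding presents_def
  proof (intro conjI ballI allI impI)
    show "a \<in> El (representable T X) A1" using A1(2) by (simp add: representable_def arrow_def)
    show "arrow C r A2 A1" using A1 A2 by (simp add: arrow_C)
    show "\<exists>h. arrow C h W A1 \<and> x = AAr (representable T X) h a"
      if "W \<in> Obj C" "x \<in> El (representable T X) W" for W x
      using that fac[of W x] A1(1) X U_obj by (auto simp: representable_def arrow_C arrow_def[of T])
    show "AAr (representable T X) h a = \<one>\<^bsub>AOb (representable T X) W\<^esub> \<longleftrightarrow> (\<exists>k. arrow C k W A2 \<and> h = r \<cdot>\<^bsub>C\<^esub> k)"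
      if "arrow C h W A1" for W h
      using that wk[of W h] zero A2(1) by (auto simp: representable_def arrow_C)
  qed
  then show thesis by (rule that)
qed

text \<open>The functor represented by \<open>X\<close> is exact in the middle by the long exact
  sequence of a triangle, and injective along deflations by the choice of \<open>X\<close>. It is
  copied to elements in \<open>'g\<close>, and the reflection map sends the generator to
  \<open>e\<close>.\<close>

lemma ex_reflection:
  assumes F: "F \<in> Obj A"
  obtains L s where "L \<in> lexU" "arrow A s F L" "wiso s F L"
proof -
  note Fa = M.additive_Obj[OF F]
  obtain X0 x0 X1 f where pr: "presents C F X0 x0 X1 f" using F M.Obj_A M.fp_presents by metis
  note P = presentsD[OF pr]
  have X: "X1 \<in> U" "X0 \<in> U" and f: "arrow T f X1 X0" using P(2) by (auto simp: arrow_C)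
  obtain X e where e: "arrow T e X0 X" "e \<cdot> f = Zero T X1 X"
    and mono: "\<And>Z Y W p q k. \<lbrakk>conflation T U Z Y W p q; arrow T k W X; k \<cdot> q = Zero T Y X\<rbrakk> \<Longrightarrow> k = Zero T W X"
    and linj: "\<And>W k. \<lbrakk>W \<in> U; arrow T k W X0; e \<cdot> k = Zero T W X\<rbrakk> \<Longrightarrow>
       \<exists>Y g l. deflation T U Y W g \<and> arrow T l Y X1 \<and> k \<cdot> g = f \<cdot> l"
    and lsurj: "\<And>W k. \<lbrakk>W \<in> U; arrow T k W X\<rbrakk> \<Longrightarrow> \<exists>Y g l. deflation T U Y W g \<and> arrow T l Y X0 \<and> k \<cdot> g = e \<cdot> l"
    by (rule reflection_object[OF X f]) blast
  have o: "X \<in> Obj T" using e(1) by (rule arrowD)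
  let ?H = "representable T X"
  note Ha = additive_represented[OF o]
  have H: "k \<in> El ?H W \<longleftrightarrow> arrow T k W X" if "W \<in> U" for W k using that U_obj o by (simp add: representable_def arrow_def)
  have Hmap: "AAr ?H g k = k \<cdot> g" for g k by (simp add: representable_def)
  have Hone: "\<one>\<^bsub>AOb ?H W\<^esub> = Zero T W X" for W by (simp add: representable_def)
  obtain A1 a A2 r where "presents C ?H A1 a A2 r" by (rule represented_presents[OF o])
  then obtain L \<eta> where L: "L \<in> Obj A" and \<eta>: "natural_trans C ?H L \<eta>"
    and bij: "\<And>X. X \<in> Obj C \<Longrightarrow> bij_betw (\<eta> X) (El ?H X) (El L X)"
    by (rule M.small_copy[OF Ha]) blast
  note La = M.additive_Obj[OF L]
  have el: "\<exists>k. arrow T k W X \<and> y = \<eta> W k" if "W \<in> U" "y \<in> El L W" for W y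
    using bij_betw_imp_surj_on[OF bij[of W]] that H[OF that(1)] by auto
  have in_L: "\<eta> W k \<in> El L W" if "W \<in> U" "arrow T k W X" for W k
    using M.nt_closed[OF \<eta>, of W k] H that by simp
  have one: "\<eta> W k = \<one>\<^bsub>AOb L W\<^esub> \<longleftrightarrow> k = Zero T W X" if "W \<in> U" "arrow T k W X" for W k
  proof -
    have "\<eta> W (Zero T W X) = \<one>\<^bsub>AOb L W\<^esub>" using M.nt_one[OF \<eta> Ha La, of W] Hone that by simp
    moreover have "inj_on (\<eta> W) (El ?H W)" using bij_betw_imp_inj_on[OF bij] that by simp
    moreover have "k \<in> El ?H W" "Zero T W X \<in> El ?H W" using H that arrow_zero o U_obj by auto
    ultimately show ?thesis by (metis inj_on_def)
  qed
  have map: "AAr L g (\<eta> W k) = \<eta> Y (k \<cdot> g)" if "arrow C g Y W" "arrow T k W X" for g Y W k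
    using M.nt_natural[OF \<eta> that(1), of k] that H[of W k] Hmap by (simp add: arrow_C)
  have "L \<in> lexU"
    unfolding lex_iff
  proof (intro conjI allI impI ballI)
    show "L \<in> Obj A" by fact
    fix Y W q x assume q: "deflation T U Y W q" and x: "x \<in> El L W" "AAr L q x = \<one>\<^bsub>AOb L Y\<^esub>"
    obtain k where k: "arrow T k W X" "x = \<eta> W k" using el[OF deflation_U(2)[OF q] x(1)] by blast
    have "k \<cdot> q = Zero T Y X"
      using x(2) k(2) map[OF deflation_arrow_C[OF q] k(1)] one[OF deflation_U(1)[OF q] arrow_comp[OF deflation_arrow[OF q] k(1)]] by simp
    moreover obtain Z i h where "conflation T U Z Y W i q" by (rule deflationE[OF q])
    ultimately have "k = Zero T W X" using mono k(1) by blast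
    then show "x = \<one>\<^bsub>AOb L W\<^esub>" using one[OF deflation_U(2)[OF q] k(1)] k(2) by simp
  next
    fix Z Y W i q y assume conf: "conflation T U Z Y W i q" and y: "y \<in> El L Y" "AAr L i y = \<one>\<^bsub>AOb L Z\<^esub>"
    obtain h where z: "Z \<in> U" "Y \<in> U" "W \<in> U" and d: "distinguished T Z Y W i q h" using conf by (auto simp: conflation_def)
    note D = distinguishedD[OF d]
    obtain k where k: "arrow T k Y X" "y = \<eta> Y k" using el[OF z(2) y(1)] by blast
    have i: "arrow C i Z Y" and q: "arrow C q Y W" using D z by (simp_all add: arrow_C)
    have "k \<cdot> i = Zero T Z X" using y(2) k(2) map[OF i k(1)] one[OF z(1) arrow_comp[OF D(1) k(1)]] by simp
    then obtain l where l: "arrow T l W X" "l \<cdot> q = k" by (rule extend_second[OF d k(1)])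
    then show "\<exists>x\<in>El L W. y = AAr L q x" using map[OF q l(1)] k(2) in_L[OF z(3) l(1)]
      by (intro bexI[of _ "\<eta> W l"]) simp_all
  qed
  moreover obtain s where s: "arrow A s F L" "cmp s X0 x0 = \<eta> X0 e"
  proof (rule M.yoneda_arrow[OF F L pr in_L[OF X(2) e(1)]])
    show "AAr L f (\<eta> X0 e) = \<one>\<^bsub>AOb L X1\<^esub>"
      using map[OF P(2) e(1)] e(2) one[OF X(1) arrow_comp[OF f e(1)]] by simp
  qed
  have gen: "cmp s W (AAr F k x0) = \<eta> W (e \<cdot> k)" if "arrow C k W X0" for W k
    using M.cmp_natural[OF s(1) that P(1)] s(2) map[OF that e(1)] by simp
  have "wiso s F L"
    unfolding wiso_def
  proof (intro conjI ballI impI)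
    fix W x assume W: "W \<in> U" and x: "x \<in> El F W" "cmp s W x = \<one>\<^bsub>AOb L W\<^esub>"
    obtain k where k: "arrow C k W X0" "x = AAr F k x0" using P(5)[of W x] W x(1) by auto
    have kT: "arrow T k W X0" using k(1) by (simp add: arrow_C)
    have "e \<cdot> k = Zero T W X" using x(2) k(2) gen[OF k(1)] one[OF W arrow_comp[OF kT e(1)]] by simp
    then obtain Y g l where g: "deflation T U Y W g" "arrow T l Y X1" "k \<cdot> g = f \<cdot> l" using linj[OF W kT] by blast
    have l: "arrow C l Y X1" using g(2) deflation_U(1)[OF g(1)] X(1) by (simp add: arrow_C)
    have "AAr F g x = \<one>\<^bsub>AOb F Y\<^esub>"
      using k(2) M.fun_comp[OF Fa deflation_arrow_C[OF g(1)] k(1) P(1)] g(3) M.presents_relation(1)[OF Fa pr l] by simp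
    then show "\<exists>Y g. deflation T U Y W g \<and> AAr F g x = \<one>\<^bsub>AOb F Y\<^esub>" using g(1) by blast
  next
    fix W y assume W: "W \<in> U" and y: "y \<in> El L W"
    obtain k where k: "arrow T k W X" "y = \<eta> W k" using el[OF W y] by blast
    obtain Y g l where g: "deflation T U Y W g" "arrow T l Y X0" "k \<cdot> g = e \<cdot> l" using lsurj[OF W k(1)] by blast
    have l: "arrow C l Y X0" using g(2) deflation_U(1)[OF g(1)] X(2) by (simp add: arrow_C)
    have "AAr L g y = cmp s Y (AAr F l x0)" using k map[OF deflation_arrow_C[OF g(1)] k(1)] g(3) gen[OF l] by simp
    then show "\<exists>Y g x. deflation T U Y W g \<and> x \<in> El F Y \<and> AAr L g y = cmp s Y x"
      using g(1) M.fun_closed[OF Fa l P(1)] by blast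
  qed
  ultimately show thesis using that s(1) by blast
qed

section \<open>Closure properties of \<open>def U\<close> and \<open>lex U\<close>\<close>

lemma serre_def: "serre_subcat A defU"
  unfolding serre_subcat_def
proof (intro conjI allI impI)
  show "defU \<subseteq> Obj A" using def_iff by blast
  obtain N where N: "zero_object A N" by (rule M.zero_functor)
  then have No: "N \<in> Obj A" by (simp add: zero_object_def)
  \<comment> \<open>Any \<open>serre_iso\<close> has a kernel in \<open>defU\<close>, so an identity
    already shows that \<open>defU\<close> is nonempty.\<close>
  have "wiso (Ide A N) N N" by (rule wiso_ide[OF No])
  then have "serre_iso A defU N N (Ide A N)" using serre_iso_iff[OF M.mod_ide[OF No]] by blast
  then show "defU \<noteq> {}" by (auto simp: serre_iso_def)
  fix X Y Z f g assume ex: "short_exact A X Y Z f g"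
  then have f: "arrow A f X Y" and g: "arrow A g Y Z" by (simp_all add: short_exact_def arrow_def)
  have e: "M.pinj f X Y" "M.pexact f g X Y Z" "M.psurj g Y Z"
    using ex M.is_kernel_iff[OF g] M.is_cokernel_iff[OF f] by (simp_all add: short_exact_def)
  note o = arrowD(1,2)[OF f] arrowD(2)[OF g]
  note Xa = M.additive_Obj[OF o(1)] and Ya = M.additive_Obj[OF o(2)] and Za = M.additive_Obj[OF o(3)]
  have "effaceable Y \<longleftrightarrow> effaceable X \<and> effaceable Z"
  proof
    assume Y: "effaceable Y"
    have "effaceable X"
      unfolding effaceable_def
    proof (intro ballI)
      fix W x assume W: "W \<in> U" and x: "x \<in> El X W"
      have "cmp f W x \<in> El Y W" using M.cmp_closed[OF f _ x] W by simp
      then obtain W' h where h: "deflation T U W' W h" "AAr Y h (cmp f W x) = \<one>\<^bsub>AOb Y W'\<^esub>" by (rule effaceableE[OF Y W])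
      then have "AAr X h x = \<one>\<^bsub>AOb X W'\<^esub>"
        using e(1) M.cmp_natural[OF f deflation_arrow_C[OF h(1)] x] M.fun_closed[OF Xa deflation_arrow_C[OF h(1)] x]
          deflation_U(1)[OF h(1)] unfolding M.pinj_def by simp
      then show "\<exists>Y g. deflation T U Y W g \<and> AAr X g x = \<one>\<^bsub>AOb X Y\<^esub>" using h(1) by blast
    qed
    moreover have "effaceable Z"
      unfolding effaceable_def
    proof (intro ballI)
      fix W z assume W: "W \<in> U" and z: "z \<in> El Z W"
      obtain y where y: "y \<in> El Y W" "z = cmp g W y" using e(3) W z unfolding M.psurj_def by auto
      obtain W' h where h: "deflation T U W' W h" "AAr Y h y = \<one>\<^bsub>AOb Y W'\<^esub>" by (rule effaceableE[OF Y W y(1)])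
      then have "AAr Z h z = \<one>\<^bsub>AOb Z W'\<^esub>"
        using M.cmp_natural[OF g deflation_arrow_C[OF h(1)] y(1)] y(2) M.cmp_one[OF g] deflation_U(1)[OF h(1)] by simp
      then show "\<exists>Y g. deflation T U Y W g \<and> AAr Z g z = \<one>\<^bsub>AOb Z Y\<^esub>" using h(1) by blast
    qed
    ultimately show "effaceable X \<and> effaceable Z" by blast
  next
    assume XZ: "effaceable X \<and> effaceable Z"
    show "effaceable Y"
      unfolding effaceable_def
    proof (intro ballI)
      fix W y assume W: "W \<in> U" and y: "y \<in> El Y W"
      have gy: "cmp g W y \<in> El Z W" using M.cmp_closed[OF g _ y] W by simp
      \<comment> \<open>Efface the image in \<open>Z\<close> first, lift the restriction to
        \<open>X\<close> by exactness, then efface that lift.\<close>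
      obtain W' h where h: "deflation T U W' W h" "AAr Z h (cmp g W y) = \<one>\<^bsub>AOb Z W'\<^esub>" using effaceableE[OF _ W gy] XZ by blast
      note ha = deflation_arrow_C[OF h(1)]
      have "cmp g W' (AAr Y h y) = \<one>\<^bsub>AOb Z W'\<^esub>" using M.cmp_natural[OF g ha y] h(2) by simp
      then obtain x where x: "x \<in> El X W'" "AAr Y h y = cmp f W' x"
        using e(2) deflation_U(1)[OF h(1)] M.fun_closed[OF Ya ha y] unfolding M.pexact_def by auto
      obtain W'' k where k: "deflation T U W'' W' k" "AAr X k x = \<one>\<^bsub>AOb X W''\<^esub>"
        using effaceableE[OF _ deflation_U(1)[OF h(1)] x(1)] XZ by blast
      note ka = deflation_arrow_C[OF k(1)]
      have "AAr Y (h \<cdot> k) y = cmp f W'' (AAr X k x)"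
        using M.fun_comp[OF Ya ka ha y] x(2) M.cmp_natural[OF f ka x(1)] by simp
      also have "\<dots> = \<one>\<^bsub>AOb Y W''\<^esub>" using k(2) M.cmp_one[OF f] deflation_U(1)[OF k(1)] by simp
      finally show "\<exists>V g. deflation T U V W g \<and> AAr Y g y = \<one>\<^bsub>AOb Y V\<^esub>" using deflation_comp[OF k(1) h(1)] by blast
    qed
  qed
  then show "Y \<in> defU \<longleftrightarrow> X \<in> defU \<and> Z \<in> defU" using def_iff o by blast
qed

lemma zero_functor_elements:
  assumes N: "zero_object A N" and W: "W \<in> U" and x: "x \<in> El N W"
  shows "x = \<one>\<^bsub>AOb N W\<^esub>"
proof -
  have No: "N \<in> Obj A" using N by (simp add: zero_object_def)
  have "Ide A N = Zero A N N" using A.arrow_to_zero[OF N M.mod_ide[OF No]] .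
  then show ?thesis using M.cmp_ide[of W x N] M.cmp_zero[of W x N N] W x by simp
qed

lemma biproduct_elements:
  assumes "biproduct A X Y D"
  obtains i j p q where "arrow A i X D" "arrow A j Y D" "arrow A p D X" "arrow A q D Y"
    "\<And>W x. W \<in> U \<Longrightarrow> x \<in> El D W \<Longrightarrow> x = cmp i W (cmp p W x) \<otimes>\<^bsub>AOb D W\<^esub> cmp j W (cmp q W x)"
    "\<And>W x. W \<in> U \<Longrightarrow> x \<in> El D W \<Longrightarrow> cmp p W x = \<one>\<^bsub>AOb X W\<^esub> \<Longrightarrow> cmp q W x = \<one>\<^bsub>AOb Y W\<^esub> \<Longrightarrow> x = \<one>\<^bsub>AOb D W\<^esub>"
proof -
  obtain i j p q where b: "arrow A i X D" "arrow A j Y D" "arrow A p D X" "arrow A q D Y"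
    and e: "(i \<cdot>\<^bsub>A\<^esub> p) \<otimes>\<^bsub>Hom A D D\<^esub> (j \<cdot>\<^bsub>A\<^esub> q) = Ide A D"
    by (rule A.biproductE[OF assms])
  have split: "x = cmp i W (cmp p W x) \<otimes>\<^bsub>AOb D W\<^esub> cmp j W (cmp q W x)" if W: "W \<in> U" and x: "x \<in> El D W" for W x
  proof -
    have WC: "W \<in> Obj C" using W by simp
    show ?thesis
      using M.cmp_ide[OF WC x] M.cmp_sum[OF M.mod_comp[OF b(3,1)] M.mod_comp[OF b(4,2)] WC x]
        M.cmp_comp[OF b(3,1) WC x] M.cmp_comp[OF b(4,2) WC x] e by simp
  qed
  show thesis
  proof (rule that[OF b split])
    fix W x assume W: "W \<in> U" and x: "x \<in> El D W" "cmp p W x = \<one>\<^bsub>AOb X W\<^esub>" "cmp q W x = \<one>\<^bsub>AOb Y W\<^esub>"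
    have WC: "W \<in> Obj C" using W by simp
    note Da = M.arrow_objects(2)[OF b(1)]
    show "x = \<one>\<^bsub>AOb D W\<^esub>"
      using split[OF W x(1)] x(2,3) M.cmp_one[OF b(1) WC] M.cmp_one[OF b(2) WC]
        monoid.r_one[OF group.is_monoid[OF M.fun_group[OF Da WC]]] M.fun_one_closed[OF Da WC] by simp
  qed
qed

lemma additive_def: "additive_category (full_subcat A defU)"
proof -
  obtain N where N: "zero_object A N" by (rule M.zero_functor)
  then have No: "N \<in> Obj A" by (simp add: zero_object_def)
  have ND: "N \<in> defU"
    unfolding def_iff effaceable_def
    using No zero_functor_elements[OF N] deflation_ide M.fun_one[OF M.additive_Obj[OF No] deflation_arrow_C] by metis
  show ?thesis
  proof (rule A.additive_full_subcat[OF _ N ND])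
    show "defU \<subseteq> Obj A" using def_iff by blast
    fix X Y assume XY: "X \<in> defU" "Y \<in> defU"
    then have o: "X \<in> Obj A" "Y \<in> Obj A" and eff: "effaceable X" "effaceable Y" using def_iff by auto
    obtain D where D: "biproduct A X Y D" using A.ex_biproduct[OF o] by blast
    then have Do: "D \<in> Obj A" by (simp add: biproduct_def)
    obtain i j p q where b: "arrow A i X D" "arrow A j Y D" "arrow A p D X" "arrow A q D Y"
      and sp: "\<And>W x. W \<in> U \<Longrightarrow> x \<in> El D W \<Longrightarrow> cmp p W x = \<one>\<^bsub>AOb X W\<^esub> \<Longrightarrow> cmp q W x = \<one>\<^bsub>AOb Y W\<^esub> \<Longrightarrow> x = \<one>\<^bsub>AOb D W\<^esub>"
      by (rule biproduct_elements[OF D]) blast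
    note Da = M.additive_Obj[OF Do] and Xa = M.additive_Obj[OF o(1)]
    have "effaceable D"
      unfolding effaceable_def
    proof (intro ballI)
      fix W x assume W: "W \<in> U" and x: "x \<in> El D W"
      have px: "cmp p W x \<in> El X W" using M.cmp_closed[OF b(3) _ x] W by simp
      \<comment> \<open>The two components are effaced one after the other, and the two deflations
        are composed.\<close>
      obtain W' g where g: "deflation T U W' W g" "AAr X g (cmp p W x) = \<one>\<^bsub>AOb X W'\<^esub>" by (rule effaceableE[OF eff(1) W px])
      note ga = deflation_arrow_C[OF g(1)] and W' = deflation_U(1)[OF g(1)]
      have gx: "AAr D g x \<in> El D W'" using M.fun_closed[OF Da ga x] .
      have qx: "cmp q W' (AAr D g x) \<in> El Y W'" using M.cmp_closed[OF b(4) _ gx] W' by simp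
      obtain W'' h where h: "deflation T U W'' W' h" "AAr Y h (cmp q W' (AAr D g x)) = \<one>\<^bsub>AOb Y W''\<^esub>"
        by (rule effaceableE[OF eff(2) W' qx])
      note ha = deflation_arrow_C[OF h(1)] and W'' = deflation_U(1)[OF h(1)]
      have "AAr D h (AAr D g x) = \<one>\<^bsub>AOb D W''\<^esub>"
      proof (rule sp[OF W'' M.fun_closed[OF Da ha gx]])
        show "cmp p W'' (AAr D h (AAr D g x)) = \<one>\<^bsub>AOb X W''\<^esub>"
          using M.cmp_natural[OF b(3) ha gx] M.cmp_natural[OF b(3) ga x] g(2) M.fun_one[OF Xa ha] by simp
        show "cmp q W'' (AAr D h (AAr D g x)) = \<one>\<^bsub>AOb Y W''\<^esub>" using M.cmp_natural[OF b(4) ha gx] h(2) by simp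
      qed
      then show "\<exists>Y g. deflation T U Y W g \<and> AAr D g x = \<one>\<^bsub>AOb D Y\<^esub>"
        using deflation_comp[OF h(1) g(1)] M.fun_comp[OF Da ha ga x] by auto
    qed
    then show "\<exists>D\<in>defU. biproduct A X Y D" using D Do def_iff by blast
  qed
qed

lemma additive_lex: "additive_category (full_subcat A lexU)"
proof -
  obtain N where N: "zero_object A N" by (rule M.zero_functor)
  then have No: "N \<in> Obj A" by (simp add: zero_object_def)
  note Na = M.additive_Obj[OF No]
  have NL: "N \<in> lexU"
    unfolding lex_iff
  proof (intro conjI allI impI ballI)
    show "x = \<one>\<^bsub>AOb N X\<^esub>" if "deflation T U Y X g" "x \<in> El N X" for Y X g x
      using zero_functor_elements[OF N deflation_U(2)[OF that(1)] that(2)] .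
    fix Z Y X f g y assume conf: "conflation T U Z Y X f g" and y: "y \<in> El N Y"
    then have z: "Y \<in> U" "X \<in> U" and g: "arrow C g Y X"
      using deflation_arrow_C[of Y X g] by (auto simp: conflation_def deflation_def)
    show "\<exists>x\<in>El N X. y = AAr N g x"
      using zero_functor_elements[OF N z(1) y] M.fun_one[OF Na g] M.fun_one_closed[OF Na, of X] z(2)
      by (intro bexI[of _ "\<one>\<^bsub>AOb N X\<^esub>"]) auto
  qed (rule No)
  show ?thesis
  proof (rule A.additive_full_subcat[OF _ N NL])
    show "lexU \<subseteq> Obj A" using lexD(1) by blast
    fix X Y assume XY: "X \<in> lexU" "Y \<in> lexU"
    note o = lexD(1)[OF XY(1)] lexD(1)[OF XY(2)]
    obtain D where D: "biproduct A X Y D" using A.ex_biproduct[OF o] by blast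
    then have Do: "D \<in> Obj A" by (simp add: biproduct_def)
    obtain i j p q where b: "arrow A i X D" "arrow A j Y D" "arrow A p D X" "arrow A q D Y"
      and dec: "\<And>W x. W \<in> U \<Longrightarrow> x \<in> El D W \<Longrightarrow> x = cmp i W (cmp p W x) \<otimes>\<^bsub>AOb D W\<^esub> cmp j W (cmp q W x)"
      and sp: "\<And>W x. W \<in> U \<Longrightarrow> x \<in> El D W \<Longrightarrow> cmp p W x = \<one>\<^bsub>AOb X W\<^esub> \<Longrightarrow> cmp q W x = \<one>\<^bsub>AOb Y W\<^esub> \<Longrightarrow> x = \<one>\<^bsub>AOb D W\<^esub>"
      by (rule biproduct_elements[OF D]) blast
    note Da = M.additive_Obj[OF Do]
    have "D \<in> lexU"
      unfolding lex_iff
    proof (intro conjI allI impI ballI)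
      fix W' W g x assume g: "deflation T U W' W g" and x: "x \<in> El D W" "AAr D g x = \<one>\<^bsub>AOb D W'\<^esub>"
      note ga = deflation_arrow_C[OF g] and W' = deflation_U[OF g]
      have c: "cmp p W x \<in> El X W" "cmp q W x \<in> El Y W" using M.cmp_closed[OF b(3) _ x(1)] M.cmp_closed[OF b(4) _ x(1)] W' by auto
      have "AAr X g (cmp p W x) = \<one>\<^bsub>AOb X W'\<^esub>" "AAr Y g (cmp q W x) = \<one>\<^bsub>AOb Y W'\<^esub>"
        using M.cmp_natural[OF b(3) ga x(1)] M.cmp_natural[OF b(4) ga x(1)] x(2) M.cmp_one[OF b(3)] M.cmp_one[OF b(4)] W' by auto
      then show "x = \<one>\<^bsub>AOb D W\<^esub>"
        using sp[OF W'(2) x(1)] lexD(2)[OF XY(1) g c(1)] lexD(2)[OF XY(2) g c(2)] by blast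
    next
      fix Z W' W f g y assume conf: "conflation T U Z W' W f g" and y: "y \<in> El D W'" "AAr D f y = \<one>\<^bsub>AOb D Z\<^esub>"
      obtain h where z: "Z \<in> U" "W' \<in> U" "W \<in> U" and d: "distinguished T Z W' W f g h" using conf by (auto simp: conflation_def)
      have f: "arrow C f Z W'" and g: "arrow C g W' W" using distinguishedD[OF d] z by (simp_all add: arrow_C)
      have WC: "W \<in> Obj C" "W' \<in> Obj C" "Z \<in> Obj C" using z by auto
      have "AAr X f (cmp p W' y) = \<one>\<^bsub>AOb X Z\<^esub>" "AAr Y f (cmp q W' y) = \<one>\<^bsub>AOb Y Z\<^esub>"
        using M.cmp_natural[OF b(3) f y(1)] M.cmp_natural[OF b(4) f y(1)] y(2) M.cmp_one[OF b(3) WC(3)] M.cmp_one[OF b(4) WC(3)] by simp_all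
      \<comment> \<open>Each component descends along \<open>g\<close>; the element sought is
        reassembled from the two.\<close>
      then obtain c1 c2 where c: "c1 \<in> El X W" "cmp p W' y = AAr X g c1" "c2 \<in> El Y W" "cmp q W' y = AAr Y g c2"
        using lexD(3)[OF XY(1) conf M.cmp_closed[OF b(3) WC(2) y(1)]] lexD(3)[OF XY(2) conf M.cmp_closed[OF b(4) WC(2) y(1)]] by blast
      have ij: "cmp i W c1 \<in> El D W" "cmp j W c2 \<in> El D W" using M.cmp_closed[OF b(1) WC(1) c(1)] M.cmp_closed[OF b(2) WC(1) c(3)] .
      have "y = AAr D g (cmp i W c1 \<otimes>\<^bsub>AOb D W\<^esub> cmp j W c2)"
        using dec[OF z(2) y(1)] c M.cmp_natural[OF b(1) g c(1)] M.cmp_natural[OF b(2) g c(3)] M.fun_mult[OF Da g ij] by simp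
      moreover have "cmp i W c1 \<otimes>\<^bsub>AOb D W\<^esub> cmp j W c2 \<in> El D W"
        using monoid.m_closed[OF group.is_monoid[OF M.fun_group[OF Da WC(1)]] ij] .
      ultimately show "\<exists>x\<in>El D W. y = AAr D g x" by blast
    qed (rule Do)
    then show "\<exists>D\<in>lexU. biproduct A X Y D" using D by blast
  qed
qed

text \<open>The conditions on \<open>serre_iso\<close> are the elementwise facts on
  \<open>wiso\<close>, translated by \<open>serre_iso_iff\<close>.\<close>

lemma reflective: "reflective_localization A defU lexU"
proof (rule reflective_localization.intro[OF M.abelian_A], rule reflective_localization_axioms.intro)
  show "serre_subcat A defU" by (rule serre_def)
  show "additive_category (full_subcat A defU)" by (rule additive_def)
  show "lexU \<subseteq> Obj A" using lexD(1) by blast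
  show "additive_category (full_subcat A lexU)" by (rule additive_lex)
  show "serre_iso A defU X X (Ide A X)" if "X \<in> Obj A" for X
    using serre_iso_iff[OF M.mod_ide[OF that]] wiso_ide[OF that] by blast
  show "serre_iso A defU X Z (t \<cdot>\<^bsub>A\<^esub> s)"
    if "X \<in> Obj A" "Y \<in> Obj A" "Z \<in> Obj A" "serre_iso A defU X Y s" "serre_iso A defU Y Z t" for X Y Z s t
  proof -
    note s = serre_isoE[OF that(4,1,2)] and t = serre_isoE[OF that(5,2,3)]
    show ?thesis using serre_iso_iff[OF M.mod_comp[OF s(1) t(1)]] wiso_comp[OF s t] by blast
  qed
  show "\<exists>P t f'. arrow A t P W \<and> serre_iso A defU P W t \<and> arrow A f' P V' \<and> f \<cdot>\<^bsub>A\<^esub> t = s \<cdot>\<^bsub>A\<^esub> f'"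
    if "arrow A f W Y" "arrow A s V' Y" "serre_iso A defU V' Y s" for f W Y s V'
    using wiso_ore[OF that(1,2)] serre_iso_iff that(2,3) by metis
  show "\<exists>K k. arrow A k K P \<and> serre_iso A defU K P k \<and> h \<cdot>\<^bsub>A\<^esub> k = Zero A K Y"
    if "arrow A h P Y" "arrow A s Y L" "serre_iso A defU Y L s" "s \<cdot>\<^bsub>A\<^esub> h = Zero A P L" for h P Y s L
    using wiso_cancel[OF that(1,2) _ that(4)] serre_iso_iff that(2,3) by metis
  show "\<exists>L\<in>lexU. \<exists>s. serre_iso A defU X L s" if "X \<in> Obj A" for X
    using ex_reflection[OF that] serre_iso_iff by metis
  show "\<exists>!q. arrow A q Y L \<and> q \<cdot>\<^bsub>A\<^esub> s = p"
    if "L \<in> lexU" "arrow A s X Y" "serre_iso A defU X Y s" "arrow A p X L" for L s X Y p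
    using lex_local[OF that(1,2) _ that(4)] serre_iso_iff[OF that(2)] that(3) by blast
qed

end

text \<open>The type \<open>'g\<close> has to hold the elements of all finitely presented functors
  on \<open>U\<close>; \<open>small\<close> asks that the hom sets of \<open>U\<close> embed into
  it. With \<open>'g\<close> taken as \<open>'m\<close> the identity serves.\<close>

theorem corollary4p3:
  fixes T :: "('o, 'm, 'z) tricat_scheme" and U V :: "'o set"
  assumes "triangulated_category T"
    and "cotorsion_pair T U V"
    and small: "\<And>X Y. X \<in> U \<Longrightarrow> Y \<in> U \<Longrightarrow> \<exists>\<iota> :: 'm \<Rightarrow> 'g. inj_on \<iota> (Arr T X Y)"
  defines "modU \<equiv> mod_cat (full_subcat T U) :: (('o, 'm, 'g) abfunctor, ('o, 'm, 'g) nattrans) precat"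
  defines "lexU \<equiv> full_subcat modU (lex_objects T U)"
  shows "\<exists>Q. localization_sequence modU (def_objects T U) lexU Q \<and>
             adjunction modU lexU Q incl_functor"
proof -
  have "cotorsion_modules T U V modU"
    using assms(1,2) small unfolding modU_def
    by (intro cotorsion_modules.intro cotorsion_category.intro cotorsion_category_axioms.intro cotorsion_modules_axioms.intro) auto
  then interpret R: reflective_localization modU "def_objects T U" "lex_objects T U"
    by (rule cotorsion_modules.reflective)
  show ?thesis unfolding lexU_def using R.localization R.adjunction_Q by blast
qed

end
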